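(* Let $\Gamma$ be a finitely generated group and set $n=\dim H_1(\Gamma,\mathbb{C})$. If $n<2$ then $X(\Gamma)$ is smooth at the trivial character; if $n>2$, then $X(\Gamma)$ is not smooth at the trivial character.
   Context: $R(\Gamma)=\mathrm{Hom}(\Gamma,\mathrm{SL}_2(\mathbb{C}))$, and $A(\Gamma)$ is its (possibly non-reduced) ring of regular functions: the $\mathbb{C}$-algebra generated by the entries of the matrices $\rho(\gamma_l)$, for $\gamma_1,\dots,\gamma_r$ generating $\Gamma$, modulo the relations coming from $\det\rho(\gamma_l)=1$ and from the relations of $\Gamma$. $\mathrm{SL}_2(\mathbb{C})$ acts by conjugation, and $X(\Gamma)$ is the algebraic quotient, the affine scheme with ring of regular functions $A(\Gamma)^{\mathrm{SL}_2(\mathbb{C})}$, which is generated by the functions $t_\gamma(\rho)=\mathrm{Tr}\,\rho(\gamma)$. The trivial character $\chi$ is the point with $t_\gamma=2$ for all $\gamma$, i.e. the maximal ideal $m$ generated by the $t_\gamma-2$. $X(\Gamma)$ is smooth at $\chi$ if $\dim_\chi X(\Gamma)=\dim T_\chi X(\Gamma)$, where $\dim_\chi X(\Gamma)$ is the local dimension (the infimum of the dimensions of open neighbourhoods of $\chi$) and $T_\chi X(\Gamma)=(m/m^2)^*$ is the Zariski-tangent space; equivalently the localisation of $A(\Gamma)^{\mathrm{SL}_2(\mathbb{C})}$ at $m$ is a regular local ring. *)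

theory Defs
  imports
    "HOL-Analysis.Analysis"
    "HOL-Library.Extended_Nat"
    "HOL-Library.Poly_Mapping"
    "HOL-Algebra.Algebra"
    "HOL-Algebra.Algebraic_Closure_Type"
begin

section \<open>Complex vector spaces as HOL-Algebra modules\<close>

text \<open>
  Complex vector spaces and complex algebras are records of type
  \<open>(complex, 'a) module\<close>.  For a vector space the fields \<open>mult\<close> and \<open>one\<close> play no role.
\<close>

definition lin_indep :: "(complex, 'a) module \<Rightarrow> 'a set \<Rightarrow> bool" where
  "lin_indep V F \<longleftrightarrow>
     (\<forall>c :: 'a \<Rightarrow> complex. (\<Oplus>\<^bsub>V\<^esub>v\<in>F. c v \<odot>\<^bsub>V\<^esub> v) = \<zero>\<^bsub>V\<^esub> \<longrightarrow> (\<forall>v\<in>F. c v = 0))"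

definition vdim :: "(complex, 'a) module \<Rightarrow> enat" where
  "vdim V = (SUP F \<in> {F. finite F \<and> F \<subseteq> carrier V \<and> lin_indep V F}. enat (card F))"

text \<open>
  The quotient \<open>V / W\<close>: a vector space if \<open>W\<close> is a subspace of \<open>V\<close>, and a complex algebra
  if \<open>V\<close> is an algebra and \<open>W\<close> an ideal.
\<close>

definition quot_mod :: "(complex, 'a) module \<Rightarrow> 'a set \<Rightarrow> (complex, 'a set) module" where
  "quot_mod V W =
     ring.extend (V Quot W) (module.fields (\<lambda>c C. \<Union>x\<in>C. W +>\<^bsub>V\<^esub> (c \<odot>\<^bsub>V\<^esub> x)))"

definition dual_mod :: "(complex, 'a) module \<Rightarrow> (complex, 'a \<Rightarrow> complex) module" where
  "dual_mod V =
     \<lparr> carrier = {f \<in> carrier V \<rightarrow>\<^sub>E UNIV.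
         (\<forall>x\<in>carrier V. \<forall>y\<in>carrier V. f (x \<oplus>\<^bsub>V\<^esub> y) = f x + f y) \<and>
         (\<forall>c. \<forall>x\<in>carrier V. f (c \<odot>\<^bsub>V\<^esub> x) = c * f x)},
       mult = undefined, one = undefined,
       ring.zero = (\<lambda>x\<in>carrier V. 0),
       add = (\<lambda>f g. \<lambda>x\<in>carrier V. f x + g x),
       smult = (\<lambda>c f. \<lambda>x\<in>carrier V. c * f x) \<rparr>"

section \<open>Affine schemes and smoothness\<close>

definition spec_topology :: "('a, 'm) ring_scheme \<Rightarrow> 'a set topology" where
  "spec_topology R =
     topology_generated_by {{P. primeideal P R \<and> f \<notin> P} | f. f \<in> carrier R}"

definition irreducible_closedin :: "'p topology \<Rightarrow> 'p set \<Rightarrow> bool" where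
  "irreducible_closedin T Z \<longleftrightarrow> closedin T Z \<and> Z \<noteq> {} \<and>
     (\<forall>A B. closedin T A \<longrightarrow> closedin T B \<longrightarrow> Z = A \<union> B \<longrightarrow> Z = A \<or> Z = B)"

text \<open>
  The supremum of the lengths \<open>k\<close> of chains \<open>Z\<^sub>0 \<subset> \<dots> \<subset> Z\<^sub>k\<close> of irreducible closed subsets.
  (The empty space gets dimension 0; only nonempty spaces are used.)
\<close>

definition krull_dim :: "'p topology \<Rightarrow> enat" where
  "krull_dim T = (SUP Zs \<in> {Zs. Zs \<noteq> [] \<and> sorted_wrt (\<subset>) Zs \<and>
       (\<forall>Z\<in>set Zs. irreducible_closedin T Z)}. enat (length Zs - 1))"

definition local_dim :: "'p topology \<Rightarrow> 'p \<Rightarrow> enat" where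
  "local_dim T x = (INF U \<in> {U. openin T U \<and> x \<in> U}. krull_dim (subtopology T U))"

text \<open>
  An affine scheme over the complex numbers is given by its complex algebra \<open>R\<close> of regular
  functions; \<open>m\<close> is a maximal ideal with residue field the complex numbers.
\<close>

definition cotangent_space ::
    "(complex, 'a) module \<Rightarrow> 'a set \<Rightarrow> (complex, 'a set) module" where
  "cotangent_space R m = quot_mod (R\<lparr>carrier := m\<rparr>) (m \<cdot>\<^bsub>R\<^esub> m)"

definition tangent_space ::
    "(complex, 'a) module \<Rightarrow> 'a set \<Rightarrow> (complex, 'a set \<Rightarrow> complex) module" where
  "tangent_space R m = dual_mod (cotangent_space R m)"

definition smooth_at :: "(complex, 'a) module \<Rightarrow> 'a set \<Rightarrow> bool" where
  "smooth_at R m \<longleftrightarrow> local_dim (spec_topology R) m = vdim (tangent_space R m)"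

section \<open>First homology of a group with complex coefficients\<close>

text \<open>
  The bar complex \<open>C\<^sub>2 \<rightarrow> C\<^sub>1 \<rightarrow> C\<^sub>0\<close>, where \<open>C\<^sub>n\<close> is free on \<open>n\<close>-tuples of group elements.  As
  the coefficients are trivial, \<open>C\<^sub>1 \<rightarrow> C\<^sub>0\<close> is zero, so that every element of \<open>C\<^sub>1\<close> is a cycle.
\<close>

definition bar_C1 :: "('g, 'm) monoid_scheme \<Rightarrow> (complex, 'g \<Rightarrow>\<^sub>0 complex) module" where
  "bar_C1 G =
     \<lparr> carrier = {c. Poly_Mapping.keys c \<subseteq> carrier G},
       mult = undefined, one = undefined, ring.zero = 0, add = (+),
       smult = (\<lambda>a. Poly_Mapping.map ((*) a)) \<rparr>"

definition bar_d2 ::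
    "('g, 'm) monoid_scheme \<Rightarrow> ('g \<times> 'g \<Rightarrow>\<^sub>0 complex) \<Rightarrow> ('g \<Rightarrow>\<^sub>0 complex)" where
  "bar_d2 G c = (\<Sum>(g, h)\<in>Poly_Mapping.keys c.
     let a = Poly_Mapping.lookup c (g, h)
     in Poly_Mapping.single h a - Poly_Mapping.single (g \<otimes>\<^bsub>G\<^esub> h) a + Poly_Mapping.single g a)"

definition group_H1 :: "('g, 'm) monoid_scheme \<Rightarrow> (complex, ('g \<Rightarrow>\<^sub>0 complex) set) module" where
  "group_H1 G = quot_mod (bar_C1 G)
     (bar_d2 G ` {c. Poly_Mapping.keys c \<subseteq> carrier G \<times> carrier G})"

section \<open>The scheme of representations in \<open>SL\<^sub>2\<close>\<close>

text \<open>
  Polynomials in the matrix entries \<open>(l, i, j)\<close>, \<open>i, j \<in> {1, 2}\<close>, of one generic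
  two-by-two matrix for each index \<open>l\<close> of a generator.
\<close>

type_synonym 'i mpoly = "(('i \<times> 2 \<times> 2) \<Rightarrow>\<^sub>0 nat) \<Rightarrow>\<^sub>0 complex"

definition Const :: "complex \<Rightarrow> 'i mpoly" where
  "Const c = Poly_Mapping.single 0 c"

definition Var :: "'i \<times> 2 \<times> 2 \<Rightarrow> 'i mpoly" where
  "Var x = Poly_Mapping.single (Poly_Mapping.single x 1) 1"

definition mpoly_alg :: "(complex, 'i mpoly) module" where
  "mpoly_alg = ring.extend ring_of_type_algebra (module.fields (\<lambda>c p. Const c * p))"

definition msubst :: "('i \<times> 2 \<times> 2 \<Rightarrow> 'i mpoly) \<Rightarrow> 'i mpoly \<Rightarrow> 'i mpoly" where
  "msubst v p = (\<Sum>m\<in>Poly_Mapping.keys p. Const (Poly_Mapping.lookup p m) *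
     (\<Prod>x\<in>Poly_Mapping.keys m. v x ^ Poly_Mapping.lookup m x))"

definition gen_mat :: "'i \<Rightarrow> 'i mpoly^2^2" where
  "gen_mat l = (\<chi> i j. Var (l, i, j))"

definition adjugate2 :: "'a::comm_ring_1^2^2 \<Rightarrow> 'a^2^2" where
  "adjugate2 M = vector [vector [M $ 2 $ 2, - M $ 1 $ 2], vector [- M $ 2 $ 1, M $ 1 $ 1]]"

text \<open>
  A word is a list of letters \<open>(l, e)\<close>, standing for the generator with index \<open>l\<close> if \<open>e\<close>
  holds and for its inverse otherwise.  On generic matrices the inverse is the adjugate, which
  is inverse to the matrix once the determinants are set to one.
\<close>

definition word_val :: "('g, 'm) monoid_scheme \<Rightarrow> ('i \<Rightarrow> 'g) \<Rightarrow> ('i \<times> bool) list \<Rightarrow> 'g" where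
  "word_val G \<gamma> w = foldr (\<lambda>(l, e) x. (if e then \<gamma> l else inv\<^bsub>G\<^esub> \<gamma> l) \<otimes>\<^bsub>G\<^esub> x) w \<one>\<^bsub>G\<^esub>"

definition word_mat :: "('i \<times> bool) list \<Rightarrow> 'i mpoly^2^2" where
  "word_mat w =
     foldr (\<lambda>(l, e) M. (if e then gen_mat l else adjugate2 (gen_mat l)) ** M) w (mat 1)"

definition rep_ideal :: "('g, 'm) monoid_scheme \<Rightarrow> ('i \<Rightarrow> 'g) \<Rightarrow> 'i mpoly set" where
  "rep_ideal G \<gamma> = Idl\<^bsub>mpoly_alg\<^esub>
     ({det (gen_mat l) - 1 | l. True} \<union>
      {(word_mat w - mat 1) $ i $ j | w i j. word_val G \<gamma> w = \<one>\<^bsub>G\<^esub>})"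

text \<open>The algebra \<open>A(\<Gamma>)\<close>, for the group \<open>\<Gamma> = G\<close> with generators \<open>\<gamma>\<close>.\<close>

definition rep_alg ::
    "('g, 'm) monoid_scheme \<Rightarrow> ('i \<Rightarrow> 'g) \<Rightarrow> (complex, 'i mpoly set) module" where
  "rep_alg G \<gamma> = quot_mod mpoly_alg (rep_ideal G \<gamma>)"

section \<open>The scheme of characters\<close>

text \<open>\<open>(s \<cdot> f)(\<rho>) = f (s\<^sup>-\<^sup>1 \<rho> s)\<close>\<close>

definition conj_act :: "complex^2^2 \<Rightarrow> 'i mpoly \<Rightarrow> 'i mpoly" where
  "conj_act s = msubst (\<lambda>(l, i, j).
     ((\<chi> i j. Const (matrix_inv s $ i $ j)) ** gen_mat l ** (\<chi> i j. Const (s $ i $ j))) $ i $ j)"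

text \<open>
  The algebra of invariants.  For \<open>s \<in> SL\<^sub>2\<close> the automorphism \<open>conj_act s\<close> of the polynomial
  algebra preserves \<open>rep_ideal\<close>, hence maps cosets to cosets; the image map is the induced
  automorphism of \<open>rep_alg\<close>.
\<close>

definition char_alg ::
    "('g, 'm) monoid_scheme \<Rightarrow> ('i \<Rightarrow> 'g) \<Rightarrow> (complex, 'i mpoly set) module" where
  "char_alg G \<gamma> = (rep_alg G \<gamma>)
     \<lparr>carrier := {a \<in> carrier (rep_alg G \<gamma>). \<forall>s::complex^2^2. det s = 1 \<longrightarrow> conj_act s ` a = a}\<rparr>"

text \<open>
  The function \<open>t\<^sub>g\<close>, for \<open>g\<close> the value of the word \<open>w\<close>; modulo \<open>rep_ideal\<close> it depends on
  \<open>g\<close> only.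
\<close>

definition trace_fun ::
    "('g, 'm) monoid_scheme \<Rightarrow> ('i \<Rightarrow> 'g) \<Rightarrow> ('i \<times> bool) list \<Rightarrow> 'i mpoly set" where
  "trace_fun G \<gamma> w = rep_ideal G \<gamma> +>\<^bsub>mpoly_alg\<^esub> trace (word_mat w)"

definition trivial_character ::
    "('g, 'm) monoid_scheme \<Rightarrow> ('i \<Rightarrow> 'g) \<Rightarrow> 'i mpoly set set" where
  "trivial_character G \<gamma> = Idl\<^bsub>char_alg G \<gamma>\<^esub>
     {trace_fun G \<gamma> w \<ominus>\<^bsub>char_alg G \<gamma>\<^esub> (2 \<odot>\<^bsub>char_alg G \<gamma>\<^esub> \<one>\<^bsub>char_alg G \<gamma>\<^esub>) | w. True}"

end

theory Submission
  imports Defs "HOL-Computational_Algebra.Polynomial"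
begin

text \<open>
  Averaging over \<open>SL\<^sub>2\<close>, in the guise of a contraction operator, shows that the invariants are
  generated by traces; so \<open>X(\<Gamma>)\<close> is the quotient of the ring generated by generic traces by
  the contraction of the relation ideal.

  A linear functional on the cotangent space at the trivial character \<open>\<chi>\<close> gives, through
  \<open>g \<mapsto> t\<^sub>g - 2\<close>, a function with \<open>f (x y) + f (x y\<^sup>-\<^sup>1) = 2 f x + 2 f y\<close>.  The third difference of
  such a function is trilinear and alternating.  If \<open>n < 2\<close> it vanishes, so \<open>f\<close> is a quadratic form
  and the tangent space has dimension at most 1; for \<open>n = 1\<close> the diagonal representations
  \<open>diag (e\<^sup>u\<^sup>\<phi>, e\<^sup>-\<^sup>u\<^sup>\<phi>)\<close> show that the local dimension is 1 if the tangent space is not zero.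

  If \<open>n > 2\<close>, take three independent classes and the Gram matrix \<open>h\<^sub>i\<^sub>j = 2 t(w\<^sub>i w\<^sub>j) - t(w\<^sub>i) t(w\<^sub>j)\<close>.
  With \<open>z = t(w\<^sub>1 w\<^sub>2 w\<^sub>3) - t(w\<^sub>1 w\<^sub>3 w\<^sub>2)\<close> one has \<open>4 z\<^sup>2 = - det h\<close>.  At a smooth point no nonzero
  form of degree \<open>k\<close> in a basis of \<open>m / m\<^sup>2\<close> lies in \<open>m\<^sup>k\<^sup>+\<^sup>1\<close>.  If \<open>z \<notin> m\<^sup>2\<close>, this fails for
  \<open>z\<^sup>2 \<in> m\<^sup>3\<close>; if \<open>z \<in> m\<^sup>2\<close>, it fails for \<open>det h \<in> m\<^sup>4\<close>, as the six \<open>h\<^sub>i\<^sub>j\<close> are independent modulo \<open>m\<^sup>2\<close>.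
\<close>

text \<open>Smoothness is a statement about lengths of chains of primes; what has to be extracted
  from it is that forms in a cotangent basis satisfy no relations. Derivations do the translation. A
  chain of k steps starting at a prime P below m gives k derivations modulo P in triangular
  position, because in characteristic 0 a derivation extends, up to a factor outside P, along each
  generator of a finitely generated algebra. By Krull's intersection theorem such a derivation is
  determined modulo P by its values on elements spanning m / m^2. So a chain has at most as many
  steps as there are spanning elements, and when the two numbers agree there are derivations dual to
  these elements. A relation between forms continues to a formal power series vanishing to every
  order, and differentiation reads off its coefficients.

  Quotients and localisations are avoided: everything happens inside one ring type, with congruences
  modulo P in place of the quotient and factors outside P or m in place of denominators.\<close>

section \<open>Subrings and ideals as subsets of one ring type\<close>

definition subring_of :: "'a::comm_ring_1 set \<Rightarrow> bool" where
  "subring_of S \<longleftrightarrow> 0 \<in> S \<and> 1 \<in> S \<and> (\<forall>a\<in>S. \<forall>b\<in>S. a + b \<in> S \<and> a - b \<in> S \<and> a * b \<in> S)"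

definition ideal_in :: "'a::comm_ring_1 set \<Rightarrow> 'a set \<Rightarrow> bool" where
  "ideal_in S I \<longleftrightarrow> I \<subseteq> S \<and> 0 \<in> I \<and> (\<forall>a\<in>I. \<forall>b\<in>I. a + b \<in> I) \<and> (\<forall>r\<in>S. \<forall>a\<in>I. r * a \<in> I)"

text \<open>The S-submodule spanned by \<open>B\<close>, built one summand at a time so that
  inductions peel off a single multiple. The subring \<open>S\<close> is a parameter because the
  Noetherian property is proved along towers of subrings inside one type.\<close>

inductive_set gen_ideal :: "'a::comm_ring_1 set \<Rightarrow> 'a set \<Rightarrow> 'a set" for S B where
  gen_ideal_zero: "0 \<in> gen_ideal S B"
| gen_ideal_step: "a \<in> gen_ideal S B \<Longrightarrow> s \<in> S \<Longrightarrow> b \<in> B \<Longrightarrow> a + s * b \<in> gen_ideal S B"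

lemma gen_ideal_add: "a \<in> gen_ideal S B \<Longrightarrow> b \<in> gen_ideal S B \<Longrightarrow> a + b \<in> gen_ideal S B"
proof (induction a rule: gen_ideal.induct)
  case (gen_ideal_step a s c)
  then have "(a + b) + s * c \<in> gen_ideal S B" by (blast intro: gen_ideal.intros)
  then show ?case by (simp add: algebra_simps)
qed auto

lemma gen_ideal_mult:
  assumes "subring_of S" "r \<in> S" "a \<in> gen_ideal S B"
  shows "r * a \<in> gen_ideal S B"
  using assms(3)
proof (induction a rule: gen_ideal.induct)
  case gen_ideal_zero
  then show ?case by (simp add: gen_ideal.gen_ideal_zero)
next
  case (gen_ideal_step a s c)
  have "r * s \<in> S" using assms gen_ideal_step by (auto simp: subring_of_def)
  then have "r * a + (r * s) * c \<in> gen_ideal S B" using gen_ideal_step by (blast intro: gen_ideal.intros)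
  then show ?case by (simp add: algebra_simps)
qed

lemma gen_ideal_gen: "1 \<in> S \<Longrightarrow> b \<in> B \<Longrightarrow> b \<in> gen_ideal S B"
  using gen_ideal_step[OF gen_ideal_zero, of 1 S b B] by simp

lemma gen_ideal_least:
  assumes "ideal_in S I" "B \<subseteq> I"
  shows "gen_ideal S B \<subseteq> I"
proof
  fix a assume "a \<in> gen_ideal S B"
  then show "a \<in> I"
    by (induction a rule: gen_ideal.induct) (use assms in \<open>auto simp: ideal_in_def\<close>)
qed

lemma subring_of_UNIV [simp]: "subring_of UNIV"
  by (simp add: subring_of_def)

lemma subring_of_sum:
  assumes "subring_of S" "\<And>i. i \<in> A \<Longrightarrow> f i \<in> S"
  shows "sum f A \<in> S"
  using assms(2)
  by (induction A rule: infinite_finite_induct) (use assms(1) in \<open>auto simp: subring_of_def\<close>)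

lemma subring_of_power: "subring_of S \<Longrightarrow> a \<in> S \<Longrightarrow> a ^ n \<in> S"
  by (induction n) (auto simp: subring_of_def)

lemma subring_of_uminus: "subring_of S \<Longrightarrow> a \<in> S \<Longrightarrow> - a \<in> S"
  unfolding subring_of_def by (metis diff_0)

abbreviation is_ideal :: "'a::comm_ring_1 set \<Rightarrow> bool" where
  "is_ideal \<equiv> ideal_in UNIV"

lemma is_ideal_gen_ideal [simp]: "is_ideal (gen_ideal UNIV B)"
  by (simp add: ideal_in_def gen_ideal_zero gen_ideal_add gen_ideal_mult)

lemma is_idealD:
  assumes "is_ideal I"
  shows "0 \<in> I" "\<And>a b. a \<in> I \<Longrightarrow> b \<in> I \<Longrightarrow> a + b \<in> I" "\<And>r a. a \<in> I \<Longrightarrow> r * a \<in> I"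
    "\<And>r a. a \<in> I \<Longrightarrow> a * r \<in> I"
    "\<And>a. a \<in> I \<Longrightarrow> - a \<in> I" "\<And>a b. a \<in> I \<Longrightarrow> b \<in> I \<Longrightarrow> a - b \<in> I"
    "\<And>A f. (\<And>i. i \<in> A \<Longrightarrow> f i \<in> I) \<Longrightarrow> sum f A \<in> I"
proof -
  show 1: "0 \<in> I" and 2: "\<And>a b. a \<in> I \<Longrightarrow> b \<in> I \<Longrightarrow> a + b \<in> I"
    and 3: "\<And>r a. a \<in> I \<Longrightarrow> r * a \<in> I"
    using assms by (auto simp: ideal_in_def)
  show "\<And>r a. a \<in> I \<Longrightarrow> a * r \<in> I" using 3 by (metis mult.commute)
  show 4: "\<And>a. a \<in> I \<Longrightarrow> - a \<in> I" using 3[of _ "-1"] by simp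
  show "\<And>a b. a \<in> I \<Longrightarrow> b \<in> I \<Longrightarrow> a - b \<in> I"
    using 2 4 by (metis add_uminus_conv_diff)
  show "sum f A \<in> I" if "\<And>i. i \<in> A \<Longrightarrow> f i \<in> I" for A and f :: "'b \<Rightarrow> 'a"
    using that by (induction A rule: infinite_finite_induct) (use 1 2 in auto)
qed

lemma is_ideal_one: "is_ideal I \<Longrightarrow> 1 \<in> I \<Longrightarrow> I = UNIV"
  using is_idealD(3)[of I 1] by auto

section \<open>Noetherian rings\<close>

definition noetherian :: "'a::comm_ring_1 set \<Rightarrow> bool" where
  "noetherian S \<longleftrightarrow> (\<forall>I. ideal_in S I \<longrightarrow> (\<exists>B. finite B \<and> B \<subseteq> I \<and> I \<subseteq> gen_ideal S B))"

definition coeffs_in :: "'a::comm_ring_1 set \<Rightarrow> 'a poly set" where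
  "coeffs_in S = {q. \<forall>i. Polynomial.coeff q i \<in> S}"

text \<open>S[y], whether or not y is free over \<open>S\<close>. Elements are handled through
  representing polynomials, so Hilbert's basis theorem is proved for S[y] without a detour through a
  polynomial ring.\<close>

definition adjoin :: "'a::comm_ring_1 set \<Rightarrow> 'a \<Rightarrow> 'a set" where
  "adjoin S y = (\<lambda>q. poly q y) ` coeffs_in S"

lemma coeffs_in_closed:
  assumes "subring_of S"
  shows "0 \<in> coeffs_in S" "1 \<in> coeffs_in S"
    "p \<in> coeffs_in S \<Longrightarrow> q \<in> coeffs_in S \<Longrightarrow> p + q \<in> coeffs_in S"
    "p \<in> coeffs_in S \<Longrightarrow> q \<in> coeffs_in S \<Longrightarrow> p - q \<in> coeffs_in S"
    "p \<in> coeffs_in S \<Longrightarrow> q \<in> coeffs_in S \<Longrightarrow> p * q \<in> coeffs_in S"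
    "a \<in> S \<Longrightarrow> q \<in> coeffs_in S \<Longrightarrow> Polynomial.smult a q \<in> coeffs_in S"
    "a \<in> S \<Longrightarrow> Polynomial.monom a k \<in> coeffs_in S"
    "a \<in> S \<Longrightarrow> q \<in> coeffs_in S \<Longrightarrow> pCons a q \<in> coeffs_in S"
  using assms
  by (auto simp: coeffs_in_def subring_of_def coeff_mult coeff_pCons split: nat.splits
      intro!: subring_of_sum[OF assms])

lemma subring_of_adjoin:
  assumes "subring_of S"
  shows "subring_of (adjoin S y)"
proof -
  note c = coeffs_in_closed[OF assms]
  show ?thesis
    unfolding subring_of_def adjoin_def
    by (auto intro: image_eqI[OF _ c(1)] image_eqI[OF _ c(2)] image_eqI[OF _ c(3)]
        image_eqI[OF _ c(4)] image_eqI[OF _ c(5)])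
qed

lemma adjoin_superset:
  assumes "subring_of S"
  shows "S \<subseteq> adjoin S y" "y \<in> adjoin S y"
proof -
  have "a \<in> adjoin S y" if "a \<in> S" for a
    using coeffs_in_closed(7)[OF assms that, of 0] unfolding adjoin_def
    by (force intro: image_eqI[of _ _ "Polynomial.monom a 0"] simp: poly_monom)
  then show "S \<subseteq> adjoin S y" by auto
  have "Polynomial.monom 1 1 \<in> coeffs_in S"
    using assms by (intro coeffs_in_closed(7)) (auto simp: subring_of_def)
  then show "y \<in> adjoin S y"
    unfolding adjoin_def by (force intro: image_eqI[of _ _ "Polynomial.monom 1 1"] simp: poly_monom)
qed

text \<open>Via the ideals of leading coefficients in degree \<open>n\<close>.\<close>

lemma noetherian_adjoin:
  assumes S: "subring_of S" and N: "noetherian S"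
  shows "noetherian (adjoin S y)"
  unfolding noetherian_def
proof (intro allI impI)
  fix I assume I: "ideal_in (adjoin S y) I"
  note c = coeffs_in_closed[OF S]
  \<comment> \<open>Polynomials of degree at most n that represent elements of \<open>I\<close>.
    Multiplication by powers of the variable makes the ideals \<open>L n\<close> of their n-th
    coefficients increase, so they stabilise.\<close>
  define Q where "Q n = {q \<in> coeffs_in S. poly q y \<in> I \<and> (\<forall>i>n. Polynomial.coeff q i = 0)}" for n
  define L where "L n = (\<lambda>q. Polynomial.coeff q n) ` Q n" for n
  have Iadd: "a + b \<in> I" if "a \<in> I" "b \<in> I" for a b using I that by (auto simp: ideal_in_def)
  have Imult: "r * b \<in> I" if "r \<in> adjoin S y" "b \<in> I" for r b using I that by (auto simp: ideal_in_def)
  have Sad: "r \<in> adjoin S y" if "r \<in> S" for r using adjoin_superset[OF S] that by auto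
  have Q0: "0 \<in> Q n" for n using I c by (auto simp: Q_def ideal_in_def)
  have Qadd: "p + q \<in> Q n" if "p \<in> Q n" "q \<in> Q n" for p q n
    using that c Iadd by (auto simp: Q_def)
  have Qsm: "Polynomial.smult a q \<in> Q n" if "a \<in> S" "q \<in> Q n" for a q n
    using that c Imult Sad by (auto simp: Q_def)
  have Qshift: "Polynomial.monom 1 k * q \<in> Q (n + k)" if "q \<in> Q n" for q n k
  proof -
    have "y ^ k \<in> adjoin S y"
      by (intro subring_of_power subring_of_adjoin S adjoin_superset)
    then show ?thesis
      using that c S Imult
      by (auto simp: Q_def coeff_monom_mult poly_monom subring_of_def)
  qed
  have Lid: "ideal_in S (L n)" for n
    unfolding ideal_in_def
  proof (intro conjI ballI)
    show "L n \<subseteq> S" by (auto simp: L_def Q_def coeffs_in_def)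
    show "0 \<in> L n" using Q0[of n] unfolding L_def by (force intro: image_eqI[of _ _ 0])
    show "a + b \<in> L n" if "a \<in> L n" "b \<in> L n" for a b
      using that Qadd unfolding L_def by (auto simp flip: coeff_add)
    show "r * b \<in> L n" if "r \<in> S" "b \<in> L n" for r b
      using that Qsm unfolding L_def by (auto simp flip: coeff_smult)
  qed
  have Lmono: "L n \<subseteq> L (n + k)" for n k
  proof
    fix a assume "a \<in> L n"
    then obtain q where q: "q \<in> Q n" "a = Polynomial.coeff q n" by (auto simp: L_def)
    then show "a \<in> L (n + k)"
      using Qshift[OF q(1), of k] unfolding L_def
      by (auto intro!: image_eqI[of _ _ "Polynomial.monom 1 k * q"] simp: coeff_monom_mult)
  qed
  have Lmono': "L n \<subseteq> L k" if "n \<le> k" for n k using Lmono[of n "k - n"] that by simp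
  have LidD: "L n \<subseteq> S" "0 \<in> L n" "\<And>a b. a \<in> L n \<Longrightarrow> b \<in> L n \<Longrightarrow> a + b \<in> L n"
    "\<And>r b. r \<in> S \<Longrightarrow> b \<in> L n \<Longrightarrow> r * b \<in> L n" for n
    using Lid[of n] by (auto simp: ideal_in_def)
  have "ideal_in S (\<Union>n. L n)"
    unfolding ideal_in_def
  proof (intro conjI ballI)
    show "(\<Union>n. L n) \<subseteq> S" "0 \<in> (\<Union>n. L n)" using LidD(1,2) by blast+
    show "a + b \<in> (\<Union>n. L n)" if ab: "a \<in> (\<Union>n. L n)" "b \<in> (\<Union>n. L n)" for a b
    proof -
      obtain i j where "a \<in> L i" "b \<in> L j" using ab by auto
      then have "a \<in> L (max i j)" "b \<in> L (max i j)" using Lmono'[of i "max i j"] Lmono'[of j "max i j"] by auto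
      then show ?thesis using Lid[of "max i j"] by (auto simp: ideal_in_def)
    qed
    show "r * b \<in> (\<Union>n. L n)" if "r \<in> S" "b \<in> (\<Union>n. L n)" for r b
      using that LidD(4) by blast
  qed
  then obtain B where B: "finite B" "B \<subseteq> (\<Union>n. L n)" "(\<Union>n. L n) \<subseteq> gen_ideal S B"
    using N unfolding noetherian_def by meson
  have "\<exists>N. B \<subseteq> L N" using B(1,2)
  proof (induction B rule: finite_induct)
    case (insert x F)
    then obtain N k where "F \<subseteq> L N" "x \<in> L k" by auto
    then have "insert x F \<subseteq> L (max N k)" using Lmono'[of N "max N k"] Lmono'[of k "max N k"] by auto
    then show ?case by blast
  qed auto
  then obtain N where BN: "B \<subseteq> L N" by blast
  have stab: "L n \<subseteq> L N" for n
    using B(3) gen_ideal_least[OF Lid BN] by blast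
  have "\<exists>B. finite B \<and> B \<subseteq> L n \<and> L n \<subseteq> gen_ideal S B" for n
    using N Lid unfolding noetherian_def by blast
  then obtain Bn where Bn: "\<And>n. finite (Bn n)" "\<And>n. Bn n \<subseteq> L n" "\<And>n. L n \<subseteq> gen_ideal S (Bn n)" by metis
  have "\<exists>q. q \<in> Q n \<and> Polynomial.coeff q n = b" if "b \<in> Bn n" for n b
    using Bn(2)[of n] that by (auto simp: L_def)
  then have "\<exists>qq. \<forall>n b. b \<in> Bn n \<longrightarrow> qq n b \<in> Q n \<and> Polynomial.coeff (qq n b) n = b"
    by (intro choice allI) blast
  then obtain qq where qq: "\<And>n b. b \<in> Bn n \<Longrightarrow> qq n b \<in> Q n \<and> Polynomial.coeff (qq n b) n = b" by blast
  \<comment> \<open>Generators for the degrees up to \<open>N\<close> suffice: above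
    \<open>N\<close> a leading coefficient already occurs in degree \<open>N\<close> and is reached
    by a shift.\<close>
  define C where "C = (\<Union>n\<in>{..N}. (\<lambda>b. poly (qq n b) y) ` Bn n)"
  let ?H = "gen_ideal (adjoin S y) C"
  have lead: "\<exists>q\<in>Q n. Polynomial.coeff q n = a \<and> poly q y \<in> ?H" if "n \<le> N" "a \<in> L n" for a n
  proof -
    have "a \<in> gen_ideal S (Bn n)" using that Bn(3)[of n] by blast
    then show ?thesis
    proof (induction a rule: gen_ideal.induct)
      case gen_ideal_zero
      then show ?case using Q0[of n] by (force intro: gen_ideal.gen_ideal_zero bexI[of _ 0])
    next
      case (gen_ideal_step a s b)
      then obtain q where q: "q \<in> Q n" "Polynomial.coeff q n = a" "poly q y \<in> ?H" by auto
      have "poly (qq n b) y \<in> C" using gen_ideal_step that by (auto simp: C_def)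
      then have "poly q y + s * poly (qq n b) y \<in> ?H"
        using q gen_ideal_step Sad by (blast intro: gen_ideal.intros)
      moreover have "q + Polynomial.smult s (qq n b) \<in> Q n" using q qq gen_ideal_step Qadd Qsm by blast
      ultimately show ?case using q qq[of b n] gen_ideal_step by (intro bexI[of _ "q + Polynomial.smult s (qq n b)"]) auto
    qed
  qed
  have lead': "\<exists>q\<in>Q n. Polynomial.coeff q n = a \<and> poly q y \<in> ?H" if "a \<in> L n" for a n
  proof (cases "n \<le> N")
    case False
    have "a \<in> L N" using stab that by auto
    then obtain q where q: "q \<in> Q N" "Polynomial.coeff q N = a" "poly q y \<in> ?H" using lead[of N a] by auto
    have "poly (Polynomial.monom 1 (n - N) * q) y \<in> ?H"
      using q(3) gen_ideal_mult[OF subring_of_adjoin[OF S], of "y ^ (n - N)" y]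
      by (simp add: poly_monom subring_of_power[OF subring_of_adjoin[OF S]] adjoin_superset[OF S])
    then show ?thesis using q Qshift[OF q(1), of "n - N"] False
      by (intro bexI[of _ "Polynomial.monom 1 (n - N) * q"]) (auto simp: coeff_monom_mult)
  qed (use lead that in blast)
  have gen: "poly q y \<in> ?H" if "q \<in> coeffs_in S" "poly q y \<in> I" "\<forall>i\<ge>d. Polynomial.coeff q i = 0" for q d
    using that
  proof (induction d arbitrary: q)
    case 0
    then have "q = 0" by (simp add: poly_eq_iff)
    then show ?case by (simp add: gen_ideal_zero)
  next
    case (Suc d)
    then have "q \<in> Q d" by (auto simp: Q_def)
    then obtain p where p: "p \<in> Q d" "Polynomial.coeff p d = Polynomial.coeff q d" "poly p y \<in> ?H"
      using lead'[of "Polynomial.coeff q d" d] by (auto simp: L_def)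
    let ?r = "q + Polynomial.smult (-1) p"
    have "-1 \<in> S" using subring_of_uminus[OF S] S by (auto simp: subring_of_def)
    then have r: "?r \<in> Q d" using Qadd Qsm \<open>q \<in> Q d\<close> p by blast
    have "\<forall>i\<ge>d. Polynomial.coeff ?r i = 0"
      using r p(2) by (auto simp: Q_def le_less)
    then have "poly ?r y \<in> ?H" using Suc.IH[of ?r] r by (auto simp: Q_def)
    from gen_ideal_add[OF this p(3)] show ?case by simp
  qed
  have "I \<subseteq> ?H"
  proof
    fix a assume a: "a \<in> I"
    then obtain q where "q \<in> coeffs_in S" "a = poly q y" using I by (auto simp: ideal_in_def adjoin_def)
    then show "a \<in> ?H" using gen[of q "Suc (Polynomial.degree q)"] a by (auto simp: coeff_eq_0)
  qed
  moreover have "finite C" using Bn by (auto simp: C_def)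
  moreover have "C \<subseteq> I" using qq by (fastforce simp: C_def Q_def)
  ultimately show "\<exists>B. finite B \<and> B \<subseteq> I \<and> I \<subseteq> gen_ideal (adjoin S y) B" by blast
qed

text \<open>Zorn's lemma applies because the union of a chain of ideals is finitely generated: its
  finitely many generators lie in one member, which is then the whole union.\<close>

lemma noetherian_maximal:
  fixes F :: "'a::comm_ring_1 set set"
  assumes N: "noetherian (UNIV :: 'a set)" and F: "F \<noteq> {}" "\<forall>K\<in>F. is_ideal K"
  shows "\<exists>M\<in>F. \<forall>K\<in>F. M \<subseteq> K \<longrightarrow> K = M"
proof (rule subset_Zorn_nonempty[OF F(1)])
  fix C assume C: "C \<noteq> {}" "subset.chain F C"
  then have CX: "C \<subseteq> F" by (auto simp: subset.chain_def)
  have ch: "I \<subseteq> K \<or> K \<subseteq> I" if "I \<in> C" "K \<in> C" for I K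
    using C that by (auto simp: subset.chain_def)
  have FC: "is_ideal K" if "K \<in> C" for K using that CX F(2) by auto
  have id: "is_ideal (\<Union>C)"
    unfolding ideal_in_def
  proof (intro conjI ballI)
    obtain K where "K \<in> C" using C by auto
    then show "0 \<in> \<Union>C" using is_idealD(1)[OF FC] by auto
    show "a + b \<in> \<Union>C" if ab: "a \<in> \<Union>C" "b \<in> \<Union>C" for a b
    proof -
      obtain I K where IK: "I \<in> C" "K \<in> C" "a \<in> I" "b \<in> K" using ab by auto
      consider "I \<subseteq> K" | "K \<subseteq> I" using ch IK by auto
      then show ?thesis
      proof cases
        case 1
        then have "a + b \<in> K" using IK by (intro is_idealD(2)[OF FC]) auto
        then show ?thesis using IK by auto
      next
        case 2
        then have "a + b \<in> I" using IK by (intro is_idealD(2)[OF FC]) auto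
        then show ?thesis using IK by auto
      qed
    qed
    show "r * a \<in> \<Union>C" if a: "a \<in> \<Union>C" for r a
    proof -
      obtain K where K: "K \<in> C" "a \<in> K" using a by auto
      then have "r * a \<in> K" by (intro is_idealD(3)[OF FC])
      then show ?thesis using K by auto
    qed
  qed auto
  then obtain B where B: "finite B" "B \<subseteq> \<Union>C" "\<Union>C \<subseteq> gen_ideal UNIV B"
    using N unfolding noetherian_def by blast
  obtain K where K: "K \<in> C" "B \<subseteq> K"
    by (rule finite_subset_Union_chain[OF B(1,2) C])
  have "gen_ideal UNIV B \<subseteq> K" by (rule gen_ideal_least[OF FC[OF K(1)] K(2)])
  then have "\<Union>C = K" using B(3) K(1) by auto
  then show "\<Union>C \<in> F" using K CX by auto
qed

section \<open>Prime ideals\<close>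

definition is_prime :: "'a::comm_ring_1 set \<Rightarrow> bool" where
  "is_prime P \<longleftrightarrow> is_ideal P \<and> 1 \<notin> P \<and> (\<forall>a b. a * b \<in> P \<longrightarrow> a \<in> P \<or> b \<in> P)"

lemma is_primeD:
  assumes "is_prime P"
  shows "is_ideal P" "1 \<notin> P" "\<And>a b. a * b \<in> P \<Longrightarrow> a \<in> P \<or> b \<in> P"
  using assms by (auto simp: is_prime_def)

lemma is_ideal_quotient: "is_ideal K \<Longrightarrow> is_ideal {x. a * x \<in> K}"
  by (auto simp: ideal_in_def distrib_left mult.left_commute[of a])

lemma is_prime_power: "is_prime P \<Longrightarrow> a ^ n \<in> P \<Longrightarrow> a \<in> P"
  by (induction n) (auto dest: is_primeD)

lemma is_prime_prod:
  assumes "is_prime P" "finite A" "prod f A \<in> P"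
  shows "\<exists>i\<in>A. f i \<in> P"
  using assms(2,3,1) by (induction A rule: finite_induct) (auto dest: is_primeD)

lemma gen_ideal_insertE:
  assumes "x \<in> gen_ideal UNIV (insert a J)" "is_ideal J"
  obtains j r where "j \<in> J" "x = j + r * a"
proof -
  have "\<exists>j r. j \<in> J \<and> x = j + r * a"
    using assms(1)
  proof (induction x rule: gen_ideal.induct)
    case gen_ideal_zero
    then show ?case using is_idealD(1)[OF assms(2)] by (intro exI[of _ 0]) auto
  next
    case (gen_ideal_step x s b)
    then obtain j r where j: "j \<in> J" "x = j + r * a" by auto
    show ?case
    proof (cases "b \<in> J")
      case True
      then have "j + s * b \<in> J" using j is_idealD(2,3)[OF assms(2)] by auto
      then show ?thesis using j by (intro exI[of _ "j + s * b"] exI[of _ r]) auto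
    next
      case False
      then have "b = a" using gen_ideal_step by auto
      then show ?thesis using j by (intro exI[of _ j] exI[of _ "r + s"]) (auto simp: algebra_simps)
    qed
  qed
  then show ?thesis using that by blast
qed

lemma prod_lessThan_add:
  fixes f :: "nat \<Rightarrow> 'a::comm_monoid_mult"
  shows "(\<Prod>i<a + b. f i) = (\<Prod>i<a. f i) * (\<Prod>i<b. f (a + i))"
  by (induction b) (auto simp: mult_ac)

text \<open>If a maximal counterexample M contains a b but neither factor, then M + (a) and M + (b)
  contain products of primes, and the product of these two ideals lies in M. Products of ideals are
  expressed by elements picked from each member of the list; the empty list serves the unit
  ideal.\<close>

lemma noetherian_prime_product:
  fixes J :: "'a::comm_ring_1 set"
  assumes N: "noetherian (UNIV :: 'a set)" and J: "is_ideal J"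
  shows "\<exists>Ps. (\<forall>P\<in>set Ps. is_prime P \<and> J \<subseteq> P) \<and>
    (\<forall>f. (\<forall>i<length Ps. f i \<in> Ps ! i) \<longrightarrow> (\<Prod>i<length Ps. f i) \<in> J)"
proof (rule ccontr)
  define good where "good J \<longleftrightarrow> (\<exists>Ps. (\<forall>P\<in>set Ps. is_prime P \<and> J \<subseteq> P) \<and>
    (\<forall>f. (\<forall>i<length Ps. f i \<in> Ps ! i) \<longrightarrow> (\<Prod>i<length Ps. f i) \<in> J))" for J :: "'a set"
  assume "\<not> ?thesis"
  then have "{J. is_ideal J \<and> \<not> good J} \<noteq> {}" using J unfolding good_def by blast
  then obtain M where M: "is_ideal M" "\<not> good M"
    and max: "\<And>K. is_ideal K \<Longrightarrow> \<not> good K \<Longrightarrow> M \<subseteq> K \<Longrightarrow> K = M"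
    using noetherian_maximal[OF N, of "{J. is_ideal J \<and> \<not> good J}"] by blast
  have "M \<noteq> UNIV"
  proof
    assume "M = UNIV"
    then have "good M" unfolding good_def by (intro exI[of _ "[]"]) auto
    with M show False by blast
  qed
  then have one: "1 \<notin> M" using is_ideal_one M by blast
  have "\<not> is_prime M"
  proof
    assume "is_prime M"
    then have "good M" unfolding good_def by (intro exI[of _ "[M]"]) auto
    with M show False by blast
  qed
  then obtain a b where ab: "a * b \<in> M" "a \<notin> M" "b \<notin> M" using M one by (auto simp: is_prime_def)
  have gd: "\<exists>Ps. (\<forall>P\<in>set Ps. is_prime P \<and> M \<subseteq> P) \<and>
    (\<forall>f. (\<forall>i<length Ps. f i \<in> Ps ! i) \<longrightarrow> (\<Prod>i<length Ps. f i) \<in> gen_ideal UNIV (insert x M))"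
    if "x \<notin> M" for x
  proof -
    have sub: "M \<subseteq> gen_ideal UNIV (insert x M)" and "x \<in> gen_ideal UNIV (insert x M)"
      by (auto intro: gen_ideal_gen)
    then have "good (gen_ideal UNIV (insert x M))" using max[of "gen_ideal UNIV (insert x M)"] that by auto
    then show ?thesis using sub unfolding good_def by (meson subset_trans)
  qed
  obtain Ps where Ps: "\<forall>P\<in>set Ps. is_prime P \<and> M \<subseteq> P"
    "\<And>f. (\<forall>i<length Ps. f i \<in> Ps ! i) \<Longrightarrow> (\<Prod>i<length Ps. f i) \<in> gen_ideal UNIV (insert a M)"
    using gd[OF ab(2)] by blast
  obtain Qs where Qs: "\<forall>P\<in>set Qs. is_prime P \<and> M \<subseteq> P"
    "\<And>f. (\<forall>i<length Qs. f i \<in> Qs ! i) \<Longrightarrow> (\<Prod>i<length Qs. f i) \<in> gen_ideal UNIV (insert b M)"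
    using gd[OF ab(3)] by blast
  have "(\<Prod>i<length (Ps @ Qs). f i) \<in> M" if f: "\<forall>i<length (Ps @ Qs). f i \<in> (Ps @ Qs) ! i" for f
  proof -
    have "(\<Prod>i<length (Ps @ Qs). f i) = (\<Prod>i<length Ps. f i) * (\<Prod>i<length Qs. f (length Ps + i))"
      using prod_lessThan_add[of f "length Ps" "length Qs"] by simp
    moreover have "(\<Prod>i<length Ps. f i) \<in> gen_ideal UNIV (insert a M)"
    proof (intro Ps(2) allI impI)
      show "f i \<in> Ps ! i" if "i < length Ps" for i
        using f[rule_format, of i] that by (simp add: nth_append)
    qed
    moreover have "(\<Prod>i<length Qs. f (length Ps + i)) \<in> gen_ideal UNIV (insert b M)"
    proof (intro Qs(2) allI impI)
      show "f (length Ps + i) \<in> Qs ! i" if "i < length Qs" for i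
        using f[rule_format, of "length Ps + i"] that by simp
    qed
    moreover have "x * y \<in> M" if xy: "x \<in> gen_ideal UNIV (insert a M)" "y \<in> gen_ideal UNIV (insert b M)" for x y
    proof -
      obtain j r where x: "j \<in> M" "x = j + r * a" using xy M by (elim gen_ideal_insertE)
      obtain k s where y: "k \<in> M" "y = k + s * b" using xy M by (elim gen_ideal_insertE)
      have "x * y = j * y + (r * a) * k + (r * s) * (a * b)" by (simp add: x y algebra_simps)
      also have "\<dots> \<in> M"
        using x(1) y(1) ab M by (intro is_idealD(2)[OF M(1)]) (auto intro: is_idealD(3,4)[OF M(1)])
      finally show ?thesis .
    qed
    ultimately show ?thesis by simp
  qed
  then have "good M" unfolding good_def using Ps(1) Qs(1) by (intro exI[of _ "Ps @ Qs"]) auto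
  then show False using M by blast
qed

text \<open>\<open>g\<close> is a product of elements, one from each listed prime that is not
  contained in \<open>m\<close>. Where \<open>g\<close> does not vanish, only the components of V(J)
  through \<open>m\<close> are left. This is the neighbourhood of \<open>m\<close> on which the
  local dimension is estimated.\<close>

lemma exists_generizing_element:
  fixes J :: "'a::comm_ring_1 set"
  assumes N: "noetherian (UNIV :: 'a set)" and J: "is_ideal J" and m: "is_prime m"
  shows "\<exists>g. g \<notin> m \<and> (\<forall>Q. is_prime Q \<and> J \<subseteq> Q \<and> g \<notin> Q \<longrightarrow> (\<exists>P. is_prime P \<and> J \<subseteq> P \<and> P \<subseteq> Q \<and> P \<subseteq> m))"
proof -
  obtain Ps where Ps: "\<forall>P\<in>set Ps. is_prime P \<and> J \<subseteq> P"
    "\<And>f. (\<forall>i<length Ps. f i \<in> Ps ! i) \<Longrightarrow> (\<Prod>i<length Ps. f i) \<in> J"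
    using noetherian_prime_product[OF N J] by blast
  define f where "f i = (if Ps ! i \<subseteq> m then 1 else (SOME x. x \<in> Ps ! i \<and> x \<notin> m))" for i
  have f: "f i \<in> Ps ! i \<and> f i \<notin> m" if "\<not> Ps ! i \<subseteq> m" for i
    using that someI_ex[of "\<lambda>x. x \<in> Ps ! i \<and> x \<notin> m"] by (auto simp: f_def)
  define g where "g = (\<Prod>i<length Ps. f i)"
  have "g \<notin> m" using is_prime_prod[OF m, of "{..<length Ps}" f] f is_primeD(2)[OF m]
    by (auto simp: g_def) (metis f_def)
  moreover have "\<exists>P. is_prime P \<and> J \<subseteq> P \<and> P \<subseteq> Q \<and> P \<subseteq> m" if Q: "is_prime Q" "J \<subseteq> Q" "g \<notin> Q" for Q
  proof -
    have "\<exists>i<length Ps. Ps ! i \<subseteq> Q"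
    proof (rule ccontr)
      assume "\<not> ?thesis"
      then have "\<forall>i. \<exists>x. i < length Ps \<longrightarrow> x \<in> Ps ! i \<and> x \<notin> Q" by blast
      then obtain h where h: "\<And>i. i < length Ps \<Longrightarrow> h i \<in> Ps ! i \<and> h i \<notin> Q" by metis
      then have "(\<Prod>i<length Ps. h i) \<in> Q" using Ps(2)[of h] Q(2) by blast
      then show False using is_prime_prod[OF Q(1), of "{..<length Ps}" h] h by auto
    qed
    then obtain i where i: "i < length Ps" "Ps ! i \<subseteq> Q" by blast
    have "Ps ! i \<subseteq> m"
    proof (rule ccontr)
      assume "\<not> Ps ! i \<subseteq> m"
      then have "f i \<in> Q" using f[of i] i by blast
      moreover have "g = f i * prod f ({..<length Ps} - {i})"
        unfolding g_def using i by (intro prod.remove) auto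
      ultimately have "g \<in> Q" using is_idealD(4)[OF is_primeD(1)[OF Q(1)]] by metis
      then show False using Q by blast
    qed
    then show ?thesis using i Ps(1) by (intro exI[of _ "Ps ! i"]) auto
  qed
  ultimately show ?thesis by blast
qed

text \<open>A localisation argument without localisation: if every listed prime inside
  \<open>m\<close> contained \<open>x\<close>, then picking \<open>x\<close> from those and elements
  outside \<open>m\<close> from the others would give a product \<open>x ^ k * g\<close> in
  \<open>J\<close>.\<close>

lemma exists_prime_avoiding:
  fixes J :: "'a::comm_ring_1 set"
  assumes N: "noetherian (UNIV :: 'a set)" and J: "is_ideal J" and m: "is_prime m"
    and x: "\<And>k g. g \<notin> m \<Longrightarrow> x ^ k * g \<notin> J"
  shows "\<exists>P. is_prime P \<and> J \<subseteq> P \<and> P \<subseteq> m \<and> x \<notin> P"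
proof (rule ccontr)
  assume no: "\<not> ?thesis"
  obtain Ps where Ps: "\<forall>P\<in>set Ps. is_prime P \<and> J \<subseteq> P"
    "\<And>f. (\<forall>i<length Ps. f i \<in> Ps ! i) \<Longrightarrow> (\<Prod>i<length Ps. f i) \<in> J"
    using noetherian_prime_product[OF N J] by blast
  define f where "f i = (if Ps ! i \<subseteq> m then x else (SOME x. x \<in> Ps ! i \<and> x \<notin> m))" for i
  have f: "f i \<in> Ps ! i \<and> f i \<notin> m" if "\<not> Ps ! i \<subseteq> m" for i
    using that someI_ex[of "\<lambda>x. x \<in> Ps ! i \<and> x \<notin> m"] by (auto simp: f_def)
  have "f i \<in> Ps ! i" if "i < length Ps" for i
  proof (cases "Ps ! i \<subseteq> m")
    case True
    then show ?thesis using no Ps(1) that nth_mem by (fastforce simp: f_def)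
  qed (use f in blast)
  then have "(\<Prod>i<length Ps. f i) \<in> J" by (intro Ps(2)) auto
  moreover have "\<exists>k g. g \<notin> m \<and> (\<Prod>i<n. f i) = x ^ k * g" for n
  proof (induction n)
    case 0
    then show ?case using is_primeD(2)[OF m] by (intro exI[of _ 0] exI[of _ 1]) auto
  next
    case (Suc n)
    then obtain k g where kg: "g \<notin> m" "(\<Prod>i<n. f i) = x ^ k * g" by blast
    show ?case
    proof (cases "Ps ! n \<subseteq> m")
      case True
      then show ?thesis using kg by (intro exI[of _ "Suc k"] exI[of _ g]) (auto simp: f_def)
    next
      case False
      then show ?thesis using kg f[of n] is_primeD(3)[OF m, of g "f n"]
        by (intro exI[of _ k] exI[of _ "g * f n"]) (auto simp: mult.assoc)
    qed
  qed
  ultimately show False using x by metis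
qed

section \<open>The adic filtration modulo a prime\<close>

text \<open>The ideal m^N + P, the N-th step of the m-adic filtration of the quotient by
  \<open>P\<close>. Adding \<open>P\<close> at each stage keeps the quotient inside the original
  ring.\<close>

primrec filt :: "'a::comm_ring_1 set \<Rightarrow> 'a set \<Rightarrow> nat \<Rightarrow> 'a set" where
  "filt m P 0 = UNIV"
| "filt m P (Suc N) = gen_ideal UNIV ({a * b | a b. a \<in> m \<and> b \<in> filt m P N} \<union> P)"

lemma is_ideal_UNIV [simp]: "is_ideal UNIV"
  by (simp add: ideal_in_def)

lemma is_ideal_filt: "is_ideal (filt m P N)"
  by (cases N) auto

lemma filt_superset: "P \<subseteq> filt m P N"
  by (cases N) (auto intro: gen_ideal_gen)

lemma filt_mult1: "a \<in> m \<Longrightarrow> b \<in> filt m P N \<Longrightarrow> a * b \<in> filt m P (Suc N)"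
  by (auto intro!: gen_ideal_gen)

lemma filt_Suc_least:
  assumes "is_ideal K" "P \<subseteq> K" "\<And>a b. a \<in> m \<Longrightarrow> b \<in> filt m P N \<Longrightarrow> a * b \<in> K"
  shows "filt m P (Suc N) \<subseteq> K"
  unfolding filt.simps using assms by (intro gen_ideal_least) auto

lemma filt_Suc_subset: "filt m P (Suc N) \<subseteq> filt m P N"
  by (rule filt_Suc_least[OF is_ideal_filt filt_superset is_idealD(3)[OF is_ideal_filt]])

lemma filt_antimono: "i \<le> j \<Longrightarrow> filt m P j \<subseteq> filt m P i"
  using lift_Suc_antimono_le[of "filt m P" i j] filt_Suc_subset[of m P] by blast

lemma filt_1: "is_ideal m \<Longrightarrow> P \<subseteq> m \<Longrightarrow> filt m P (Suc 0) = m"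
proof
  assume m: "is_ideal m" "P \<subseteq> m"
  show "filt m P (Suc 0) \<subseteq> m"
    using m by (intro filt_Suc_least is_idealD(4)) auto
  show "m \<subseteq> filt m P (Suc 0)"
    using filt_mult1[of _ m 1 P 0] by auto
qed

lemma filt_mult:
  assumes P: "is_ideal P"
  shows "a \<in> filt m P i \<Longrightarrow> b \<in> filt m P j \<Longrightarrow> a * b \<in> filt m P (i + j)"
proof (induction i arbitrary: a b)
  case 0
  then show ?case by (auto intro: is_idealD(3)[OF is_ideal_filt])
next
  case (Suc i)
  from Suc.prems(1)[unfolded filt.simps] show ?case
  proof (induction a rule: gen_ideal.induct)
    case gen_ideal_zero
    show ?case using is_idealD(1)[OF is_ideal_filt] by (simp only: mult_zero_left)
  next
    case (gen_ideal_step a s c)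
    have "c * b \<in> filt m P (Suc i + j)"
    proof (cases "c \<in> P")
      case True
      then have "c * b \<in> P" by (rule is_idealD(4)[OF P])
      then show ?thesis using filt_superset by blast
    next
      case False
      then obtain u v where "c = u * v" "u \<in> m" "v \<in> filt m P i" using gen_ideal_step by auto
      then show ?thesis using Suc.IH[of v b] Suc.prems(2) filt_mult1[of u m "v * b" P "i + j"]
        by (simp add: mult.assoc del: filt.simps)
    qed
    then have "a * b + s * (c * b) \<in> filt m P (Suc i + j)"
      by (rule is_idealD(2)[OF is_ideal_filt gen_ideal_step.IH is_idealD(3)[OF is_ideal_filt]])
    then show ?case by (simp add: distrib_right mult.assoc del: filt.simps)
  qed
qed

text \<open>One factor is split off at a time: \<open>K\<close> is replaced by the colon ideal of
  all \<open>x\<close> with \<open>a * x\<close> in \<open>K\<close>, which contains the products of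
  one factor fewer.\<close>

lemma filt_subset_products:
  assumes "is_ideal m" "is_ideal K" "P \<subseteq> K" "\<And>f. (\<forall>i<N. f i \<in> m) \<Longrightarrow> (\<Prod>i<N. f i) \<in> K"
  shows "filt m P N \<subseteq> K"
  using assms(2-)
proof (induction N arbitrary: K)
  case 0
  have "K = UNIV" using 0(3)[of "\<lambda>_. 0"] by (intro is_ideal_one[OF 0(1)]) simp
  then show ?case by simp
next
  case (Suc N)
  have "a * b \<in> K" if a: "a \<in> m" and b: "b \<in> filt m P N" for a b
  proof -
    have "filt m P N \<subseteq> {x. a * x \<in> K}"
    proof (rule Suc.IH)
      show "is_ideal {x. a * x \<in> K}"
        by (rule is_ideal_quotient[OF Suc.prems(1)])
      show "P \<subseteq> {x. a * x \<in> K}" using Suc.prems(2) by (auto intro: is_idealD(3)[OF Suc.prems(1)])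
      show "(\<Prod>i<N. f i) \<in> {x. a * x \<in> K}" if "\<forall>i<N. f i \<in> m" for f
        using Suc.prems(3)[of "\<lambda>i. if i = N then a else f i"] that a
        by (auto simp: less_Suc_eq mult.commute)
    qed
    then show ?thesis using b by auto
  qed
  then show ?case using Suc.prems(1,2) by (intro filt_Suc_least)
qed

text \<open>If b is outside P, then b is not in m b + P, as (1 - u) b in P would force 1 - u into P
  and hence into m. Among the ideals that contain m b + P but not b, a maximal one \<open>K\<close>
  contains a power of every element of \<open>m\<close>. So all primes above \<open>K\<close>
  contain \<open>m\<close>, and \<open>K\<close> contains some m^N + P, hence b.\<close>

lemma krull_intersection:
  fixes m :: "'a::comm_ring_1 set"
  assumes N: "noetherian (UNIV :: 'a set)" and P: "is_prime P" and m: "is_ideal m" "1 \<notin> m" "P \<subseteq> m"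
    and b: "\<And>N. b \<in> filt m P N"
  shows "b \<in> P"
proof (rule ccontr)
  assume bP: "b \<notin> P"
  note Pid = is_primeD(1)[OF P]
  define L where "L = {u * b + p | u p. u \<in> m \<and> p \<in> P}"
  have L: "u * b + p \<in> L" if "u \<in> m" "p \<in> P" for u p using that by (auto simp: L_def)
  have Lid: "is_ideal L"
    unfolding ideal_in_def
  proof (intro conjI ballI)
    show "0 \<in> L" using L[OF is_idealD(1)[OF m(1)] is_idealD(1)[OF Pid]] by simp
    show "x + y \<in> L" if xy: "x \<in> L" "y \<in> L" for x y
    proof -
      obtain u p v q where "u \<in> m" "p \<in> P" "x = u * b + p" "v \<in> m" "q \<in> P" "y = v * b + q"
        using xy by (auto simp: L_def)
      then show ?thesis
        using L[of "u + v" "p + q"] is_idealD(2)[OF m(1), of u v] is_idealD(2)[OF Pid, of p q]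
        by (simp add: algebra_simps)
    qed
    show "r * x \<in> L" if x: "x \<in> L" for r x
    proof -
      obtain u p where "u \<in> m" "p \<in> P" "x = u * b + p" using x by (auto simp: L_def)
      then show ?thesis
        using L[of "r * u" "r * p"] is_idealD(3)[OF m(1), of u r] is_idealD(3)[OF Pid, of p r]
        by (simp add: algebra_simps)
    qed
  qed auto
  have "b \<notin> L"
  proof
    assume "b \<in> L"
    then obtain u p where up: "u \<in> m" "p \<in> P" "b = u * b + p" by (auto simp: L_def)
    have "(1 - u) * b = p" using arg_cong[OF up(3), of "\<lambda>z. z - u * b"] by (simp add: algebra_simps)
    then have "(1 - u) * b \<in> P" using up(2) by simp
    then have "1 - u \<in> m" using is_primeD(3)[OF P] bP m by blast
    then show False using m up(1) is_idealD(2)[OF m(1), of "1 - u" u] by simp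
  qed
  then have "{K. is_ideal K \<and> L \<subseteq> K \<and> b \<notin> K} \<noteq> {}"
    "\<forall>K\<in>{K. is_ideal K \<and> L \<subseteq> K \<and> b \<notin> K}. is_ideal K" using Lid by auto
  from noetherian_maximal[OF N this]
  obtain K where KX: "K \<in> {K. is_ideal K \<and> L \<subseteq> K \<and> b \<notin> K}"
    and KM: "\<forall>K'\<in>{K. is_ideal K \<and> L \<subseteq> K \<and> b \<notin> K}. K \<subseteq> K' \<longrightarrow> K' = K" by (rule bexE)
  have K: "is_ideal K" "L \<subseteq> K" "b \<notin> K" using KX by auto
  have max: "K' = K" if "is_ideal K'" "L \<subseteq> K'" "b \<notin> K'" "K \<subseteq> K'" for K' using KM that by auto
  have PK: "P \<subseteq> K" using L[OF is_idealD(1)[OF m(1)]] K(2) by auto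
  \<comment> \<open>The colon ideals of \<open>K\<close> by a^k stabilise. If a^k were not in
    \<open>K\<close>, maximality would give b = c + y a^k with c in \<open>K\<close>; since a b lies
    in \<open>K\<close>, so does a^(k+1) y, hence already a^k y, and then b.\<close>
  have nil: "\<exists>k. a ^ k \<in> K" if a: "a \<in> m" for a
  proof -
    define T where "T k = {x. a ^ k * x \<in> K}" for k :: nat
    have T: "is_ideal (T k)" for k
      unfolding T_def by (rule is_ideal_quotient[OF K(1)])
    have "range T \<noteq> {}" "\<forall>K\<in>range T. is_ideal K" using T by auto
    from noetherian_maximal[OF N this]
    obtain M where M: "M \<in> range T" "\<forall>K\<in>range T. M \<subseteq> K \<longrightarrow> K = M" by (rule bexE)
    then obtain k where "M = T k" by auto
    then have k: "T j = T k" if "T k \<subseteq> T j" for j using M(2) that by auto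
    have "T k \<subseteq> T (Suc k)"
    proof
      fix x assume "x \<in> T k"
      then have "a ^ k * x \<in> K" by (simp add: T_def)
      then have "a * (a ^ k * x) \<in> K" by (rule is_idealD(3)[OF K(1)])
      then show "x \<in> T (Suc k)" by (simp add: T_def mult.assoc)
    qed
    then have Tk: "T (Suc k) = T k" by (rule k)
    have "a ^ k \<in> K"
    proof (rule ccontr)
      assume "a ^ k \<notin> K"
      let ?K = "gen_ideal UNIV (insert (a ^ k) K)"
      have "K \<subseteq> ?K" "a ^ k \<in> ?K" by (auto intro: gen_ideal_gen)
      moreover have "L \<subseteq> ?K" using K(2) \<open>K \<subseteq> ?K\<close> by (rule subset_trans)
      ultimately have "b \<in> ?K" using max[OF is_ideal_gen_ideal, of "insert (a ^ k) K"] \<open>a ^ k \<notin> K\<close> \<open>K \<subseteq> ?K\<close> \<open>a ^ k \<in> ?K\<close> by blast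
      then obtain c y where c: "c \<in> K" "b = c + y * a ^ k" using K(1) by (elim gen_ideal_insertE)
      have "a * b + 0 \<in> L" by (rule L[OF a is_idealD(1)[OF Pid]])
      then have "a * b \<in> K" using K(2) by auto
      then have "a * b - a * c \<in> K" by (rule is_idealD(6)[OF K(1) _ is_idealD(3)[OF K(1) c(1)]])
      moreover have "a ^ Suc k * y = a * b - a * c" by (simp add: c(2) distrib_left mult_ac)
      ultimately have "y \<in> T (Suc k)" unfolding T_def by simp
      then have "y \<in> T k" unfolding Tk .
      then have "y * a ^ k \<in> K" by (simp add: T_def mult.commute)
      then show False using c K(3) is_idealD(2)[OF K(1) c(1)] by simp
    qed
    then show ?thesis by blast
  qed
  obtain Ps where Ps: "\<forall>P\<in>set Ps. is_prime P \<and> K \<subseteq> P"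
    "\<And>f. (\<forall>i<length Ps. f i \<in> Ps ! i) \<Longrightarrow> (\<Prod>i<length Ps. f i) \<in> K"
    using noetherian_prime_product[OF N K(1)] by blast
  have "m \<subseteq> Ps ! i" if i: "i < length Ps" for i
  proof
    fix a assume "a \<in> m"
    then obtain k where "a ^ k \<in> K" using nil by blast
    then have "a ^ k \<in> Ps ! i" using Ps(1) i by (meson nth_mem subsetD)
    then show "a \<in> Ps ! i" using Ps(1) i by (meson nth_mem is_prime_power)
  qed
  then have "(\<Prod>i<length Ps. f i) \<in> K" if "\<forall>i<length Ps. f i \<in> m" for f
    using that by (intro Ps(2)) auto
  then have "filt m P (length Ps) \<subseteq> K" by (rule filt_subset_products[OF m(1) K(1) PK])
  then show False using b[of "length Ps"] K(3) by auto
qed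

section \<open>Derivations modulo a prime\<close>

text \<open>A derivation from the image of \<open>S\<close> in R / P to R / P, represented by a
  function into R, so its laws hold modulo \<open>P\<close>. Only the value at 0 is exact, because
  \<open>map_poly\<close> is to apply it to coefficients.\<close>

definition deriv_mod :: "'a::comm_ring_1 set \<Rightarrow> 'a set \<Rightarrow> ('a \<Rightarrow> 'a) \<Rightarrow> bool" where
  "deriv_mod P S E \<longleftrightarrow> E 0 = 0 \<and> (\<forall>a\<in>S \<inter> P. E a \<in> P) \<and>
     (\<forall>a\<in>S. \<forall>b\<in>S. E (a + b) - (E a + E b) \<in> P \<and> E (a * b) - (a * E b + b * E a) \<in> P)"

lemma pCons_in_coeffs_in [simp]: "pCons a q \<in> coeffs_in S \<longleftrightarrow> a \<in> S \<and> q \<in> coeffs_in S"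
  unfolding coeffs_in_def by (auto simp: coeff_pCons split: nat.splits)

lemma poly_in_ideal:
  assumes "is_ideal P" "q \<in> coeffs_in P"
  shows "poly q y \<in> P"
  using assms(2) by (induction q) (auto intro: is_idealD[OF assms(1)])

lemma ideal_diff_iff:
  assumes "is_ideal P" "a - b \<in> P"
  shows "a \<in> P \<longleftrightarrow> b \<in> P"
proof
  show "b \<in> P" if "a \<in> P" using is_idealD(6)[OF assms(1) that assms(2)] by simp
  show "a \<in> P" if "b \<in> P" using is_idealD(2)[OF assms(1) assms(2) that] by simp
qed

text \<open>The library's \<open>pderiv\<close> requires a coefficient ring without zero divisors.\<close>

definition pder :: "'a::comm_ring_1 poly \<Rightarrow> 'a poly" where
  "pder q = Poly (map (\<lambda>n. of_nat (Suc n) * Polynomial.coeff q (Suc n)) [0..<Polynomial.degree q])"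

lemma coeff_pder: "Polynomial.coeff (pder q) n = of_nat (Suc n) * Polynomial.coeff q (Suc n)"
  by (auto simp: pder_def nth_default_def coeff_eq_0 simp del: of_nat_Suc)

lemma pder_0 [simp]: "pder 0 = 0"
  by (simp add: pder_def)

lemma pder_pCons: "pder (pCons a p) = p + pCons 0 (pder p)"
  by (rule poly_eqI) (auto simp: coeff_pder coeff_pCons algebra_simps split: nat.splits)

text \<open>The value that an extension of \<open>h\<close> times \<open>E\<close> with value
  \<open>e\<close> at \<open>y\<close> must have on q(y): one term differentiates the coefficients,
  the other the powers of \<open>y\<close>. The factor \<open>h\<close> makes room for the
  denominator f'(y) of the algebraic case.\<close>

definition ext_val :: "('a::comm_ring_1 \<Rightarrow> 'a) \<Rightarrow> 'a \<Rightarrow> 'a \<Rightarrow> 'a \<Rightarrow> 'a poly \<Rightarrow> 'a" where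
  "ext_val E h y e q = h * poly (map_poly E q) y + poly (pder q) y * e"

lemma ext_val_0 [simp]: "ext_val E h y e 0 = 0"
  by (simp add: ext_val_def)

lemma ext_val_pCons:
  assumes "E 0 = 0"
  shows "ext_val E h y e (pCons a q) = h * E a + y * ext_val E h y e q + poly q y * e"
  by (cases "a = 0 \<and> q = 0") (use assms in \<open>auto simp: ext_val_def map_poly_pCons pder_pCons algebra_simps\<close>)

context
  fixes P S :: "'a::comm_ring_1 set" and E :: "'a \<Rightarrow> 'a"
  assumes P: "is_ideal P" and S: "subring_of S" and E: "deriv_mod P S E"
begin

lemma E_simps: "E 0 = 0" "a \<in> S \<Longrightarrow> a \<in> P \<Longrightarrow> E a \<in> P"
  "a \<in> S \<Longrightarrow> b \<in> S \<Longrightarrow> E (a + b) - (E a + E b) \<in> P"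
  "a \<in> S \<Longrightarrow> b \<in> S \<Longrightarrow> E (a * b) - (a * E b + b * E a) \<in> P"
  using E by (auto simp: deriv_mod_def)

lemma deriv_mod_one: "E 1 \<in> P"
proof -
  have "E (1 * 1) - (1 * E 1 + 1 * E 1) \<in> P"
    using S by (intro E_simps) (auto simp: subring_of_def)
  then show ?thesis using is_idealD(5)[OF P] by fastforce
qed

lemma ext_val_add:
  assumes "q \<in> coeffs_in S" "r \<in> coeffs_in S"
  shows "ext_val E h y e (q + r) - (ext_val E h y e q + ext_val E h y e r) \<in> P"
  using assms
proof (induction q r rule: poly_induct2)
  case 0
  then show ?case using is_idealD(1)[OF P] by simp
next
  case (pCons a q b r)
  have "ext_val E h y e (pCons a q + pCons b r) -
      (ext_val E h y e (pCons a q) + ext_val E h y e (pCons b r))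
    = h * (E (a + b) - (E a + E b)) +
      y * (ext_val E h y e (q + r) - (ext_val E h y e q + ext_val E h y e r))"
    by (simp add: ext_val_pCons E_simps algebra_simps)
  also have "\<dots> \<in> P"
    using pCons by (intro is_idealD(2,3)[OF P] E_simps) auto
  finally show ?case .
qed

lemma ext_val_smult:
  assumes "a \<in> S" "r \<in> coeffs_in S"
  shows "ext_val E h y e (Polynomial.smult a r) - (a * ext_val E h y e r + h * E a * poly r y) \<in> P"
  using assms(2)
proof (induction r)
  case 0
  then show ?case using is_idealD(1)[OF P] by simp
next
  case (pCons b r)
  have "ext_val E h y e (Polynomial.smult a (pCons b r)) -
      (a * ext_val E h y e (pCons b r) + h * E a * poly (pCons b r) y)
    = h * (E (a * b) - (a * E b + b * E a)) +
      y * (ext_val E h y e (Polynomial.smult a r) - (a * ext_val E h y e r + h * E a * poly r y))"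
    by (simp add: ext_val_pCons E_simps algebra_simps)
  also have "\<dots> \<in> P"
    using pCons assms(1) by (intro is_idealD(2,3)[OF P] E_simps) auto
  finally show ?case .
qed

lemma ext_val_mult:
  assumes "q \<in> coeffs_in S" "r \<in> coeffs_in S"
  shows "ext_val E h y e (q * r) - (poly q y * ext_val E h y e r + poly r y * ext_val E h y e q) \<in> P"
  using assms(1)
proof (induction q)
  case 0
  then show ?case using is_idealD(1)[OF P] by simp
next
  case (pCons a q)
  note c = coeffs_in_closed[OF S]
  have qr: "pCons 0 (q * r) \<in> coeffs_in S" "Polynomial.smult a r \<in> coeffs_in S"
    using pCons assms(2) c S by (auto simp: subring_of_def)
  have "ext_val E h y e (pCons a q * r) -
      (poly (pCons a q) y * ext_val E h y e r + poly r y * ext_val E h y e (pCons a q))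
    = (ext_val E h y e (Polynomial.smult a r + pCons 0 (q * r)) -
        (ext_val E h y e (Polynomial.smult a r) + ext_val E h y e (pCons 0 (q * r)))) +
      ((ext_val E h y e (Polynomial.smult a r) - (a * ext_val E h y e r + h * E a * poly r y)) +
      y * (ext_val E h y e (q * r) - (poly q y * ext_val E h y e r + poly r y * ext_val E h y e q)))"
    by (simp add: ext_val_pCons E_simps algebra_simps)
  also have "\<dots> \<in> P"
    using pCons assms(2) qr
    by (intro is_idealD(2,3)[OF P] ext_val_add ext_val_smult pCons.IH) auto
  finally show ?case .
qed

lemma ext_val_coeffs_in_P:
  assumes "q \<in> coeffs_in S" "q \<in> coeffs_in P"
  shows "ext_val E h y e q \<in> P"
  using assms
proof (induction q)
  case 0
  then show ?case using is_idealD(1)[OF P] by simp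
next
  case (pCons a q)
  then have "E a \<in> P" "poly q y \<in> P" using E_simps(2) poly_in_ideal[OF P] by auto
  then show ?case
    using pCons is_idealD(2)[OF P is_idealD(2)[OF P is_idealD(3)[OF P] is_idealD(3)[OF P]] is_idealD(4)[OF P]]
    by (simp add: ext_val_pCons E_simps)
qed

text \<open>\<open>W\<close> is well-definedness: the prescribed value then depends, modulo
  \<open>P\<close>, only on q(y) modulo \<open>P\<close>. The derivation laws are inherited from
  those for polynomials.\<close>

lemma deriv_mod_adjoin:
  assumes W: "\<And>q. q \<in> coeffs_in S \<Longrightarrow> poly q y \<in> P \<Longrightarrow> ext_val E h y e q \<in> P"
  shows "\<exists>E'. deriv_mod P (adjoin S y) E' \<and> (\<forall>a\<in>S. E' a - h * E a \<in> P) \<and> E' y - e \<in> P"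
proof -
  note c = coeffs_in_closed[OF S]
  let ?w = "ext_val E h y e"
  define r where "r a = (SOME q. q \<in> coeffs_in S \<and> poly q y = a)" for a
  \<comment> \<open>The value 0 on all of \<open>P\<close> keeps \<open>E' 0 = 0\<close>
    exact.\<close>
  define E' where "E' a = (if a \<in> P then 0 else ?w (r a))" for a
  have r: "r a \<in> coeffs_in S" "poly (r a) y = a" if "a \<in> adjoin S y" for a
    using that someI_ex[of "\<lambda>q. q \<in> coeffs_in S \<and> poly q y = a"]
    by (auto simp: adjoin_def r_def)
  have E': "E' (poly q y) - ?w q \<in> P" if q: "q \<in> coeffs_in S" for q
  proof (cases "poly q y \<in> P")
    case True
    then show ?thesis using W[OF q] is_idealD(5)[OF P] by (auto simp: E'_def)
  next
    case False
    let ?r = "r (poly q y)"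
    have r': "?r \<in> coeffs_in S" "poly ?r y = poly q y"
      using r[of "poly q y"] q by (auto simp: adjoin_def)
    have d: "?r - q \<in> coeffs_in S" using c r' q by auto
    have "poly (?r - q) y \<in> P" using r' is_idealD(1)[OF P] by simp
    then have 1: "?w (?r - q) \<in> P" using W d by blast
    have 2: "?w ((?r - q) + q) - (?w (?r - q) + ?w q) \<in> P" by (rule ext_val_add[OF d q])
    have "?w ?r - ?w q = ?w ((?r - q) + q) - (?w (?r - q) + ?w q) + ?w (?r - q)" by simp
    then have "?w ?r - ?w q \<in> P" using is_idealD(2)[OF P 2 1] by simp
    then show ?thesis using False by (simp add: E'_def)
  qed
  have "deriv_mod P (adjoin S y) E'"
    unfolding deriv_mod_def
  proof (intro conjI ballI)
    show "E' 0 = 0" using is_idealD(1)[OF P] by (simp add: E'_def)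
    show "E' a \<in> P" if "a \<in> adjoin S y \<inter> P" for a
      using that is_idealD(1)[OF P] by (simp add: E'_def)
    fix a b assume "a \<in> adjoin S y" "b \<in> adjoin S y"
    then obtain p q where p: "p \<in> coeffs_in S" "a = poly p y" and q: "q \<in> coeffs_in S" "b = poly q y"
      by (auto simp: adjoin_def)
    have "E' (a + b) - (E' a + E' b) = (E' (poly (p + q) y) - ?w (p + q)) + (?w (p + q) - (?w p + ?w q))
        - ((E' (poly p y) - ?w p) + (E' (poly q y) - ?w q))"
      by (simp add: p q)
    also have "\<dots> \<in> P"
      by (rule is_idealD(6)[OF P is_idealD(2)[OF P E'[OF c(3)[OF p(1) q(1)]] ext_val_add[OF p(1) q(1)]]
            is_idealD(2)[OF P E'[OF p(1)] E'[OF q(1)]]])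
    finally show "E' (a + b) - (E' a + E' b) \<in> P" .
    have "E' (a * b) - (a * E' b + b * E' a) = (E' (poly (p * q) y) - ?w (p * q))
        + (?w (p * q) - (poly p y * ?w q + poly q y * ?w p))
        - (poly q y * (E' (poly p y) - ?w p) + poly p y * (E' (poly q y) - ?w q))"
      by (simp add: p q algebra_simps)
    also have "\<dots> \<in> P"
      by (rule is_idealD(6)[OF P is_idealD(2)[OF P E'[OF c(5)[OF p(1) q(1)]] ext_val_mult[OF p(1) q(1)]]
            is_idealD(2)[OF P is_idealD(3)[OF P E'[OF p(1)]] is_idealD(3)[OF P E'[OF q(1)]]]])
    finally show "E' (a * b) - (a * E' b + b * E' a) \<in> P" .
  qed
  moreover have "E' a - h * E a \<in> P" if "a \<in> S" for a
    using E'[of "[:a:]"] that c(1) by (simp add: ext_val_pCons E_simps)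
  moreover have "E' y - e \<in> P"
  proof -
    have "E' (poly [:0, 1:] y) - ?w [:0, 1:] \<in> P" using S c(1) by (intro E') (auto simp: subring_of_def)
    then have "E' y - (y * (h * E 1) + e) \<in> P" by (simp add: ext_val_pCons E_simps algebra_simps)
    moreover have "y * (h * E 1) \<in> P" using deriv_mod_one is_idealD(3)[OF P] by blast
    ultimately have "E' y - (y * (h * E 1) + e) + y * (h * E 1) \<in> P" by (rule is_idealD(2)[OF P])
    then show ?thesis by simp
  qed
  ultimately show ?thesis by blast
qed

end

definition transc :: "'a::comm_ring_1 set \<Rightarrow> 'a set \<Rightarrow> 'a \<Rightarrow> bool" where
  "transc P S y \<longleftrightarrow> (\<forall>q\<in>coeffs_in S. poly q y \<in> P \<longrightarrow> q \<in> coeffs_in P)"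

lemma deriv_mod_transc:
  assumes P: "is_ideal P" and S: "subring_of S" and E: "deriv_mod P S E" and y: "transc P S y"
  shows "\<exists>E'. deriv_mod P (adjoin S y) E' \<and> (\<forall>a\<in>S. E' a - E a \<in> P) \<and> E' y - e \<in> P"
proof -
  have "ext_val E 1 y e q \<in> P" if "q \<in> coeffs_in S" "poly q y \<in> P" for q
    using ext_val_coeffs_in_P[OF P S E that(1)] y that by (auto simp: transc_def)
  from deriv_mod_adjoin[OF P S E this] show ?thesis by simp
qed

lemma coeffs_in_pder:
  assumes S: "subring_of S" and q: "q \<in> coeffs_in S"
  shows "pder q \<in> coeffs_in S"
proof -
  have "of_nat n \<in> S" for n
    by (induction n) (use S in \<open>auto simp: subring_of_def\<close>)
  then show ?thesis
    using q S by (auto simp: coeffs_in_def coeff_pder subring_of_def simp del: of_nat_Suc)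
qed

text \<open>
  In the algebraic case \<open>y\<close> is a root mod \<open>P\<close> of a polynomial \<open>f\<close> of minimal degree, and
  \<open>f' (y) E\<close> extends by \<open>y \<mapsto> - f\<^sup>E (y)\<close>; well-definedness is pseudo-division by \<open>f\<close>.
\<close>

lemma deriv_mod_algebraic:
  assumes P: "is_prime P" and S: "subring_of S" and E: "deriv_mod P S E" and y: "\<not> transc P S y"
    and char0: "\<And>n. n > 0 \<Longrightarrow> of_nat n \<notin> P"
  shows "\<exists>h E'. h \<notin> P \<and> deriv_mod P (adjoin S y) E' \<and> (\<forall>a\<in>S. E' a - h * E a \<in> P)"
proof -
  note c = coeffs_in_closed[OF S]
  note Pid = is_primeD(1)[OF P]
  define Q where "Q = {q \<in> coeffs_in S. poly q y \<in> P \<and> Polynomial.lead_coeff q \<notin> P}"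
  \<comment> \<open>Leading terms with coefficient in \<open>P\<close> are stripped until the
    leading coefficient is outside \<open>P\<close>.\<close>
  have exQ: "\<exists>f\<in>Q. Polynomial.degree f \<le> Polynomial.degree q"
    if "q \<in> coeffs_in S" "poly q y \<in> P" "q \<notin> coeffs_in P" for q
    using that
  proof (induction "Polynomial.degree q" arbitrary: q rule: less_induct)
    case less
    show ?case
    proof (cases "Polynomial.lead_coeff q \<in> P")
      case False
      then show ?thesis using less by (auto simp: Q_def)
    next
      case True
      let ?n = "Polynomial.degree q"
      define r where "r = q - Polynomial.monom (Polynomial.lead_coeff q) ?n"
      have "q \<noteq> 0" using less(4) is_idealD(1)[OF Pid] by (auto simp: coeffs_in_def)
      have r: "r \<in> coeffs_in S" using less(2) unfolding r_def
        by (intro c(4) c(7)) (auto simp: coeffs_in_def)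
      have rP: "poly r y \<in> P"
        unfolding r_def using is_idealD(6)[OF Pid less(3) is_idealD(4)[OF Pid True, of "y ^ ?n"]]
        by (simp add: poly_monom)
      have rn: "r \<notin> coeffs_in P"
      proof
        assume *: "r \<in> coeffs_in P"
        have "q = r + Polynomial.monom (Polynomial.lead_coeff q) ?n" by (simp add: r_def)
        moreover have "Polynomial.coeff (r + Polynomial.monom (Polynomial.lead_coeff q) ?n) i \<in> P" for i
          using * True is_idealD(1,2)[OF Pid] by (auto simp: coeffs_in_def)
        ultimately have "q \<in> coeffs_in P" by (auto simp: coeffs_in_def)
        then show False using less(4) by blast
      qed
      have "r \<noteq> 0" using rn is_idealD(1)[OF Pid] by (auto simp: coeffs_in_def)
      have "Polynomial.degree r < ?n"
      proof -
        have "Polynomial.coeff r ?n = 0" by (simp add: r_def)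
        moreover have "Polynomial.degree r \<le> ?n"
          unfolding r_def by (intro degree_diff_le) (auto simp: degree_monom_le)
        ultimately show ?thesis using \<open>r \<noteq> 0\<close> by (metis leading_coeff_0_iff le_less)
      qed
      then show ?thesis using less(1)[OF _ r rP rn] by (meson less_imp_le order_trans)
    qed
  qed
  obtain q0 where q0: "q0 \<in> coeffs_in S" "poly q0 y \<in> P" "q0 \<notin> coeffs_in P"
    using y unfolding transc_def by blast
  obtain f0 where "f0 \<in> Q" using exQ[OF q0] by (elim bexE)
  from ex_has_least_nat[of "\<lambda>q. q \<in> Q", OF this, of Polynomial.degree]
  obtain f where f: "f \<in> Q" and fmin': "\<forall>q. q \<in> Q \<longrightarrow> Polynomial.degree f \<le> Polynomial.degree q"
    by (elim exE conjE)
  have fmin: "Polynomial.degree f \<le> Polynomial.degree q" if "q \<in> Q" for q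
    using fmin' that by blast
  have fS: "f \<in> coeffs_in S" "poly f y \<in> P" "Polynomial.lead_coeff f \<notin> P" using f by (auto simp: Q_def)
  have small: "q \<in> coeffs_in P"
    if "q \<in> coeffs_in S" "poly q y \<in> P" "Polynomial.degree q < Polynomial.degree f" for q
    using exQ[OF that(1,2)] that(3) fmin by force
  have deg: "Polynomial.degree f > 0"
  proof (rule ccontr)
    assume "\<not> ?thesis"
    then have "poly f y = Polynomial.lead_coeff f" by (metis degree_0_id coeff_pCons_0 gr0I poly_pCons poly_0 mult_zero_right add.right_neutral)
    then show False using fS by simp
  qed
  define h where "h = poly (pder f) y"
  \<comment> \<open>Separability: f' has smaller degree than f, so by minimality f'(y) in
    \<open>P\<close> would put all coefficients of f' into \<open>P\<close>, in particular the
    degree of f times its leading coefficient, against \<open>char0\<close>.\<close>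
  have "h \<notin> P"
  proof
    assume "h \<in> P"
    moreover have "Polynomial.degree (pder f) < Polynomial.degree f"
    proof (rule ccontr)
      assume *: "\<not> ?thesis"
      then have "Polynomial.coeff (pder f) (Polynomial.degree (pder f)) = 0"
        by (simp add: coeff_pder coeff_eq_0)
      then have "pder f = 0" by simp
      then show False using * deg by simp
    qed
    ultimately have "pder f \<in> coeffs_in P"
      using small coeffs_in_pder[OF S fS(1)] by (auto simp: h_def)
    then have "Polynomial.coeff (pder f) (Polynomial.degree f - 1) \<in> P" by (auto simp: coeffs_in_def)
    then have "of_nat (Polynomial.degree f) * Polynomial.lead_coeff f \<in> P"
      using deg by (simp add: coeff_pder)
    then show False using is_primeD(3)[OF P] char0 deg fS(3) by blast
  qed
  define e where "e = - poly (map_poly E f) y"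
  have wf0: "ext_val E h y e f = 0" by (simp add: ext_val_def h_def e_def algebra_simps)
  have W: "ext_val E h y e q \<in> P" if "q \<in> coeffs_in S" "poly q y \<in> P" for q
    using that
  proof (induction "Polynomial.degree q" arbitrary: q rule: less_induct)
    case less
    show ?case
    proof (cases "Polynomial.degree q < Polynomial.degree f")
      case True
      then show ?thesis using ext_val_coeffs_in_P[OF Pid S E] less small by blast
    next
      case False
      let ?w = "ext_val E h y e" and ?d = "Polynomial.degree q - Polynomial.degree f"
      define b where "b = Polynomial.lead_coeff f"
      define t where "t = Polynomial.monom (Polynomial.lead_coeff q) ?d"
      define r where "r = Polynomial.smult b q - t * f"
      have bS: "b \<in> S" "Polynomial.lead_coeff q \<in> S" using fS less by (auto simp: b_def coeffs_in_def)
      have tS: "t \<in> coeffs_in S" unfolding t_def by (rule c(7)[OF bS(2)])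
      have qS: "Polynomial.smult b q \<in> coeffs_in S" "t * f \<in> coeffs_in S"
        by (rule c(6)[OF bS(1) less(2)], rule c(5)[OF tS fS(1)])
      have rS: "r \<in> coeffs_in S" unfolding r_def by (rule c(4)[OF qS])
      have rP: "poly r y \<in> P" unfolding r_def
        using is_idealD(6)[OF Pid is_idealD(3)[OF Pid less(3)] is_idealD(3)[OF Pid fS(2)]] by simp
      have tf: "?w (t * f) \<in> P"
      proof -
        have "?w (t * f) - (poly t y * ?w f + poly f y * ?w t) \<in> P"
          by (rule ext_val_mult[OF Pid S E tS fS(1)])
        then show ?thesis using ideal_diff_iff[OF Pid] wf0 is_idealD(4)[OF Pid fS(2)] by simp
      qed
      have "?w r \<in> P"
      proof (cases "Polynomial.degree r < Polynomial.degree q")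
        case True
        then show ?thesis using less rS rP by blast
      next
        case F: False
        have "Polynomial.degree t \<le> ?d" by (simp add: t_def degree_monom_le)
        then have "Polynomial.degree (t * f) \<le> Polynomial.degree q"
          using degree_mult_le[of t f] False by linarith
        then have le: "Polynomial.degree r \<le> Polynomial.degree q"
          unfolding r_def by (intro degree_diff_le degree_smult_le) auto
        have "Polynomial.coeff r (Polynomial.degree q) = 0"
          using False by (simp add: r_def t_def b_def coeff_monom_mult)
        then have "r = 0" using le F by (metis leading_coeff_0_iff le_antisym not_le)
        then show ?thesis using is_idealD(1)[OF Pid] by simp
      qed
      moreover have "?w (r + t * f) - (?w r + ?w (t * f)) \<in> P"
        by (rule ext_val_add[OF Pid S E rS qS(2)])
      ultimately have "?w (r + t * f) \<in> P"
        using ideal_diff_iff[OF Pid] is_idealD(2)[OF Pid _ tf] by metis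
      then have "?w (Polynomial.smult b q) \<in> P" by (simp add: r_def)
      moreover have "?w (Polynomial.smult b q) - (b * ?w q + h * E b * poly q y) \<in> P"
        by (rule ext_val_smult[OF Pid S E bS(1) less(2)])
      ultimately have "b * ?w q + h * E b * poly q y \<in> P" using ideal_diff_iff[OF Pid] by metis
      from is_idealD(6)[OF Pid this is_idealD(3)[OF Pid less(3), of "h * E b"]]
      have "b * ?w q \<in> P" by simp
      then show ?thesis using is_primeD(3)[OF P] fS(3) unfolding b_def by blast
    qed
  qed
  show ?thesis using deriv_mod_adjoin[OF Pid S E W] \<open>h \<notin> P\<close> by blast
qed

section \<open>Towers of extensions, chains of primes and linear dependence\<close>

primrec adjoin_list :: "'a::comm_ring_1 set \<Rightarrow> 'a list \<Rightarrow> 'a set" where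
  "adjoin_list S [] = S"
| "adjoin_list S (y # ys) = adjoin_list (adjoin S y) ys"

lemma adjoin_list_append: "adjoin_list S (xs @ ys) = adjoin_list (adjoin_list S xs) ys"
  by (induction xs arbitrary: S) auto

lemma subring_of_adjoin_list: "subring_of S \<Longrightarrow> subring_of (adjoin_list S ys)"
  by (induction ys arbitrary: S) (auto intro: subring_of_adjoin)

lemma adjoin_list_superset_Un: "subring_of S \<Longrightarrow> S \<union> set ys \<subseteq> adjoin_list S ys"
proof (induction ys arbitrary: S)
  case (Cons y ys)
  have "adjoin S y \<union> set ys \<subseteq> adjoin_list S (y # ys)"
    using Cons.IH[OF subring_of_adjoin[OF Cons.prems]] by simp
  then show ?case using adjoin_superset[OF Cons.prems, of y] by auto
qed auto

lemma adjoin_list_superset: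
  assumes "subring_of S"
  shows "S \<subseteq> adjoin_list S ys" "set ys \<subseteq> adjoin_list S ys"
  using adjoin_list_superset_Un[OF assms, of ys] by auto

lemma adjoin_least:
  assumes T: "subring_of T" "S \<subseteq> T" "y \<in> T"
  shows "adjoin S y \<subseteq> T"
proof
  fix a assume "a \<in> adjoin S y"
  then obtain q where "q \<in> coeffs_in S" "a = poly q y" by (auto simp: adjoin_def)
  moreover have "q \<in> coeffs_in S \<Longrightarrow> poly q y \<in> T" for q
    by (induction q) (use T in \<open>auto simp: subring_of_def\<close>)
  ultimately show "a \<in> T" by blast
qed

lemma adjoin_list_least:
  assumes "subring_of T" "S \<subseteq> T" "set ys \<subseteq> T"
  shows "adjoin_list S ys \<subseteq> T"
  using assms by (induction ys arbitrary: S) (auto intro: adjoin_least[THEN subsetD])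

lemma noetherian_adjoin_list:
  "subring_of S \<Longrightarrow> noetherian S \<Longrightarrow> noetherian (adjoin_list S ys)"
  by (induction ys arbitrary: S) (auto intro: subring_of_adjoin noetherian_adjoin)

text \<open>Each algebraic generator contributes a factor outside \<open>P\<close>, each
  transcendental one the factor 1; \<open>h\<close> collects their product.\<close>

lemma deriv_mod_adjoin_list:
  assumes P: "is_prime P" and char0: "\<And>n. n > 0 \<Longrightarrow> of_nat n \<notin> P"
  shows "subring_of S \<Longrightarrow> deriv_mod P S E \<Longrightarrow>
    \<exists>h E'. h \<notin> P \<and> deriv_mod P (adjoin_list S ys) E' \<and> (\<forall>a\<in>S. E' a - h * E a \<in> P)"
proof (induction ys arbitrary: S E)
  case Nil
  then show ?case using is_primeD[OF P] is_idealD(1)[of P] by (intro exI[of _ 1] exI[of _ E]) auto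
next
  case (Cons y ys)
  note Pid = is_primeD(1)[OF P]
  have "\<exists>h E'. h \<notin> P \<and> deriv_mod P (adjoin S y) E' \<and> (\<forall>a\<in>S. E' a - h * E a \<in> P)"
  proof (cases "transc P S y")
    case True
    then show ?thesis
      using deriv_mod_transc[OF Pid Cons.prems, of y 0] is_primeD(2)[OF P]
      by (intro exI[of _ 1]) auto
  next
    case False
    then show ?thesis using deriv_mod_algebraic[OF P Cons.prems] char0 by blast
  qed
  then obtain h1 E1 where 1: "h1 \<notin> P" "deriv_mod P (adjoin S y) E1" "\<forall>a\<in>S. E1 a - h1 * E a \<in> P" by blast
  obtain h2 E2 where 2: "h2 \<notin> P" "deriv_mod P (adjoin_list (adjoin S y) ys) E2"
    "\<forall>a\<in>adjoin S y. E2 a - h2 * E1 a \<in> P"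
    using Cons.IH[OF subring_of_adjoin[OF Cons.prems(1)] 1(2)] by blast
  have "E2 a - (h2 * h1) * E a \<in> P" if "a \<in> S" for a
  proof -
    have "E2 a - h2 * E1 a \<in> P" using 2 that adjoin_superset[OF Cons.prems(1)] by blast
    moreover have "h2 * (E1 a - h1 * E a) \<in> P" using 1 that is_idealD(3)[OF Pid] by blast
    ultimately have "E2 a - h2 * E1 a + h2 * (E1 a - h1 * E a) \<in> P" by (rule is_idealD(2)[OF Pid])
    then show ?thesis by (simp add: algebra_simps)
  qed
  moreover have "h2 * h1 \<notin> P" using is_primeD(3)[OF P] 1 2 by blast
  ultimately show ?case using 2(2) by auto
qed

text \<open>The constant coefficient of \<open>q\<close> lies in \<open>R\<close> because q(y) and y
  do, hence in \<open>P\<close>; then y cancels modulo the prime \<open>Q\<close> and the induction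
  goes on. For \<open>Q = P\<close> this is transcendence of y modulo \<open>P\<close>; for larger
  \<open>Q\<close> it shows that S[y] meets \<open>Q\<close> only inside \<open>P\<close>.\<close>

lemma transc_of_chain:
  assumes P: "is_prime Q" and sub: "P \<subseteq> Q" "Q \<subseteq> R" and y: "y \<in> R" "y \<notin> Q"
    and S: "S \<inter> R \<subseteq> P" and R: "is_ideal R"
  shows "q \<in> coeffs_in S \<Longrightarrow> poly q y \<in> Q \<Longrightarrow> q \<in> coeffs_in P"
proof (induction q)
  case 0
  then show ?case using S is_idealD(1)[OF R] by (auto simp: coeffs_in_def)
next
  case (pCons a q)
  have ayQ: "a + y * poly q y \<in> Q" using pCons(4) by simp
  have "a + y * poly q y - y * poly q y \<in> R"
    using ayQ sub(2) by (intro is_idealD(6)[OF R _ is_idealD(4)[OF R y(1)]]) auto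
  then have a: "a \<in> P" using S pCons(3) by auto
  have "a + y * poly q y - a \<in> Q" using a sub(1) by (intro is_idealD(6)[OF is_primeD(1)[OF P] ayQ]) auto
  then have "y * poly q y \<in> Q" by simp
  then have "poly q y \<in> Q" using y(2) is_primeD(3)[OF P, of y "poly q y"] by blast
  then have "q \<in> coeffs_in P" using pCons(2,3) by simp
  then show ?case using a by simp
qed

text \<open>
  Elements \<open>c j\<close> of successive differences of a chain of primes, from the top down, are
  algebraically independent modulo the smallest prime.
\<close>

lemma chain_derivations:
  fixes p :: "nat \<Rightarrow> 'a::comm_ring_1 set"
  assumes p: "\<And>i. i \<le> k \<Longrightarrow> is_prime (p i)" "\<And>i. i < k \<Longrightarrow> p i \<subset> p (Suc i)"
    and K: "subring_of K" "\<And>i. i \<le> k \<Longrightarrow> K \<inter> p i \<subseteq> {0}"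
    and gen: "adjoin_list K ys = UNIV" and char0: "\<And>n. n > 0 \<Longrightarrow> of_nat n \<notin> p 0"
  shows "\<exists>c E. \<forall>j<k. deriv_mod (p 0) UNIV (E j) \<and> (\<forall>a\<in>K. E j a \<in> p 0) \<and>
    E j (c j) \<notin> p 0 \<and> (\<forall>i<j. E j (c i) \<in> p 0)"
proof -
  note P = p(1)[of 0, simplified]
  note Pid = is_primeD(1)[OF P]
  define q where "q i = (SOME x. x \<in> p (Suc i) \<and> x \<notin> p i)" for i
  have q: "q i \<in> p (Suc i)" "q i \<notin> p i" if "i < k" for i
    using someI_ex[of "\<lambda>x. x \<in> p (Suc i) \<and> x \<notin> p i"] p(2)[OF that] unfolding q_def by blast+
  have p0: "p 0 \<subseteq> p i" if "i \<le> k" for i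
    using that
  proof (induction i)
    case (Suc i)
    then show ?case using p(2)[of i] by simp
  qed simp
  \<comment> \<open>Reversed order: the element from the top step of the chain is adjoined first, so
    that \<open>T j\<close> meets \<open>p (k - j)\<close> only inside \<open>p 0\<close>.\<close>
  define c where "c j = q (k - 1 - j)" for j
  define T where "T j = adjoin_list K (map c [0..<j])" for j
  have Tsub: "subring_of (T j)" for j unfolding T_def by (intro subring_of_adjoin_list K)
  have TSuc: "T (Suc j) = adjoin (T j) (c j)" for j by (simp add: T_def adjoin_list_append)
  have T: "j \<le> k \<Longrightarrow> T j \<inter> p (k - j) \<subseteq> p 0" for j
  proof (induction j)
    case 0
    then show ?case using K is_idealD(1)[OF Pid] by (auto simp: T_def)
  next
    case (Suc j)
    let ?i = "k - Suc j"
    have i: "Suc ?i = k - j" "?i < k" "k - 1 - j = ?i" using Suc by auto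
    have "a \<in> p 0" if a: "a \<in> T (Suc j)" "a \<in> p ?i" for a
    proof -
      obtain r where r: "r \<in> coeffs_in (T j)" "a = poly r (c j)" using a TSuc by (auto simp: adjoin_def)
      have "r \<in> coeffs_in (p 0)"
      proof (rule transc_of_chain)
        show "is_prime (p ?i)" "is_ideal (p (k - j))" by (simp_all add: p(1) is_primeD(1))
        show "p 0 \<subseteq> p ?i" "p ?i \<subseteq> p (k - j)" using p0[of ?i] p(2)[OF i(2)] i by auto
        show "c j \<in> p (k - j)" "c j \<notin> p ?i" using q[OF i(2)] i by (auto simp: c_def)
        show "T j \<inter> p (k - j) \<subseteq> p 0" using Suc by simp
        show "r \<in> coeffs_in (T j)" "poly r (c j) \<in> p ?i" using r a(2) by auto
      qed
      then show ?thesis using r poly_in_ideal[OF Pid] by blast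
    qed
    then show ?case by auto
  qed
  have tr: "transc (p 0) (T j) (c j)" if j: "j < k" for j
  proof -
    let ?i = "k - Suc j"
    have i: "Suc ?i = k - j" "?i < k" "k - 1 - j = ?i" using j by auto
    show ?thesis
      unfolding transc_def
    proof (intro ballI impI, rule transc_of_chain)
      show "is_prime (p 0)" "is_ideal (p (k - j))" by (simp_all add: p(1) is_primeD(1))
      show "p 0 \<subseteq> p 0" "p 0 \<subseteq> p (k - j)" using p0[of "k - j"] by auto
      show "c j \<in> p (k - j)" "c j \<notin> p 0" using q[OF i(2)] p0[of ?i] i by (auto simp: c_def)
      show "T j \<inter> p (k - j) \<subseteq> p 0" using T j by simp
    qed
  qed
  \<comment> \<open>Start from the zero derivation on \<open>T j\<close>, send the transcendental
    \<open>c j\<close> to 1, and extend through the remaining generators. Vanishing on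
    \<open>T j\<close>, which contains the earlier \<open>c i\<close>, makes the family
    triangular.\<close>
  have "\<exists>E. deriv_mod (p 0) UNIV E \<and> (\<forall>a\<in>T j. E a \<in> p 0) \<and> E (c j) \<notin> p 0" if j: "j < k" for j
  proof -
    have "deriv_mod (p 0) (T j) (\<lambda>_. 0)" using is_idealD(1)[OF Pid] by (auto simp: deriv_mod_def)
    from deriv_mod_transc[OF Pid Tsub this tr[OF j], of 1]
    obtain E1 where E1: "deriv_mod (p 0) (T (Suc j)) E1" "\<forall>a\<in>T j. E1 a \<in> p 0" "E1 (c j) - 1 \<in> p 0"
      by (auto simp: TSuc)
    obtain h E where E: "h \<notin> p 0" "deriv_mod (p 0) (adjoin_list (T (Suc j)) ys) E"
      "\<forall>a\<in>T (Suc j). E a - h * E1 a \<in> p 0"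
      using deriv_mod_adjoin_list[OF P char0 Tsub E1(1)] by blast
    have "K \<subseteq> adjoin_list (T (Suc j)) ys"
      using adjoin_list_superset(1)[OF K(1)] adjoin_list_superset(1)[OF Tsub] unfolding T_def by blast
    then have "UNIV \<subseteq> adjoin_list (T (Suc j)) ys"
      unfolding gen[symmetric]
      by (intro adjoin_list_least subring_of_adjoin_list Tsub adjoin_list_superset(2)) auto
    then have U: "adjoin_list (T (Suc j)) ys = UNIV" by blast
    have "E a \<in> p 0" if "a \<in> T j" for a
    proof -
      have "E a - h * E1 a \<in> p 0" using E that adjoin_superset(1)[OF Tsub] TSuc by blast
      moreover have "h * E1 a \<in> p 0" using E1 that is_idealD(3)[OF Pid] by blast
      ultimately show ?thesis using ideal_diff_iff[OF Pid] by blast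
    qed
    moreover have "E (c j) \<notin> p 0"
    proof
      assume *: "E (c j) \<in> p 0"
      have "E (c j) - h * E1 (c j) \<in> p 0" using E adjoin_superset(2)[OF Tsub] TSuc by blast
      then have "h * E1 (c j) \<in> p 0" using * ideal_diff_iff[OF Pid] by blast
      then have "E1 (c j) \<in> p 0" using E is_primeD(3)[OF P] by blast
      then have "1 \<in> p 0" using E1(3) ideal_diff_iff[OF Pid] by blast
      then show False using is_primeD(2)[OF P] by blast
    qed
    ultimately show ?thesis using E(2) U by auto
  qed
  then have "\<exists>E. \<forall>j. j < k \<longrightarrow> deriv_mod (p 0) UNIV (E j) \<and> (\<forall>a\<in>T j. E j a \<in> p 0) \<and> E j (c j) \<notin> p 0"
    by (intro choice allI) blast
  then obtain E where E: "\<And>j. j < k \<Longrightarrow> deriv_mod (p 0) UNIV (E j) \<and> (\<forall>a\<in>T j. E j a \<in> p 0) \<and> E j (c j) \<notin> p 0"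
    by blast
  have "c i \<in> T j" if "i < j" for i j
    using adjoin_list_superset(2)[OF K(1), of "map c [0..<j]"] that unfolding T_def by auto
  moreover have "K \<subseteq> T j" for j unfolding T_def by (rule adjoin_list_superset(1)[OF K(1)])
  ultimately show ?thesis using E by (intro exI[of _ c] exI[of _ E]) blast
qed

text \<open>Gaussian elimination without division over the domain R / P: a row \<open>k\<close> with
  \<open>v k d\<close> outside \<open>P\<close> clears the last coordinate of the other rows after
  cross-multiplication. The case of P = {0} in the complex numbers serves for ordinary linear
  algebra below.\<close>

lemma linear_dependence:
  fixes v :: "'i \<Rightarrow> nat \<Rightarrow> 'a::comm_ring_1"
  assumes P: "is_prime P"
  shows "finite A \<Longrightarrow> card A > d \<Longrightarrow>
    \<exists>a. (\<exists>i\<in>A. a i \<notin> P) \<and> (\<forall>j<d. (\<Sum>i\<in>A. a i * v i j) \<in> P)"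
proof (induction d arbitrary: A v)
  case 0
  then have "A \<noteq> {}" by auto
  then show ?case using is_primeD(2)[OF P] by (intro exI[of _ "\<lambda>_. 1"]) auto
next
  case (Suc d)
  note Pid = is_primeD(1)[OF P]
  show ?case
  proof (cases "\<forall>i\<in>A. v i d \<in> P")
    case True
    obtain a where a: "\<exists>i\<in>A. a i \<notin> P" "\<forall>j<d. (\<Sum>i\<in>A. a i * v i j) \<in> P"
      using Suc.IH[of A v] Suc.prems by auto
    have "(\<Sum>i\<in>A. a i * v i d) \<in> P" using True by (intro is_idealD(7)[OF Pid] is_idealD(3)[OF Pid]) auto
    then show ?thesis using a by (intro exI[of _ a]) (auto simp: less_Suc_eq)
  next
    case False
    then obtain k where k: "k \<in> A" "v k d \<notin> P" by blast
    define w where "w i j = v k d * v i j - v i d * v k j" for i j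
    have "card (A - {k}) > d" using Suc.prems k by simp
    then obtain a where a: "\<exists>i\<in>A - {k}. a i \<notin> P" "\<forall>j<d. (\<Sum>i\<in>A - {k}. a i * w i j) \<in> P"
      using Suc.IH[of "A - {k}" w] Suc.prems by auto
    define b where "b i = (if i = k then - (\<Sum>i\<in>A - {k}. a i * v i d) else a i * v k d)" for i
    have eq: "(\<Sum>i\<in>A. b i * v i j) = (\<Sum>i\<in>A - {k}. a i * w i j)" for j
    proof -
      have "(\<Sum>i\<in>A. b i * v i j) = b k * v k j + (\<Sum>i\<in>A - {k}. b i * v i j)"
        using k Suc.prems by (subst sum.remove[of A k]) auto
      also have "(\<Sum>i\<in>A - {k}. b i * v i j) = (\<Sum>i\<in>A - {k}. a i * v k d * v i j)"
        by (intro sum.cong) (auto simp: b_def)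
      also have "b k * v k j = - (\<Sum>i\<in>A - {k}. a i * v i d * v k j)"
        by (simp add: b_def sum_distrib_right)
      finally show ?thesis by (simp add: w_def algebra_simps sum_subtractf)
    qed
    have "(\<Sum>i\<in>A. b i * v i j) \<in> P" if "j < Suc d" for j
    proof (cases "j = d")
      case True
      then show ?thesis unfolding eq using is_idealD(1)[OF Pid] by (simp add: w_def mult.commute)
    next
      case False
      then show ?thesis unfolding eq using a that by auto
    qed
    moreover obtain i where "i \<in> A - {k}" "a i \<notin> P" using a by blast
    then have "i \<in> A" "b i \<notin> P" using is_primeD(3)[OF P, of "a i" "v k d"] k by (auto simp: b_def)
    ultimately show ?thesis by (intro exI[of _ b]) auto
  qed
qed

section \<open>Finitely generated complex algebras at a rational point\<close>

lemma filt_mono: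
  assumes "J \<subseteq> P"
  shows "filt m J N \<subseteq> filt m P N"
proof (induction N)
  case (Suc N)
  show ?case
  proof (rule filt_Suc_least[OF is_ideal_filt])
    show "J \<subseteq> filt m P (Suc N)" using assms filt_superset[of P m "Suc N"] by blast
    show "a * b \<in> filt m P (Suc N)" if "a \<in> m" "b \<in> filt m J N" for a b
      using filt_mult1[of a m b P N] that Suc by blast
  qed
qed simp

lemma filt_2_least:
  assumes "is_ideal K" "P \<subseteq> K" "\<And>a b. a \<in> m \<Longrightarrow> b \<in> m \<Longrightarrow> a * b \<in> K" "is_ideal m" "P \<subseteq> m"
  shows "filt m P 2 \<subseteq> K"
  unfolding numeral_2_eq_2
  using assms filt_1[OF assms(4,5)] by (intro filt_Suc_least) auto

lemma ideal_add_notin: "is_ideal P \<Longrightarrow> b \<in> P \<Longrightarrow> a \<notin> P \<Longrightarrow> a + b \<notin> P"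
  using is_idealD(6)[of P "a + b" b] by auto

definition cong_mod :: "'a::comm_ring_1 set \<Rightarrow> 'a \<Rightarrow> 'a \<Rightarrow> bool" where
  "cong_mod P a b \<longleftrightarrow> a - b \<in> P"

lemma cong_mod_refl: "is_ideal P \<Longrightarrow> cong_mod P a a"
  by (simp add: cong_mod_def is_idealD(1))

lemma cong_mod_trans: "is_ideal P \<Longrightarrow> cong_mod P a b \<Longrightarrow> cong_mod P b c \<Longrightarrow> cong_mod P a c"
  unfolding cong_mod_def using is_idealD(2)[of P "a - b" "b - c"] by simp

lemma cong_mod_add: "is_ideal P \<Longrightarrow> cong_mod P a b \<Longrightarrow> cong_mod P c d \<Longrightarrow> cong_mod P (a + c) (b + d)"
  unfolding cong_mod_def using is_idealD(2)[of P "a - b" "c - d"] by (simp add: algebra_simps)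

lemma cong_mod_mult: "is_ideal P \<Longrightarrow> cong_mod P a b \<Longrightarrow> cong_mod P c d \<Longrightarrow> cong_mod P (a * c) (b * d)"
  unfolding cong_mod_def
  using is_idealD(2)[of P "(a - b) * c" "b * (c - d)"] is_idealD(4)[of P "a - b" c] is_idealD(3)[of P "c - d" b]
  by (simp add: algebra_simps)

lemma cong_mod_sum:
  "is_ideal P \<Longrightarrow> (\<And>i. i \<in> A \<Longrightarrow> cong_mod P (f i) (g i)) \<Longrightarrow> cong_mod P (sum f A) (sum g A)"
  unfolding cong_mod_def sum_subtractf[symmetric] by (rule is_idealD(7))

lemma cong_mod_mem: "is_ideal P \<Longrightarrow> cong_mod P a b \<Longrightarrow> a \<in> P \<longleftrightarrow> b \<in> P"
  unfolding cong_mod_def by (rule ideal_diff_iff)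

lemma cong_mod_mono: "P \<subseteq> Q \<Longrightarrow> cong_mod P a b \<Longrightarrow> cong_mod Q a b"
  by (auto simp: cong_mod_def)

lemma deriv_mod_UNIV:
  assumes "deriv_mod P UNIV E"
  shows "cong_mod P (E (a + b)) (E a + E b)" "cong_mod P (E (a * b)) (a * E b + b * E a)"
    "E 0 = 0" "a \<in> P \<Longrightarrow> E a \<in> P"
  using assms by (auto simp: deriv_mod_def cong_mod_def)

lemma deriv_mod_sum:
  assumes P: "is_ideal P" and E: "deriv_mod P UNIV E"
  shows "cong_mod P (E (sum f A)) (\<Sum>i\<in>A. E (f i))"
proof (induction A rule: infinite_finite_induct)
  case (insert i A)
  have "cong_mod P (E (f i + sum f A)) (E (f i) + E (sum f A))" by (rule deriv_mod_UNIV(1)[OF E])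
  moreover have "cong_mod P (E (f i) + E (sum f A)) (E (f i) + (\<Sum>i\<in>A. E (f i)))"
    by (intro cong_mod_add[OF P] cong_mod_refl[OF P] insert.IH)
  ultimately show ?case using insert cong_mod_trans[OF P] by simp
qed (auto simp: deriv_mod_UNIV(3)[OF E] cong_mod_refl[OF P])

text \<open>In each Leibniz term of a product of N + 1 factors from \<open>m\<close> only one factor
  is differentiated, so N of them remain.\<close>

lemma deriv_mod_filt:
  assumes E: "deriv_mod P UNIV E"
  shows "filt m P (Suc N) \<subseteq> {s \<in> filt m P N. E s \<in> filt m P N}"
proof (induction N)
  case 0
  show ?case by (simp del: filt.simps(2))
next
  case (Suc N)
  let ?F = "filt m P (Suc N)"
  have F: "is_ideal ?F" and PF: "P \<subseteq> ?F" by (rule is_ideal_filt filt_superset)+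
  have sub: "r \<in> ?F" if "cong_mod P r s" "s \<in> ?F" for r s
    using cong_mod_mem[OF F cong_mod_mono[OF PF that(1)]] that(2) by blast
  show ?case
  proof (rule filt_Suc_least)
    show "is_ideal {s \<in> ?F. E s \<in> ?F}"
      unfolding ideal_in_def
    proof (intro conjI ballI)
      show "0 \<in> {s \<in> ?F. E s \<in> ?F}"
        using is_idealD(1)[OF F] deriv_mod_UNIV(3)[OF E] by simp
      show "s + t \<in> {s \<in> ?F. E s \<in> ?F}"
        if "s \<in> {s \<in> ?F. E s \<in> ?F}" "t \<in> {s \<in> ?F. E s \<in> ?F}" for s t
        using that sub[OF deriv_mod_UNIV(1)[OF E] is_idealD(2)[OF F, of "E s" "E t"]] is_idealD(2)[OF F, of s t]
        by (simp del: filt.simps)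
      show "s * t \<in> {s \<in> ?F. E s \<in> ?F}" if "t \<in> {s \<in> ?F. E s \<in> ?F}" for s t
      proof -
        have t: "t \<in> ?F" "E t \<in> ?F" using that by auto
        have "s * E t + t * E s \<in> ?F"
          by (rule is_idealD(2)[OF F is_idealD(3)[OF F t(2)] is_idealD(4)[OF F t(1)]])
        then have "E (s * t) \<in> ?F" by (rule sub[OF deriv_mod_UNIV(2)[OF E]])
        then show ?thesis using is_idealD(3)[OF F t(1)] by simp
      qed
    qed simp
    show "P \<subseteq> {s \<in> ?F. E s \<in> ?F}" using PF deriv_mod_UNIV(4)[OF E] by blast
    show "s * t \<in> {s \<in> ?F. E s \<in> ?F}" if st: "s \<in> m" "t \<in> filt m P (Suc N)" for s t
    proof -
      have t: "t \<in> filt m P N" "E t \<in> filt m P N" using st(2) Suc.IH by blast+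
      have "s * E t \<in> ?F" by (rule filt_mult1[OF st(1) t(2)])
      moreover have "t * E s \<in> ?F" by (rule is_idealD(4)[OF F st(2)])
      ultimately have "s * E t + t * E s \<in> ?F" by (rule is_idealD(2)[OF F])
      then have "E (s * t) \<in> ?F" by (rule sub[OF deriv_mod_UNIV(2)[OF E]])
      then show ?thesis using is_idealD(3)[OF F st(2)] by simp
    qed
  qed
qed

lemma deriv_mod_lincomb:
  assumes P: "is_ideal P" and E: "\<And>i. i \<in> A \<Longrightarrow> deriv_mod P UNIV (E i)"
  shows "deriv_mod P UNIV (\<lambda>x. \<Sum>i\<in>A. a i * E i x)"
  unfolding deriv_mod_def
proof (intro conjI ballI)
  show "(\<Sum>i\<in>A. a i * E i 0) = 0" using deriv_mod_UNIV(3)[OF E] by simp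
  show "(\<Sum>i\<in>A. a i * E i x) \<in> P" if "x \<in> UNIV \<inter> P" for x
    using that by (intro is_idealD(7)[OF P] is_idealD(3)[OF P] deriv_mod_UNIV(4)[OF E]) auto
  fix x y
  have "cong_mod P (\<Sum>i\<in>A. a i * E i (x + y)) (\<Sum>i\<in>A. a i * (E i x + E i y))"
    by (intro cong_mod_sum[OF P] cong_mod_mult[OF P] cong_mod_refl[OF P] deriv_mod_UNIV(1)[OF E])
  then show "(\<Sum>i\<in>A. a i * E i (x + y)) - ((\<Sum>i\<in>A. a i * E i x) + (\<Sum>i\<in>A. a i * E i y)) \<in> P"
    by (simp add: cong_mod_def distrib_left sum.distrib)
  have "cong_mod P (\<Sum>i\<in>A. a i * E i (x * y)) (\<Sum>i\<in>A. a i * (x * E i y + y * E i x))"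
    by (intro cong_mod_sum[OF P] cong_mod_mult[OF P] cong_mod_refl[OF P] deriv_mod_UNIV(2)[OF E])
  moreover have "(\<Sum>i\<in>A. a i * (x * E i y + y * E i x)) =
      x * (\<Sum>i\<in>A. a i * E i y) + y * (\<Sum>i\<in>A. a i * E i x)"
    by (simp add: distrib_left sum.distrib sum_distrib_left mult.left_commute)
  ultimately show "(\<Sum>i\<in>A. a i * E i (x * y)) -
      (x * (\<Sum>i\<in>A. a i * E i y) + y * (\<Sum>i\<in>A. a i * E i x)) \<in> P"
    by (simp add: cong_mod_def)
qed

locale complex_algebra =
  fixes \<kappa> :: "complex \<Rightarrow> 'a::comm_ring_1" and ys :: "'a list"
  assumes \<kappa>_add: "\<kappa> (c + d) = \<kappa> c + \<kappa> d" and \<kappa>_mult: "\<kappa> (c * d) = \<kappa> c * \<kappa> d"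
    and \<kappa>_1: "\<kappa> 1 = 1" and generated: "adjoin_list (range \<kappa>) ys = UNIV"
begin

lemma \<kappa>_0: "\<kappa> 0 = 0"
  using \<kappa>_add[of 0 0] by simp

lemma \<kappa>_uminus: "\<kappa> (- c) = - \<kappa> c"
  using \<kappa>_add[of c "- c"] by (simp add: \<kappa>_0 eq_neg_iff_add_eq_0 add.commute)

lemma \<kappa>_diff: "\<kappa> (c - d) = \<kappa> c - \<kappa> d"
  using \<kappa>_add[of c "- d"] by (simp add: \<kappa>_uminus)

lemma \<kappa>_sum: "\<kappa> (sum f A) = (\<Sum>i\<in>A. \<kappa> (f i))"
  by (induction A rule: infinite_finite_induct) (auto simp: \<kappa>_0 \<kappa>_add)

lemma \<kappa>_of_nat: "\<kappa> (of_nat n) = of_nat n"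
  by (induction n) (auto simp: \<kappa>_0 \<kappa>_1 \<kappa>_add)

lemma subring_of_scalars: "subring_of (range \<kappa>)"
  unfolding subring_of_def
  by (auto simp: \<kappa>_0[symmetric] \<kappa>_1[symmetric] \<kappa>_add[symmetric] \<kappa>_diff[symmetric] \<kappa>_mult[symmetric])

lemma scalar_in_ideal:
  assumes "is_ideal K" "1 \<notin> K" "\<kappa> c \<in> K"
  shows "c = 0"
proof (rule ccontr)
  assume "c \<noteq> 0"
  then have "\<kappa> (1 / c) * \<kappa> c = 1" by (simp add: \<kappa>_mult[symmetric] \<kappa>_1)
  then show False using is_idealD(3)[OF assms(1,3), of "\<kappa> (1 / c)"] assms(2) by simp
qed

lemma noetherian_scalars: "noetherian (range \<kappa>)"
  unfolding noetherian_def
proof (intro allI impI)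
  fix K assume K: "ideal_in (range \<kappa>) K"
  show "\<exists>B. finite B \<and> B \<subseteq> K \<and> K \<subseteq> gen_ideal (range \<kappa>) B"
  proof (cases "K \<subseteq> {0}")
    case True
    then show ?thesis by (intro exI[of _ "{}"]) (auto intro: gen_ideal_zero)
  next
    case False
    then obtain a where "a \<in> K" "a \<noteq> 0" by blast
    moreover have "K \<subseteq> range \<kappa>" using K by (simp add: ideal_in_def)
    ultimately obtain c where c: "\<kappa> c \<in> K" "\<kappa> c \<noteq> 0" by blast
    then have "c \<noteq> 0" using \<kappa>_0 by metis
    have "\<kappa> d \<in> gen_ideal (range \<kappa>) {\<kappa> c}" for d
    proof -
      have "\<kappa> d = 0 + \<kappa> (d / c) * \<kappa> c" using \<open>c \<noteq> 0\<close> by (simp add: \<kappa>_mult[symmetric])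
      also have "\<dots> \<in> gen_ideal (range \<kappa>) {\<kappa> c}"
        by (rule gen_ideal_step[OF gen_ideal_zero]) auto
      finally show ?thesis .
    qed
    moreover have "K \<subseteq> range \<kappa>" using K by (simp add: ideal_in_def)
    ultimately show ?thesis using c by (intro exI[of _ "{\<kappa> c}"]) auto
  qed
qed

lemma noetherian_UNIV: "noetherian (UNIV :: 'a set)"
  using noetherian_adjoin_list[OF subring_of_scalars noetherian_scalars, of ys] generated by simp

lemma of_nat_notin_prime:
  fixes P :: "'a set"
  assumes P: "is_prime P" and n: "n > 0"
  shows "of_nat n \<notin> P"
  using scalar_in_ideal[OF is_primeD(1)[OF P] is_primeD(2)[OF P], of "of_nat n"] n by (auto simp: \<kappa>_of_nat)

end

text \<open>The point \<open>m\<close> on the scheme with coordinate ring R / J. All computations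
  stay in R and use congruences modulo \<open>J\<close> or modulo a prime above it.\<close>

locale rational_point = complex_algebra \<kappa> ys
  for \<kappa> :: "complex \<Rightarrow> 'a::comm_ring_1" and ys :: "'a list" +
  fixes m J :: "'a set"
  assumes m: "is_ideal m" "1 \<notin> m" and J: "is_ideal J" "J \<subseteq> m"
    and residue: "\<And>a. \<exists>c. a - \<kappa> c \<in> m"
begin

lemma is_prime_m: "is_prime m"
  unfolding is_prime_def
proof (intro conjI allI impI m)
  fix a b assume ab: "a * b \<in> m"
  obtain c d where c: "cong_mod m a (\<kappa> c)" and d: "cong_mod m b (\<kappa> d)"
    using residue[of a] residue[of b] by (auto simp: cong_mod_def)
  have "\<kappa> (c * d) \<in> m"
    using cong_mod_mem[OF m(1) cong_mod_mult[OF m(1) c d]] ab by (simp add: \<kappa>_mult)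
  then have "c = 0 \<or> d = 0" using scalar_in_ideal[OF m] by fastforce
  then show "a \<in> m \<or> b \<in> m"
    using cong_mod_mem[OF m(1) c] cong_mod_mem[OF m(1) d] \<kappa>_0 is_idealD(1)[OF m(1)] by auto
qed

lemma unit_mod_m:
  assumes "a \<notin> m"
  shows "\<exists>b. 1 - a * b \<in> m"
proof -
  obtain c where c: "a - \<kappa> c \<in> m" using residue by blast
  then have "c \<noteq> 0" using assms \<kappa>_0 by auto
  then have "1 - a * \<kappa> (1 / c) = - ((a - \<kappa> c) * \<kappa> (1 / c))"
    by (simp add: left_diff_distrib \<kappa>_mult[symmetric] \<kappa>_1)
  then show ?thesis using is_idealD(5)[OF m(1) is_idealD(4)[OF m(1) c]] by metis
qed

text \<open>\<open>x\<close> spans m / (m^2 + J), the cotangent space at \<open>m\<close> of the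
  quotient by \<open>J\<close>.\<close>

definition spans :: "(nat \<Rightarrow> 'a) \<Rightarrow> nat \<Rightarrow> bool" where
  "spans x D \<longleftrightarrow> (\<forall>i<D. x i \<in> m) \<and>
     (\<forall>a\<in>m. \<exists>c. a - (\<Sum>i<D. \<kappa> (c i) * x i) \<in> filt m J 2)"

text \<open>Successive approximation: suppose all values of \<open>E\<close> lie in m^N + P. Write a
  as a scalar plus a combination of the \<open>x i\<close> plus an element of m^2 + P.
  \<open>E\<close> kills the first two modulo \<open>P\<close>, and on the last a factor from
  \<open>m\<close> survives, so the value lies in m^(N+1) + P. Krull's intersection theorem
  concludes.\<close>

lemma deriv_mod_eq_0:
  assumes P: "is_prime P" "J \<subseteq> P" "P \<subseteq> m" and x: "spans x D"
    and E: "deriv_mod P UNIV E" "\<And>c. E (\<kappa> c) \<in> P" "\<And>i. i < D \<Longrightarrow> E (x i) \<in> P"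
  shows "E a \<in> P"
proof -
  note Pid = is_primeD(1)[OF P(1)]
  have "E a \<in> filt m P N" for N a
  proof (induction N arbitrary: a)
    case (Suc N)
    let ?F = "filt m P (Suc N)"
    have F: "is_ideal ?F" by (rule is_ideal_filt)
    have PF: "P \<subseteq> ?F" by (rule filt_superset)
    have sub: "r \<in> ?F" if "cong_mod P r s" "s \<in> ?F" for r s
      using cong_mod_mem[OF F cong_mod_mono[OF PF that(1)]] that(2) by blast
    obtain c where c: "a - \<kappa> c \<in> m" using residue by blast
    then obtain d where d: "(a - \<kappa> c) - (\<Sum>i<D. \<kappa> (d i) * x i) \<in> filt m J 2" using x by (auto simp: spans_def)
    define r where "r = (a - \<kappa> c) - (\<Sum>i<D. \<kappa> (d i) * x i)"
    have r: "r \<in> filt m P 2" using d filt_mono[OF P(2)] unfolding r_def by blast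
    have "filt m P 2 \<subseteq> {s. E s \<in> ?F \<and> s \<in> m}"
    proof (rule filt_2_least)
      show "is_ideal {s. E s \<in> ?F \<and> s \<in> m}"
        unfolding ideal_in_def
      proof (intro conjI ballI)
        show "0 \<in> {s. E s \<in> ?F \<and> s \<in> m}"
          using is_idealD(1)[OF F] is_idealD(1)[OF m(1)] deriv_mod_UNIV(3)[OF E(1)] by simp
        show "s + t \<in> {s. E s \<in> ?F \<and> s \<in> m}"
          if "s \<in> {s. E s \<in> ?F \<and> s \<in> m}" "t \<in> {s. E s \<in> ?F \<and> s \<in> m}" for s t
          using that sub[OF deriv_mod_UNIV(1)[OF E(1)] is_idealD(2)[OF F]] is_idealD(2)[OF m(1)]
          by (simp del: filt.simps)
        show "s * t \<in> {s. E s \<in> ?F \<and> s \<in> m}" if "t \<in> {s. E s \<in> ?F \<and> s \<in> m}" for s t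
        proof -
          have "s * E t \<in> ?F" using that is_idealD(3)[OF F] by blast
          moreover have "t * E s \<in> ?F" using that Suc.IH[of s] by (intro filt_mult1) auto
          ultimately have "s * E t + t * E s \<in> ?F" by (rule is_idealD(2)[OF F])
          then have "E (s * t) \<in> ?F" by (rule sub[OF deriv_mod_UNIV(2)[OF E(1)]])
          moreover have "s * t \<in> m" using that by (intro is_idealD(3)[OF m(1)]) simp
          ultimately show ?thesis by simp
        qed
      qed simp
      show "P \<subseteq> {s. E s \<in> ?F \<and> s \<in> m}" using P(3) PF deriv_mod_UNIV(4)[OF E(1)] by blast
      show "s * t \<in> {s. E s \<in> ?F \<and> s \<in> m}" if st: "s \<in> m" "t \<in> m" for s t
      proof -
        have "s * E t \<in> ?F" "t * E s \<in> ?F" by (intro filt_mult1 st Suc.IH)+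
        then have "s * E t + t * E s \<in> ?F" by (rule is_idealD(2)[OF F])
        then have "E (s * t) \<in> ?F" by (rule sub[OF deriv_mod_UNIV(2)[OF E(1)]])
        moreover have "s * t \<in> m" using st by (intro is_idealD(3)[OF m(1)]) simp
        ultimately show ?thesis by simp
      qed
    qed (use m P in auto)
    then have Er: "E r \<in> ?F" using r by blast
    have "E (\<kappa> (d i) * x i) \<in> P" if "i < D" for i
    proof -
      have "\<kappa> (d i) * E (x i) + x i * E (\<kappa> (d i)) \<in> P"
        using that E by (intro is_idealD(2)[OF Pid] is_idealD(3)[OF Pid]) auto
      then show ?thesis using cong_mod_mem[OF Pid deriv_mod_UNIV(2)[OF E(1)]] by blast
    qed
    then have "(\<Sum>i<D. E (\<kappa> (d i) * x i)) \<in> P" by (intro is_idealD(7)[OF Pid]) auto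
    then have "E (\<Sum>i<D. \<kappa> (d i) * x i) \<in> P"
      using cong_mod_mem[OF Pid deriv_mod_sum[OF Pid E(1)]] by blast
    then have "E (\<kappa> c) + E (\<Sum>i<D. \<kappa> (d i) * x i) \<in> ?F"
      using is_idealD(2)[OF Pid E(2)] PF by blast
    then have "E (\<kappa> c + (\<Sum>i<D. \<kappa> (d i) * x i)) \<in> ?F" by (rule sub[OF deriv_mod_UNIV(1)[OF E(1)]])
    from is_idealD(2)[OF F this Er]
    have "E (\<kappa> c + (\<Sum>i<D. \<kappa> (d i) * x i) + r) \<in> ?F" by (rule sub[OF deriv_mod_UNIV(1)[OF E(1)]])
    then show ?case by (simp add: r_def del: filt.simps)
  qed simp
  then show ?thesis by (intro krull_intersection[OF noetherian_UNIV P(1) m P(3)])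
qed

section \<open>Chains of primes and derivations dual to a cotangent basis\<close>

text \<open>Only the bottom prime is asked to lie in \<open>m\<close>: the derivations are taken
  modulo \<open>p 0\<close>, and the point enters through \<open>p 0\<close> alone.\<close>

definition chain_at :: "(nat \<Rightarrow> 'a set) \<Rightarrow> nat \<Rightarrow> bool" where
  "chain_at p k \<longleftrightarrow> (\<forall>i\<le>k. is_prime (p i)) \<and> (\<forall>i<k. p i \<subset> p (Suc i)) \<and> J \<subseteq> p 0 \<and> p 0 \<subseteq> m"

lemma chain_at_derivations:
  assumes "chain_at p k"
  shows "\<exists>E c. \<forall>j<k. deriv_mod (p 0) UNIV (E j) \<and> (\<forall>d. E j (\<kappa> d) \<in> p 0) \<and>
    E j (c j) \<notin> p 0 \<and> (\<forall>i<j. E j (c i) \<in> p 0)"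
proof -
  have p: "is_prime (p i)" if "i \<le> k" for i using assms that by (simp add: chain_at_def)
  have K: "range \<kappa> \<inter> p i \<subseteq> {0}" if "i \<le> k" for i
    using scalar_in_ideal[OF is_primeD(1,2)[OF p[OF that]]] \<kappa>_0 by auto
  have "\<exists>c E. \<forall>j<k. deriv_mod (p 0) UNIV (E j) \<and> (\<forall>a\<in>range \<kappa>. E j a \<in> p 0) \<and>
    E j (c j) \<notin> p 0 \<and> (\<forall>i<j. E j (c i) \<in> p 0)"
  proof (rule chain_derivations)
    show "is_prime (p i)" if "i \<le> k" for i using that by (rule p)
    show "p i \<subset> p (Suc i)" if "i < k" for i using assms that by (simp add: chain_at_def)
    show "subring_of (range \<kappa>)" by (rule subring_of_scalars)
    show "range \<kappa> \<inter> p i \<subseteq> {0}" if "i \<le> k" for i using that by (rule K)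
    show "adjoin_list (range \<kappa>) ys = UNIV" by (rule generated)
    show "of_nat n \<notin> p 0" if "n > 0" for n using of_nat_notin_prime[OF p that] by simp
  qed
  then obtain c E where "\<forall>j<k. deriv_mod (p 0) UNIV (E j) \<and> (\<forall>a\<in>range \<kappa>. E j a \<in> p 0) \<and>
    E j (c j) \<notin> p 0 \<and> (\<forall>i<j. E j (c i) \<in> p 0)" by (elim exE)
  then show ?thesis by (intro exI[of _ E] exI[of _ c]) simp
qed

text \<open>Evaluate at \<open>c i\<close> for the least \<open>i\<close> with \<open>a i\<close>
  outside \<open>P\<close>: earlier terms have coefficients in \<open>P\<close>, later derivations
  have values in \<open>P\<close> there.\<close>

lemma lincomb_derivation_nonzero:
  fixes P :: "'a set" and k :: nat
  assumes P: "is_prime P" and a: "\<exists>i<k. a i \<notin> P"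
    and E: "\<And>j. j < k \<Longrightarrow> E j (c j) \<notin> P" "\<And>i j. i < j \<Longrightarrow> j < k \<Longrightarrow> E j (c i) \<in> P"
  shows "\<exists>z. (\<Sum>j<k. a j * E j z) \<notin> P"
proof -
  note Pid = is_primeD(1)[OF P]
  define i where "i = (LEAST i. i < k \<and> a i \<notin> P)"
  have i: "i < k" "a i \<notin> P" using LeastI_ex[of "\<lambda>i. i < k \<and> a i \<notin> P"] a unfolding i_def by blast+
  have less: "a j \<in> P" if "j < i" for j
    using not_less_Least[of j "\<lambda>i. i < k \<and> a i \<notin> P"] that i by (auto simp: i_def)
  have 1: "(\<Sum>j\<in>{..<k} - {i}. a j * E j (c i)) \<in> P"
  proof (rule is_idealD(7)[OF Pid])
    fix j assume j: "j \<in> {..<k} - {i}"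
    show "a j * E j (c i) \<in> P"
    proof (cases "j < i")
      case True
      then show ?thesis by (rule is_idealD(4)[OF Pid less])
    next
      case False
      then show ?thesis using j by (intro is_idealD(3)[OF Pid E(2)]) auto
    qed
  qed
  have 2: "a i * E i (c i) \<notin> P" using is_primeD(3)[OF P, of "a i" "E i (c i)"] E(1)[OF i(1)] i(2) by blast
  have 3: "(\<Sum>j<k. a j * E j (c i)) = a i * E i (c i) + (\<Sum>j\<in>{..<k} - {i}. a j * E j (c i))"
    using i(1) by (intro sum.remove) auto
  have "(\<Sum>j<k. a j * E j (c i)) \<notin> P" unfolding 3 by (rule ideal_add_notin[OF Pid 1 2])
  then show ?thesis by blast
qed

text \<open>With more derivations than spanning elements, some nontrivial combination kills all the
  \<open>x i\<close> and is therefore zero modulo \<open>p 0\<close>, against triangularity.\<close>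

lemma chain_length_le:
  assumes ch: "chain_at p k" and x: "spans x D"
  shows "k \<le> D"
proof (rule ccontr)
  assume "\<not> k \<le> D"
  have P: "is_prime (p 0)" "J \<subseteq> p 0" "p 0 \<subseteq> m" using ch by (auto simp: chain_at_def)
  from chain_at_derivations[OF ch] obtain E c
    where Ec: "\<forall>j<k. deriv_mod (p 0) UNIV (E j) \<and> (\<forall>d. E j (\<kappa> d) \<in> p 0) \<and>
      E j (c j) \<notin> p 0 \<and> (\<forall>i<j. E j (c i) \<in> p 0)"
    by (elim exE)
  have E: "\<And>j. j < k \<Longrightarrow> deriv_mod (p 0) UNIV (E j)" "\<And>j d. j < k \<Longrightarrow> E j (\<kappa> d) \<in> p 0"
    "\<And>j. j < k \<Longrightarrow> E j (c j) \<notin> p 0" "\<And>i j. i < j \<Longrightarrow> j < k \<Longrightarrow> E j (c i) \<in> p 0"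
    using Ec by auto
  obtain a where a: "\<exists>i\<in>{..<k}. a i \<notin> p 0" "\<forall>j<D. (\<Sum>i\<in>{..<k}. a i * E i (x j)) \<in> p 0"
    using linear_dependence[OF P(1) finite_lessThan[of k], of D "\<lambda>i j. E i (x j)"] \<open>\<not> k \<le> D\<close>
    by (elim meta_impE exE conjE) simp_all
  obtain z where z: "(\<Sum>j<k. a j * E j z) \<notin> p 0"
    using lincomb_derivation_nonzero[OF P(1), of k a E c] a(1) E(3,4) by auto
  have "(\<Sum>j<k. a j * E j z) \<in> p 0"
  proof (rule deriv_mod_eq_0[OF P x, where E = "\<lambda>z. \<Sum>j<k. a j * E j z"])
    show "deriv_mod (p 0) UNIV (\<lambda>z. \<Sum>j<k. a j * E j z)"
      by (rule deriv_mod_lincomb[OF is_primeD(1)[OF P(1)]]) (use E in auto)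
    show "(\<Sum>j<k. a j * E j (\<kappa> c)) \<in> p 0" for c
      by (intro is_idealD(7)[OF is_primeD(1)[OF P(1)]] is_idealD(3)[OF is_primeD(1)[OF P(1)]] E(2)) auto
    show "(\<Sum>j<k. a j * E j (x i)) \<in> p 0" if "i < D" for i using a(2) that by auto
  qed
  then show False using z by blast
qed

text \<open>A nontrivial combination of the D derivations can be made to kill the D - 1 elements
  other than \<open>x i\<close>. It is not zero modulo \<open>p 0\<close>, so it cannot kill
  \<open>x i\<close> as well.\<close>

lemma dual_derivation:
  assumes ch: "chain_at p D" and x: "spans x D" and i: "i < D"
  shows "\<exists>E. deriv_mod (p 0) UNIV E \<and> (\<forall>d. E (\<kappa> d) \<in> p 0) \<and> E (x i) \<notin> p 0 \<and>
    (\<forall>j<D. j \<noteq> i \<longrightarrow> E (x j) \<in> p 0)"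
proof -
  have P: "is_prime (p 0)" "J \<subseteq> p 0" "p 0 \<subseteq> m" using ch by (auto simp: chain_at_def)
  note Pid = is_primeD(1)[OF P(1)]
  from chain_at_derivations[OF ch] obtain E c
    where Ec: "\<forall>j<D. deriv_mod (p 0) UNIV (E j) \<and> (\<forall>d. E j (\<kappa> d) \<in> p 0) \<and>
      E j (c j) \<notin> p 0 \<and> (\<forall>i<j. E j (c i) \<in> p 0)"
    by (elim exE)
  have E: "\<And>j. j < D \<Longrightarrow> deriv_mod (p 0) UNIV (E j)" "\<And>j d. j < D \<Longrightarrow> E j (\<kappa> d) \<in> p 0"
    "\<And>j. j < D \<Longrightarrow> E j (c j) \<notin> p 0" "\<And>i j. i < j \<Longrightarrow> j < D \<Longrightarrow> E j (c i) \<in> p 0"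
    using Ec by auto
  \<comment> \<open>Enumerates the indices other than \<open>i\<close> by skipping it.\<close>
  define s where "s j = (if j < i then j else Suc j)" for j
  obtain a where a: "\<exists>i\<in>{..<D}. a i \<notin> p 0" "\<forall>j<D - 1. (\<Sum>l\<in>{..<D}. a l * E l (x (s j))) \<in> p 0"
    using linear_dependence[OF P(1) finite_lessThan[of D], of "D - 1" "\<lambda>l j. E l (x (s j))"] i
    by (elim meta_impE exE conjE) simp_all
  obtain z where z: "(\<Sum>j<D. a j * E j z) \<notin> p 0"
    using lincomb_derivation_nonzero[OF P(1), of D a E c] a(1) E(3,4) by auto
  let ?E = "\<lambda>z. \<Sum>j<D. a j * E j z"
  have 1: "deriv_mod (p 0) UNIV ?E"
    by (rule deriv_mod_lincomb[OF Pid]) (use E in auto)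
  have 2: "?E (\<kappa> c) \<in> p 0" for c
    by (intro is_idealD(7)[OF Pid] is_idealD(3)[OF Pid] E(2)) auto
  have 3: "?E (x j) \<in> p 0" if j: "j < D" "j \<noteq> i" for j
  proof -
    define l where "l = (if j < i then j else j - 1)"
    have "s l = j" "l < D - 1" using j i by (auto simp: l_def s_def)
    then show ?thesis using a(2) by auto
  qed
  have "?E (x i) \<notin> p 0"
  proof
    assume *: "?E (x i) \<in> p 0"
    have "?E z \<in> p 0"
    proof (rule deriv_mod_eq_0[OF P x, where E = ?E, OF 1 2])
      show "?E (x j) \<in> p 0" if "j < D" for j using * 3[OF that] by (cases "j = i") auto
    qed
    then show False using z by blast
  qed
  then show ?thesis using 1 2 3 by (intro exI[of _ ?E]) auto
qed

subsection \<open>Power series in a system of parameters\<close>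

text \<open>Exponents are multisets of indices, so an induction on a monomial removes one variable
  at a time, matching one differentiation.\<close>

definition monm :: "(nat \<Rightarrow> 'a) \<Rightarrow> nat multiset \<Rightarrow> 'a" where
  "monm x M = prod_mset (image_mset x M)"

definition msets :: "nat \<Rightarrow> nat \<Rightarrow> nat multiset set" where
  "msets D k = {M. set_mset M \<subseteq> {..<D} \<and> size M = k}"

definition msets_lt :: "nat \<Rightarrow> nat \<Rightarrow> nat multiset set" where
  "msets_lt D k = {M. set_mset M \<subseteq> {..<D} \<and> size M < k}"

lemma finite_msets: "finite (msets D k)"
proof (rule finite_subset)
  show "msets D k \<subseteq> mset ` {l. set l \<subseteq> {..<D} \<and> length l = k}"
  proof
    fix M assume M: "M \<in> msets D k"
    obtain l where "mset l = M" using ex_mset by blast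
    then show "M \<in> mset ` {l. set l \<subseteq> {..<D} \<and> length l = k}" using M by (auto simp: msets_def)
  qed
  show "finite (mset ` {l. set l \<subseteq> {..<D} \<and> length l = k})"
    by (intro finite_imageI finite_lists_length_eq) simp
qed

lemma msets_lt_Suc: "msets_lt D (Suc k) = msets_lt D k \<union> msets D k"
  by (auto simp: msets_def msets_lt_def)

lemma finite_msets_lt: "finite (msets_lt D k)"
proof (induction k)
  case 0
  then show ?case by (simp add: msets_lt_def)
qed (simp add: msets_lt_Suc finite_msets)

lemma monm_simps [simp]: "monm x {#} = 1" "monm x (add_mset i M) = x i * monm x M"
  by (simp_all add: monm_def)

lemma deriv_mod_monm:
  assumes P: "is_ideal P" and E: "deriv_mod P UNIV E" and j: "\<And>i. i < D \<Longrightarrow> i \<noteq> j \<Longrightarrow> E (x i) \<in> P"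
  shows "set_mset M \<subseteq> {..<D} \<Longrightarrow>
    cong_mod P (E (monm x M)) (of_nat (count M j) * E (x j) * monm x (M - {#j#}))"
proof (induction M)
  case empty
  have "cong_mod P (E (1 * 1)) (1 * E 1 + 1 * E 1)" by (rule deriv_mod_UNIV(2)[OF E])
  then have "- E 1 \<in> P" by (simp add: cong_mod_def)
  then have "E 1 \<in> P" using is_idealD(5)[OF P] by fastforce
  then show ?case by (simp add: cong_mod_def)
next
  case (add i M)
  note refl = cong_mod_refl[OF P]
  have IH: "cong_mod P (E (monm x M)) (of_nat (count M j) * E (x j) * monm x (M - {#j#}))" using add by simp
  have 1: "cong_mod P (E (x i * monm x M)) (x i * E (monm x M) + monm x M * E (x i))"
    by (rule deriv_mod_UNIV(2)[OF E])
  have 2: "cong_mod P (x i * E (monm x M) + monm x M * E (x i))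
      (x i * (of_nat (count M j) * E (x j) * monm x (M - {#j#})) + monm x M * E (x i))"
    by (intro cong_mod_add[OF P] cong_mod_mult[OF P] IH refl)
  \<comment> \<open>If \<open>j\<close> is not in \<open>M\<close>, removing it changes nothing, but
    then the count is 0.\<close>
  have eq: "of_nat (count M j) * monm x M = of_nat (count M j) * (x j * monm x (M - {#j#}))"
  proof (cases "j \<in># M")
    case True
    then have "monm x M = monm x (add_mset j (M - {#j#}))" by simp
    then show ?thesis by (metis monm_simps(2))
  qed (simp add: count_eq_zero_iff[THEN iffD2])
  have 3: "cong_mod P (x i * (of_nat (count M j) * E (x j) * monm x (M - {#j#})) + monm x M * E (x i))
      (of_nat (count (add_mset i M) j) * E (x j) * monm x (add_mset i M - {#j#}))"
  proof (cases "i = j")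
    case True
    have "x i * (of_nat (count M j) * E (x j) * monm x (M - {#j#})) + monm x M * E (x i)
        = E (x j) * (of_nat (count M j) * (x j * monm x (M - {#j#}))) + monm x M * E (x j)"
      using True by (simp add: mult_ac)
    also have "\<dots> = of_nat (count (add_mset i M) j) * E (x j) * monm x (add_mset i M - {#j#})"
      unfolding eq[symmetric] using True by (simp add: algebra_simps)
    finally show ?thesis using refl by simp
  next
    case False
    have "x i * (of_nat (count M j) * E (x j) * monm x (M - {#j#})) =
        of_nat (count (add_mset i M) j) * E (x j) * monm x (add_mset i M - {#j#})"
    proof (cases "j \<in># M")
      case True
      then have "add_mset i M - {#j#} = add_mset i (M - {#j#})" 
        using False by (intro diff_add_mset_swap) simp
      then show ?thesis using False by (simp add: mult_ac)
    next
      case nj: False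
      then have "count M j = 0" "count (add_mset i M) j = 0" using False by (simp_all add: count_eq_zero_iff)
      then show ?thesis by (simp only: of_nat_0 mult_zero_left mult_zero_right)
    qed
    moreover have "monm x M * E (x i) \<in> P" using add.prems False by (intro is_idealD(3)[OF P] j) auto
    ultimately show ?thesis unfolding cong_mod_def by (metis add_diff_cancel_left')
  qed
  show ?case using cong_mod_trans[OF P cong_mod_trans[OF P 1 2] 3] by simp
qed

text \<open>\<open>G\<close> is the coefficient function of a formal power series in
  \<open>D\<close> variables; this is its part of degree below \<open>N\<close>, evaluated at
  \<open>x\<close>.\<close>

definition trunc :: "(nat \<Rightarrow> 'a) \<Rightarrow> nat \<Rightarrow> nat \<Rightarrow> (nat multiset \<Rightarrow> complex) \<Rightarrow> 'a" where
  "trunc x D N G = (\<Sum>M\<in>msets_lt D N. \<kappa> (G M) * monm x M)"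

text \<open>The partial derivative of the series \<open>G\<close> in the variable
  \<open>j\<close>.\<close>

definition pdiff :: "nat \<Rightarrow> (nat multiset \<Rightarrow> complex) \<Rightarrow> nat multiset \<Rightarrow> complex" where
  "pdiff j G M = of_nat (Suc (count M j)) * G (add_mset j M)"

lemma deriv_mod_trunc:
  assumes P: "is_ideal P" and E: "deriv_mod P UNIV E" "\<And>c. E (\<kappa> c) \<in> P"
    and j: "\<And>i. i < D \<Longrightarrow> i \<noteq> j \<Longrightarrow> E (x i) \<in> P" "j < D"
  shows "cong_mod P (E (trunc x D (Suc N) G)) (E (x j) * trunc x D N (pdiff j G))"
proof -
  note refl = cong_mod_refl[OF P]
  let ?f = "\<lambda>M. \<kappa> (G M) * (of_nat (count M j) * E (x j) * monm x (M - {#j#}))"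
  have 1: "cong_mod P (E (trunc x D (Suc N) G)) (\<Sum>M\<in>msets_lt D (Suc N). E (\<kappa> (G M) * monm x M))"
    unfolding trunc_def by (rule deriv_mod_sum[OF P E(1)])
  have "cong_mod P (E (\<kappa> (G M) * monm x M)) (?f M)" if M: "M \<in> msets_lt D (Suc N)" for M
  proof -
    have a: "cong_mod P (E (\<kappa> (G M) * monm x M)) (\<kappa> (G M) * E (monm x M) + monm x M * E (\<kappa> (G M)))"
      by (rule deriv_mod_UNIV(2)[OF E(1)])
    have "cong_mod P (monm x M * E (\<kappa> (G M))) 0"
      using is_idealD(3)[OF P E(2)] by (simp add: cong_mod_def)
    moreover have "cong_mod P (\<kappa> (G M) * E (monm x M)) (?f M)"
      using M by (intro cong_mod_mult[OF P] refl deriv_mod_monm[OF P E(1) j(1)]) (auto simp: msets_lt_def)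
    ultimately have "cong_mod P (\<kappa> (G M) * E (monm x M) + monm x M * E (\<kappa> (G M))) (?f M + 0)"
      by (intro cong_mod_add[OF P])
    then show ?thesis using cong_mod_trans[OF P a] by simp
  qed
  then have 2: "cong_mod P (\<Sum>M\<in>msets_lt D (Suc N). E (\<kappa> (G M) * monm x M)) (\<Sum>M\<in>msets_lt D (Suc N). ?f M)"
    by (intro cong_mod_sum[OF P])
  have "(\<Sum>M\<in>msets_lt D (Suc N). ?f M) = (\<Sum>M\<in>add_mset j ` msets_lt D N. ?f M)"
  proof (rule sum.mono_neutral_right[OF finite_msets_lt])
    show "add_mset j ` msets_lt D N \<subseteq> msets_lt D (Suc N)" using j(2) by (auto simp: msets_lt_def)
    show "\<forall>M\<in>msets_lt D (Suc N) - add_mset j ` msets_lt D N. ?f M = 0"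
    proof
      fix M assume M: "M \<in> msets_lt D (Suc N) - add_mset j ` msets_lt D N"
      have "j \<notin># M"
      proof
        assume jM: "j \<in># M"
        then obtain M' where M': "M = add_mset j M'" by (meson mset_add)
        moreover have "M' \<in> msets_lt D N" using M unfolding M' by (simp add: msets_lt_def)
        ultimately show False using M by blast
      qed
      then show "?f M = 0" by (simp add: count_eq_zero_iff[THEN iffD2])
    qed
  qed
  also have "\<dots> = (\<Sum>M\<in>msets_lt D N. ?f (add_mset j M))"
    by (subst sum.reindex) (auto simp: inj_on_def)
  also have "\<dots> = E (x j) * trunc x D N (pdiff j G)"
    unfolding trunc_def sum_distrib_left pdiff_def
    by (intro sum.cong) (auto simp: \<kappa>_mult \<kappa>_of_nat mult_ac simp del: of_nat_Suc)
  finally show ?thesis using cong_mod_trans[OF P 1 2] by simp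
qed

text \<open>w is invertible modulo \<open>m\<close>: with 1 - w y in \<open>m\<close>, the identity
  u = (1 - w y) u + u w y raises the order of u by one at a time.\<close>

lemma filt_unit_cancel:
  assumes P: "is_ideal P" and w: "w \<notin> m" and u: "u * w \<in> filt m P N"
  shows "u \<in> filt m P N"
proof -
  obtain y where y: "1 - w * y \<in> m" using unit_mod_m[OF w] by blast
  have "j \<le> N \<Longrightarrow> u \<in> filt m P j" for j
  proof (induction j)
    case (Suc j)
    have "(1 - w * y) * u \<in> filt m P (Suc j)" using Suc by (intro filt_mult1[OF y]) simp
    moreover have "u * w \<in> filt m P (Suc j)" using u filt_antimono[OF Suc.prems, of m P] by blast
    then have "u * w * y \<in> filt m P (Suc j)" by (rule is_idealD(4)[OF is_ideal_filt])
    ultimately have "(1 - w * y) * u + u * w * y \<in> filt m P (Suc j)" by (rule is_idealD(2)[OF is_ideal_filt])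
    then show ?case by (simp add: algebra_simps del: filt.simps)
  qed simp
  then show ?thesis by simp
qed

lemma monm_in_m:
  assumes "\<And>i. i < D \<Longrightarrow> x i \<in> m" "set_mset M \<subseteq> {..<D}" "M \<noteq> {#}"
  shows "monm x M \<in> m"
proof -
  obtain i where "i \<in># M" using assms(3) by blast
  then obtain M' where "M = add_mset i M'" by (meson mset_add)
  then show ?thesis using assms by (auto intro!: is_idealD(4)[OF m(1)])
qed

text \<open>A nonzero constant term would make the series a unit at \<open>m\<close>, so that u
  would lie in every m^N + P and hence in P. Other coefficients are reached by differentiating with
  the derivations dual to the \<open>x j\<close>. The statement carries a multiplier
  \<open>u\<close> because differentiation produces the factor \<open>E (x j)\<close>, known only to
  be outside \<open>p 0\<close>.\<close>

lemma power_series_eq_0: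
  assumes ch: "chain_at p D" and x: "spans x D"
  shows "set_mset M \<subseteq> {..<D} \<Longrightarrow> u \<notin> p 0 \<Longrightarrow> (\<And>N. u * trunc x D N G \<in> filt m (p 0) N) \<Longrightarrow> G M = 0"
proof (induction M arbitrary: u G)
  have P: "is_prime (p 0)" "J \<subseteq> p 0" "p 0 \<subseteq> m" using ch by (auto simp: chain_at_def)
  note Pid = is_primeD(1)[OF P(1)]
  have xm: "x i \<in> m" if "i < D" for i using x that by (simp add: spans_def)
  {
    case (empty u G)
    show ?case
    proof (rule ccontr)
      assume G: "G {#} \<noteq> 0"
      have "u \<in> filt m (p 0) N" for N
      proof (cases N)
        case (Suc n)
        have mem: "{#} \<in> msets_lt D N" using Suc by (simp add: msets_lt_def)
        have "trunc x D N G = \<kappa> (G {#}) * monm x {#} + (\<Sum>M\<in>msets_lt D N - {{#}}. \<kappa> (G M) * monm x M)"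
          unfolding trunc_def by (rule sum.remove[OF finite_msets_lt mem])
        moreover have rest: "(\<Sum>M\<in>msets_lt D N - {{#}}. \<kappa> (G M) * monm x M) \<in> m"
        proof (rule is_idealD(7)[OF m(1)])
          fix M assume "M \<in> msets_lt D N - {{#}}"
          then have "monm x M \<in> m" by (intro monm_in_m[of D] xm) (auto simp: msets_lt_def)
          then show "\<kappa> (G M) * monm x M \<in> m" by (rule is_idealD(3)[OF m(1)])
        qed
        ultimately have "cong_mod m (trunc x D N G) (\<kappa> (G {#}))" by (simp add: cong_mod_def)
        then have "trunc x D N G \<notin> m"
          using cong_mod_mem[OF m(1), of "trunc x D N G" "\<kappa> (G {#})"] scalar_in_ideal[OF m, of "G {#}"] G by blast
        then show ?thesis by (rule filt_unit_cancel[OF Pid _ empty(3)])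
      qed simp
      then have "u \<in> p 0" by (intro krull_intersection[OF noetherian_UNIV P(1) m P(3)])
      then show False using empty by blast
    qed
  next
    case (add j M u G)
    then have jD: "j < D" by simp
    obtain E where E: "deriv_mod (p 0) UNIV E" "\<And>d. E (\<kappa> d) \<in> p 0" "E (x j) \<notin> p 0"
      "\<And>i. i < D \<Longrightarrow> i \<noteq> j \<Longrightarrow> E (x i) \<in> p 0"
      using dual_derivation[OF ch x jD] by blast
    \<comment> \<open>The second factor \<open>u\<close> absorbs the Leibniz term with
      \<open>E u\<close>: its cofactor becomes \<open>u\<close> times the series, which is
      small.\<close>
    let ?u = "u * u * E (x j)"
    have 1: "?u * trunc x D N (pdiff j G) \<in> filt m (p 0) N" for N
    proof -
      let ?F = "filt m (p 0) N" and ?t = "trunc x D (Suc N) G"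
      have F: "is_ideal ?F" by (rule is_ideal_filt)
      have EF: "E a \<in> ?F" if "a \<in> filt m (p 0) (Suc N)" for a
        using deriv_mod_filt[OF E(1)] that by blast
      have 1: "cong_mod (p 0) (E (u * ?t)) (u * E ?t + ?t * E u)" by (rule deriv_mod_UNIV(2)[OF E(1)])
      have "cong_mod (p 0) (u * E ?t + ?t * E u) (u * (E (x j) * trunc x D N (pdiff j G)) + ?t * E u)"
        by (intro cong_mod_add[OF Pid] cong_mod_mult[OF Pid] cong_mod_refl[OF Pid]
            deriv_mod_trunc[OF Pid E(1,2,4) jD])
      from cong_mod_trans[OF Pid 1 this]
      have "cong_mod ?F (E (u * ?t)) (u * (E (x j) * trunc x D N (pdiff j G)) + ?t * E u)"
        by (rule cong_mod_mono[OF filt_superset])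
      then have "u * (E (x j) * trunc x D N (pdiff j G)) + ?t * E u \<in> ?F"
        using cong_mod_mem[OF F] EF[OF add.prems(3)] by blast
      then have "u * (u * (E (x j) * trunc x D N (pdiff j G)) + ?t * E u) \<in> ?F" by (rule is_idealD(3)[OF F])
      moreover have "u * ?t \<in> ?F" using add.prems(3)[of "Suc N"] filt_Suc_subset by blast
      then have "u * ?t * E u \<in> ?F" by (rule is_idealD(4)[OF F])
      ultimately have "u * (u * (E (x j) * trunc x D N (pdiff j G)) + ?t * E u) - u * ?t * E u \<in> ?F"
        by (rule is_idealD(6)[OF F])
      then show ?thesis by (simp add: algebra_simps)
    qed
    have 2: "?u \<notin> p 0" using is_primeD(3)[OF P(1)] add.prems(2) E(3) by blast
    have "set_mset M \<subseteq> {..<D}" using add.prems by simp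
    then have "pdiff j G M = 0" by (rule add.IH[OF _ 2 1])
    then show ?case by (simp add: pdiff_def del: of_nat_Suc)
  }
qed

text \<open>The associated graded ring is generated in degree 1. The set \<open>L\<close> of
  elements having a leading form is visibly closed under addition and scalars only, while
  \<open>filt_Suc_least\<close> asks for an ideal; hence the elements all of whose multiples lie in
  \<open>L\<close> are considered.\<close>

lemma filt_leading_form:
  assumes P: "is_ideal P" "J \<subseteq> P" "P \<subseteq> m" and x: "spans x D"
  shows "r \<in> filt m P N \<Longrightarrow>
    \<exists>f. r - (\<Sum>M\<in>msets D N. \<kappa> (f M) * monm x M) \<in> filt m P (Suc N)"
proof (induction N arbitrary: r)
  case 0
  have m0: "msets D 0 = {{#}}" by (auto simp: msets_def)
  obtain c where "r - \<kappa> c \<in> m" using residue by blast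
  then show ?case using filt_1[OF m(1) P(3)] by (intro exI[of _ "\<lambda>_. c"]) (simp add: m0 del: filt.simps)
next
  case (Suc N)
  let ?F = "filt m P (Suc (Suc N))"
  have F: "is_ideal ?F" by (rule is_ideal_filt)
  define L where "L = {r. \<exists>f. r - (\<Sum>M\<in>msets D (Suc N). \<kappa> (f M) * monm x M) \<in> ?F}"
  have LF: "r \<in> L" if "r \<in> ?F" for r
    unfolding L_def using that by (intro CollectI exI[of _ "\<lambda>_. 0"]) (simp add: \<kappa>_0 del: filt.simps)
  have Ladd: "r + s \<in> L" if rs: "r \<in> L" "s \<in> L" for r s
  proof -
    obtain f g where f: "r - (\<Sum>M\<in>msets D (Suc N). \<kappa> (f M) * monm x M) \<in> ?F"
      and g: "s - (\<Sum>M\<in>msets D (Suc N). \<kappa> (g M) * monm x M) \<in> ?F" using rs by (auto simp: L_def)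
    from is_idealD(2)[OF F f g]
    have "r + s - (\<Sum>M\<in>msets D (Suc N). \<kappa> (f M + g M) * monm x M) \<in> ?F"
      by (simp add: \<kappa>_add algebra_simps sum.distrib del: filt.simps)
    then show ?thesis unfolding L_def by (intro CollectI exI[of _ "\<lambda>M. f M + g M"])
  qed
  have L0: "0 \<in> L" by (rule LF[OF is_idealD(1)[OF F]])
  have Lsum: "sum g A \<in> L" if "\<And>i. i \<in> A \<Longrightarrow> g i \<in> L" for g and A :: "'z set"
    using that by (induction A rule: infinite_finite_induct) (auto intro: L0 Ladd)
  have Lsc: "\<kappa> c * r \<in> L" if r: "r \<in> L" for c r
  proof -
    obtain f where f: "r - (\<Sum>M\<in>msets D (Suc N). \<kappa> (f M) * monm x M) \<in> ?F" using r by (auto simp: L_def)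
    from is_idealD(3)[OF F f, of "\<kappa> c"]
    have "\<kappa> c * r - (\<Sum>M\<in>msets D (Suc N). \<kappa> (c * f M) * monm x M) \<in> ?F"
      by (simp add: \<kappa>_mult right_diff_distrib sum_distrib_left mult.assoc del: filt.simps)
    then show ?thesis unfolding L_def by (intro CollectI exI[of _ "\<lambda>M. c * f M"])
  qed
  have Lmon: "monm x M \<in> L" if M: "M \<in> msets D (Suc N)" for M
  proof -
    have "(\<Sum>K\<in>msets D (Suc N). \<kappa> (if K = M then 1 else 0) * monm x K)
        = (\<Sum>K\<in>msets D (Suc N). if K = M then monm x K else 0)"
      by (intro sum.cong) (auto simp: \<kappa>_0 \<kappa>_1)
    also have "\<dots> = monm x M" using M by (simp add: finite_msets)
    finally have "monm x M - (\<Sum>K\<in>msets D (Suc N). \<kappa> (if K = M then 1 else 0) * monm x K) \<in> ?F"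
      using is_idealD(1)[OF F] by simp
    then show ?thesis unfolding L_def by (intro CollectI exI)
  qed
  have Lprod: "a * b \<in> L" if a: "a \<in> m" and b: "b \<in> filt m P N" for a b
  proof -
    obtain c where c: "a - (\<Sum>i<D. \<kappa> (c i) * x i) \<in> filt m P 2"
      using x a filt_mono[OF P(2), of m 2] unfolding spans_def by blast
    obtain f where f: "b - (\<Sum>M\<in>msets D N. \<kappa> (f M) * monm x M) \<in> filt m P (Suc N)" using Suc.IH[OF b] by blast
    define a1 b1 where "a1 = (\<Sum>i<D. \<kappa> (c i) * x i)" and "b1 = (\<Sum>M\<in>msets D N. \<kappa> (f M) * monm x M)"
    have "a1 \<in> m" unfolding a1_def using x
      by (intro is_idealD(7)[OF m(1)] is_idealD(3)[OF m(1)]) (auto simp: spans_def)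
    then have "a1 * (b - b1) \<in> ?F" using f unfolding b1_def by (rule filt_mult1)
    moreover have "(a - a1) * b \<in> filt m P (2 + N)"
      using c b unfolding a1_def by (rule filt_mult[OF P(1)])
    ultimately have rest: "a1 * (b - b1) + (a - a1) * b \<in> ?F"
      using is_idealD(2)[OF F] by (simp del: filt.simps)
    have "a1 * b1 = (\<Sum>i<D. \<Sum>M\<in>msets D N. \<kappa> (c i) * (\<kappa> (f M) * monm x (add_mset i M)))"
      unfolding a1_def b1_def sum_product by (intro sum.cong) (auto simp: mult_ac)
    also have "\<dots> \<in> L" by (intro Lsum Lsc Lmon) (auto simp: msets_def)
    finally have "a1 * b1 \<in> L" .
    from Ladd[OF this LF[OF rest]] show ?thesis by (simp add: algebra_simps)
  qed
  have "filt m P (Suc N) \<subseteq> {r. \<forall>s. s * r \<in> L}"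
  proof (rule filt_Suc_least)
    show "is_ideal {r. \<forall>s. s * r \<in> L}"
      unfolding ideal_in_def using L0 Ladd by (auto simp: distrib_left mult.assoc[symmetric])
    show "P \<subseteq> {r. \<forall>s. s * r \<in> L}"
      using is_idealD(3)[OF P(1)] filt_superset[of P m "Suc (Suc N)"] LF by blast
    show "a * b \<in> {r. \<forall>s. s * r \<in> L}" if "a \<in> m" "b \<in> filt m P N" for a b
      using Lprod[OF is_idealD(3)[OF m(1) that(1)] that(2)] by (simp add: mult.assoc)
  qed
  then have "1 * r \<in> L" using Suc.prems by blast
  then show ?case by (simp add: L_def)
qed

text \<open>Freeness of the associated graded ring at a smooth point. The form has order above k;
  subtracting leading forms again and again continues it to a power series \<open>G\<close> whose
  truncations have arbitrarily high order, and \<open>power_series_eq_0\<close> applies.\<close>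

theorem form_eq_0:
  assumes ch: "chain_at p D" and x: "spans x D"
    and f: "(\<Sum>M\<in>msets D k. \<kappa> (f M) * monm x M) \<in> filt m (p 0) (Suc k)" and M: "M \<in> msets D k"
  shows "f M = 0"
proof -
  have P: "is_prime (p 0)" "J \<subseteq> p 0" "p 0 \<subseteq> m" using ch by (auto simp: chain_at_def)
  note Pid = is_primeD(1)[OF P(1)]
  define lin where "lin N g = (\<Sum>M\<in>msets D N. \<kappa> (g M) * monm x M)" for N and g :: "nat multiset \<Rightarrow> complex"
  define lead where "lead N r = (SOME g. r - lin N g \<in> filt m (p 0) (Suc N))" for N r
  have lead: "r - lin N (lead N r) \<in> filt m (p 0) (Suc N)" if "r \<in> filt m (p 0) N" for N r
    using someI_ex[OF filt_leading_form[OF Pid P(2,3) x that]] unfolding lead_def lin_def .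
  \<comment> \<open>\<open>R n\<close> is what is left, of order at least \<open>Suc k + n\<close>,
    after corrections in the degrees \<open>Suc k\<close> up to \<open>k + n\<close>.\<close>
  define R where "R = rec_nat (lin k f) (\<lambda>n r. r - lin (Suc k + n) (lead (Suc k + n) r))"
  have R0: "R 0 = lin k f" and RS: "R (Suc n) = R n - lin (Suc k + n) (lead (Suc k + n) (R n))" for n
    by (simp_all add: R_def)
  have R: "R n \<in> filt m (p 0) (Suc k + n)" for n
  proof (induction n)
    case 0
    then show ?case using f by (simp add: R0 lin_def)
  next
    case (Suc n)
    show ?case unfolding RS using lead[OF Suc.IH] by simp
  qed
  define G where "G M = (if size M < k then 0 else if size M = k then f M
    else - lead (size M) (R (size M - Suc k)) M)" for M
  have split: "trunc x D (Suc N) G = trunc x D N G + lin N G" for N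
    unfolding trunc_def lin_def msets_lt_Suc
    by (rule sum.union_disjoint[OF finite_msets_lt finite_msets]) (auto simp: msets_def msets_lt_def)
  have low: "N \<le> k \<Longrightarrow> trunc x D N G = 0" for N
    unfolding trunc_def by (intro sum.neutral) (auto simp: msets_lt_def G_def \<kappa>_0)
  have tr: "trunc x D (Suc k + n) G = R n" for n
  proof (induction n)
    case 0
    have "lin k G = lin k f" unfolding lin_def by (intro sum.cong) (auto simp: msets_def G_def)
    then show ?case using split[of k] low[of k] by (simp add: R0)
  next
    case (Suc n)
    have "lin (Suc k + n) G = - lin (Suc k + n) (lead (Suc k + n) (R n))"
      unfolding lin_def sum_negf[symmetric] by (intro sum.cong) (auto simp: msets_def G_def \<kappa>_uminus)
    then show ?case using split[of "Suc k + n"] Suc.IH by (simp add: RS)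
  qed
  have *: "1 * trunc x D N G \<in> filt m (p 0) N" for N
  proof (cases "N \<le> k")
    case True
    then show ?thesis using low[OF True] is_idealD(1)[OF is_ideal_filt] by simp
  next
    case False
    then obtain n where N: "N = Suc k + n" using less_imp_Suc_add[of k N] by auto
    show ?thesis using R[of n] unfolding N tr mult_1_left .
  qed
  have "G M = 0"
    using M by (intro power_series_eq_0[OF ch x _ is_primeD(2)[OF P(1)] *]) (simp add: msets_def)
  then show ?thesis using M by (simp add: G_def msets_def)
qed

end

section \<open>Evaluation of polynomials\<close>

lemma pm_sum_keys: "F = (\<Sum>k\<in>Poly_Mapping.keys F. Poly_Mapping.single k (Poly_Mapping.lookup F k))"
proof (rule poly_mapping_eqI)
  fix k
  have "(\<Sum>i\<in>Poly_Mapping.keys F. Poly_Mapping.lookup (Poly_Mapping.single i (Poly_Mapping.lookup F i)) k) =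
      (\<Sum>i\<in>Poly_Mapping.keys F. if i = k then Poly_Mapping.lookup F i else 0)"
    by (intro sum.cong) (auto simp: lookup_single when_def)
  then show "Poly_Mapping.lookup F k = Poly_Mapping.lookup (\<Sum>k\<in>Poly_Mapping.keys F. Poly_Mapping.single k (Poly_Mapping.lookup F k)) k"
    by (simp add: lookup_sum in_keys_iff)
qed

text \<open>Common form of evaluation, differentiation, contraction, the bar differential and the
  pairing with functions on the group; additivity in the coefficient is all that has to be
  checked.\<close>

definition pm_ext :: "('x \<Rightarrow> 'b::zero \<Rightarrow> 'c::comm_monoid_add) \<Rightarrow> ('x \<Rightarrow>\<^sub>0 'b) \<Rightarrow> 'c" where
  "pm_ext h F = (\<Sum>k\<in>Poly_Mapping.keys F. h k (Poly_Mapping.lookup F k))"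

lemma pm_ext_single: "h k 0 = 0 \<Longrightarrow> pm_ext h (Poly_Mapping.single k a) = h k a"
  by (simp add: pm_ext_def)

lemma pm_ext_add:
  fixes F G :: "'x \<Rightarrow>\<^sub>0 'b::comm_monoid_add"
  assumes "\<And>k. h k 0 = 0" "\<And>k a b. h k (a + b) = h k a + h k b"
  shows "pm_ext h (F + G) = pm_ext h F + pm_ext h G"
  unfolding pm_ext_def by (rule setsum_keys_plus_distrib) (use assms in auto)

lemma pm_additive_induct:
  fixes F :: "'x \<Rightarrow>\<^sub>0 'b::comm_monoid_add"
  assumes "P 0" "\<And>F G. P F \<Longrightarrow> P G \<Longrightarrow> P (F + G)" "\<And>k a. P (Poly_Mapping.single k a)"
  shows "P F"
proof -
  have "P (\<Sum>k\<in>A. Poly_Mapping.single k (Poly_Mapping.lookup F k))" for A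
    by (induction A rule: infinite_finite_induct) (use assms in auto)
  then show ?thesis by (subst pm_sum_keys)
qed

definition mono_val :: "('x \<Rightarrow> 'b::comm_ring_1) \<Rightarrow> ('x \<Rightarrow>\<^sub>0 nat) \<Rightarrow> 'b" where
  "mono_val v m = (\<Prod>x\<in>Poly_Mapping.keys m. v x ^ Poly_Mapping.lookup m x)"

lemma mono_val_superset:
  assumes "finite A" "Poly_Mapping.keys m \<subseteq> A"
  shows "mono_val v m = (\<Prod>x\<in>A. v x ^ Poly_Mapping.lookup m x)"
  unfolding mono_val_def using assms by (intro prod.mono_neutral_left) (auto simp: in_keys_iff)

lemma mono_val_add: "mono_val v (m + n) = mono_val v m * mono_val v n"
proof -
  let ?A = "Poly_Mapping.keys m \<union> Poly_Mapping.keys n"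
  have "mono_val v (m + n) = (\<Prod>x\<in>?A. v x ^ Poly_Mapping.lookup (m + n) x)"
    by (rule mono_val_superset) (use keys_add[of m n] in auto)
  then show ?thesis
    by (simp add: mono_val_superset[of ?A m] mono_val_superset[of ?A n] lookup_add power_add prod.distrib)
qed

lemma mono_val_0 [simp]: "mono_val v 0 = 1"
  by (simp add: mono_val_def)

lemma mono_val_single [simp]: "mono_val v (Poly_Mapping.single x k) = v x ^ k"
  by (simp add: mono_val_def)

definition ring_hom_map :: "('c::comm_ring_1 \<Rightarrow> 'b::comm_ring_1) \<Rightarrow> bool" where
  "ring_hom_map f \<longleftrightarrow> f 1 = 1 \<and> (\<forall>a b. f (a + b) = f a + f b \<and> f (a * b) = f a * f b)"

lemma ring_hom_mapD:
  assumes "ring_hom_map f"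
  shows "f 1 = 1" "f (a + b) = f a + f b" "f (a * b) = f a * f b" "f 0 = 0" "f (- a) = - f a"
    "f (a - b) = f a - f b" "f (sum g A) = (\<Sum>x\<in>A. f (g x))" "f (prod g A) = (\<Prod>x\<in>A. f (g x))" "f (a ^ n) = f a ^ n"
proof -
  show 1: "f 1 = 1" and add: "f (a + b) = f a + f b" and mult: "f (a * b) = f a * f b" for a b
    using assms by (auto simp: ring_hom_map_def)
  show 0: "f 0 = 0" using add[of 0 0] by simp
  show um: "f (- a) = - f a" for a using add[of a "- a"] 0 by (simp add: eq_neg_iff_add_eq_0 add.commute)
  show "f (a - b) = f a - f b" using add[of a "- b"] um by simp
  show "f (sum g A) = (\<Sum>x\<in>A. f (g x))" by (induction A rule: infinite_finite_induct) (auto simp: 0 add)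
  show "f (prod g A) = (\<Prod>x\<in>A. f (g x))" by (induction A rule: infinite_finite_induct) (auto simp: 1 mult)
  show "f (a ^ n) = f a ^ n" by (induction n) (auto simp: 1 mult)
qed

definition evalp :: "('c::comm_ring_1 \<Rightarrow> 'b::comm_ring_1) \<Rightarrow> ('x \<Rightarrow> 'b) \<Rightarrow> (('x \<Rightarrow>\<^sub>0 nat) \<Rightarrow>\<^sub>0 'c) \<Rightarrow> 'b" where
  "evalp f v p = (\<Sum>m\<in>Poly_Mapping.keys p. f (Poly_Mapping.lookup p m) * mono_val v m)"

lemma evalp_pm_ext: "evalp f v = pm_ext (\<lambda>m c. f c * mono_val v m)"
  by (simp add: evalp_def pm_ext_def fun_eq_iff)

lemma evalp_add: "ring_hom_map f \<Longrightarrow> evalp f v (p + q) = evalp f v p + evalp f v q"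
  unfolding evalp_pm_ext by (rule pm_ext_add) (auto simp: ring_hom_mapD algebra_simps)

lemma evalp_single: "ring_hom_map f \<Longrightarrow> evalp f v (Poly_Mapping.single m c) = f c * mono_val v m"
  unfolding evalp_pm_ext by (subst pm_ext_single) (auto simp: ring_hom_mapD)

lemma evalp_mult:
  assumes f: "ring_hom_map f"
  shows "evalp f v (p * q) = evalp f v p * evalp f v q"
proof (induction p rule: pm_additive_induct)
  case 1
  then show ?case by (simp add: evalp_def)
next
  case (2 F G)
  then show ?case by (simp add: distrib_right evalp_add[OF f])
next
  case (3 m a)
  show ?case
  proof (induction q rule: pm_additive_induct)
    case 1
    then show ?case by (simp add: evalp_def)
  next
    case (2 F G)
    then show ?case by (simp add: distrib_left evalp_add[OF f])
  next
    case (3 n b)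
    show ?case
      by (simp add: mult_single evalp_single[OF f] ring_hom_mapD[OF f] mono_val_add mult_ac)
  qed
qed

lemma evalp_1: "ring_hom_map f \<Longrightarrow> evalp f v 1 = 1"
  using evalp_single[of f v 0 1] by (simp add: ring_hom_mapD)

lemma ring_hom_map_evalp: "ring_hom_map f \<Longrightarrow> ring_hom_map (evalp f v)"
  unfolding ring_hom_map_def[of "evalp f v"] by (simp add: evalp_add evalp_mult evalp_1)

lemma evalp_comp:
  assumes f: "ring_hom_map f" and g: "ring_hom_map g" and h: "ring_hom_map h" and gf: "\<And>c. g (f c) = h c"
  shows "g (evalp f v p) = evalp h (\<lambda>x. g (v x)) p"
  unfolding evalp_def mono_val_def by (simp add: ring_hom_mapD[OF g] gf)

lemma ring_hom_map_Const: "ring_hom_map Const"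
  by (simp add: ring_hom_map_def Const_def single_add mult_single)

lemma ring_hom_map_id: "ring_hom_map (\<lambda>x. x)"
  by (simp add: ring_hom_map_def)

lemmas Const_simps = ring_hom_mapD[OF ring_hom_map_Const]

lemma msubst_evalp: "msubst = evalp Const"
  by (simp add: msubst_def evalp_def mono_val_def fun_eq_iff)

lemma evalp_Const: "ring_hom_map f \<Longrightarrow> evalp f v (Const c) = f c"
  unfolding Const_def by (simp add: evalp_single)

lemma evalp_Var: "ring_hom_map f \<Longrightarrow> evalp f v (Var x) = v x"
  unfolding Var_def by (simp add: evalp_single ring_hom_mapD)

lemma mpoly_induct [case_names Const Var add mult]:
  fixes p :: "'i mpoly"
  assumes "\<And>c. P (Const c)" "\<And>x. P (Var x)" "\<And>p q. P p \<Longrightarrow> P q \<Longrightarrow> P (p + q)" "\<And>p q. P p \<Longrightarrow> P q \<Longrightarrow> P (p * q)"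
  shows "P p"
proof (induction p rule: pm_additive_induct)
  case 1
  then show ?case using assms(1)[of 0] by (simp add: Const_simps)
next
  case (2 F G)
  then show ?case by (rule assms(3))
next
  case (3 m a)
  have "P (Poly_Mapping.single m 1)"
  proof (induction m rule: pm_additive_induct)
    case 1
    then show ?case using assms(1)[of 1] by (simp add: Const_def)
  next
    case (2 m n)
    then show ?case using assms(4)[of "Poly_Mapping.single m 1" "Poly_Mapping.single n 1"] by (simp add: mult_single)
  next
    case (3 x k)
    show ?case
    proof (induction k)
      case 0
      then show ?case using assms(1)[of 1] by (simp add: Const_def)
    next
      case (Suc k)
      then show ?case using assms(4)[OF assms(2)[of x] Suc]
        by (simp add: Var_def mult_single single_add[symmetric])
    qed
  qed
  from assms(4)[OF assms(1)[of a] this] show ?case by (simp add: Const_def mult_single)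
qed

section \<open>Two-by-two matrices and words\<close>

abbreviation ent :: "'a^'n^'m \<Rightarrow> 'm \<Rightarrow> 'n \<Rightarrow> 'a" where
  "ent A i j \<equiv> vec_nth (vec_nth A i) j"

lemma vec2_eq_iff: "(A :: 'a^2^2) = B \<longleftrightarrow> ent A 1 1 = ent B 1 1 \<and> ent A 1 2 = ent B 1 2 \<and> ent A 2 1 = ent B 2 1 \<and> ent A 2 2 = ent B 2 2"
  unfolding vec_eq_iff forall_2 by blast

lemma mat2_mult: "ent ((A :: 'a::comm_ring_1^2^2) ** B) i j = ent A i 1 * ent B 1 j + ent A i 2 * ent B 2 j"
  by (simp add: matrix_matrix_mult_def sum_2)

lemma trace2: "trace (A :: 'a::comm_ring_1^2^2) = ent A 1 1 + ent A 2 2"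
  by (simp add: trace_def sum_2)

lemma adjugate2_nth [simp]:
  fixes A :: "'a::comm_ring_1^2^2"
  shows
  "ent (adjugate2 A) 1 1 = ent A 2 2" "ent (adjugate2 A) 1 2 = - ent A 1 2"
  "ent (adjugate2 A) 2 1 = - ent A 2 1" "ent (adjugate2 A) 2 2 = ent A 1 1"
  by (simp_all add: adjugate2_def)

lemma mat2_one: "ent (mat 1 :: 'a::comm_ring_1^2^2) 1 1 = 1" "ent (mat 1 :: 'a^2^2) 1 2 = 0"
  "ent (mat 1 :: 'a^2^2) 2 1 = 0" "ent (mat 1 :: 'a^2^2) 2 2 = 1"
  by (simp_all add: mat_def)

lemmas mat2_simps = vec2_eq_iff mat2_mult trace2 mat2_one

lemma adjugate2_mult: "adjugate2 (A ** B) = adjugate2 B ** adjugate2 A"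
  by (simp add: mat2_simps algebra_simps)

lemma adjugate2_adjugate2: "adjugate2 (adjugate2 A) = A"
  by (simp add: mat2_simps)

lemma adjugate2_one: "adjugate2 (mat 1) = mat 1"
  by (simp add: mat2_simps)

lemma trace2_mult_commute: "trace ((A :: 'a::comm_ring_1^2^2) ** B) = trace (B ** A)"
  by (simp add: mat2_simps algebra_simps)

lemma trace_product: "trace (A :: 'a::comm_ring_1^2^2) * trace B = trace (A ** B) + trace (A ** adjugate2 B)"
  by (simp add: mat2_simps algebra_simps)

lemma mult_adjugate2: "A ** adjugate2 A = (\<chi> i j. if i = j then det A else 0)"
  "adjugate2 A ** A = (\<chi> i j. if i = j then det A else 0)" for A :: "'a::comm_ring_1^2^2"
  by (simp_all add: mat2_simps det_2 algebra_simps)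

lemma det2_mult: "det ((A :: 'a::comm_ring_1^2^2) ** B) = det A * det B"
  by (simp add: det_2 mat2_mult algebra_simps)

lemma word_mat_Nil [simp]: "word_mat [] = mat 1"
  by (simp add: word_mat_def)

lemma word_mat_Cons: "word_mat ((l, e) # w) = (if e then gen_mat l else adjugate2 (gen_mat l)) ** word_mat w"
  by (simp add: word_mat_def)

lemma word_mat_append: "word_mat (u @ v) = word_mat u ** word_mat v"
  by (induction u) (auto simp: word_mat_Cons matrix_mul_assoc)

definition inv_word :: "('i \<times> bool) list \<Rightarrow> ('i \<times> bool) list" where
  "inv_word w = rev (map (\<lambda>(l, e). (l, \<not> e)) w)"

lemma adjugate2_word_mat: "adjugate2 (word_mat w) = word_mat (inv_word w)"
  by (induction w)
    (auto simp: word_mat_Cons word_mat_append inv_word_def adjugate2_mult adjugate2_one adjugate2_adjugate2)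

definition mat_map :: "('a \<Rightarrow> 'b) \<Rightarrow> 'a^2^2 \<Rightarrow> 'b^2^2" where
  "mat_map f A = (\<chi> i j. f (ent A i j))"

lemma mat_map_nth [simp]: "ent (mat_map f A) i j = f (ent A i j)"
  by (simp add: mat_map_def)

lemma mat_map_hom:
  assumes "ring_hom_map f"
  shows "mat_map f (A ** B) = mat_map f A ** mat_map f B" "mat_map f (adjugate2 A) = adjugate2 (mat_map f A)"
    "mat_map f (mat 1) = mat 1" "f (trace A) = trace (mat_map f A)" "f (det A) = det (mat_map f A)"
  by (simp_all add: mat2_simps det_2 ring_hom_mapD[OF assms])

section \<open>The algebra generated by traces\<close>

text \<open>Taken in the free polynomial ring, before det = 1 is imposed. Inverse letters are
  adjugates, so trace identities hold here as polynomial identities.\<close>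

inductive_set trace_alg :: "'i mpoly set" where
  trace_alg_Const: "Const c \<in> trace_alg"
| trace_alg_trace: "trace (word_mat w) \<in> trace_alg"
| trace_alg_add: "p \<in> trace_alg \<Longrightarrow> q \<in> trace_alg \<Longrightarrow> p + q \<in> trace_alg"
| trace_alg_mult: "p \<in> trace_alg \<Longrightarrow> q \<in> trace_alg \<Longrightarrow> p * q \<in> trace_alg"

lemma trace_alg_0: "0 \<in> trace_alg" and trace_alg_1: "1 \<in> trace_alg"
  using trace_alg_Const[of 0] trace_alg_Const[of 1] by (simp_all add: Const_simps)

lemma trace_alg_uminus: "p \<in> trace_alg \<Longrightarrow> - p \<in> trace_alg"
  using trace_alg_mult[OF trace_alg_Const[of "-1"], of p] by (simp add: Const_simps)

lemma trace_alg_diff: "p \<in> trace_alg \<Longrightarrow> q \<in> trace_alg \<Longrightarrow> p - q \<in> trace_alg"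
  using trace_alg_add[of p "- q"] trace_alg_uminus[of q] by simp

text \<open>
  A repeated letter \<open>x\<close> in a word is removed by
  \<open>tr (x u x v) = tr (x u) tr (x v) - det x tr (u adj v)\<close>, so finitely many traces generate.
\<close>

lemma trace_repeated_letter:
  fixes A U V :: "'a::comm_ring_1^2^2"
  shows "2 * trace (A ** U ** A ** V) = 2 * trace (A ** U) * trace (A ** V)
    - (trace A * trace A - trace (A ** A)) * trace (U ** adjugate2 V)"
  by (simp add: mat2_simps algebra_simps)

section \<open>Contraction of polynomials on two-by-two matrices\<close>

text \<open>Polynomials in the entries of a generic matrix \<open>S\<close>, with coefficients in the entries of the \<open>gen_mat l\<close>.\<close>

type_synonym 'i qpoly = "((2 \<times> 2) \<Rightarrow>\<^sub>0 nat) \<Rightarrow>\<^sub>0 'i mpoly"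

definition qc :: "'i mpoly \<Rightarrow> 'i qpoly" where "qc t = Poly_Mapping.single 0 t"

definition qvar :: "2 \<Rightarrow> 2 \<Rightarrow> 'i qpoly" where
  "qvar a j = Poly_Mapping.single (Poly_Mapping.single (a, j) 1) 1"

lemma ring_hom_map_qc: "ring_hom_map qc"
  by (simp add: ring_hom_map_def qc_def single_add mult_single)

lemmas qc_simps = ring_hom_mapD[OF ring_hom_map_qc]

text \<open>The partial derivative in the variable \<open>x\<close>. Subtraction of exponents is
  truncated, but a truncated term has coefficient 0.\<close>

definition qd :: "2 \<times> 2 \<Rightarrow> 'i qpoly \<Rightarrow> 'i qpoly" where
  "qd x = pm_ext (\<lambda>m c. Poly_Mapping.single (m - Poly_Mapping.single x 1) (of_nat (Poly_Mapping.lookup m x) * c))"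

lemma qd_single: "qd x (Poly_Mapping.single m c) =
    Poly_Mapping.single (m - Poly_Mapping.single x 1) (of_nat (Poly_Mapping.lookup m x) * c)"
  unfolding qd_def by (subst pm_ext_single) auto

lemma qd_add: "qd x (F + G) = qd x F + qd x G"
  unfolding qd_def by (rule pm_ext_add) (auto simp: distrib_left single_add)

lemma qd_0 [simp]: "qd x 0 = 0"
  using qd_add[of x 0 0] by simp

lemma qd_uminus: "qd x (- F) = - qd x F"
  using qd_add[of x F "- F"] by (simp add: eq_neg_iff_add_eq_0 add.commute)

lemma qd_diff: "qd x (F - G) = qd x F - qd x G"
  using qd_add[of x F "- G"] by (simp add: qd_uminus)

lemma qd_mult_single:
  "qd x (Poly_Mapping.single m a * Poly_Mapping.single n b) =
    Poly_Mapping.single m a * qd x (Poly_Mapping.single n b) + Poly_Mapping.single n b * qd x (Poly_Mapping.single m a)"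
proof -
  let ?e = "Poly_Mapping.single x (1::nat)"
  have 1: "Poly_Mapping.single (m + (n - ?e)) (a * (of_nat (Poly_Mapping.lookup n x) * b)) =
      Poly_Mapping.single (m + n - ?e) (a * (of_nat (Poly_Mapping.lookup n x) * b))"
  proof (cases "Poly_Mapping.lookup n x = 0")
    case False
    then have "m + (n - ?e) = m + n - ?e"
      by (intro poly_mapping_eqI) (auto simp: lookup_add lookup_minus lookup_single when_def)
    then show ?thesis by simp
  qed simp
  have 2: "Poly_Mapping.single (n + (m - ?e)) (b * (of_nat (Poly_Mapping.lookup m x) * a)) =
      Poly_Mapping.single (m + n - ?e) (b * (of_nat (Poly_Mapping.lookup m x) * a))"
  proof (cases "Poly_Mapping.lookup m x = 0")
    case False
    then have "n + (m - ?e) = m + n - ?e"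
      by (intro poly_mapping_eqI) (auto simp: lookup_add lookup_minus lookup_single when_def)
    then show ?thesis by simp
  qed simp
  show ?thesis
    unfolding mult_single qd_single 1 2 single_add[symmetric]
    by (simp add: lookup_add algebra_simps)
qed

lemma qd_mult: "qd x (F * G) = F * qd x G + G * qd x F"
proof (induction F rule: pm_additive_induct)
  case (2 F1 filt2)
  then show ?case by (simp add: distrib_right distrib_left qd_add)
next
  case (3 m a)
  show ?case
  proof (induction G rule: pm_additive_induct)
    case (2 G1 G2)
    then show ?case by (simp add: distrib_right distrib_left qd_add)
  qed (simp_all add: qd_mult_single)
qed simp

lemma qd_qc [simp]: "qd x (qc t) = 0"
  by (simp add: qc_def qd_single)

lemma qd_qvar: "qd x (qvar a j) = (if x = (a, j) then 1 else 0)"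
  by (auto simp: qvar_def qd_single lookup_single when_def)

definition bar :: "2 \<Rightarrow> 2" where "bar j = (if j = 1 then 2 else 1)"

lemma bar_simps [simp]: "bar 1 = 2" "bar 2 = 1"
  by (simp_all add: bar_def)

text \<open>
  Up to a factor, the integral of a monomial over \<open>SU(2)\<close>.  It contracts \<open>S\<^sub>1\<^sub>1\<close> with \<open>S\<^sub>2\<^sub>2\<close>, and
  \<open>S\<^sub>1\<^sub>2\<close> with \<open>S\<^sub>2\<^sub>1\<close> with a sign, which is Cayley's Omega process.
\<close>

definition ell :: "((2 \<times> 2) \<Rightarrow>\<^sub>0 nat) \<Rightarrow> complex" where
  "ell m = (let k = Poly_Mapping.lookup m in if k (1, 1) = k (2, 2) \<and> k (1, 2) = k (2, 1)
     then fact (k (1, 1)) * fact (k (1, 2)) * (- 1) ^ k (1, 2) else 0)"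

text \<open>Pairing a variable with one of its partners in \<open>m\<close> lowers two factorials to
  one by k! = k (k - 1)! and costs a sign for an off-diagonal pair.\<close>

lemma ell_wick:
  "ell (Poly_Mapping.single (a, j) 1 + m) = (if a = j then 1 else - 1) *
    (of_nat (Poly_Mapping.lookup m (bar a, bar j)) * ell (m - Poly_Mapping.single (bar a, bar j) 1))"
proof -
  have "\<forall>a j :: 2. ell (Poly_Mapping.single (a, j) 1 + m) = (if a = j then 1 else - 1) *
    (of_nat (Poly_Mapping.lookup m (bar a, bar j)) * ell (m - Poly_Mapping.single (bar a, bar j) 1))"
    unfolding forall_2
  proof (intro conjI)
    let ?k = "Poly_Mapping.lookup m"
    show "ell (Poly_Mapping.single (1, 1) 1 + m) = (if (1::2) = 1 then 1 else - 1) *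
        (of_nat (?k (bar 1, bar 1)) * ell (m - Poly_Mapping.single (bar 1, bar 1) 1))"
      by (cases "?k (2, 2)") (auto simp: ell_def Let_def lookup_add lookup_minus lookup_single when_def)
    show "ell (Poly_Mapping.single (1, 2) 1 + m) = (if (1::2) = 2 then 1 else - 1) *
        (of_nat (?k (bar 1, bar 2)) * ell (m - Poly_Mapping.single (bar 1, bar 2) 1))"
      by (cases "?k (2, 1)") (auto simp: ell_def Let_def lookup_add lookup_minus lookup_single when_def)
    show "ell (Poly_Mapping.single (2, 1) 1 + m) = (if (2::2) = 1 then 1 else - 1) *
        (of_nat (?k (bar 2, bar 1)) * ell (m - Poly_Mapping.single (bar 2, bar 1) 1))"
      by (cases "?k (1, 2)") (auto simp: ell_def Let_def lookup_add lookup_minus lookup_single when_def)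
    show "ell (Poly_Mapping.single (2, 2) 1 + m) = (if (2::2) = 2 then 1 else - 1) *
        (of_nat (?k (bar 2, bar 2)) * ell (m - Poly_Mapping.single (bar 2, bar 2) 1))"
      by (cases "?k (1, 1)") (auto simp: ell_def Let_def lookup_add lookup_minus lookup_single when_def)
  qed
  then show ?thesis by blast
qed

definition wick :: "'i qpoly \<Rightarrow> 'i mpoly" where
  "wick = pm_ext (\<lambda>m c. Const (ell m) * c)"

lemma wick_add: "wick (F + G) = wick F + wick G"
  unfolding wick_def by (rule pm_ext_add) (auto simp: distrib_left)

lemma wick_single: "wick (Poly_Mapping.single m c) = Const (ell m) * c"
  unfolding wick_def by (subst pm_ext_single) auto

lemma wick_0 [simp]: "wick 0 = 0"
  using wick_add[of 0 0] by simp

lemma wick_qc_mult: "wick (qc t * F) = t * wick F"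
  by (induction F rule: pm_additive_induct)
    (simp_all add: wick_add distrib_left qc_def mult_single wick_single mult.left_commute)

lemma wick_diff: "wick (F - G) = wick F - wick G"
  using wick_add[of "F - G" G] by (simp add: eq_diff_eq)

lemma wick_1: "wick 1 = 1"
  using wick_single[of 0 1] by (simp add: ell_def Const_simps)

text \<open>Integration by parts: under \<open>wick\<close>, multiplication by a variable becomes
  differentiation by its partner.\<close>

lemma wick_qvar_mult:
  "wick (qvar a j * F) = Const (if a = j then 1 else - 1) * wick (qd (bar a, bar j) F)"
proof (induction F rule: pm_additive_induct)
  case (2 F G)
  then show ?case by (simp add: distrib_left wick_add qd_add)
next
  case (3 m c)
  have "(of_nat n :: 'a mpoly) = Const (of_nat n)" for n
    by (induction n) (auto simp: Const_simps)
  then show ?case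
    unfolding qvar_def mult_single qd_single wick_single ell_wick by (simp add: Const_simps mult_ac)
qed simp

text \<open>Entry \<open>b\<close> of the vector W S_k, where S_k is column \<open>k\<close> of the
  generic matrix S.\<close>

definition qvec :: "'i mpoly^2^2 \<Rightarrow> 2 \<Rightarrow> 2 \<Rightarrow> 'i qpoly" where
  "qvec W k b = qc (ent W b 1) * qvar 1 k + qc (ent W b 2) * qvar 2 k"

text \<open>\<open>\<omega> (S\<^sub>j, W S\<^sub>k)\<close> for the columns of \<open>S\<close> and the symplectic form \<open>\<omega>\<close>\<close>

definition chain :: "2 \<Rightarrow> 'i mpoly^2^2 \<Rightarrow> 2 \<Rightarrow> 'i qpoly" where
  "chain j W k = qvar 1 j * qvec W k 2 - qvar 2 j * qvec W k 1"

text \<open>The polarisation derivation that substitutes W S_k for the column of index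
  \<open>bar j\<close>, in one place at a time.\<close>

definition contract :: "2 \<Rightarrow> 'i mpoly^2^2 \<Rightarrow> 2 \<Rightarrow> 'i qpoly \<Rightarrow> 'i qpoly" where
  "contract j W k F = qvec W k 1 * qd (1, bar j) F + qvec W k 2 * qd (2, bar j) F"

lemma qd_qvec: "qd (b, i) (qvec W k b) = qc (if k = i then ent W b b else 0)"
proof -
  have "\<forall>b. qd (b, i) (qvec W k b) = qc (if k = i then ent W b b else 0)"
    unfolding forall_2 by (auto simp: qvec_def qd_add qd_mult qd_qvar qc_simps)
  then show ?thesis by blast
qed

text \<open>Integrate the column S_j by parts. The derivative along column \<open>bar j\<close>
  either meets W S_k in the same chain, which closes up to the trace of W, or acts on the remaining
  factors, which is \<open>contract\<close>.\<close>

lemma wick_chain_mult: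
  "wick (chain j W k * F) = Const (if j = 1 then 1 else - 1) *
    ((if k = bar j then trace W else 0) * wick F + wick (contract j W k F))"
proof -
  have 1: "chain j W k * F = qvar 1 j * (qvec W k 2 * F) - qvar 2 j * (qvec W k 1 * F)"
    by (simp add: chain_def left_diff_distrib mult.assoc)
  have eq: "wick (qd (b, bar j) (qvec W k b * F)) =
      wick (qvec W k b * qd (b, bar j) F) + (if k = bar j then ent W b b else 0) * wick F" for b
    unfolding qd_mult qd_qvec wick_add using wick_qc_mult[of "if k = bar j then ent W b b else 0" F]
    by (simp add: mult.commute)
  have j: "j = 1 \<or> j = 2" by (rule exhaust_2)
  show ?thesis
    unfolding 1 wick_diff wick_qvar_mult bar_simps eq contract_def wick_add trace2 using j
    by (elim disjE) (simp_all add: Const_simps algebra_simps)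
qed

lemma contract_add: "contract j W k (F + G) = contract j W k F + contract j W k G"
  by (simp add: contract_def qd_add algebra_simps)

lemma contract_mult: "contract j W k (F * G) = F * contract j W k G + G * contract j W k F"
  by (simp add: contract_def qd_mult algebra_simps)

lemma contract_1 [simp]: "contract j W k 1 = 0"
  using contract_mult[of j W k 1 1] by simp

lemma contract_qvar: "contract j W k (qvar b i) = (if i = bar j then qvec W k b else 0)"
proof -
  have "\<forall>b. contract j W k (qvar b i) = (if i = bar j then qvec W k b else 0)"
    unfolding forall_2 by (auto simp: contract_def qd_qvar)
  then show ?thesis by blast
qed

lemma contract_qc [simp]: "contract j W k (qc t) = 0"
  by (simp add: contract_def)

lemma contract_diff: "contract j W k (F - G) = contract j W k F - contract j W k G"
  by (simp add: contract_def qd_diff algebra_simps)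

lemma contract_qvec: "contract j W k (qvec V i b) = (if i = bar j then qvec (V ** W) k b else 0)"
  unfolding qvec_def[of V] contract_add contract_mult contract_qvar contract_qc
  by (simp add: qvec_def mat2_mult qc_simps algebra_simps)

text \<open>Substitution in the right column lengthens the word on the right. In the left column it
  uses that the adjugate is the adjoint for the symplectic form: \<omega>(W x, V y) = \<omega>(x,
  adj(W) V y).\<close>

lemma contract_chain:
  "contract j W k (chain i V l) =
    (if i = bar j then chain k (adjugate2 W ** V) l else 0) + (if l = bar j then chain i (V ** W) k else 0)"
proof -
  have "qvec W k 1 * qvec V l 2 - qvec W k 2 * qvec V l 1 = chain k (adjugate2 W ** V) l"
    unfolding chain_def qvec_def by (simp add: mat2_mult qc_simps algebra_simps)
  then show ?thesis
    unfolding chain_def[of i] contract_diff contract_mult contract_qvar contract_qvec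
    by (auto simp: chain_def algebra_simps)
qed

section \<open>Products of chains contract to traces\<close>

definition chains :: "(2 \<times> ('i \<times> bool) list \<times> 2) list \<Rightarrow> 'i qpoly" where
  "chains xs = prod_list (map (\<lambda>(j, w, k). chain j (word_mat w) k) xs)"

text \<open>\<open>A\<close> records how many chains a product may have: contraction preserves this
  number, on which the induction in \<open>wick_chains\<close> rests, while \<open>UNIV\<close>
  forgets it.\<close>

inductive_set chain_span :: "nat set \<Rightarrow> 'i qpoly set" for A where
  chain_span_0: "0 \<in> chain_span A"
| chain_span_step: "F \<in> chain_span A \<Longrightarrow> length xs \<in> A \<Longrightarrow> F + qc (Const c) * chains xs \<in> chain_span A"

lemma chain_span_add: "F \<in> chain_span A \<Longrightarrow> G \<in> chain_span A \<Longrightarrow> F + G \<in> chain_span A"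
proof (induction F rule: chain_span.induct)
  case (chain_span_step F xs c)
  then have "(F + G) + qc (Const c) * chains xs \<in> chain_span A" by (blast intro: chain_span.intros)
  then show ?case by (simp add: algebra_simps)
qed simp

lemma chain_span_chains: "length xs \<in> A \<Longrightarrow> chains xs \<in> chain_span A"
  using chain_span_step[OF chain_span_0, of xs A 1] by (simp add: Const_simps qc_simps)

lemma chain_span_mult_chains:
  "F \<in> chain_span A \<Longrightarrow> (\<And>n. n \<in> A \<Longrightarrow> n + length ys \<in> B) \<Longrightarrow> F * (qc (Const d) * chains ys) \<in> chain_span B"
proof (induction F rule: chain_span.induct)
  case (chain_span_step F xs c)
  then have "F * (qc (Const d) * chains ys) + qc (Const (c * d)) * chains (xs @ ys) \<in> chain_span B"
    by (intro chain_span.intros) auto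
  then show ?case by (simp add: algebra_simps chains_def Const_simps qc_simps)
qed (simp add: chain_span_0)

lemma chain_span_mult:
  assumes "F \<in> chain_span UNIV" "G \<in> chain_span UNIV"
  shows "F * G \<in> chain_span UNIV"
  using assms(2)
proof (induction G rule: chain_span.induct)
  case (chain_span_step G ys d)
  then have "F * G + F * (qc (Const d) * chains ys) \<in> chain_span UNIV"
    by (intro chain_span_add chain_span_mult_chains[OF assms(1)]) auto
  then show ?case by (simp add: distrib_left)
qed (simp add: chain_span_0)

lemma contract_chains: "contract j (word_mat w) k (chains xs) \<in> chain_span {length xs}"
proof (induction xs)
  case Nil
  then show ?case by (simp add: chains_def chain_span_0)
next
  case (Cons x xs)
  obtain i v l where x: "x = (i, v, l)" by (cases x)
  let ?n = "{length (x # xs)}"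
  have ch: "chains (x # xs) = chain i (word_mat v) l * chains xs" by (simp add: chains_def x)
  have c1: "chains [(i, v, l)] = chain i (word_mat v) l" for i v l by (simp add: chains_def)
  have "contract j (word_mat w) k (chains xs) * (qc (Const 1) * chains [(i, v, l)]) \<in> chain_span ?n"
    using Cons.IH by (rule chain_span_mult_chains) simp
  then have 1: "chain i (word_mat v) l * contract j (word_mat w) k (chains xs) \<in> chain_span ?n"
    by (simp add: c1 Const_simps qc_simps mult.commute)
  have e1: "chain k (adjugate2 (word_mat w) ** word_mat v) l * chains xs = chains ((k, inv_word w @ v, l) # xs)"
    by (simp add: chains_def word_mat_append adjugate2_word_mat)
  have e2: "chain i (word_mat v ** word_mat w) k * chains xs = chains ((i, v @ w, k) # xs)"
    by (simp add: chains_def word_mat_append)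
  have "chains xs * contract j (word_mat w) k (chain i (word_mat v) l) =
     (if i = bar j then chains ((k, inv_word w @ v, l) # xs) else 0) + (if l = bar j then chains ((i, v @ w, k) # xs) else 0)"
    unfolding contract_chain e1[symmetric] e2[symmetric] by (simp add: algebra_simps)
  also have "\<dots> \<in> chain_span ?n"
    by (intro chain_span_add) (auto intro: chain_span_0 chain_span_chains)
  finally show ?case unfolding ch contract_mult by (intro chain_span_add 1)
qed

text \<open>\<open>wick_chain_mult\<close> uses up one chain; contraction glues its word to the
  words of the others without changing their number. So the number of chains decreases until only
  traces are left.\<close>

lemma wick_chains:
  fixes xs :: "(2 \<times> ('i \<times> bool) list \<times> 2) list"
  shows "wick (chains xs) \<in> trace_alg"
proof (induction "length xs" arbitrary: xs rule: less_induct)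
  case less
  show ?case
  proof (cases xs)
    case Nil
    then show ?thesis by (simp add: chains_def wick_1 trace_alg_1)
  next
    case (Cons x ys)
    obtain j w k where x: "x = (j, w, k)" by (cases x)
    have ch: "chains xs = chain j (word_mat w) k * chains ys" by (simp add: chains_def x Cons)
    have "F \<in> chain_span {length ys} \<Longrightarrow> wick F \<in> trace_alg" for F :: "'i qpoly"
    proof (induction F rule: chain_span.induct)
      case (chain_span_step F zs c)
      then have "wick (chains zs) \<in> trace_alg" using less Cons by simp
      then show ?case using chain_span_step
        by (auto simp: wick_add wick_qc_mult intro: trace_alg.intros)
    qed (simp add: trace_alg_0)
    then have "wick (contract j (word_mat w) k (chains ys)) \<in> trace_alg" using contract_chains by blast
    moreover have "wick (chains ys) \<in> trace_alg" using less Cons by simp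
    ultimately show ?thesis
      unfolding ch wick_chain_mult by (auto intro!: trace_alg.intros trace_alg_0)
  qed
qed

lemma wick_chain_span: "F \<in> chain_span A \<Longrightarrow> wick F \<in> trace_alg"
  by (induction F rule: chain_span.induct)
    (auto simp: wick_add wick_qc_mult intro: trace_alg.intros trace_alg_0 wick_chains)

abbreviation qdet :: "'i qpoly" where "qdet \<equiv> chain 1 (mat 1) 2"

lemma contract_qdet: "contract 1 (mat 1) 2 qdet = qdet"
  by (simp add: contract_chain)

lemma contract_qdet_power: "contract 1 (mat 1) 2 (qdet ^ n) = of_nat n * qdet ^ n"
proof (induction n)
  case (Suc n)
  then show ?case by (simp add: contract_mult contract_qdet algebra_simps)
qed simp

text \<open>The normalising constant of the average. Integrating one factor \<open>qdet\<close> by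
  parts gives 2, the trace of the identity, plus n from the other n factors, each of which is
  reproduced by \<open>contract\<close>.\<close>

lemma wick_qdet_power: "wick (qdet ^ n :: 'i qpoly) = Const (fact (Suc n))"
proof (induction n)
  case 0
  then show ?case by (simp add: wick_1 Const_simps)
next
  case (Suc n)
  have nat: "(of_nat n :: 'i mpoly) = Const (of_nat n)" "(of_nat n :: 'i qpoly) = qc (Const (of_nat n))" for n
    by (induction n) (auto simp: Const_simps qc_simps)
  have "wick (qdet ^ Suc n :: 'i qpoly) = (2 + of_nat n) * wick (qdet ^ n)"
    unfolding power_Suc wick_chain_mult contract_qdet_power nat(2) wick_qc_mult nat(1)
    by (simp add: Const_simps trace2 mat2_one algebra_simps)
  also have "(2 + of_nat n :: 'i mpoly) = Const (of_nat (Suc (Suc n)))"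
    unfolding nat(1)[symmetric] by simp
  finally show ?case unfolding Suc Const_simps(3)[symmetric]
    by (simp add: algebra_simps)
qed

section \<open>Invariants are generated by traces\<close>

definition evq :: "(2 \<times> 2 \<Rightarrow> complex) \<Rightarrow> 'i qpoly \<Rightarrow> 'i mpoly" where
  "evq s = evalp (\<lambda>x. x) (\<lambda>x. Const (s x))"

lemma ring_hom_map_evq: "ring_hom_map (evq s)"
  unfolding evq_def by (rule ring_hom_map_evalp[OF ring_hom_map_id])

lemmas evq_simps = ring_hom_mapD[OF ring_hom_map_evq]

lemma evq_qc: "evq s (qc t) = t"
  by (simp add: evq_def qc_def evalp_single[OF ring_hom_map_id])

lemma evq_qvar: "evq s (qvar a j) = Const (s (a, j))"
  by (simp add: evq_def qvar_def evalp_single[OF ring_hom_map_id])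

lemma UNIV_22: "(UNIV :: (2 \<times> 2) set) = {(1, 1), (1, 2), (2, 1), (2, 2)}"
  by (auto simp: UNIV_2 simp flip: UNIV_Times_UNIV)

lemma digits_unique:
  fixes B :: nat
  assumes "a + B * r = a' + B * r'" "a < B" "a' < B"
  shows "a = a' \<and> r = r'"
proof -
  have "(a + B * r) mod B = (a' + B * r') mod B" "(a + B * r) div B = (a' + B * r') div B"
    using assms(1) by simp_all
  then show ?thesis using assms(2,3) by simp
qed

text \<open>
  If a polynomial takes values in an ideal, its coefficients lie in the ideal: scaling the
  variables by \<open>2, 2 ^ B, 2 ^ (B\<^sup>2), 2 ^ (B\<^sup>3)\<close> separates the monomials.
\<close>

lemma polynomial_values_in_ideal:
  fixes I :: "'i mpoly set" and S :: "((2 \<times> 2) \<Rightarrow>\<^sub>0 nat) set"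
  assumes I: "is_ideal I" and S: "finite S"
    and val: "\<And>s. (\<Sum>m\<in>S. Const (mono_val s m) * c m) \<in> I" and m: "m \<in> S"
  shows "c m \<in> I"
proof -
  \<comment> \<open>\<open>B\<close> exceeds all exponents, so that \<open>e m\<close> determines
    the monomial \<open>m\<close> by its expansion in base \<open>B\<close>.\<close>
  define B where "B = Suc (Max ((\<lambda>(m, x). Poly_Mapping.lookup m x) ` (S \<times> UNIV)))"
  have B: "Poly_Mapping.lookup m x < B" if "m \<in> S" for m x
    unfolding B_def less_Suc_eq_le using S that by (intro Max_ge) (auto intro!: image_eqI[of _ _ "(m, x)"])
  define w where "w x = (if x = (1, 1) then 1 else if x = (1, 2) then B else if x = (2, 1) then B * B else B * B * B)"
    for x :: "2 \<times> 2"
  define e where "e m = Poly_Mapping.lookup m (1, 1) + B * (Poly_Mapping.lookup m (1, 2) +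
    B * (Poly_Mapping.lookup m (2, 1) + B * Poly_Mapping.lookup m (2, 2)))" for m :: "(2 \<times> 2) \<Rightarrow>\<^sub>0 nat"
  have f: "finite (UNIV :: (2 \<times> 2) set)" by simp
  have scale: "mono_val (\<lambda>x. 2 ^ w x * s x) m = 2 ^ e m * mono_val s m" for s :: "2 \<times> 2 \<Rightarrow> complex" and m
    unfolding mono_val_superset[OF f subset_UNIV] UNIV_22
    by (simp add: w_def e_def power_mult_distrib power_add power_mult[symmetric] algebra_simps)
  have inj: "m = n" if mn: "m \<in> S" "n \<in> S" "e m = e n" for m n :: "(2 \<times> 2) \<Rightarrow>\<^sub>0 nat"
  proof -
    let ?m = "Poly_Mapping.lookup m" and ?n = "Poly_Mapping.lookup n"
    have 1: "?m (1, 1) = ?n (1, 1) \<and> ?m (1, 2) + B * (?m (2, 1) + B * ?m (2, 2)) = ?n (1, 2) + B * (?n (2, 1) + B * ?n (2, 2))"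
      using mn B unfolding e_def by (intro digits_unique) auto
    then have 2: "?m (1, 2) = ?n (1, 2) \<and> ?m (2, 1) + B * ?m (2, 2) = ?n (2, 1) + B * ?n (2, 2)"
      using mn B by (intro digits_unique) auto
    then have 3: "?m (2, 1) = ?n (2, 1) \<and> ?m (2, 2) = ?n (2, 2)"
      using mn B by (intro digits_unique) auto
    show "m = n"
    proof (rule poly_mapping_eqI)
      fix x :: "2 \<times> 2"
      have "x \<in> {(1, 1), (1, 2), (2, 1), (2, 2)}" using UNIV_22 by blast
      then show "?m x = ?n x" using 1 2 3 by auto
    qed
  qed
  \<comment> \<open>Induction over subsets with arbitrary coefficients: scaling the variables and
    subtracting \<open>2 ^ e m\<close> times the original relation removes the monomial
    \<open>m\<close> and multiplies the other coefficients by nonzero scalars.\<close>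
  have "T \<subseteq> S \<Longrightarrow> (\<And>s. (\<Sum>m\<in>T. Const (mono_val s m) * c m) \<in> I) \<Longrightarrow> m \<in> T \<Longrightarrow> c m \<in> I"
    for T m and c :: "((2 \<times> 2) \<Rightarrow>\<^sub>0 nat) \<Rightarrow> 'i mpoly"
  proof (induction "card T" arbitrary: T m c)
    case 0
    have "finite T" by (rule finite_subset[OF 0(2) S])
    then show ?case using 0(1,4) by auto
  next
    case (Suc n)
    have fT: "finite T" by (rule finite_subset[OF Suc.prems(1) S])
    have other: "c m' \<in> I" if m': "m' \<in> T" "m' \<noteq> m" for m'
    proof -
      let ?c = "\<lambda>k. Const (2 ^ e k - 2 ^ e m) * c k"
      have "?c m' \<in> I"
      proof (rule Suc.hyps(1))
        show "n = card (T - {m})" using Suc.hyps(2) Suc.prems(3) fT by simp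
        show "T - {m} \<subseteq> S" "m' \<in> T - {m}" using Suc.prems m' by auto
        show "(\<Sum>k\<in>T - {m}. Const (mono_val s k) * ?c k) \<in> I" for s
        proof -
          have "(\<Sum>k\<in>T. Const (mono_val (\<lambda>x. 2 ^ w x * s x) k) * c k) -
              Const (2 ^ e m) * (\<Sum>k\<in>T. Const (mono_val s k) * c k) \<in> I"
            by (rule is_idealD(6)[OF I Suc.prems(2) is_idealD(3)[OF I Suc.prems(2)]])
          also have "(\<Sum>k\<in>T. Const (mono_val (\<lambda>x. 2 ^ w x * s x) k) * c k) -
              Const (2 ^ e m) * (\<Sum>k\<in>T. Const (mono_val s k) * c k) = (\<Sum>k\<in>T. Const (mono_val s k) * ?c k)"
            unfolding scale sum_distrib_left sum_subtractf[symmetric]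
            by (intro sum.cong) (auto simp: Const_simps(3,6) algebra_simps)
          also have "\<dots> = (\<Sum>k\<in>T - {m}. Const (mono_val s k) * ?c k)"
            using fT Suc.prems(3) by (subst sum.remove[of T m]) (auto simp: Const_simps(4))
          finally show ?thesis .
        qed
      qed
      then have "Const (1 / (2 ^ e m' - 2 ^ e m)) * ?c m' \<in> I" by (rule is_idealD(3)[OF I])
      moreover have "e m' \<noteq> e m" using inj[of m' m] m' Suc.prems(1,3) by auto
      then have "(2 ^ e m' - 2 ^ e m :: complex) \<noteq> 0"
        using of_nat_eq_iff[of "2 ^ e m'" "2 ^ e m", where 'a = complex] by simp
      then have "Const (1 / (2 ^ e m' - 2 ^ e m)) * ?c m' = c m'"
        by (simp add: mult.assoc[symmetric] Const_simps(3)[symmetric] Const_simps(1))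
      ultimately show ?thesis by simp
    qed
    \<comment> \<open>At the point where all variables are 1 every monomial is 1, so the sum of the
      coefficients lies in \<open>I\<close>, and with it the one remaining coefficient.\<close>
    have one: "mono_val (\<lambda>_. 1) k = (1 :: complex)" for k :: "(2 \<times> 2) \<Rightarrow>\<^sub>0 nat" by (simp add: mono_val_def)
    have "(\<Sum>k\<in>T. c k) \<in> I" using Suc.prems(2)[of "\<lambda>_. 1"] by (simp add: one Const_simps)
    moreover have "(\<Sum>k\<in>T - {m}. c k) \<in> I" using other by (intro is_idealD(7)[OF I]) auto
    ultimately have "(\<Sum>k\<in>T. c k) - (\<Sum>k\<in>T - {m}. c k) \<in> I" by (rule is_idealD(6)[OF I])
    then show ?case using fT Suc.prems(3) by (simp add: sum.remove[of T m])
  qed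
  from this[OF subset_refl val m] show ?thesis .
qed

lemma wick_in_ideal:
  assumes I: "is_ideal I" and F: "\<And>s. evq s F \<in> I"
  shows "wick F \<in> I"
proof -
  have mv: "mono_val (\<lambda>x. Const (s x)) m = Const (mono_val s m)" for s :: "2 \<times> 2 \<Rightarrow> complex" and m
    by (simp add: mono_val_def Const_simps)
  have "Poly_Mapping.lookup F m \<in> I" if "m \<in> Poly_Mapping.keys F" for m
  proof (rule polynomial_values_in_ideal[OF I finite_keys _ that])
    show "(\<Sum>m\<in>Poly_Mapping.keys F. Const (mono_val s m) * Poly_Mapping.lookup F m) \<in> I" for s
      using F[of s] by (simp add: evq_def evalp_def mv mult.commute)
  qed
  then show ?thesis unfolding wick_def pm_ext_def
    by (intro is_idealD(7)[OF I] is_idealD(3)[OF I])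
qed

text \<open>Entries of det(s) times s^-1 M s, hence polynomial in \<open>s\<close> and meaningful
  also where \<open>s\<close> is singular.\<close>

definition conj_entry :: "(2 \<times> 2 \<Rightarrow> complex) \<Rightarrow> 'i \<times> 2 \<times> 2 \<Rightarrow> 'i mpoly" where
  "conj_entry s = (\<lambda>(l, i, j). ent (adjugate2 (\<chi> i j. Const (s (i, j))) ** gen_mat l ** (\<chi> i j. Const (s (i, j)))) i j)"

definition sdet :: "(2 \<times> 2 \<Rightarrow> complex) \<Rightarrow> complex" where
  "sdet s = s (1, 1) * s (2, 2) - s (1, 2) * s (2, 1)"

lemma evq_qdet: "evq s qdet = Const (sdet s)"
  by (simp add: chain_def qvec_def mat2_one qc_simps evq_simps evq_qvar sdet_def Const_simps mult.commute)

text \<open>The rows of the adjugate of S are the columns of S turned by the symplectic form: entry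
  (1, j) is minus \<omega>(S_2, M S_j) and entry (2, j) is \<omega>(S_1, M S_j).\<close>

lemma conj_entry_chain: "\<exists>F\<in>chain_span UNIV. \<forall>s. evq s F = conj_entry s x"
proof -
  obtain l i j where x: "x = (l, i, j)" by (cases x)
  have g: "word_mat [(l, True)] = gen_mat l" by (simp add: word_mat_Cons)
  have c: "chains [(i, [(l, True)], j)] = chain i (gen_mat l) j" for i j by (simp add: chains_def g[simplified])
  have m: "chain i (gen_mat l) j \<in> chain_span UNIV" "qc (Const (- 1)) * chain i (gen_mat l) j \<in> chain_span UNIV" for i j
    using chain_span_step[OF chain_span_0, of "[(i, [(l, True)], j)]" UNIV 1]
      chain_span_step[OF chain_span_0, of "[(i, [(l, True)], j)]" UNIV "- 1"]
    by (simp_all add: c Const_simps qc_simps)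
  have "i = 1 \<or> i = 2" by (rule exhaust_2)
  then show ?thesis
  proof
    assume i: "i = 1"
    have "evq s (qc (Const (- 1)) * chain 2 (gen_mat l) j) = conj_entry s x" for s
      by (simp add: x i conj_entry_def chain_def qvec_def evq_simps evq_qc evq_qvar mat2_mult Const_simps algebra_simps)
    then show ?thesis using m by blast
  next
    assume i: "i = 2"
    have "evq s (chain 1 (gen_mat l) j) = conj_entry s x" for s
      by (simp add: x i conj_entry_def chain_def qvec_def evq_simps evq_qc evq_qvar mat2_mult Const_simps algebra_simps)
    then show ?thesis using m by blast
  qed
qed

lemma qdet_in_chain_span: "qdet \<in> chain_span UNIV"
  using chain_span_chains[of "[(1, [], 2)]" UNIV] by (simp add: chains_def)

lemma qc_Const_in_chain_span: "qc (Const c) \<in> chain_span UNIV"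
  using chain_span_step[OF chain_span_0, of "[]" UNIV c] by (simp add: chains_def)

lemma qdet_power_in_chain_span: "qdet ^ n \<in> chain_span UNIV"
proof (induction n)
  case 0
  then show ?case using chain_span_chains[of "[]" UNIV] by (simp add: chains_def)
next
  case (Suc n)
  then show ?case by (simp add: chain_span_mult qdet_in_chain_span)
qed

text \<open>Clearing denominators in the polynomial \<open>p (S\<^sup>-\<^sup>1 M S)\<close> of \<open>S\<close> and \<open>1 / det S\<close>.\<close>

lemma conj_polynomial:
  fixes p :: "'i mpoly"
  shows "\<exists>N. \<forall>n\<ge>N. \<exists>F\<in>chain_span UNIV. \<forall>s. sdet s \<noteq> 0 \<longrightarrow>
     evq s F = Const (sdet s) ^ n * msubst (\<lambda>x. Const (1 / sdet s) * conj_entry s x) p"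
proof (induction p rule: mpoly_induct)
  case (Const c)
  have "qc (Const c) * qdet ^ n \<in> chain_span UNIV" for n
    by (intro chain_span_mult qc_Const_in_chain_span qdet_power_in_chain_span)
  moreover have "evq s (qc (Const c) * qdet ^ n) = Const (sdet s) ^ n * msubst v (Const c)" for s n v
    by (simp add: evq_simps evq_qc evq_qdet msubst_evalp evalp_Const[OF ring_hom_map_Const])
  ultimately show ?case by blast
next
  case (Var x)
  obtain F where F: "F \<in> chain_span UNIV" "\<And>s. evq s F = conj_entry s x" using conj_entry_chain by blast
  have "\<exists>F\<in>chain_span UNIV. \<forall>s. sdet s \<noteq> 0 \<longrightarrow>
     evq s F = Const (sdet s) ^ n * msubst (\<lambda>x. Const (1 / sdet s) * conj_entry s x) (Var x)" if "n \<ge> 1" for n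
  proof (intro bexI[of _ "qdet ^ (n - 1) * F"] allI impI chain_span_mult qdet_power_in_chain_span F(1))
    fix s assume s: "sdet s \<noteq> 0"
    have "Const (sdet s) ^ n * Const (1 / sdet s) = (Const (sdet s) ^ (n - 1) :: 'i mpoly)"
      unfolding Const_simps(9)[symmetric] Const_simps(3)[symmetric] using that s by (cases n) auto
    then show "evq s (qdet ^ (n - 1) * F) = Const (sdet s) ^ n * msubst (\<lambda>x. Const (1 / sdet s) * conj_entry s x) (Var x)"
      by (simp add: evq_simps evq_qdet F msubst_evalp evalp_Var[OF ring_hom_map_Const] mult.assoc[symmetric])
  qed
  then show ?case by blast
next
  \<comment> \<open>Quantifying over all large exponents gives \<open>p\<close> and \<open>q\<close>
    a common power of the determinant; for a product the exponent is split as N1 + (n - N1).\<close>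
  case (add p q)
  then obtain N1 N2 where N: "\<forall>n\<ge>N1. \<exists>F\<in>chain_span UNIV. \<forall>s. sdet s \<noteq> 0 \<longrightarrow>
     evq s F = Const (sdet s) ^ n * msubst (\<lambda>x. Const (1 / sdet s) * conj_entry s x) p"
    "\<forall>n\<ge>N2. \<exists>F\<in>chain_span UNIV. \<forall>s. sdet s \<noteq> 0 \<longrightarrow>
     evq s F = Const (sdet s) ^ n * msubst (\<lambda>x. Const (1 / sdet s) * conj_entry s x) q" by blast
  have "\<exists>F\<in>chain_span UNIV. \<forall>s. sdet s \<noteq> 0 \<longrightarrow>
     evq s F = Const (sdet s) ^ n * msubst (\<lambda>x. Const (1 / sdet s) * conj_entry s x) (p + q)" if n: "n \<ge> max N1 N2" for n
  proof -
    obtain F where F: "F \<in> chain_span UNIV" "\<forall>s. sdet s \<noteq> 0 \<longrightarrow>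
     evq s F = Const (sdet s) ^ n * msubst (\<lambda>x. Const (1 / sdet s) * conj_entry s x) p"
      using N(1)[rule_format, of n] n by auto
    obtain G where G: "G \<in> chain_span UNIV" "\<forall>s. sdet s \<noteq> 0 \<longrightarrow>
     evq s G = Const (sdet s) ^ n * msubst (\<lambda>x. Const (1 / sdet s) * conj_entry s x) q"
      using N(2)[rule_format, of n] n by auto
    show ?thesis
      by (rule bexI[OF _ chain_span_add[OF F(1) G(1)]])
        (simp add: evq_simps F(2) G(2) msubst_evalp evalp_add[OF ring_hom_map_Const] distrib_left)
  qed
  then show ?case by blast
next
  case (mult p q)
  then obtain N1 N2 where N: "\<forall>n\<ge>N1. \<exists>F\<in>chain_span UNIV. \<forall>s. sdet s \<noteq> 0 \<longrightarrow>
     evq s F = Const (sdet s) ^ n * msubst (\<lambda>x. Const (1 / sdet s) * conj_entry s x) p"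
    "\<forall>n\<ge>N2. \<exists>F\<in>chain_span UNIV. \<forall>s. sdet s \<noteq> 0 \<longrightarrow>
     evq s F = Const (sdet s) ^ n * msubst (\<lambda>x. Const (1 / sdet s) * conj_entry s x) q" by blast
  have "\<exists>F\<in>chain_span UNIV. \<forall>s. sdet s \<noteq> 0 \<longrightarrow>
     evq s F = Const (sdet s) ^ n * msubst (\<lambda>x. Const (1 / sdet s) * conj_entry s x) (p * q)" if n: "n \<ge> N1 + N2" for n
  proof -
    obtain F where F: "F \<in> chain_span UNIV" "\<forall>s. sdet s \<noteq> 0 \<longrightarrow>
     evq s F = Const (sdet s) ^ N1 * msubst (\<lambda>x. Const (1 / sdet s) * conj_entry s x) p"
      using N(1)[rule_format, of N1] by auto
    have le_diff: "N2 \<le> n - N1" using n by simp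
    obtain G where G: "G \<in> chain_span UNIV" "\<forall>s. sdet s \<noteq> 0 \<longrightarrow>
     evq s G = Const (sdet s) ^ (n - N1) * msubst (\<lambda>x. Const (1 / sdet s) * conj_entry s x) q"
      using N(2)[rule_format, OF le_diff] by auto
    have "(Const (sdet s) ^ n :: 'i mpoly) = Const (sdet s) ^ N1 * Const (sdet s) ^ (n - N1)" for s :: "2 \<times> 2 \<Rightarrow> complex"
      using n by (simp add: power_add[symmetric])
    then show ?thesis
      by (intro bexI[OF _ chain_span_mult[OF F(1) G(1)]])
        (simp add: evq_simps F(2) G(2) msubst_evalp evalp_mult[OF ring_hom_map_Const] mult_ac)
  qed
  then show ?case by blast
qed

lemma matrix_inv_SL2:
  fixes s :: "complex^2^2"
  assumes "det s = 1"
  shows "matrix_inv s = adjugate2 s"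
proof -
  have 1: "s ** adjugate2 s = mat 1" "adjugate2 s ** s = mat 1"
    unfolding mult_adjugate2 assms by (simp_all add: mat_def)
  then have "s ** matrix_inv s = mat 1 \<and> matrix_inv s ** s = mat 1"
    unfolding matrix_inv_def by (intro someI_ex[of "\<lambda>A'. s ** A' = mat 1 \<and> A' ** s = mat 1"]) blast
  then have "adjugate2 s ** (s ** matrix_inv s) = adjugate2 s" by simp
  then show ?thesis unfolding matrix_mul_assoc 1 by simp
qed

text \<open>Conjugation does not see scalars, so an invertible matrix may be divided by a square
  root of its determinant. This carries invariance under determinant 1 over to all \<open>s\<close>
  with nonzero determinant.\<close>

lemma conj_act_scaled:
  assumes s: "sdet s \<noteq> 0" and r: "r * r = sdet s"
  shows "conj_act (\<chi> i j. s (i, j) / r) = (msubst (\<lambda>x. Const (1 / sdet s) * conj_entry s x) :: 'i mpoly \<Rightarrow> 'i mpoly)"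
    and "det ((\<chi> i j. s (i, j) / r) :: complex^2^2) = 1"
proof -
  let ?s = "(\<chi> i j. s (i, j) / r) :: complex^2^2"
  have r0: "r \<noteq> 0" using assms by auto
  have "det ?s = sdet s / (r * r)" using r0 by (simp add: det_2 sdet_def field_simps)
  then show d: "det ?s = 1" using s r by simp
  define k :: "'i mpoly" where "k = Const (1 / r)"
  have rr: "Const (1 / sdet s) = k * k"
    unfolding k_def Const_simps(3)[symmetric] r[symmetric] by simp
  have div: "Const (z / r) = k * Const z" for z
    unfolding k_def Const_simps(3)[symmetric] by simp
  have entry: "(ent ((\<chi> i j. Const (ent (matrix_inv ?s) i j)) ** gen_mat l ** (\<chi> i j. Const (ent ?s i j))) i j :: 'i mpoly)
      = Const (1 / sdet s) * conj_entry s (l, i, j)" for l i j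
  proof -
    have "\<forall>i. (ent ((\<chi> i j. Const (ent (matrix_inv ?s) i j)) ** gen_mat l ** (\<chi> i j. Const (ent ?s i j))) i j :: 'i mpoly)
      = Const (1 / sdet s) * conj_entry s (l, i, j)"
      unfolding forall_2 matrix_inv_SL2[OF d] conj_entry_def rr
      by (simp add: mat2_mult div Const_simps(5) algebra_simps)
    then show ?thesis by blast
  qed
  show "conj_act ?s = (msubst (\<lambda>x. Const (1 / sdet s) * conj_entry s x) :: 'i mpoly \<Rightarrow> 'i mpoly)"
    unfolding conj_act_def
  proof (rule arg_cong[of _ _ msubst], rule ext)
    fix x :: "'i \<times> 2 \<times> 2"
    obtain l i j where x: "x = (l, i, j)" by (cases x)
    show "(case x of (l, i, j) \<Rightarrow> ent ((\<chi> i j. Const (ent (matrix_inv ?s) i j)) ** gen_mat l ** (\<chi> i j. Const (ent ?s i j))) i j)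
        = Const (1 / sdet s) * conj_entry s x"
      unfolding x prod.case by (rule entry)
  qed
qed

text \<open>\<open>wick\<close> plays the part of the Reynolds operator. Since \<open>p\<close> is
  invariant only modulo \<open>I\<close>, \<open>wick_in_ideal\<close> is what keeps the average of
  the difference inside \<open>I\<close>.\<close>

lemma invariant_lift:
  fixes p :: "'i mpoly"
  assumes I: "is_ideal I" and inv: "\<And>s. det s = 1 \<Longrightarrow> conj_act s p - p \<in> I"
  shows "\<exists>q\<in>trace_alg. p - q \<in> I"
proof -
  obtain n F where F: "F \<in> chain_span UNIV" "\<And>s. sdet s \<noteq> 0 \<Longrightarrow>
     evq s F = Const (sdet s) ^ n * msubst (\<lambda>x. Const (1 / sdet s) * conj_entry s x) p"
    using conj_polynomial[of p] by blast
  \<comment> \<open>The additional factor \<open>qdet\<close> makes both terms vanish at singular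
    \<open>s\<close>, where invariance says nothing. Under \<open>wick\<close> the second term
    becomes a nonzero multiple of \<open>p\<close>.\<close>
  define G where "G = qdet * F - qc p * qdet ^ Suc n"
  have "evq s G \<in> I" for s
  proof (cases "sdet s = 0")
    case True
    then show ?thesis using is_idealD(1)[OF I] by (simp add: G_def evq_simps evq_qdet Const_simps)
  next
    case False
    have "csqrt (sdet s) * csqrt (sdet s) = sdet s"
      using power2_csqrt[of "sdet s"] by (simp add: power2_eq_square)
    note c = conj_act_scaled[OF False this]
    have "Const (sdet s) ^ Suc n * (conj_act (\<chi> i j. s (i, j) / csqrt (sdet s)) p - p) \<in> I"
      by (rule is_idealD(3)[OF I inv[OF c(2)]])
    then show ?thesis unfolding c(1)
      by (simp add: G_def evq_simps evq_qdet evq_qc F(2)[OF False] algebra_simps)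
  qed
  then have W: "wick G \<in> I" by (rule wick_in_ideal[OF I])
  have E: "wick G = wick (qdet * F) - Const (fact (Suc (Suc n))) * p"
    unfolding G_def wick_diff wick_qc_mult wick_qdet_power by (simp only: mult.commute)
  have A: "Const (- 1 / fact (Suc (Suc n))) * (wick (qdet * F) - Const (fact (Suc (Suc n))) * p) \<in> I"
    using is_idealD(3)[OF I W] unfolding E .
  have B: "Const (- 1 / fact (Suc (Suc n))) * (wick (qdet * F) - Const (fact (Suc (Suc n))) * p)
      = p - Const (1 / fact (Suc (Suc n))) * wick (qdet * F)"
  proof -
    have "Const (- 1 / fact (Suc (Suc n))) * Const (fact (Suc (Suc n))) = - (1 :: 'i mpoly)"
      unfolding Const_simps(3)[symmetric] by (simp add: Const_simps(1,5) del: fact_Suc)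
    moreover have "Const (- 1 / fact (Suc (Suc n))) = - (Const (1 / fact (Suc (Suc n))) :: 'i mpoly)"
      by (simp add: Const_simps(5)[symmetric] del: fact_Suc)
    ultimately show ?thesis by (simp add: right_diff_distrib mult.assoc[symmetric] del: fact_Suc)
  qed
  have "Const (1 / fact (Suc (Suc n))) * wick (qdet * F) \<in> trace_alg"
    by (intro trace_alg.intros wick_chain_span[of _ UNIV] chain_span_mult qdet_in_chain_span F(1))
  with A[unfolded B] show ?thesis by (rule bexI)
qed

section \<open>Bases of the cotangent space\<close>

context rational_point
begin

definition lspan :: "(nat \<Rightarrow> 'a) \<Rightarrow> nat \<Rightarrow> 'a set" where
  "lspan x D = {a. \<exists>c. a - (\<Sum>i<D. \<kappa> (c i) * x i) \<in> filt m J 2}"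

definition indep :: "(nat \<Rightarrow> 'a) \<Rightarrow> nat \<Rightarrow> bool" where
  "indep x D \<longleftrightarrow> (\<forall>c. (\<Sum>i<D. \<kappa> (c i) * x i) \<in> filt m J 2 \<longrightarrow> (\<forall>i<D. c i = 0))"

lemma filt2: "is_ideal (filt m J 2)" "J \<subseteq> filt m J 2" "filt m J 2 \<subseteq> m"
proof -
  show "is_ideal (filt m J 2)" "J \<subseteq> filt m J 2" by (rule is_ideal_filt filt_superset)+
  have "filt m J 2 \<subseteq> filt m J (Suc 0)" by (rule filt_antimono) simp
  then show "filt m J 2 \<subseteq> m" using filt_1[OF m(1) J(2)] by simp
qed

lemma filt2_mult: "a \<in> m \<Longrightarrow> b \<in> m \<Longrightarrow> a * b \<in> filt m J 2"
  using filt_mult1[of a m b J "Suc 0"] filt_1[OF m(1) J(2)] by (simp add: numeral_2_eq_2 del: filt.simps)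

lemma lspan_filt2: "a \<in> filt m J 2 \<Longrightarrow> a \<in> lspan x D"
  unfolding lspan_def by (intro CollectI exI[of _ "\<lambda>_. 0"]) (simp add: \<kappa>_0)

lemma lspan_add:
  assumes "a \<in> lspan x D" "b \<in> lspan x D"
  shows "a + b \<in> lspan x D"
proof -
  obtain c d where c: "a - (\<Sum>i<D. \<kappa> (c i) * x i) \<in> filt m J 2" and d: "b - (\<Sum>i<D. \<kappa> (d i) * x i) \<in> filt m J 2"
    using assms by (auto simp: lspan_def)
  from is_idealD(2)[OF filt2(1) c d] have "a + b - (\<Sum>i<D. \<kappa> (c i + d i) * x i) \<in> filt m J 2"
    by (simp add: \<kappa>_add algebra_simps sum.distrib)
  then show ?thesis unfolding lspan_def by (intro CollectI exI[of _ "\<lambda>i. c i + d i"])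
qed

lemma lspan_scale:
  assumes "a \<in> lspan x D"
  shows "\<kappa> k * a \<in> lspan x D"
proof -
  obtain c where c: "a - (\<Sum>i<D. \<kappa> (c i) * x i) \<in> filt m J 2" using assms by (auto simp: lspan_def)
  from is_idealD(3)[OF filt2(1) c, of "\<kappa> k"] have "\<kappa> k * a - (\<Sum>i<D. \<kappa> (k * c i) * x i) \<in> filt m J 2"
    by (simp add: \<kappa>_mult right_diff_distrib sum_distrib_left mult.assoc)
  then show ?thesis unfolding lspan_def by (intro CollectI exI[of _ "\<lambda>i. k * c i"])
qed

lemma lspan_uminus: "a \<in> lspan x D \<Longrightarrow> - a \<in> lspan x D"
  using lspan_scale[of a x D "-1"] by (simp add: \<kappa>_uminus \<kappa>_1)

lemma lspan_mono:
  assumes "a \<in> lspan x D" "D \<le> D'" "\<And>i. i < D \<Longrightarrow> x' i = x i"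
  shows "a \<in> lspan x' D'"
proof -
  obtain c where c: "a - (\<Sum>i<D. \<kappa> (c i) * x i) \<in> filt m J 2" using assms by (auto simp: lspan_def)
  have "(\<Sum>i<D'. \<kappa> (if i < D then c i else 0) * x' i) = (\<Sum>i<D. \<kappa> (if i < D then c i else 0) * x' i)"
    using assms(2) by (intro sum.mono_neutral_right) (auto simp: \<kappa>_0)
  also have "\<dots> = (\<Sum>i<D. \<kappa> (c i) * x i)" using assms(3) by (intro sum.cong) auto
  finally show ?thesis using c unfolding lspan_def by (intro CollectI exI[of _ "\<lambda>i. if i < D then c i else 0"]) simp
qed

lemma lspan_basis: "i < D \<Longrightarrow> x i \<in> lspan x D"
proof -
  assume i: "i < D"
  have "(\<Sum>j<D. \<kappa> (if j = i then 1 else 0) * x j) = (\<Sum>j<D. if j = i then x j else 0)"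
    by (intro sum.cong) (auto simp: \<kappa>_0 \<kappa>_1)
  also have "\<dots> = x i" using i by simp
  finally show ?thesis unfolding lspan_def
    by (intro CollectI exI[of _ "\<lambda>j. if j = i then 1 else 0"]) (simp add: is_idealD(1)[OF filt2(1)])
qed

lemma indep_extend:
  assumes "indep x D" "\<And>i. i < D \<Longrightarrow> x i \<in> m" "set zs \<subseteq> m"
  shows "\<exists>x' D'. D \<le> D' \<and> (\<forall>i<D. x' i = x i) \<and> (\<forall>i<D'. x' i \<in> m) \<and> indep x' D' \<and> set zs \<subseteq> lspan x' D'"
  using assms(3)
proof (induction zs)
  case Nil
  then show ?case using assms by (intro exI[of _ x] exI[of _ D]) auto
next
  case (Cons z zs)
  then obtain y K where y: "D \<le> K" "\<forall>i<D. y i = x i" "\<forall>i<K. y i \<in> m" "indep y K" "set zs \<subseteq> lspan y K" by auto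
  show ?case
  proof (cases "z \<in> lspan y K")
    case True
    then show ?thesis using y by (intro exI[of _ y] exI[of _ K]) auto
  next
    case False
    define y' where "y' = y(K := z)"
    have sum: "(\<Sum>i<Suc K. \<kappa> (c i) * y' i) = (\<Sum>i<K. \<kappa> (c i) * y i) + \<kappa> (c K) * z" for c
    proof -
      have "(\<Sum>i<K. \<kappa> (c i) * y' i) = (\<Sum>i<K. \<kappa> (c i) * y i)" by (intro sum.cong) (auto simp: y'_def)
      then show ?thesis by (simp add: y'_def)
    qed
    have "indep y' (Suc K)"
      unfolding indep_def
    proof (intro allI impI)
      fix c i assume c: "(\<Sum>i<Suc K. \<kappa> (c i) * y' i) \<in> filt m J 2" and i: "i < Suc K"
      have cK: "c K = 0"
      proof (rule ccontr)
        assume cK: "c K \<noteq> 0"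
        have "\<kappa> (c K) * z + (\<Sum>i<K. \<kappa> (c i) * y i) \<in> filt m J 2" using c unfolding sum by (simp add: add.commute)
        then have "\<kappa> (c K) * z - (\<Sum>i<K. \<kappa> (- c i) * y i) \<in> filt m J 2"
          by (simp add: \<kappa>_uminus sum_negf)
        then have "\<kappa> (c K) * z \<in> lspan y K" unfolding lspan_def by (intro CollectI exI[of _ "\<lambda>i. - c i"])
        from lspan_scale[OF this, of "1 / c K"] have "z \<in> lspan y K"
          using cK by (simp add: mult.assoc[symmetric] \<kappa>_mult[symmetric] \<kappa>_1)
        then show False using False by blast
      qed
      then have "(\<Sum>i<K. \<kappa> (c i) * y i) \<in> filt m J 2" using c unfolding sum by (simp add: cK \<kappa>_0)
      then show "c i = 0" using y(4) i cK unfolding indep_def by (auto simp: less_Suc_eq)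
    qed
    moreover have "a \<in> lspan y' (Suc K)" if "a \<in> lspan y K" for a
      using lspan_mono[OF that, of "Suc K" y'] by (simp add: y'_def)
    moreover have "z \<in> lspan y' (Suc K)" using lspan_basis[of K "Suc K" y'] by (simp add: y'_def)
    moreover have "\<forall>i<D. y' i = x i" "\<forall>i<Suc K. y' i \<in> m" "D \<le> Suc K"
      using y Cons.prems by (auto simp: y'_def less_Suc_eq)
    ultimately show ?thesis using y(5) by (intro exI[of _ y'] exI[of _ "Suc K"]) auto
  qed
qed

text \<open>Sums of a scalar and an element of \<open>lspan x D\<close> form a subring, because a
  product of two elements of \<open>m\<close> lies in m^2. It contains the scalars and the
  generators, so it is everything.\<close>

lemma spans_of_generators:
  assumes x: "\<And>i. i < D \<Longrightarrow> x i \<in> m" and ys: "\<And>y. y \<in> set ys \<Longrightarrow> \<exists>c. y - \<kappa> c \<in> lspan x D"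
  shows "spans x D"
proof -
  have lm: "a \<in> m" if a: "a \<in> lspan x D" for a
  proof -
    obtain c where c: "a - (\<Sum>i<D. \<kappa> (c i) * x i) \<in> filt m J 2" using a by (auto simp: lspan_def)
    have "(\<Sum>i<D. \<kappa> (c i) * x i) \<in> m" by (intro is_idealD(7)[OF m(1)] is_idealD(3)[OF m(1)] x) auto
    then have "a - (\<Sum>i<D. \<kappa> (c i) * x i) + (\<Sum>i<D. \<kappa> (c i) * x i) \<in> m"
      using c filt2(3) by (intro is_idealD(2)[OF m(1)]) auto
    then show ?thesis by simp
  qed
  let ?T = "{a. \<exists>c. a - \<kappa> c \<in> lspan x D}"
  have z: "0 \<in> lspan x D" by (rule lspan_filt2[OF is_idealD(1)[OF filt2(1)]])
  have T: "subring_of ?T"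
    unfolding subring_of_def
  proof (intro conjI ballI)
    show "0 \<in> ?T" using z by (intro CollectI exI[of _ 0]) (simp add: \<kappa>_0)
    show "1 \<in> ?T" using z by (intro CollectI exI[of _ 1]) (simp add: \<kappa>_1)
    fix a b assume "a \<in> ?T" "b \<in> ?T"
    then obtain c d where c: "a - \<kappa> c \<in> lspan x D" and d: "b - \<kappa> d \<in> lspan x D" by auto
    show "a + b \<in> ?T" using lspan_add[OF c d] by (intro CollectI exI[of _ "c + d"]) (simp add: \<kappa>_add algebra_simps)
    show "a - b \<in> ?T" using lspan_add[OF c lspan_uminus[OF d]]
      by (intro CollectI exI[of _ "c - d"]) (simp add: \<kappa>_diff algebra_simps)
    have "(a - \<kappa> c) * (b - \<kappa> d) \<in> lspan x D" by (intro lspan_filt2 filt2_mult lm c d)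
    from lspan_add[OF lspan_add[OF lspan_scale[OF d, of c] lspan_scale[OF c, of d]] this]
    show "a * b \<in> ?T" by (intro CollectI exI[of _ "c * d"]) (simp add: \<kappa>_mult algebra_simps)
  qed
  have "\<kappa> c \<in> ?T" for c using z by (intro CollectI exI[of _ c]) simp
  then have "range \<kappa> \<subseteq> ?T" by blast
  then have U: "UNIV \<subseteq> ?T" unfolding generated[symmetric] using ys by (intro adjoin_list_least[OF T]) blast+
  have "a \<in> lspan x D" if a: "a \<in> m" for a
  proof -
    obtain c where c: "a - \<kappa> c \<in> lspan x D" using U by blast
    have "a - (a - \<kappa> c) \<in> m" by (rule is_idealD(6)[OF m(1) a lm[OF c]])
    then have "c = 0" using scalar_in_ideal[OF m, of c] by simp
    then show ?thesis using c by (simp add: \<kappa>_0)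
  qed
  then show ?thesis using x by (auto simp: spans_def lspan_def)
qed

lemma indep_extend_basis:
  assumes "indep x D" "\<And>i. i < D \<Longrightarrow> x i \<in> m"
  shows "\<exists>x' D'. D \<le> D' \<and> (\<forall>i<D. x' i = x i) \<and> indep x' D' \<and> spans x' D'"
proof -
  \<comment> \<open>The generators, shifted by scalars into \<open>m\<close>.\<close>
  define zs where "zs = map (\<lambda>y. y - \<kappa> (SOME c. y - \<kappa> c \<in> m)) ys"
  have "set zs \<subseteq> m" using someI_ex[OF residue] by (auto simp: zs_def)
  from indep_extend[OF assms this] obtain x' D' where x': "D \<le> D'" "\<forall>i<D. x' i = x i" "\<forall>i<D'. x' i \<in> m"
    "indep x' D'" "set zs \<subseteq> lspan x' D'" by blast
  have "\<exists>c. y - \<kappa> c \<in> lspan x' D'" if "y \<in> set ys" for y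
  proof -
    have "y - \<kappa> (SOME c. y - \<kappa> c \<in> m) \<in> set zs" using that by (simp add: zs_def)
    then show ?thesis using x'(5) by blast
  qed
  then have "spans x' D'" using x'(3) by (intro spans_of_generators) simp_all
  then show ?thesis using x' by blast
qed

end

section \<open>Dimension and tangent space of the spectrum\<close>

text \<open>A supremum in \<open>enat\<close> that is at least a positive number has a member that
  is. For 0 the empty family would be a counterexample, hence \<open>Suc k\<close>.\<close>

lemma enat_le_SUP:
  fixes f :: "'z \<Rightarrow> nat"
  assumes "enat (Suc k) \<le> (SUP z\<in>A. enat (f z))"
  shows "\<exists>z\<in>A. Suc k \<le> f z"
proof (rule ccontr)
  assume "\<not> ?thesis"
  then have "(SUP z\<in>A. enat (f z)) \<le> enat k" by (intro SUP_least) (auto simp: not_le less_Suc_eq_le)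
  then show False using assms by (meson enat_ord_simps(1) not_less_eq_eq order_trans order_refl)
qed

text \<open>Presents the record \<open>R\<close> as the quotient of a ring type by \<open>J\<close>,
  so that prime ideals of \<open>R\<close> correspond to primes of the type above \<open>J\<close>
  and the preceding theory applies to its spectrum.\<close>

locale spec_point = rational_point \<kappa> ys m J
  for \<kappa> :: "complex \<Rightarrow> 'a::comm_ring_1" and ys :: "'a list" and m J :: "'a set" +
  fixes R :: "(complex, 'b) module" and \<pi> :: "'a \<Rightarrow> 'b"
  assumes R: "cring R" and carrier: "carrier R = range \<pi>"
    and pi_add: "\<pi> (a + b) = \<pi> a \<oplus>\<^bsub>R\<^esub> \<pi> b" and pi_mult: "\<pi> (a * b) = \<pi> a \<otimes>\<^bsub>R\<^esub> \<pi> b"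
    and pi_one: "\<pi> 1 = \<one>\<^bsub>R\<^esub>" and pi_zero: "\<pi> a = \<zero>\<^bsub>R\<^esub> \<longleftrightarrow> a \<in> J"
    and pi_smult: "\<pi> (\<kappa> c * a) = c \<odot>\<^bsub>R\<^esub> \<pi> a"
begin

lemma pi_eq: "\<pi> a = \<pi> b \<longleftrightarrow> a - b \<in> J"
proof -
  interpret R: cring R by (rule R)
  have c: "\<pi> a \<in> carrier R" for a using carrier by auto
  have z: "\<pi> 0 = \<zero>\<^bsub>R\<^esub>" using pi_zero is_idealD(1)[OF J(1)] by blast
  have "\<pi> (a - b) \<oplus>\<^bsub>R\<^esub> \<pi> b = \<pi> a" using pi_add[of "a - b" b] by simp
  then have "\<pi> (a - b) = \<zero>\<^bsub>R\<^esub> \<longleftrightarrow> \<pi> a = \<pi> b" using c by (metis R.l_zero R.add.l_cancel_one' R.add.r_cancel z)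
  then show ?thesis using pi_zero by simp
qed

lemma pi_uminus: "\<pi> (- a) = \<ominus>\<^bsub>R\<^esub> \<pi> a"
proof -
  interpret R: cring R by (rule R)
  have "\<pi> (- a) \<oplus>\<^bsub>R\<^esub> \<pi> a = \<zero>\<^bsub>R\<^esub>" using pi_add[of "- a" a] pi_zero[of 0] is_idealD(1)[OF J(1)] by simp
  then show ?thesis using R.minus_equality carrier by (metis rangeI)
qed

lemma prime_vimage:
  assumes "primeideal Q R"
  shows "is_prime (\<pi> -` Q)" "J \<subseteq> \<pi> -` Q"
proof -
  interpret Q: primeideal Q R by (rule assms)
  have c: "\<pi> a \<in> carrier R" for a using carrier by auto
  show "J \<subseteq> \<pi> -` Q" using pi_zero Q.zero_closed by fastforce
  have "1 \<notin> \<pi> -` Q" using Q.I_notcarr Q.one_imp_carrier by (auto simp: pi_one)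
  moreover have "is_ideal (\<pi> -` Q)"
    unfolding ideal_in_def
    using pi_zero[of 0] is_idealD(1)[OF J(1)] Q.zero_closed Q.I_l_closed c by (auto simp: pi_add pi_mult)
  ultimately show "is_prime (\<pi> -` Q)"
    unfolding is_prime_def using Q.I_prime[OF c c] by (auto simp: pi_mult)
qed

lemma pi_image_mem:
  assumes "is_ideal P" "J \<subseteq> P"
  shows "\<pi> a \<in> \<pi> ` P \<longleftrightarrow> a \<in> P"
proof
  assume "\<pi> a \<in> \<pi> ` P"
  then obtain b where b: "b \<in> P" "\<pi> a = \<pi> b" by auto
  then have "a - b \<in> P" using assms pi_eq by auto
  then show "a \<in> P" using is_idealD(2)[OF assms(1) _ b(1)] by fastforce
qed auto

lemma ideal_image:
  assumes "is_ideal P"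
  shows "ideal (\<pi> ` P) R"
proof (rule idealI)
  interpret R: cring R by (rule R)
  show "ring R" by (rule cring.axioms(1)[OF R])
  show "subgroup (\<pi> ` P) (add_monoid R)"
  proof (rule R.add.subgroupI)
    show "\<pi> ` P \<subseteq> carrier R" using carrier by auto
    show "\<pi> ` P \<noteq> {}" using is_idealD(1)[OF assms] by auto
    show "\<And>a. a \<in> \<pi> ` P \<Longrightarrow> \<ominus>\<^bsub>R\<^esub> a \<in> \<pi> ` P" using is_idealD(5)[OF assms] by (auto simp: pi_uminus[symmetric])
    show "\<And>a b. a \<in> \<pi> ` P \<Longrightarrow> b \<in> \<pi> ` P \<Longrightarrow> a \<oplus>\<^bsub>R\<^esub> b \<in> \<pi> ` P"
      using is_idealD(2)[OF assms] by (auto simp: pi_add[symmetric])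
  qed
  show "\<And>a r. a \<in> \<pi> ` P \<Longrightarrow> r \<in> carrier R \<Longrightarrow> r \<otimes>\<^bsub>R\<^esub> a \<in> \<pi> ` P"
    "\<And>a r. a \<in> \<pi> ` P \<Longrightarrow> r \<in> carrier R \<Longrightarrow> a \<otimes>\<^bsub>R\<^esub> r \<in> \<pi> ` P"
    using is_idealD(3,4)[OF assms] by (auto simp: carrier pi_mult[symmetric])
qed

lemma prime_image:
  assumes P: "is_prime P" "J \<subseteq> P"
  shows "primeideal (\<pi> ` P) R"
proof (rule primeidealI[OF ideal_image[OF is_primeD(1)[OF P(1)]] R])
  note mem = pi_image_mem[OF is_primeD(1)[OF P(1)] P(2)]
  have "\<pi> 1 \<notin> \<pi> ` P" using mem is_primeD(2)[OF P(1)] by blast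
  then show "carrier R \<noteq> \<pi> ` P" using carrier by auto
  fix a b assume "a \<in> carrier R" "b \<in> carrier R" and ab: "a \<otimes>\<^bsub>R\<^esub> b \<in> \<pi> ` P"
  then obtain a' b' where a': "a = \<pi> a'" "b = \<pi> b'" by (auto simp: carrier)
  then have "a' * b' \<in> P" using ab mem[of "a' * b'"] by (simp add: pi_mult)
  then show "a \<in> \<pi> ` P \<or> b \<in> \<pi> ` P" using is_primeD(3)[OF P(1), of a' b'] by (auto simp: a')
qed

abbreviation T where "T \<equiv> spec_topology R"

definition basic :: "'a \<Rightarrow> 'b set set" where
  "basic f = {Q. primeideal Q R \<and> \<pi> f \<notin> Q}"

lemma openin_basic: "openin T (basic f)"
  unfolding spec_topology_def basic_def by (rule topology_generated_by_Basis) (use carrier in auto)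

lemma topspace_T: "topspace T = {Q. primeideal Q R}"
proof -
  have "Q \<in> basic 1" if "primeideal Q R" for Q
    using prime_vimage(1)[OF that] that by (auto simp: basic_def dest: is_primeD)
  then show ?thesis
    unfolding spec_topology_def topology_generated_by_topspace using carrier by (auto simp: basic_def)
qed

lemma openin_basicE:
  assumes "openin T S" "Q \<in> S"
  shows "\<exists>f. Q \<in> basic f \<and> basic f \<subseteq> S"
proof -
  have "generate_topology_on {{P. primeideal P R \<and> f \<notin> P} | f. f \<in> carrier R} S"
    using assms(1) by (simp add: spec_topology_def openin_topology_generated_by_iff)
  then show ?thesis using assms(2)
  proof (induction S)
    case (Int S S')
    then obtain f g where f: "Q \<in> basic f" "basic f \<subseteq> S" and g: "Q \<in> basic g" "basic g \<subseteq> S'" by blast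
    have Q: "primeideal Q R" using f by (simp add: basic_def)
    have "basic (f * g) \<subseteq> basic f \<inter> basic g"
    proof
      fix P assume "P \<in> basic (f * g)"
      then have P: "primeideal P R" "f * g \<notin> \<pi> -` P" by (auto simp: basic_def)
      note id = is_primeD(1)[OF prime_vimage(1)[OF P(1)]]
      show "P \<in> basic f \<inter> basic g"
        using P is_idealD(3)[OF id, of g f] is_idealD(4)[OF id, of f g] by (auto simp: basic_def)
    qed
    moreover have "Q \<in> basic (f * g)"
      using f(1) g(1) Q is_primeD(3)[OF prime_vimage(1)[OF Q], of f g] by (auto simp: basic_def)
    ultimately show ?case using f g by blast
  next
    case (Basis S)
    then obtain f where "S = basic f" using carrier by (auto simp: basic_def)
    then show ?case using Basis by blast
  qed blast+
qed

definition vanishing :: "'b set set \<Rightarrow> 'a set" where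
  "vanishing Z = {a. \<forall>Q\<in>Z. \<pi> a \<in> Q}"

lemma closed_vanishing:
  assumes Z: "closedin (subtopology T (basic g)) Z" and Q: "Q \<in> basic g" "vanishing Z \<subseteq> \<pi> -` Q"
  shows "Q \<in> Z"
proof (rule ccontr)
  assume QZ: "Q \<notin> Z"
  have ts: "topspace (subtopology T (basic g)) = basic g"
    unfolding topspace_subtopology topspace_T by (auto simp: basic_def)
  have "openin (subtopology T (basic g)) (basic g - Z)" using Z ts by (auto simp: closedin_def)
  then obtain S where S: "openin T S" "basic g - Z = S \<inter> basic g" by (auto simp: openin_subtopology)
  then have "Q \<in> S" using Q QZ by blast
  then obtain f where f: "Q \<in> basic f" "basic f \<subseteq> S" using openin_basicE S by blast
  have Zg: "Z \<subseteq> basic g" using closedin_subset[OF Z] ts by simp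
  have "\<pi> f \<in> Q'" if Q': "Q' \<in> Z" for Q'
  proof (rule ccontr)
    assume "\<pi> f \<notin> Q'"
    then have "Q' \<in> basic f" using Q' Zg by (auto simp: basic_def)
    then show False using f S Q' Zg by blast
  qed
  then have "\<pi> f \<in> Q" using Q(2) by (auto simp: vanishing_def)
  then show False using f by (simp add: basic_def)
qed

text \<open>If a b vanishes on \<open>Z\<close>, the loci in \<open>Z\<close> where a and where b
  vanish are closed and cover \<open>Z\<close>, so irreducibility makes one of them all of
  \<open>Z\<close>.\<close>

lemma vanishing_prime:
  assumes Z: "irreducible_closedin (subtopology T (basic g)) Z"
  shows "is_prime (vanishing Z)" "J \<subseteq> vanishing Z" "g \<notin> vanishing Z"
proof -
  have cl: "closedin (subtopology T (basic g)) Z" and ne: "Z \<noteq> {}"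
    using Z by (auto simp: irreducible_closedin_def)
  have "topspace (subtopology T (basic g)) = basic g"
    unfolding topspace_subtopology topspace_T by (auto simp: basic_def)
  then have Zg: "Z \<subseteq> basic g" using closedin_subset[OF cl] by simp
  have prZ: "primeideal Q R" if "Q \<in> Z" for Q using that Zg by (auto simp: basic_def)
  note pr = prime_vimage[OF prZ]
  have eq: "vanishing Z = (\<Inter>Q\<in>Z. \<pi> -` Q)" by (auto simp: vanishing_def)
  show "J \<subseteq> vanishing Z" unfolding eq using pr(2) by blast
  show "g \<notin> vanishing Z" using ne Zg by (auto simp: vanishing_def basic_def)
  have sub: "closedin (subtopology T (basic g)) {Q \<in> Z. \<pi> a \<in> Q}" for a
  proof -
    obtain C where C: "closedin T C" "Z = C \<inter> basic g" using cl by (auto simp: closedin_subtopology)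
    have "closedin T (topspace T - basic a)" using openin_basic by (simp add: closedin_diff)
    then have "closedin T (C \<inter> (topspace T - basic a))" using C by (intro closedin_Int)
    moreover have "{Q \<in> Z. \<pi> a \<in> Q} = (C \<inter> (topspace T - basic a)) \<inter> basic g"
      using C by (auto simp: topspace_T basic_def)
    ultimately show ?thesis by (auto simp: closedin_subtopology)
  qed
  show "is_prime (vanishing Z)"
    unfolding is_prime_def
  proof (intro conjI allI impI)
    show "is_ideal (vanishing Z)"
      unfolding eq ideal_in_def
    proof (intro conjI ballI INT_I)
      fix Q assume "Q \<in> Z"
      then have id: "is_ideal (\<pi> -` Q)" by (rule is_primeD(1)[OF pr(1)])
      show "0 \<in> \<pi> -` Q" by (rule is_idealD(1)[OF id])
      show "a + b \<in> \<pi> -` Q" if "a \<in> (\<Inter>Q\<in>Z. \<pi> -` Q)" "b \<in> (\<Inter>Q\<in>Z. \<pi> -` Q)" for a b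
        using that \<open>Q \<in> Z\<close> by (intro is_idealD(2)[OF id]) auto
      show "r * a \<in> \<pi> -` Q" if "a \<in> (\<Inter>Q\<in>Z. \<pi> -` Q)" for r a
        using that \<open>Q \<in> Z\<close> by (intro is_idealD(3)[OF id]) auto
    qed simp
    obtain Q0 where Q0: "Q0 \<in> Z" using ne by blast
    show "1 \<notin> vanishing Z" using is_primeD(2)[OF pr(1)[OF Q0]] Q0 by (auto simp: vanishing_def)
    fix a b assume ab: "a * b \<in> vanishing Z"
    have "\<pi> a \<in> Q \<or> \<pi> b \<in> Q" if "Q \<in> Z" for Q
      using is_primeD(3)[OF pr(1)[OF that], of a b] ab that by (auto simp: vanishing_def)
    then have "Z = {Q \<in> Z. \<pi> a \<in> Q} \<union> {Q \<in> Z. \<pi> b \<in> Q}" by blast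
    then have "Z = {Q \<in> Z. \<pi> a \<in> Q} \<or> Z = {Q \<in> Z. \<pi> b \<in> Q}"
      using Z sub unfolding irreducible_closedin_def by blast
    then show "a \<in> vanishing Z \<or> b \<in> vanishing Z" by (auto simp: vanishing_def)
  qed
qed

text \<open>The neighbourhood of \<open>exists_generizing_element\<close> bounds the local dimension
  from above by its own dimension, so it contains a long chain of irreducible closed sets, and the
  bottom prime of the corresponding chain can be moved below \<open>m\<close>.\<close>

lemma local_dim_chain:
  assumes "enat (Suc k) \<le> local_dim T (\<pi> ` m)"
  shows "\<exists>p. chain_at p (Suc k)"
proof -
  from exists_generizing_element[OF noetherian_UNIV J(1) is_prime_m]
  obtain g where g: "g \<notin> m" and
    gen: "\<forall>Q. is_prime Q \<and> J \<subseteq> Q \<and> g \<notin> Q \<longrightarrow> (\<exists>P. is_prime P \<and> J \<subseteq> P \<and> P \<subseteq> Q \<and> P \<subseteq> m)"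
    by (elim exE conjE)
  have "\<pi> ` m \<in> basic g"
    using prime_image[OF is_prime_m J(2)] pi_image_mem[OF m(1) J(2)] g by (auto simp: basic_def)
  then have "local_dim T (\<pi> ` m) \<le> krull_dim (subtopology T (basic g))"
    unfolding local_dim_def using openin_basic by (intro INF_lower) auto
  then have "enat (Suc k) \<le> krull_dim (subtopology T (basic g))" using assms by (rule order_trans[rotated])
  then obtain Zs where Z0: "Zs \<in> {Zs. Zs \<noteq> [] \<and> sorted_wrt (\<subset>) Zs \<and>
       (\<forall>Z\<in>set Zs. irreducible_closedin (subtopology T (basic g)) Z)}" and Zk: "Suc k \<le> length Zs - 1"
    unfolding krull_dim_def by (rule bexE[OF enat_le_SUP])
  have Zs: "sorted_wrt (\<subset>) Zs" "\<And>Z. Z \<in> set Zs \<Longrightarrow> irreducible_closedin (subtopology T (basic g)) Z"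
    "Suc k \<le> length Zs - 1" using Z0 Zk by simp_all
  define n where "n = length Zs - 1"
  \<comment> \<open>Larger closed sets have smaller ideals, so the list is read backwards.\<close>
  define q where "q i = vanishing (Zs ! (n - i))" for i
  have irr: "irreducible_closedin (subtopology T (basic g)) (Zs ! (n - i))" if "i \<le> n" for i
    using Zs(2,3) by (intro Zs(2) nth_mem) (auto simp: n_def)
  have q: "is_prime (q i)" "J \<subseteq> q i" "g \<notin> q i" if "i \<le> n" for i
    using vanishing_prime[OF irr[OF that]] by (auto simp: q_def)
  have mono: "q i \<subset> q (Suc i)" if i: "Suc i \<le> n" for i
  proof -
    have lt: "Zs ! (n - Suc i) \<subset> Zs ! (n - i)"
      using i Zs(3) by (intro sorted_wrt_nth_less[OF Zs(1)]) (auto simp: n_def)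
    then have sub: "q i \<subseteq> q (Suc i)" by (auto simp: q_def vanishing_def)
    obtain Q where Q: "Q \<in> Zs ! (n - i)" "Q \<notin> Zs ! (n - Suc i)" using lt by blast
    have cl: "closedin (subtopology T (basic g)) (Zs ! (n - j))" if "j \<le> n" for j
      using irr[OF that] by (simp add: irreducible_closedin_def)
    have "Q \<in> basic g"
      using closedin_subset[OF cl[of i]] Q(1) i unfolding topspace_subtopology by auto
    then have "\<not> vanishing (Zs ! (n - Suc i)) \<subseteq> \<pi> -` Q" using closed_vanishing[OF cl] Q(2) i by blast
    moreover have "vanishing (Zs ! (n - i)) \<subseteq> \<pi> -` Q" using Q(1) by (auto simp: vanishing_def)
    ultimately show ?thesis using sub by (auto simp: q_def)
  qed
  obtain P where P: "is_prime P" "J \<subseteq> P" "P \<subseteq> q 0" "P \<subseteq> m"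
    using gen[rule_format, of "q 0"] q[of 0] by auto
  \<comment> \<open>Only the bottom prime is replaced: \<open>q 0\<close> may fail to lie in
    \<open>m\<close>, but \<open>P\<close> lies in \<open>m\<close> and below \<open>q 0\<close>, so
    the inclusions stay strict.\<close>
  define p where "p i = (if i = 0 then P else q i)" for i
  have kn: "Suc k \<le> n" using Zs(3) by (simp add: n_def)
  have "p i \<subset> p (Suc i)" if "i < Suc k" for i
    using mono[of i] P(3) kn that by (cases "i = 0") (auto simp: p_def)
  moreover have "is_prime (p i)" if "i \<le> Suc k" for i using q(1)[of i] P(1) kn that by (simp add: p_def)
  ultimately have "chain_at p (Suc k)" using P by (auto simp: chain_at_def p_def)
  then show ?thesis by blast
qed

lemma local_dim_le:
  assumes "spans x D"
  shows "local_dim T (\<pi> ` m) \<le> enat D"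
proof (rule ccontr)
  assume "\<not> ?thesis"
  then have "enat (Suc D) \<le> local_dim T (\<pi> ` m)" using ileI1[of "enat D"] by (simp add: eSuc_enat not_le)
  then show False using local_dim_chain chain_length_le[OF _ assms] by fastforce
qed

text \<open>In any neighbourhood of the point, the closed point itself and the closure of
  \<open>P\<close> form a chain with one step, since open sets are stable under passing to smaller
  primes.\<close>

lemma local_dim_ge_1:
  assumes P: "is_prime P" "J \<subseteq> P" "P \<subset> m"
  shows "1 \<le> local_dim T (\<pi> ` m)"
  unfolding local_dim_def
proof (rule INF_greatest)
  fix U assume "U \<in> {U. openin T U \<and> \<pi> ` m \<in> U}"
  then have U: "openin T U" "\<pi> ` m \<in> U" by auto
  let ?S = "subtopology T U" and ?M = "\<pi> ` m" and ?P = "\<pi> ` P"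
  have pr: "primeideal ?M R" "primeideal ?P R" using prime_image P is_prime_m J(2) by auto
  have UT: "U \<subseteq> topspace T" using U openin_subset by blast
  note memP = pi_image_mem[OF is_primeD(1)[OF P(1)] P(2)]
  obtain f where f: "?M \<in> basic f" "basic f \<subseteq> U" using openin_basicE U by blast
  have PU: "?P \<in> U" using f pr P(3) by (auto simp: basic_def)
  have ts: "topspace ?S = U" using UT by (auto simp: topspace_subtopology)
  have gen: "?P \<in> S" if S: "openin T S" "Q \<in> S" "?P \<subseteq> Q" for S Q
  proof -
    obtain f where f: "Q \<in> basic f" "basic f \<subseteq> S" using openin_basicE[OF S(1,2)] by blast
    have "\<pi> f \<notin> ?P" using f(1) S(3) unfolding basic_def by blast
    then have "?P \<in> basic f" using pr(2) by (simp add: basic_def)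
    then show ?thesis using f(2) by blast
  qed
  have c1: "closedin ?S {?M}"
  proof -
    have "openin T (topspace T - {?M})"
    proof (subst openin_subopen, intro ballI)
      fix Q assume "Q \<in> topspace T - {?M}"
      then have Q: "primeideal Q R" "Q \<noteq> ?M" by (auto simp: topspace_T)
      have "\<not> \<pi> -` Q \<subseteq> m \<or> \<not> m \<subseteq> \<pi> -` Q"
      proof (rule ccontr)
        assume "\<not> ?thesis"
        then have "\<pi> -` Q = m" by blast
        moreover have "Q \<subseteq> range \<pi>" using primeideal.axioms(1)[OF Q(1)] carrier ideal.Icarr by fastforce
        ultimately have "Q = ?M" by blast
        then show False using Q by blast
      qed
      moreover have "m \<subseteq> \<pi> -` Q \<Longrightarrow> \<pi> -` Q \<subseteq> m"
      proof
        fix a assume mQ: "m \<subseteq> \<pi> -` Q" and a: "a \<in> \<pi> -` Q"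
        note id = is_primeD[OF prime_vimage(1)[OF Q(1)]]
        show "a \<in> m"
        proof (rule ccontr)
          assume "a \<notin> m"
          then obtain b where "1 - a * b \<in> m" using unit_mod_m by blast
          then have "1 - a * b \<in> \<pi> -` Q" using mQ by blast
          from is_idealD(2)[OF id(1) this is_idealD(4)[OF id(1) a, of b]] show False using id(2) by simp
        qed
      qed
      ultimately obtain a where a: "a \<in> m" "\<pi> a \<notin> Q" by blast
      then have "Q \<in> basic a" "?M \<notin> basic a" using Q by (auto simp: basic_def)
      then show "\<exists>S. openin T S \<and> Q \<in> S \<and> S \<subseteq> topspace T - {?M}"
        using openin_basic[of a] openin_subset[OF openin_basic[of a]] by blast
    qed
    then have "closedin T {?M}" using pr by (auto simp: closedin_def topspace_T)
    moreover have "{?M} = {?M} \<inter> U" using U by blast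
    ultimately show ?thesis unfolding closedin_subtopology by blast
  qed
  then have irr1: "irreducible_closedin ?S {?M}" unfolding irreducible_closedin_def by blast
  let ?Z = "{Q \<in> U. ?P \<subseteq> Q}"
  have "closedin T {Q \<in> topspace T. ?P \<subseteq> Q}"
  proof -
    have "topspace T - {Q \<in> topspace T. ?P \<subseteq> Q} = (\<Union>a\<in>P. basic a)" by (auto simp: topspace_T basic_def)
    then show ?thesis using openin_basic by (auto simp: closedin_def intro!: openin_Union)
  qed
  moreover have "?Z = {Q \<in> topspace T. ?P \<subseteq> Q} \<inter> U" using UT by auto
  ultimately have c2: "closedin ?S ?Z" unfolding closedin_subtopology by blast
  have H: "?Z = A \<or> ?Z = B" if AB: "closedin ?S A" "closedin ?S B" "?Z = A \<union> B" for A B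
  proof -
    have "?Z \<subseteq> A" if A: "closedin ?S A" "?P \<in> A" for A
    proof (rule ccontr)
      assume "\<not> ?Z \<subseteq> A"
      then obtain Q where Q: "Q \<in> U" "?P \<subseteq> Q" "Q \<notin> A" by blast
      obtain S where S: "openin T S" "U - A = S \<inter> U" using A ts by (auto simp: closedin_def openin_subtopology)
      then have "?P \<in> S" using gen[of S Q] Q by blast
      then show False using S A PU by blast
    qed
    note ZA = this
    have "?P \<in> ?Z" using PU by simp
    then have "?P \<in> A \<or> ?P \<in> B" unfolding AB(3) by simp
    moreover have "A \<subseteq> ?Z" "B \<subseteq> ?Z" unfolding AB(3) by simp_all
    ultimately show ?thesis using ZA[OF AB(1)] ZA[OF AB(2)] by (metis subset_antisym)
  qed
  have irr2: "irreducible_closedin ?S ?Z"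
    unfolding irreducible_closedin_def
  proof (intro conjI allI impI)
    show "closedin ?S ?Z" by (rule c2)
    show "?Z \<noteq> {}" using PU by auto
    show "?Z = A \<or> ?Z = B" if "closedin ?S A" "closedin ?S B" "?Z = A \<union> B" for A B
      using that by (rule H)
  qed
  have "{?M} \<subset> ?Z"
  proof -
    obtain a where a: "a \<in> m" "a \<notin> P" using P(3) by blast
    have ne: "?P \<noteq> ?M"
    proof
      assume "?P = ?M"
      then have "\<pi> a \<in> ?P" using a(1) by simp
      then show False using memP[of a] a(2) by simp
    qed
    have "?P \<subseteq> ?M" by (rule image_mono[OF psubset_imp_subset[OF P(3)]])
    then have MZ: "?M \<in> ?Z" using U(2) by simp
    have PZ: "?P \<in> ?Z" using PU by simp
    show ?thesis
    proof (rule psubsetI)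
      show "{?M} \<subseteq> ?Z" using MZ by (intro subsetI) simp
      show "{?M} \<noteq> ?Z"
      proof
        assume "{?M} = ?Z"
        then have "?P \<in> {?M}" using PZ by simp
        then show False using ne by simp
      qed
    qed
  qed
  then have "[{?M}, ?Z] \<in> {Zs. Zs \<noteq> [] \<and> sorted_wrt (\<subset>) Zs \<and> (\<forall>Z\<in>set Zs. irreducible_closedin ?S Z)}"
    using irr1 irr2 by simp
  then have "enat (length [{?M}, ?Z] - 1) \<le> krull_dim ?S" unfolding krull_dim_def by (rule SUP_upper)
  then show "1 \<le> krull_dim ?S" by (simp add: one_enat_def)
qed

section \<open>Cotangent and tangent space of the spectrum\<close>

definition W where "W = \<pi> ` filt m J 2"

lemma ideal_prod_eq: "(\<pi> ` m) \<cdot>\<^bsub>R\<^esub> (\<pi> ` m) = W"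
proof
  show "(\<pi> ` m) \<cdot>\<^bsub>R\<^esub> (\<pi> ` m) \<subseteq> W"
  proof
    fix a assume "a \<in> (\<pi> ` m) \<cdot>\<^bsub>R\<^esub> (\<pi> ` m)"
    then show "a \<in> W"
    proof (induction a rule: ideal_prod.induct)
      case (prod i j)
      then show ?case using filt2_mult unfolding W_def by (auto simp: pi_mult[symmetric])
    next
      case (sum s1 s2)
      then show ?case using is_idealD(2)[OF filt2(1)] unfolding W_def by (auto simp: pi_add[symmetric])
    qed
  qed
  let ?K = "{a. \<pi> a \<in> (\<pi> ` m) \<cdot>\<^bsub>R\<^esub> (\<pi> ` m)}"
  have "filt m J 2 \<subseteq> ?K"
  proof (rule filt_2_least)
    have z: "\<pi> a \<in> (\<pi> ` m) \<cdot>\<^bsub>R\<^esub> (\<pi> ` m)" if "a \<in> J" for a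
    proof -
      have "\<pi> (0 * 0) \<in> (\<pi> ` m) \<cdot>\<^bsub>R\<^esub> (\<pi> ` m)"
        unfolding pi_mult using is_idealD(1)[OF m(1)] by (intro ideal_prod.prod) auto
      moreover have "\<pi> a = \<pi> (0 * 0)" using that pi_eq by simp
      ultimately show ?thesis by simp
    qed
    \<comment> \<open>An element of the ideal product comes without a distinguished preimage, so one
      is built along with its construction as a sum of products.\<close>
    have mult: "b \<in> (\<pi> ` m) \<cdot>\<^bsub>R\<^esub> (\<pi> ` m) \<Longrightarrow> \<exists>a. b = \<pi> a \<and> \<pi> (r * a) \<in> (\<pi> ` m) \<cdot>\<^bsub>R\<^esub> (\<pi> ` m)" for b r
    proof (induction b rule: ideal_prod.induct)
      case (prod i j)
      then obtain u v where "u \<in> m" "v \<in> m" "i = \<pi> u" "j = \<pi> v" by auto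
      note uv = this
      have "\<pi> (r * u) \<otimes>\<^bsub>R\<^esub> \<pi> v \<in> (\<pi> ` m) \<cdot>\<^bsub>R\<^esub> (\<pi> ` m)"
        using is_idealD(3)[OF m(1) uv(1), of r] uv(2) by (intro ideal_prod.prod) auto
      then have "\<pi> (r * (u * v)) \<in> (\<pi> ` m) \<cdot>\<^bsub>R\<^esub> (\<pi> ` m)" by (simp only: pi_mult[symmetric] mult.assoc)
      moreover have "i \<otimes>\<^bsub>R\<^esub> j = \<pi> (u * v)" by (simp add: uv pi_mult)
      ultimately show ?case by blast
    next
      case (sum s t)
      then obtain u v where "s = \<pi> u" "\<pi> (r * u) \<in> (\<pi> ` m) \<cdot>\<^bsub>R\<^esub> (\<pi> ` m)"
        "t = \<pi> v" "\<pi> (r * v) \<in> (\<pi> ` m) \<cdot>\<^bsub>R\<^esub> (\<pi> ` m)" by auto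
      note uv = this
      have "\<pi> (r * (u + v)) \<in> (\<pi> ` m) \<cdot>\<^bsub>R\<^esub> (\<pi> ` m)"
        unfolding distrib_left pi_add by (rule ideal_prod.sum[OF uv(2,4)])
      moreover have "s \<oplus>\<^bsub>R\<^esub> t = \<pi> (u + v)" by (simp add: uv pi_add)
      ultimately show ?case by blast
    qed
    show "is_ideal ?K"
      unfolding ideal_in_def
    proof (intro conjI ballI)
      show "0 \<in> ?K" using z[OF is_idealD(1)[OF J(1)]] by simp
      show "a + b \<in> ?K" if "a \<in> ?K" "b \<in> ?K" for a b using that by (auto simp: pi_add intro: ideal_prod.sum)
      show "r * b \<in> ?K" if b: "b \<in> ?K" for r b
      proof -
        obtain a where a: "\<pi> b = \<pi> a" "\<pi> (r * a) \<in> (\<pi> ` m) \<cdot>\<^bsub>R\<^esub> (\<pi> ` m)" using mult[of "\<pi> b" r] b by auto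
        then show ?thesis by (simp add: pi_mult)
      qed
    qed simp
    show "J \<subseteq> ?K" using z by blast
    show "a * b \<in> ?K" if "a \<in> m" "b \<in> m" for a b using that by (auto simp: pi_mult intro: ideal_prod.prod)
  qed (use m J in auto)
  then show "W \<subseteq> (\<pi> ` m) \<cdot>\<^bsub>R\<^esub> (\<pi> ` m)" unfolding W_def by blast
qed

definition coset :: "'a \<Rightarrow> 'b set" where "coset a = \<pi> ` {b. b - a \<in> filt m J 2}"

lemma coset_eq: "coset a = coset b \<longleftrightarrow> a - b \<in> filt m J 2"
proof
  assume "coset a = coset b"
  then have "\<pi> a \<in> coset b" using is_idealD(1)[OF filt2(1)] unfolding coset_def by force
  then obtain c where "\<pi> a = \<pi> c" "c - b \<in> filt m J 2" by (auto simp: coset_def)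
  then have "(a - c) + (c - b) \<in> filt m J 2" using pi_eq filt2(2) by (intro is_idealD(2)[OF filt2(1)]) auto
  then show "a - b \<in> filt m J 2" by simp
next
  assume ab: "a - b \<in> filt m J 2"
  have "c - a \<in> filt m J 2 \<longleftrightarrow> c - b \<in> filt m J 2" for c
    using is_idealD(2)[OF filt2(1) _ ab, of "c - a"] is_idealD(6)[OF filt2(1) _ ab, of "c - b"] by auto
  then show "coset a = coset b" by (simp add: coset_def)
qed

abbreviation cot where "cot \<equiv> cotangent_space R (\<pi> ` m)"

lemma cot_simps:
  "carrier cot = coset ` m"
  "coset a \<oplus>\<^bsub>cot\<^esub> coset b = coset (a + b)"
  "c \<odot>\<^bsub>cot\<^esub> coset a = coset (\<kappa> c * a)"
proof -
  have cs: "W +>\<^bsub>R\<lparr>carrier := \<pi> ` m\<rparr>\<^esub> \<pi> a = coset a" for a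
  proof -
    have "W +>\<^bsub>R\<lparr>carrier := \<pi> ` m\<rparr>\<^esub> \<pi> a = (\<lambda>w. \<pi> (w + a)) ` filt m J 2"
      by (auto simp: a_r_coset_def r_coset_def W_def pi_add)
    also have "\<dots> = coset a"
    proof
      show "(\<lambda>w. \<pi> (w + a)) ` filt m J 2 \<subseteq> coset a" by (auto simp: coset_def)
      show "coset a \<subseteq> (\<lambda>w. \<pi> (w + a)) ` filt m J 2"
      proof
        fix z assume "z \<in> coset a"
        then obtain b where "z = \<pi> b" "b - a \<in> filt m J 2" by (auto simp: coset_def)
        then show "z \<in> (\<lambda>w. \<pi> (w + a)) ` filt m J 2" by (intro image_eqI[of _ _ "b - a"]) auto
      qed
    qed
    finally show ?thesis .
  qed
  show "carrier cot = coset ` m"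
  proof -
    have "carrier cot = a_rcosets\<^bsub>R\<lparr>carrier := \<pi> ` m\<rparr>\<^esub> W"
      by (simp add: cotangent_space_def quot_mod_def ring.defs module.defs ideal_prod_eq FactRing_def)
    also have "\<dots> = (\<Union>y\<in>\<pi> ` m. {W +>\<^bsub>R\<lparr>carrier := \<pi> ` m\<rparr>\<^esub> y})" by (simp add: A_RCOSETS_def')
    also have "\<dots> = coset ` m" by (auto simp: cs)
    finally show ?thesis .
  qed
  show "coset a \<oplus>\<^bsub>cot\<^esub> coset b = coset (a + b)"
  proof -
    have "coset a \<oplus>\<^bsub>cot\<^esub> coset b = {x \<oplus>\<^bsub>R\<^esub> y | x y. x \<in> coset a \<and> y \<in> coset b}"
      by (auto simp: cotangent_space_def quot_mod_def ring.defs module.defs FactRing_def set_add_def set_mult_def)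
    also have "\<dots> = coset (a + b)"
    proof
      show "{x \<oplus>\<^bsub>R\<^esub> y | x y. x \<in> coset a \<and> y \<in> coset b} \<subseteq> coset (a + b)"
      proof
        fix z assume "z \<in> {x \<oplus>\<^bsub>R\<^esub> y | x y. x \<in> coset a \<and> y \<in> coset b}"
        then obtain u v where "z = \<pi> u \<oplus>\<^bsub>R\<^esub> \<pi> v" "u - a \<in> filt m J 2" "v - b \<in> filt m J 2" by (auto simp: coset_def)
        then show "z \<in> coset (a + b)" using is_idealD(2)[OF filt2(1), of "u - a" "v - b"]
          unfolding coset_def by (intro image_eqI[of _ _ "u + v"]) (auto simp: pi_add algebra_simps)
      qed
      show "coset (a + b) \<subseteq> {x \<oplus>\<^bsub>R\<^esub> y | x y. x \<in> coset a \<and> y \<in> coset b}"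
      proof
        fix z assume "z \<in> coset (a + b)"
        then obtain u where u: "z = \<pi> u" "u - (a + b) \<in> filt m J 2" by (auto simp: coset_def)
        have "z = \<pi> (u - b) \<oplus>\<^bsub>R\<^esub> \<pi> b" using pi_add[of "u - b" b] u by simp
        moreover have "\<pi> (u - b) \<in> coset a" "\<pi> b \<in> coset b"
          unfolding coset_def using u is_idealD(1)[OF filt2(1)] by (auto simp: algebra_simps intro!: imageI)
        ultimately show "z \<in> {x \<oplus>\<^bsub>R\<^esub> y | x y. x \<in> coset a \<and> y \<in> coset b}" by blast
      qed
    qed
    finally show ?thesis .
  qed
  show "c \<odot>\<^bsub>cot\<^esub> coset a = coset (\<kappa> c * a)"
  proof -
    have "c \<odot>\<^bsub>cot\<^esub> coset a = (\<Union>x\<in>coset a. W +>\<^bsub>R\<lparr>carrier := \<pi> ` m\<rparr>\<^esub> (c \<odot>\<^bsub>R\<^esub> x))"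
      by (simp add: cotangent_space_def quot_mod_def ring.defs module.defs ideal_prod_eq)
    also have "\<dots> = (\<Union>b\<in>{b. b - a \<in> filt m J 2}. coset (\<kappa> c * b))"
      by (simp add: coset_def[of a] pi_smult[symmetric] cs)
    also have "\<dots> = (\<Union>b\<in>{b. b - a \<in> filt m J 2}. coset (\<kappa> c * a))"
    proof (rule SUP_cong[OF refl])
      fix b assume "b \<in> {b. b - a \<in> filt m J 2}"
      then show "coset (\<kappa> c * b) = coset (\<kappa> c * a)"
        unfolding coset_eq right_diff_distrib[symmetric] by (intro is_idealD(3)[OF filt2(1)]) simp
    qed
    also have "\<dots> = coset (\<kappa> c * a)"
    proof -
      have "a \<in> {b. b - a \<in> filt m J 2}" using is_idealD(1)[OF filt2(1)] by simp
      then have "{b. b - a \<in> filt m J 2} \<noteq> {}" by blast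
      then show ?thesis by (simp only: UN_constant if_False)
    qed
    finally show ?thesis .
  qed
qed

abbreviation tan where "tan \<equiv> tangent_space R (\<pi> ` m)"

lemma tan_carrier: "f \<in> carrier tan \<longleftrightarrow> f \<in> extensional (coset ` m) \<and>
    (\<forall>a\<in>m. \<forall>b\<in>m. f (coset (a + b)) = f (coset a) + f (coset b)) \<and>
    (\<forall>c. \<forall>a\<in>m. f (coset (\<kappa> c * a)) = c * f (coset a))"
  unfolding tangent_space_def dual_mod_def partial_object.simps
  by (auto simp: cot_simps PiE_def)

lemma tan_lincomb:
  fixes D :: nat
  assumes f: "f \<in> carrier tan" and x: "\<And>i. i < D \<Longrightarrow> x i \<in> m"
  shows "f (coset (\<Sum>i<D. \<kappa> (c i) * x i)) = (\<Sum>i<D. c i * f (coset (x i)))"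
  using x
proof (induction D)
  case 0
  have "f (coset (\<kappa> 0 * 0)) = 0 * f (coset 0)" using f is_idealD(1)[OF m(1)] unfolding tan_carrier by blast
  then show ?case by simp
next
  case (Suc D)
  have "(\<Sum>i<D. \<kappa> (c i) * x i) \<in> m" "\<kappa> (c D) * x D \<in> m"
    using Suc.prems by (auto intro!: is_idealD(7)[OF m(1)] is_idealD(3)[OF m(1)])
  then show ?case using f Suc by (simp add: tan_carrier)
qed

lemma abelian_monoid_tan: "abelian_monoid tan"
proof (rule abelian_monoidI)
  have ops: "f \<oplus>\<^bsub>tan\<^esub> g = (\<lambda>x\<in>coset ` m. f x + g x)" "\<zero>\<^bsub>tan\<^esub> = (\<lambda>x\<in>coset ` m. 0)" for f g
    by (simp_all add: tangent_space_def dual_mod_def cot_simps)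
  have cl: "coset (a + b) \<in> coset ` m" "coset (\<kappa> c * a) \<in> coset ` m" if "a \<in> m" "b \<in> m" for a b c
    using that is_idealD(2,3)[OF m(1)] by auto
  show "f \<oplus>\<^bsub>tan\<^esub> g \<in> carrier tan" if "f \<in> carrier tan" "g \<in> carrier tan" for f g
    using that cl unfolding tan_carrier ops by (auto simp: algebra_simps)
  show "\<zero>\<^bsub>tan\<^esub> \<in> carrier tan" unfolding tan_carrier ops using cl by auto
  show "f \<oplus>\<^bsub>tan\<^esub> g \<oplus>\<^bsub>tan\<^esub> h = f \<oplus>\<^bsub>tan\<^esub> (g \<oplus>\<^bsub>tan\<^esub> h)" for f g h
    unfolding ops by (auto simp: fun_eq_iff restrict_def)
  show "f \<oplus>\<^bsub>tan\<^esub> g = g \<oplus>\<^bsub>tan\<^esub> f" for f g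
    unfolding ops by (auto simp: fun_eq_iff restrict_def add.commute)
  show "\<zero>\<^bsub>tan\<^esub> \<oplus>\<^bsub>tan\<^esub> f = f" if "f \<in> carrier tan" for f
    using that unfolding ops tan_carrier by (auto simp: fun_eq_iff restrict_def extensional_def)
qed

lemma tan_finsum:
  assumes "finite F" "F \<subseteq> carrier tan"
  shows "(\<Oplus>\<^bsub>tan\<^esub>f\<in>F. c f \<odot>\<^bsub>tan\<^esub> f) = (\<lambda>x\<in>coset ` m. \<Sum>f\<in>F. c f * f x)"
  using assms
proof (induction F rule: finite_induct)
  interpret abelian_monoid tan by (rule abelian_monoid_tan)
  have ops: "f \<oplus>\<^bsub>tan\<^esub> g = (\<lambda>x\<in>coset ` m. f x + g x)" "\<zero>\<^bsub>tan\<^esub> = (\<lambda>x\<in>coset ` m. 0)"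
    "k \<odot>\<^bsub>tan\<^esub> f = (\<lambda>x\<in>coset ` m. k * f x)" for f g k
    by (simp_all add: tangent_space_def dual_mod_def cot_simps)
  { case empty then show ?case by (simp add: ops) }
  { case (insert f F)
    have cl: "coset (a + b) \<in> coset ` m" "coset (\<kappa> c * a) \<in> coset ` m" if "a \<in> m" "b \<in> m" for a b c
      using that is_idealD(2,3)[OF m(1)] by auto
    have sc: "k \<odot>\<^bsub>tan\<^esub> g \<in> carrier tan" if "g \<in> carrier tan" for k g
      using that cl unfolding tan_carrier ops by (auto simp: algebra_simps)
    have "(\<Oplus>\<^bsub>tan\<^esub>g\<in>insert f F. c g \<odot>\<^bsub>tan\<^esub> g) = c f \<odot>\<^bsub>tan\<^esub> f \<oplus>\<^bsub>tan\<^esub> (\<Oplus>\<^bsub>tan\<^esub>g\<in>F. c g \<odot>\<^bsub>tan\<^esub> g)"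
      using insert sc by (intro finsum_insert) auto
    then show ?case using insert unfolding ops by (auto simp: fun_eq_iff restrict_def) }
qed

text \<open>A functional is determined by its values at the \<open>x i\<close>, so more than D
  functionals are dependent by \<open>linear_dependence\<close> over the complex numbers. Conversely
  the coordinates with respect to \<open>x\<close> give D independent functionals.\<close>

lemma vdim_tan:
  assumes x: "spans x D" "indep x D"
  shows "vdim tan = enat D"
proof (rule antisym)
  have xm: "x i \<in> m" if "i < D" for i using x(1) that by (simp add: spans_def)
  have zero: "\<zero>\<^bsub>tan\<^esub> = (\<lambda>x\<in>coset ` m. 0)"
    by (simp add: tangent_space_def dual_mod_def cot_simps)
  have ex: "\<exists>c. a - (\<Sum>i<D. \<kappa> (c i) * x i) \<in> filt m J 2" if "a \<in> m" for a using x(1) that by (simp add: spans_def)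
  show "vdim tan \<le> enat D"
    unfolding vdim_def
  proof (rule SUP_least)
    fix F assume "F \<in> {F. finite F \<and> F \<subseteq> carrier tan \<and> lin_indep tan F}"
    then have F: "finite F" "F \<subseteq> carrier tan" "lin_indep tan F" by auto
    show "enat (card F) \<le> enat D"
    proof (rule ccontr)
      assume "\<not> ?thesis"
      then have "D < card F" by simp
      moreover have "is_prime {0 :: complex}" by (auto simp: is_prime_def ideal_in_def)
      ultimately obtain c where c: "\<exists>f\<in>F. c f \<noteq> 0" "\<forall>j<D. (\<Sum>f\<in>F. c f * f (coset (x j))) = 0"
        using linear_dependence[of "{0 :: complex}" F D "\<lambda>f j. f (coset (x j))"] F(1) by auto
      have "(\<Sum>f\<in>F. c f * f (coset a)) = 0" if a: "a \<in> m" for a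
      proof -
        obtain d where d: "a - (\<Sum>i<D. \<kappa> (d i) * x i) \<in> filt m J 2" using ex[OF a] by blast
        then have "coset a = coset (\<Sum>i<D. \<kappa> (d i) * x i)" by (simp add: coset_eq)
        then have "(\<Sum>f\<in>F. c f * f (coset a)) = (\<Sum>f\<in>F. \<Sum>i<D. d i * (c f * f (coset (x i))))"
          using F(2) xm by (intro sum.cong) (auto simp: tan_lincomb subsetD sum_distrib_left mult.left_commute)
        also have "\<dots> = (\<Sum>i<D. d i * (\<Sum>f\<in>F. c f * f (coset (x i))))"
          unfolding sum_distrib_left by (rule sum.swap)
        also have "\<dots> = 0" using c(2) by (intro sum.neutral) auto
        finally show ?thesis .
      qed
      then have "(\<Oplus>\<^bsub>tan\<^esub>f\<in>F. c f \<odot>\<^bsub>tan\<^esub> f) = \<zero>\<^bsub>tan\<^esub>"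
        unfolding tan_finsum[OF F(1,2)] zero by (auto simp: restrict_def fun_eq_iff)
      then show False using F(3) c(1) by (auto simp: lin_indep_def)
    qed
  qed
  define co where "co a = (SOME c. a - (\<Sum>i<D. \<kappa> (c i) * x i) \<in> filt m J 2)" for a
  have co: "a - (\<Sum>i<D. \<kappa> (co a i) * x i) \<in> filt m J 2" if "a \<in> m" for a
    unfolding co_def by (rule someI_ex[OF ex[OF that]])
  have uniq: "co a i = c i" if a: "a \<in> m" "a - (\<Sum>i<D. \<kappa> (c i) * x i) \<in> filt m J 2" "i < D" for a c i
  proof -
    from is_idealD(6)[OF filt2(1) a(2) co[OF a(1)]]
    have "(\<Sum>i<D. \<kappa> (co a i - c i) * x i) \<in> filt m J 2"
      by (simp add: \<kappa>_diff left_diff_distrib sum_subtractf)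
    then have "\<forall>i<D. co a i - c i = 0" by (rule spec[OF x(2)[unfolded indep_def], of "\<lambda>i. co a i - c i", THEN mp])
    then show ?thesis using a(3) by simp
  qed
  define rep where "rep C = (SOME a. a \<in> m \<and> coset a = C)" for C
  have rep: "rep (coset a) \<in> m \<and> coset (rep (coset a)) = coset a" if "a \<in> m" for a
    unfolding rep_def by (rule someI[of _ a]) (use that in simp)
  define \<delta> where "\<delta> i = (\<lambda>C\<in>coset ` m. co (rep C) i)" for i
  have \<delta>: "\<delta> i (coset a) = c i" if a: "a \<in> m" "a - (\<Sum>i<D. \<kappa> (c i) * x i) \<in> filt m J 2" "i < D" for i a c
  proof -
    have "rep (coset a) - a \<in> filt m J 2" using rep[OF a(1)] by (simp add: coset_eq)
    from is_idealD(2)[OF filt2(1) this a(2)] have "co (rep (coset a)) i = c i"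
      using rep[OF a(1)] a(3) by (intro uniq) auto
    then show ?thesis using a(1) by (simp add: \<delta>_def)
  qed
  have \<delta>c: "\<delta> i \<in> carrier tan" if i: "i < D" for i
    unfolding tan_carrier
  proof (intro conjI ballI allI)
    show "\<delta> i \<in> extensional (coset ` m)" by (simp add: \<delta>_def)
    fix a assume a: "a \<in> m"
    show "\<delta> i (coset (a + b)) = \<delta> i (coset a) + \<delta> i (coset b)" if b: "b \<in> m" for b
    proof -
      from is_idealD(2)[OF filt2(1) co[OF a] co[OF b]]
      have "a + b - (\<Sum>i<D. \<kappa> (co a i + co b i) * x i) \<in> filt m J 2"
        by (simp add: \<kappa>_add algebra_simps sum.distrib)
      from \<delta>[OF is_idealD(2)[OF m(1) a b] this i] show ?thesis
        using \<delta>[OF a co[OF a] i] \<delta>[OF b co[OF b] i] by simp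
    qed
    show "\<delta> i (coset (\<kappa> c * a)) = c * \<delta> i (coset a)" for c
    proof -
      from is_idealD(3)[OF filt2(1) co[OF a], of "\<kappa> c"]
      have "\<kappa> c * a - (\<Sum>i<D. \<kappa> (c * co a i) * x i) \<in> filt m J 2"
        by (simp add: \<kappa>_mult right_diff_distrib sum_distrib_left mult.assoc)
      from \<delta>[OF is_idealD(3)[OF m(1) a] this i] show ?thesis using \<delta>[OF a co[OF a] i] by simp
    qed
  qed
  have \<delta>x: "\<delta> i (coset (x j)) = (if i = j then 1 else 0)" if "i < D" "j < D" for i j
  proof -
    have "(\<Sum>k<D. \<kappa> (if k = j then 1 else 0) * x k) = (\<Sum>k<D. if k = j then x k else 0)"
      by (intro sum.cong) (auto simp: \<kappa>_0 \<kappa>_1)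
    also have "\<dots> = x j" using that by simp
    finally show ?thesis using \<delta>[OF xm[OF that(2)], of "\<lambda>k. if k = j then 1 else 0" i] that is_idealD(1)[OF filt2(1)] by simp
  qed
  have inj: "inj_on \<delta> {..<D}"
  proof (rule inj_onI)
    fix i j assume i: "i \<in> {..<D}" and j: "j \<in> {..<D}" and eq: "\<delta> i = \<delta> j"
    show "i = j"
    proof (rule ccontr)
      assume ne: "i \<noteq> j"
      have "\<delta> i (coset (x i)) = 1" using \<delta>x[of i i] i by simp
      moreover have "\<delta> j (coset (x i)) = 0" using \<delta>x[of j i] i j ne by simp
      ultimately show False unfolding eq by simp
    qed
  qed
  have "lin_indep tan (\<delta> ` {..<D})"
    unfolding lin_indep_def
  proof (intro allI impI)
    fix c assume c: "(\<Oplus>\<^bsub>tan\<^esub>f\<in>\<delta> ` {..<D}. c f \<odot>\<^bsub>tan\<^esub> f) = \<zero>\<^bsub>tan\<^esub>"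
    have sub: "\<delta> ` {..<D} \<subseteq> carrier tan" using \<delta>c by auto
    have "c (\<delta> j) = 0" if j: "j < D" for j
    proof -
      have "(\<lambda>y\<in>coset ` m. \<Sum>f\<in>\<delta> ` {..<D}. c f * f y) (coset (x j)) = 0"
        using c xm[OF j] unfolding tan_finsum[OF finite_imageI[OF finite_lessThan] sub] zero by simp
      then have "(\<Sum>f\<in>\<delta> ` {..<D}. c f * f (coset (x j))) = 0" using xm[OF j] by simp
      then have "(\<Sum>i<D. c (\<delta> i) * \<delta> i (coset (x j))) = 0" by (simp add: sum.reindex[OF inj])
      moreover have "(\<Sum>i<D. c (\<delta> i) * \<delta> i (coset (x j))) = (\<Sum>i<D. if i = j then c (\<delta> i) else 0)"
        using j by (intro sum.cong) (auto simp: \<delta>x)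
      ultimately show ?thesis using j by simp
    qed
    then show "\<forall>v\<in>\<delta> ` {..<D}. c v = 0" by auto
  qed
  then have "\<delta> ` {..<D} \<in> {F. finite F \<and> F \<subseteq> carrier tan \<and> lin_indep tan F}" using \<delta>c by auto
  then have "enat (card (\<delta> ` {..<D})) \<le> vdim tan" unfolding vdim_def by (rule SUP_upper)
  then show "enat D \<le> vdim tan" by (simp add: card_image[OF inj])
qed

end

section \<open>Quadratic functions on groups\<close>

definition additive_on :: "('g, 'm) monoid_scheme \<Rightarrow> ('g \<Rightarrow> complex) \<Rightarrow> bool" where
  "additive_on G \<phi> \<longleftrightarrow> (\<forall>x\<in>carrier G. \<forall>y\<in>carrier G. \<phi> (x \<otimes>\<^bsub>G\<^esub> y) = \<phi> x + \<phi> y)"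

lemma eliminate_mixed_terms:
  fixes a s :: complex
  assumes "a + s = 2 * x + 2 * yz" "p + s = 2 * q + 2 * y" "b + p = 2 * xy + 2 * z" "xz + q = 2 * x + 2 * z"
  shows "a + b = 2 * yz + 2 * xz + 2 * xy - 2 * x - 2 * y - 2 * z"
proof -
  have a: "a = 2 * x + 2 * yz - s" and s: "s = 2 * q + 2 * y - p" and p: "p = 2 * xy + 2 * z - b" and q: "q = 2 * x + 2 * z - xz"
    using assms by (simp_all add: eq_diff_eq add.commute)
  show ?thesis unfolding a s p q by (simp add: algebra_simps)
qed

lemma defect_as_additivity:
  fixes a b :: complex
  assumes "a - b - c - d + x + y + z = 0"
  shows "a - b - z = (d - x - z) + (c - y - z)"
proof -
  have "a - b - z - ((d - x - z) + (c - y - z)) = a - b - c - d + x + y + z" by (simp add: algebra_simps)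
  then have "a - b - z - ((d - x - z) + (c - y - z)) = 0" by (rule trans[OF _ assms])
  then show ?thesis by (simp only: right_minus_eq)
qed

lemma eliminate_coefficient:
  fixes c d :: complex
  assumes "c * p + d * q = 0" "c * r + d * s = 0"
  shows "d * (q * r - s * p) = 0"
proof -
  have "d * (q * r - s * p) = r * (c * p + d * q) - p * (c * r + d * s)" by (simp add: algebra_simps)
  then show ?thesis using assms by simp
qed

context group
begin

context
  fixes f :: "'a \<Rightarrow> complex"
  assumes F: "x \<in> carrier G \<Longrightarrow> y \<in> carrier G \<Longrightarrow> f (x \<otimes> y) + f (x \<otimes> inv y) = 2 * f x + 2 * f y"
begin

lemma quadratic_one: "f \<one> = 0"
  using F[of \<one> \<one>] by simp

lemma quadratic_inv: "x \<in> carrier G \<Longrightarrow> f (inv x) = f x"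
  using F[of \<one> x] quadratic_one by (simp add: algebra_simps)

text \<open>\<open>f (x \<otimes> inv y)\<close> is symmetric because \<open>f\<close> is invariant
  under inversion, and the functional equation transfers this symmetry to the product.\<close>

lemma quadratic_commute:
  assumes "x \<in> carrier G" "y \<in> carrier G"
  shows "f (x \<otimes> y) = f (y \<otimes> x)"
proof -
  have "f (x \<otimes> inv y) = f (y \<otimes> inv x)"
    using quadratic_inv[of "x \<otimes> inv y"] assms by (simp add: inv_mult_group)
  moreover have "f (x \<otimes> y) = 2 * f x + 2 * f y - f (x \<otimes> inv y)" "f (y \<otimes> x) = 2 * f y + 2 * f x - f (y \<otimes> inv x)"
    using F[OF assms] F[OF assms(2,1)] by (simp_all add: eq_diff_eq)
  ultimately show ?thesis by simp
qed

definition quadratic_T :: "'a \<Rightarrow> 'a \<Rightarrow> 'a \<Rightarrow> complex" where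
  "quadratic_T x y z = f (x \<otimes> y \<otimes> z) - f (x \<otimes> y) - f (y \<otimes> z) - f (x \<otimes> z) + f x + f y + f z"

text \<open>The functional equation at the pairs (x, y z), (x z^-1, y), (y x, z) and (x, z) involves
  three values with inverses, which \<open>eliminate_mixed_terms\<close> removes.\<close>

lemma quadratic_T_swap:
  assumes c: "x \<in> carrier G" "y \<in> carrier G" "z \<in> carrier G"
  shows "quadratic_T y x z = - quadratic_T x y z"
proof -
  have 1: "f (x \<otimes> y \<otimes> z) + f (x \<otimes> inv z \<otimes> inv y) = 2 * f x + 2 * f (y \<otimes> z)"
    using F[of x "y \<otimes> z"] c by (simp add: inv_mult_group m_assoc)
  have 2: "f (x \<otimes> inv z \<otimes> y) + f (x \<otimes> inv z \<otimes> inv y) = 2 * f (x \<otimes> inv z) + 2 * f y"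
    using F[of "x \<otimes> inv z" y] c by simp
  have 3: "f (x \<otimes> inv z \<otimes> y) = f (y \<otimes> x \<otimes> inv z)"
    using quadratic_commute[of "x \<otimes> inv z" y] c by (simp add: m_assoc)
  have 4: "f (y \<otimes> x \<otimes> z) + f (y \<otimes> x \<otimes> inv z) = 2 * f (y \<otimes> x) + 2 * f z"
    using F[of "y \<otimes> x" z] c by simp
  have 5: "f (x \<otimes> z) + f (x \<otimes> inv z) = 2 * f x + 2 * f z" using F c by simp
  have 6: "f (y \<otimes> x) = f (x \<otimes> y)" using quadratic_commute c by simp
  have "f (x \<otimes> y \<otimes> z) + f (y \<otimes> x \<otimes> z) =
      2 * f (y \<otimes> z) + 2 * f (x \<otimes> z) + 2 * f (x \<otimes> y) - 2 * f x - 2 * f y - 2 * f z"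
    by (rule eliminate_mixed_terms[OF 1 2[unfolded 3] 4[unfolded 6] 5])
  then have b: "f (y \<otimes> x \<otimes> z) =
      2 * f (y \<otimes> z) + 2 * f (x \<otimes> z) + 2 * f (x \<otimes> y) - 2 * f x - 2 * f y - 2 * f z - f (x \<otimes> y \<otimes> z)"
    by (simp only: eq_diff_eq add.commute)
  show ?thesis unfolding quadratic_T_def b 6 by (simp add: algebra_simps)
qed

lemma quadratic_T_cycle:
  assumes c: "x \<in> carrier G" "y \<in> carrier G" "z \<in> carrier G"
  shows "quadratic_T y z x = quadratic_T x y z"
proof -
  have "f (y \<otimes> z \<otimes> x) = f (x \<otimes> y \<otimes> z)" using quadratic_commute[of x "y \<otimes> z"] c by (simp add: m_assoc)
  moreover have "f (z \<otimes> x) = f (x \<otimes> z)" "f (y \<otimes> x) = f (x \<otimes> y)" using quadratic_commute c by auto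
  ultimately show ?thesis unfolding quadratic_T_def by simp
qed

definition quadratic_defect :: "'a \<Rightarrow> 'a \<Rightarrow> 'a \<Rightarrow> 'a \<Rightarrow> complex" where
  "quadratic_defect x y z w = quadratic_T (x \<otimes> y) z w - quadratic_T x z w - quadratic_T y z w"

text \<open>The defect is antisymmetric in its last two arguments and invariant under the 4-cycle, hence
  antisymmetric under all transpositions.  As the 4-cycle is odd, the defect vanishes.\<close>

lemma quadratic_T_additive:
  assumes c: "x \<in> carrier G" "y \<in> carrier G" "z \<in> carrier G" "w \<in> carrier G"
  shows "quadratic_T (x \<otimes> y) z w = quadratic_T x z w + quadratic_T y z w"
proof -
  let ?d = quadratic_defect
  have cyc: "?d y z w x = ?d x y z w"
    if c: "x \<in> carrier G" "y \<in> carrier G" "z \<in> carrier G" "w \<in> carrier G" for x y z w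
  proof -
    have comm: "f (y \<otimes> z \<otimes> w \<otimes> x) = f (x \<otimes> y \<otimes> z \<otimes> w)" "f (y \<otimes> z \<otimes> x) = f (x \<otimes> y \<otimes> z)"
      "f (y \<otimes> w \<otimes> x) = f (x \<otimes> y \<otimes> w)" "f (z \<otimes> w \<otimes> x) = f (x \<otimes> z \<otimes> w)"
      "f (y \<otimes> x) = f (x \<otimes> y)" "f (z \<otimes> x) = f (x \<otimes> z)" "f (w \<otimes> x) = f (x \<otimes> w)"
      using quadratic_commute[of x "y \<otimes> z \<otimes> w"] quadratic_commute[of x "y \<otimes> z"] quadratic_commute[of x "y \<otimes> w"]
        quadratic_commute[of x "z \<otimes> w"] quadratic_commute[of x] c
      by (simp_all add: m_assoc)
    show ?thesis unfolding quadratic_defect_def quadratic_T_def comm by (simp add: algebra_simps)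
  qed
  have sw: "?d x y w z = - ?d x y z w"
    if c: "x \<in> carrier G" "y \<in> carrier G" "z \<in> carrier G" "w \<in> carrier G" for x y z w
  proof -
    have "quadratic_T u w z = - quadratic_T u z w" if "u \<in> carrier G" for u
      using quadratic_T_swap[of z w u] quadratic_T_cycle[of u z w] quadratic_T_cycle[of u w z] c that by simp
    then show ?thesis unfolding quadratic_defect_def using c by simp
  qed
  have "?d x y z w = - ?d x y w z" using sw[OF c] by simp
  also have "\<dots> = - ?d w z x y" using cyc[of w x y z] cyc[of z w x y] cyc[of y z w x] cyc[of x y w z] cyc[of y w z x] c by simp
  also have "\<dots> = ?d w z y x" using sw[of w z x y] c by simp
  also have "\<dots> = ?d z y x w" using cyc[of w z y x] c by simp
  also have "\<dots> = - ?d z y w x" using sw[of z y x w] c by simp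
  also have "\<dots> = - ?d y w x z" using cyc[of z y w x] c by simp
  also have "\<dots> = ?d y w z x" using sw[of y w z x] c by simp
  also have "\<dots> = ?d x y w z" using cyc[of x y w z] c by simp
  also have "\<dots> = - ?d x y z w" by (rule sw[OF c])
  finally have "?d x y z w = 0" by simp
  then show ?thesis by (simp add: quadratic_defect_def algebra_simps)
qed

text \<open>Additivity and \<open>k\<close> move two arguments of the third difference to
  \<open>g0\<close>, where alternation gives 0. Hence \<open>B\<close> is biadditive,
  \<open>f x\<close> is half of \<open>B x x\<close>, and \<open>k\<close> enters quadratically. For
  the second claim, \<open>B g0 g0\<close> is a value at \<open>g0\<close> of an additive
  function.\<close>

lemma quadratic_function:
  assumes g0: "g0 \<in> carrier G"
    and k: "\<And>\<phi> x. additive_on G \<phi> \<Longrightarrow> x \<in> carrier G \<Longrightarrow> \<phi> x = k x * \<phi> g0"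
  shows "x \<in> carrier G \<Longrightarrow> f x = (k x)\<^sup>2 * f g0"
    and "(\<And>\<phi>. additive_on G \<phi> \<Longrightarrow> \<phi> g0 = 0) \<Longrightarrow> f g0 = 0"
proof -
  have T0: "quadratic_T x y z = 0" if c: "x \<in> carrier G" "y \<in> carrier G" "z \<in> carrier G" for x y z
  proof -
    have h1: "quadratic_T x y z = k x * quadratic_T g0 y z" if "x \<in> carrier G" "y \<in> carrier G" "z \<in> carrier G" for x y z
      using k[of "\<lambda>x. quadratic_T x y z" x] quadratic_T_additive that by (simp add: additive_on_def)
    have "quadratic_T g0 y z = - quadratic_T y g0 z" using quadratic_T_swap[of y g0 z] c g0 by simp
    also have "\<dots> = - (k y * quadratic_T g0 g0 z)" using h1[of y g0 z] c g0 by simp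
    also have "quadratic_T g0 g0 z = 0" using quadratic_T_swap[of g0 g0 z] c g0 by simp
    finally show ?thesis using h1[OF c] by simp
  qed
  define B where "B x y = f (x \<otimes> y) - f x - f y" for x y
  have Ba: "additive_on G (\<lambda>x. B x z)" if "z \<in> carrier G" for z
    unfolding additive_on_def
  proof (intro ballI)
    fix x y assume "x \<in> carrier G" "y \<in> carrier G"
    then have "quadratic_T x y z = 0" using T0 that by simp
    then show "B (x \<otimes> y) z = B x z + B y z" unfolding quadratic_T_def B_def by (rule defect_as_additivity)
  qed
  have Bc: "B x y = B y x" if "x \<in> carrier G" "y \<in> carrier G" for x y
    using quadratic_commute[OF that] by (simp add: B_def)
  have Bx: "B x x = 2 * f x" if "x \<in> carrier G" for x
    using F[OF that that] quadratic_one that by (simp add: B_def)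
  { assume x: "x \<in> carrier G"
    have "B x x = k x * B g0 x" using k[OF Ba[OF x] x] .
    also have "B g0 x = k x * B g0 g0" using k[OF Ba[OF g0] x] Bc[OF x g0] by simp
    finally show "f x = (k x)\<^sup>2 * f g0" using Bx[OF x] Bx[OF g0] by (simp add: power2_eq_square) }
  { assume "\<And>\<phi>. additive_on G \<phi> \<Longrightarrow> \<phi> g0 = 0"
    from this[OF Ba[OF g0]] show "f g0 = 0" using Bx[OF g0] by simp }
qed

end

end

section \<open>First homology and additive functions\<close>

abbreviation smul :: "complex \<Rightarrow> ('g \<Rightarrow>\<^sub>0 complex) \<Rightarrow> ('g \<Rightarrow>\<^sub>0 complex)" where
  "smul a \<equiv> Poly_Mapping.map ((*) a)"

lemma lookup_smul [simp]: "Poly_Mapping.lookup (smul c a) k = c * Poly_Mapping.lookup a k"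
  by (simp add: Poly_Mapping.map.rep_eq when_def)

interpretation chain_space: vector_space "smul :: complex \<Rightarrow> ('g \<Rightarrow>\<^sub>0 complex) \<Rightarrow> _"
  by unfold_locales (auto intro!: poly_mapping_eqI simp: lookup_add algebra_simps)

interpretation chain_space_pair: vector_space_pair "smul :: complex \<Rightarrow> ('g \<Rightarrow>\<^sub>0 complex) \<Rightarrow> _" "(*) :: complex \<Rightarrow> _"
  by unfold_locales (auto simp: algebra_simps)

lemma smul_single: "smul c (Poly_Mapping.single g a) = Poly_Mapping.single g (c * a)"
  by (intro poly_mapping_eqI) (simp add: lookup_single when_def)

lemma keys_smul: "Poly_Mapping.keys (smul c a) \<subseteq> Poly_Mapping.keys a"
  by (auto simp: in_keys_iff)

context
  fixes G :: "('g, 'm) monoid_scheme"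
  assumes G: "group G"
begin

interpretation G: group G by (rule G)

definition boundaries :: "('g \<Rightarrow>\<^sub>0 complex) set" where
  "boundaries = bar_d2 G ` {c. Poly_Mapping.keys c \<subseteq> carrier G \<times> carrier G}"

definition C1 :: "('g \<Rightarrow>\<^sub>0 complex) set" where "C1 = {c. Poly_Mapping.keys c \<subseteq> carrier G}"

definition bar_term :: "'g \<times> 'g \<Rightarrow> complex \<Rightarrow> 'g \<Rightarrow>\<^sub>0 complex" where
  "bar_term k a = (case k of (g, h) \<Rightarrow>
     Poly_Mapping.single h a - Poly_Mapping.single (g \<otimes>\<^bsub>G\<^esub> h) a + Poly_Mapping.single g a)"

lemma bar_term_simps: "bar_term k 0 = 0" "bar_term k (a + b) = bar_term k a + bar_term k b"
  "smul c (bar_term k a) = bar_term k (c * a)"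
  by (auto simp: bar_term_def single_add chain_space.scale_right_distrib chain_space.scale_right_diff_distrib smul_single
      split: prod.splits)

lemma bar_d2_pm_ext: "bar_d2 G = pm_ext bar_term"
  by (auto simp: fun_eq_iff bar_d2_def pm_ext_def bar_term_def Let_def intro!: sum.cong)

lemma bar_d2_add: "bar_d2 G (c + d) = bar_d2 G c + bar_d2 G d"
  unfolding bar_d2_pm_ext by (rule pm_ext_add) (simp_all add: bar_term_simps)

lemma bar_d2_single: "bar_d2 G (Poly_Mapping.single k a) = bar_term k a"
  unfolding bar_d2_pm_ext by (rule pm_ext_single) (simp add: bar_term_simps)

lemma bar_d2_smul: "bar_d2 G (smul c p) = smul c (bar_d2 G p)"
proof (induction p rule: pm_additive_induct)
  case 1 then show ?case by (simp add: bar_d2_def)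
next
  case (2 p q) then show ?case by (simp add: chain_space.scale_right_distrib bar_d2_add)
next
  case (3 k a) then show ?case by (simp add: smul_single bar_d2_single bar_term_simps)
qed

lemma subspace_boundaries: "chain_space.subspace boundaries"
proof (rule chain_space.subspaceI)
  show "0 \<in> boundaries" unfolding boundaries_def by (rule image_eqI[of _ _ 0]) (simp_all add: bar_d2_def)
  show "a + b \<in> boundaries" if "a \<in> boundaries" "b \<in> boundaries" for a b
  proof -
    obtain c d where "a = bar_d2 G c" "Poly_Mapping.keys c \<subseteq> carrier G \<times> carrier G"
      "b = bar_d2 G d" "Poly_Mapping.keys d \<subseteq> carrier G \<times> carrier G" using \<open>a \<in> _\<close> \<open>b \<in> _\<close> unfolding boundaries_def by auto
    then show ?thesis unfolding boundaries_def using Poly_Mapping.keys_add[of c d]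
      by (intro image_eqI[of _ _ "c + d"]) (auto simp: bar_d2_add)
  qed
  show "smul k a \<in> boundaries" if "a \<in> boundaries" for a k
  proof -
    obtain c where "a = bar_d2 G c" "Poly_Mapping.keys c \<subseteq> carrier G \<times> carrier G" using \<open>a \<in> _\<close> unfolding boundaries_def by auto
    then show ?thesis unfolding boundaries_def using keys_smul[of k c]
      by (intro image_eqI[of _ _ "smul k c"]) (auto simp: bar_d2_smul)
  qed
qed

lemma subspace_C1: "chain_space.subspace C1"
  unfolding C1_def
proof (rule chain_space.subspaceI)
  show "a + b \<in> {c. Poly_Mapping.keys c \<subseteq> carrier G}"
    if "a \<in> {c. Poly_Mapping.keys c \<subseteq> carrier G}" "b \<in> {c. Poly_Mapping.keys c \<subseteq> carrier G}" for a b
    using that Poly_Mapping.keys_add[of a b] by auto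
  show "smul k a \<in> {c. Poly_Mapping.keys c \<subseteq> carrier G}" if "a \<in> {c. Poly_Mapping.keys c \<subseteq> carrier G}" for a k
    using that keys_smul[of k a] by auto
qed simp

lemma bar_term_boundary: "g \<in> carrier G \<Longrightarrow> h \<in> carrier G \<Longrightarrow> bar_term (g, h) a \<in> boundaries"
  unfolding boundaries_def
  by (rule image_eqI[of _ _ "Poly_Mapping.single (g, h) a"]) (auto simp: bar_d2_single split: if_splits)

lemma C1_sum_singles: "a \<in> C1 \<Longrightarrow> a \<in> chain_space.span ((\<lambda>g. Poly_Mapping.single g 1) ` carrier G)"
proof -
  assume a: "a \<in> C1"
  have "a = (\<Sum>g\<in>Poly_Mapping.keys a. smul (Poly_Mapping.lookup a g) (Poly_Mapping.single g 1))"
    using pm_sum_keys[of a] by (simp add: smul_single)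
  also have "\<dots> \<in> chain_space.span ((\<lambda>g. Poly_Mapping.single g 1) ` carrier G)"
    using a unfolding C1_def by (intro chain_space.span_sum chain_space.span_scale chain_space.span_base) auto
  finally show ?thesis .
qed

definition hcls :: "('g \<Rightarrow>\<^sub>0 complex) \<Rightarrow> ('g \<Rightarrow>\<^sub>0 complex) set" where "hcls a = {b. b - a \<in> boundaries}"

lemma hcls_eq: "hcls a = hcls b \<longleftrightarrow> a - b \<in> boundaries"
proof
  assume "hcls a = hcls b"
  moreover have "a \<in> hcls a" using chain_space.subspace_0[OF subspace_boundaries] by (simp add: hcls_def)
  ultimately show "a - b \<in> boundaries" by (simp add: hcls_def)
next
  assume ab: "a - b \<in> boundaries"
  have "c - a \<in> boundaries \<longleftrightarrow> c - b \<in> boundaries" for c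
    using chain_space.subspace_add[OF subspace_boundaries _ ab, of "c - a"]
      chain_space.subspace_diff[OF subspace_boundaries _ ab, of "c - b"] by auto
  then show "hcls a = hcls b" by (simp add: hcls_def)
qed

lemma H1_simps:
  "carrier (group_H1 G) = hcls ` C1"
  "hcls a \<oplus>\<^bsub>group_H1 G\<^esub> hcls b = hcls (a + b)"
  "c \<odot>\<^bsub>group_H1 G\<^esub> hcls a = hcls (smul c a)"
  "\<zero>\<^bsub>group_H1 G\<^esub> = hcls 0"
proof -
  have cs: "boundaries +>\<^bsub>bar_C1 G\<^esub> a = hcls a" for a
  proof -
    have "boundaries +>\<^bsub>bar_C1 G\<^esub> a = (\<lambda>w. w + a) ` boundaries"
      by (auto simp: a_r_coset_def r_coset_def bar_C1_def)
    also have "\<dots> = hcls a"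
    proof
      show "hcls a \<subseteq> (\<lambda>w. w + a) ` boundaries"
      proof
        fix b assume "b \<in> hcls a"
        then show "b \<in> (\<lambda>w. w + a) ` boundaries" by (intro image_eqI[of _ _ "b - a"]) (auto simp: hcls_def)
      qed
    qed (auto simp: hcls_def)
    finally show ?thesis .
  qed
  show "carrier (group_H1 G) = hcls ` C1"
  proof -
    have "carrier (group_H1 G) = a_rcosets\<^bsub>bar_C1 G\<^esub> boundaries"
      by (simp add: group_H1_def boundaries_def quot_mod_def ring.defs module.defs FactRing_def)
    also have "\<dots> = (\<Union>y\<in>carrier (bar_C1 G). {boundaries +>\<^bsub>bar_C1 G\<^esub> y})" by (simp add: A_RCOSETS_def')
    also have "\<dots> = hcls ` C1" by (simp add: cs UNION_singleton_eq_range C1_def) (simp add: bar_C1_def)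
    finally show ?thesis .
  qed
  show "hcls a \<oplus>\<^bsub>group_H1 G\<^esub> hcls b = hcls (a + b)"
  proof -
    have "hcls a \<oplus>\<^bsub>group_H1 G\<^esub> hcls b = {x + y | x y. x \<in> hcls a \<and> y \<in> hcls b}"
      by (auto simp: group_H1_def quot_mod_def ring.defs module.defs FactRing_def set_add_def set_mult_def bar_C1_def)
    also have "\<dots> = hcls (a + b)"
    proof
      show "{x + y | x y. x \<in> hcls a \<and> y \<in> hcls b} \<subseteq> hcls (a + b)"
      proof
        fix z assume "z \<in> {x + y | x y. x \<in> hcls a \<and> y \<in> hcls b}"
        then obtain u v where "z = u + v" "u - a \<in> boundaries" "v - b \<in> boundaries" by (auto simp: hcls_def)
        then show "z \<in> hcls (a + b)"
          using chain_space.subspace_add[OF subspace_boundaries, of "u - a" "v - b"] by (simp add: hcls_def algebra_simps)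
      qed
      show "hcls (a + b) \<subseteq> {x + y | x y. x \<in> hcls a \<and> y \<in> hcls b}"
      proof
        fix z assume z: "z \<in> hcls (a + b)"
        have "z = (z - b) + b" by simp
        moreover have "z - b \<in> hcls a" using z by (simp add: hcls_def algebra_simps)
        moreover have "b \<in> hcls b" using chain_space.subspace_0[OF subspace_boundaries] by (simp add: hcls_def)
        ultimately show "z \<in> {x + y | x y. x \<in> hcls a \<and> y \<in> hcls b}" by blast
      qed
    qed
    finally show ?thesis .
  qed
  show "c \<odot>\<^bsub>group_H1 G\<^esub> hcls a = hcls (smul c a)"
  proof -
    have "c \<odot>\<^bsub>group_H1 G\<^esub> hcls a = (\<Union>x\<in>hcls a. boundaries +>\<^bsub>bar_C1 G\<^esub> smul c x)"
      by (simp add: group_H1_def boundaries_def quot_mod_def ring.defs module.defs) (simp add: bar_C1_def)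
    also have "\<dots> = (\<Union>x\<in>hcls a. hcls (smul c a))"
    proof (rule SUP_cong[OF refl])
      fix x assume "x \<in> hcls a"
      then have "smul c (x - a) \<in> boundaries"
        by (intro chain_space.subspace_scale[OF subspace_boundaries]) (simp add: hcls_def)
      then show "boundaries +>\<^bsub>bar_C1 G\<^esub> smul c x = hcls (smul c a)"
        unfolding cs hcls_eq by (simp add: chain_space.scale_right_diff_distrib)
    qed
    also have "\<dots> = hcls (smul c a)"
    proof -
      have "a \<in> hcls a" using chain_space.subspace_0[OF subspace_boundaries] by (simp add: hcls_def)
      then have "hcls a \<noteq> {}" by blast
      then show ?thesis by (simp only: UN_constant if_False)
    qed
    finally show ?thesis .
  qed
  show "\<zero>\<^bsub>group_H1 G\<^esub> = hcls 0"
    by (simp add: group_H1_def quot_mod_def ring.defs module.defs FactRing_def hcls_def boundaries_def)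
qed

lemma abelian_monoid_H1: "abelian_monoid (group_H1 G)"
proof (rule abelian_monoidI)
  fix A B C
  show "\<zero>\<^bsub>group_H1 G\<^esub> \<in> carrier (group_H1 G)"
    unfolding H1_simps using chain_space.subspace_0[OF subspace_C1] by blast
  assume "A \<in> carrier (group_H1 G)" "B \<in> carrier (group_H1 G)"
  then obtain a b where a: "a \<in> C1" "A = hcls a" and b: "b \<in> C1" "B = hcls b" unfolding H1_simps by auto
  show "A \<oplus>\<^bsub>group_H1 G\<^esub> B \<in> carrier (group_H1 G)"
    unfolding a b H1_simps using chain_space.subspace_add[OF subspace_C1 a(1) b(1)] by blast
  show "A \<oplus>\<^bsub>group_H1 G\<^esub> B = B \<oplus>\<^bsub>group_H1 G\<^esub> A" unfolding a b H1_simps by (simp add: add.commute)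
  assume "C \<in> carrier (group_H1 G)"
  then obtain c where c: "C = hcls c" unfolding H1_simps by auto
  show "A \<oplus>\<^bsub>group_H1 G\<^esub> B \<oplus>\<^bsub>group_H1 G\<^esub> C = A \<oplus>\<^bsub>group_H1 G\<^esub> (B \<oplus>\<^bsub>group_H1 G\<^esub> C)"
    unfolding a b c H1_simps by (simp add: add.assoc)
next
  fix A assume "A \<in> carrier (group_H1 G)"
  then obtain a where "A = hcls a" unfolding H1_simps by auto
  then show "\<zero>\<^bsub>group_H1 G\<^esub> \<oplus>\<^bsub>group_H1 G\<^esub> A = A" by (simp add: H1_simps)
qed

lemma H1_finsum:
  assumes "finite F" "\<And>C. C \<in> F \<Longrightarrow> r C \<in> C1 \<and> C = hcls (r C)"
  shows "(\<Oplus>\<^bsub>group_H1 G\<^esub>C\<in>F. k C \<odot>\<^bsub>group_H1 G\<^esub> C) = hcls (\<Sum>C\<in>F. smul (k C) (r C))"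
  using assms
proof (induction F rule: finite_induct)
  interpret abelian_monoid "group_H1 G" by (rule abelian_monoid_H1)
  { case empty show ?case by (simp add: H1_simps) }
  { case (insert C F)
    have s: "k B \<odot>\<^bsub>group_H1 G\<^esub> B = hcls (smul (k B) (r B))" "hcls (smul (k B) (r B)) \<in> hcls ` C1" if "B \<in> insert C F" for B
    proof -
      have B: "r B \<in> C1" "B = hcls (r B)" using insert.prems that by auto
      show "k B \<odot>\<^bsub>group_H1 G\<^esub> B = hcls (smul (k B) (r B))" by (subst B(2)) (rule H1_simps(3))
      show "hcls (smul (k B) (r B)) \<in> hcls ` C1" using chain_space.subspace_scale[OF subspace_C1 B(1)] by blast
    qed
    have "(\<Oplus>\<^bsub>group_H1 G\<^esub>B\<in>insert C F. k B \<odot>\<^bsub>group_H1 G\<^esub> B) =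
        k C \<odot>\<^bsub>group_H1 G\<^esub> C \<oplus>\<^bsub>group_H1 G\<^esub> (\<Oplus>\<^bsub>group_H1 G\<^esub>B\<in>F. k B \<odot>\<^bsub>group_H1 G\<^esub> B)"
      using insert.hyps s by (intro finsum_insert) (auto simp: H1_simps(1))
    also have "(\<Oplus>\<^bsub>group_H1 G\<^esub>B\<in>F. k B \<odot>\<^bsub>group_H1 G\<^esub> B) = hcls (\<Sum>B\<in>F. smul (k B) (r B))"
      using insert.IH insert.prems by simp
    finally show ?case using insert.hyps s(1)[of C] by (simp add: H1_simps(2)) }
qed

section \<open>Additive functions as functionals on homology\<close>

definition hom_val :: "('g \<Rightarrow> complex) \<Rightarrow> ('g \<Rightarrow>\<^sub>0 complex) \<Rightarrow> complex" where
  "hom_val \<phi> = pm_ext (\<lambda>g a. a * \<phi> g)"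

lemma hom_val_simps:
  "hom_val \<phi> (a + b) = hom_val \<phi> a + hom_val \<phi> b" "hom_val \<phi> (Poly_Mapping.single g c) = c * \<phi> g"
  "hom_val \<phi> (a - b) = hom_val \<phi> a - hom_val \<phi> b" "hom_val \<phi> (\<Sum>x\<in>A. h x) = (\<Sum>x\<in>A. hom_val \<phi> (h x))"
proof -
  show add: "hom_val \<phi> (a + b) = hom_val \<phi> a + hom_val \<phi> b" for a b
    unfolding hom_val_def by (rule pm_ext_add) (auto simp: algebra_simps)
  show "hom_val \<phi> (Poly_Mapping.single g c) = c * \<phi> g" unfolding hom_val_def by (rule pm_ext_single) simp
  show "hom_val \<phi> (a - b) = hom_val \<phi> a - hom_val \<phi> b" using add[of "a - b" b] by simp
  have "hom_val \<phi> 0 = 0" using add[of 0 0] by simp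
  then show "hom_val \<phi> (\<Sum>x\<in>A. h x) = (\<Sum>x\<in>A. hom_val \<phi> (h x))"
    by (induction A rule: infinite_finite_induct) (auto simp: add)
qed

lemma hom_val_boundary:
  assumes "additive_on G \<phi>" "b \<in> boundaries"
  shows "hom_val \<phi> b = 0"
proof -
  obtain c where c: "b = pm_ext bar_term c" "Poly_Mapping.keys c \<subseteq> carrier G \<times> carrier G"
    using assms(2) unfolding boundaries_def bar_d2_pm_ext by auto
  have "hom_val \<phi> (bar_term k (Poly_Mapping.lookup c k)) = 0" if "k \<in> Poly_Mapping.keys c" for k
    using assms(1) that c(2)
    by (auto simp: bar_term_def hom_val_simps additive_on_def algebra_simps split: prod.splits)
  then show ?thesis unfolding c(1) pm_ext_def hom_val_simps by (intro sum.neutral) blast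
qed

lemma two_le_vdim_H1:
  assumes a: "a \<in> C1" "b \<in> C1" and ind: "\<And>c d. smul c a + smul d b \<in> boundaries \<Longrightarrow> c = 0 \<and> d = 0"
  shows "2 \<le> vdim (group_H1 G)"
proof -
  have ne: "hcls a \<noteq> hcls b"
  proof
    assume "hcls a = hcls b"
    then have "smul 1 a + smul (-1) b \<in> boundaries" by (simp add: hcls_eq chain_space.scale_minus_left)
    from ind[OF this] show False by simp
  qed
  define r where "r C = (if C = hcls a then a else b)" for C
  have li: "lin_indep (group_H1 G) {hcls a, hcls b}"
    unfolding lin_indep_def
  proof (intro allI impI)
    fix c assume c: "(\<Oplus>\<^bsub>group_H1 G\<^esub>v\<in>{hcls a, hcls b}. c v \<odot>\<^bsub>group_H1 G\<^esub> v) = \<zero>\<^bsub>group_H1 G\<^esub>"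
    have "(\<Oplus>\<^bsub>group_H1 G\<^esub>v\<in>{hcls a, hcls b}. c v \<odot>\<^bsub>group_H1 G\<^esub> v) = hcls (\<Sum>C\<in>{hcls a, hcls b}. smul (c C) (r C))"
      using a by (intro H1_finsum) (auto simp: r_def)
    moreover have "r (hcls a) = a" "r (hcls b) = b" using ne by (auto simp: r_def)
    ultimately have "hcls (smul (c (hcls a)) a + smul (c (hcls b)) b) = hcls 0"
      using c ne by (simp add: H1_simps(4))
    then have "smul (c (hcls a)) a + smul (c (hcls b)) b \<in> boundaries" by (simp add: hcls_eq)
    from ind[OF this] show "\<forall>v\<in>{hcls a, hcls b}. c v = 0" by simp
  qed
  have "enat (card {hcls a, hcls b}) \<le> vdim (group_H1 G)"
    unfolding vdim_def using li a by (intro SUP_upper) (auto simp: H1_simps(1))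
  then show ?thesis using ne by (simp add: numeral_eq_enat numeral_2_eq_2)
qed

text \<open>If the values of two additive functions at g0 and x had a nonzero determinant, the
  classes of g0 and x would be independent in homology. The constant depends on x and not on \<phi>,
  as \<open>quadratic_function\<close> requires.\<close>

lemma additive_on_proportional:
  assumes n: "vdim (group_H1 G) < 2"
  shows "\<exists>g0\<in>carrier G. \<forall>x\<in>carrier G. \<exists>c. \<forall>\<phi>. additive_on G \<phi> \<longrightarrow> \<phi> x = c * \<phi> g0"
proof (cases "\<forall>\<phi>. additive_on G \<phi> \<longrightarrow> (\<forall>x\<in>carrier G. \<phi> x = 0)")
  case True
  then show ?thesis by (intro bexI[of _ "\<one>\<^bsub>G\<^esub>"] ballI exI[of _ 0] allI impI) simp_all
next
  case False
  then obtain \<phi>1 g0 where \<phi>1: "additive_on G \<phi>1" "g0 \<in> carrier G" "\<phi>1 g0 \<noteq> 0" by blast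
  have "\<phi> x = \<phi>1 x / \<phi>1 g0 * \<phi> g0" if x: "x \<in> carrier G" and \<phi>: "additive_on G \<phi>" for x \<phi>
  proof (rule ccontr)
    assume ne: "\<phi> x \<noteq> \<phi>1 x / \<phi>1 g0 * \<phi> g0"
    have "2 \<le> vdim (group_H1 G)"
    proof (rule two_le_vdim_H1)
      show "Poly_Mapping.single g0 1 \<in> C1" "Poly_Mapping.single x 1 \<in> C1" using x \<phi>1 by (auto simp: C1_def)
      fix c d assume "smul c (Poly_Mapping.single g0 1) + smul d (Poly_Mapping.single x 1) \<in> boundaries"
      from hom_val_boundary[OF \<phi> this] hom_val_boundary[OF \<phi>1(1) this]
      have e: "c * \<phi> g0 + d * \<phi> x = 0" "c * \<phi>1 g0 + d * \<phi>1 x = 0" by (simp_all add: smul_single hom_val_simps)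
      have "d * (\<phi> x * \<phi>1 g0 - \<phi>1 x * \<phi> g0) = 0" by (rule eliminate_coefficient[OF e])
      moreover have "\<phi> x * \<phi>1 g0 - \<phi>1 x * \<phi> g0 \<noteq> 0" using ne \<phi>1(3) by (simp add: field_simps)
      ultimately have "d = 0" by simp
      then show "c = 0 \<and> d = 0" using e(2) \<phi>1(3) by simp
    qed
    then show False using n by simp
  qed
  note proportional = this
  show ?thesis
  proof (intro bexI[OF _ \<phi>1(2)] ballI)
    fix x assume "x \<in> carrier G"
    then show "\<exists>c. \<forall>\<phi>. additive_on G \<phi> \<longrightarrow> \<phi> x = c * \<phi> g0"
      using proportional by (intro exI[of _ "\<phi>1 x / \<phi>1 g0"]) simp
  qed
qed

text \<open>An independent set \<open>S\<close> spanning the boundaries is extended by single group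
  elements to a basis of the 1-chains. Coordinate functions of the new basis elements vanish on the
  boundaries, hence are additive, and they are dual to actual group elements rather than to
  combinations of them.\<close>

lemma additive_on_dual_triple:
  assumes n: "2 < vdim (group_H1 G)"
  shows "\<exists>(g :: nat \<Rightarrow> 'g) (\<phi> :: nat \<Rightarrow> 'g \<Rightarrow> complex). (\<forall>i<3. g i \<in> carrier G \<and> additive_on G (\<phi> i)) \<and> (\<forall>i<3. \<forall>j<3. \<phi> i (g j) = (if i = j then 1 else (0::complex)))"
proof -
  let ?e = "\<lambda>g. Poly_Mapping.single g (1 :: complex)"
  obtain S where S: "S \<subseteq> boundaries" "chain_space.independent S" "boundaries \<subseteq> chain_space.span S"
    using chain_space.basis_exists[of boundaries] by metis
  obtain B where B: "S \<subseteq> B" "B \<subseteq> S \<union> ?e ` carrier G" "chain_space.independent B" "S \<union> ?e ` carrier G \<subseteq> chain_space.span B"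
    using chain_space.maximal_independent_subset_extend[of S "S \<union> ?e ` carrier G"] S(2) by blast
  define N where "N = B - S"
  have SN: "B = S \<union> N" using B by (auto simp: N_def)
  \<comment> \<open>If \<open>N\<close> had at most two elements, their classes would span the
    homology, and more than two classes would be dependent.\<close>
  have Nf: "\<not> (finite N \<and> card N \<le> 2)"
  proof
    assume N: "finite N \<and> card N \<le> 2"
    obtain F where F: "finite F" "F \<subseteq> carrier (group_H1 G)" "lin_indep (group_H1 G) F" "2 < card F"
      using n unfolding vdim_def less_SUP_iff by (auto simp: numeral_eq_enat)
    define r where "r C = (SOME a. a \<in> C1 \<and> C = hcls a)" for C
    have r: "r C \<in> C1 \<and> C = hcls (r C)" if "C \<in> F" for C
    proof -
      have "\<exists>a. a \<in> C1 \<and> C = hcls a" using that F(2) unfolding H1_simps by blast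
      then show ?thesis unfolding r_def by (rule someI_ex)
    qed
    have spS: "chain_space.span S \<subseteq> boundaries" using S(1) subspace_boundaries by (rule chain_space.span_minimal)
    have ex: "\<exists>u. a - (\<Sum>b\<in>N. smul (u b) b) \<in> boundaries" if "a \<in> C1" for a
    proof -
      have "?e ` carrier G \<subseteq> chain_space.span B" using B(4) by blast
      then have "chain_space.span (?e ` carrier G) \<subseteq> chain_space.span B"
        using chain_space.span_mono chain_space.span_span by metis
      then have "a \<in> chain_space.span (S \<union> N)" using C1_sum_singles[OF that] SN by blast
      then obtain s u where "s \<in> chain_space.span S" "a = s + (\<Sum>b\<in>N. smul (u b) b)"
        unfolding chain_space.span_Un using chain_space.span_finite[of N] N by auto
      then show ?thesis using spS by (intro exI[of _ u]) auto
    qed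
    define u where "u C = (SOME u. r C - (\<Sum>b\<in>N. smul (u b) b) \<in> boundaries)" for C
    have u: "r C - (\<Sum>b\<in>N. smul (u C b) b) \<in> boundaries" if "C \<in> F" for C
      unfolding u_def using ex r[OF that] by (intro someI_ex[of "\<lambda>u. r C - (\<Sum>b\<in>N. smul (u b) b) \<in> boundaries"]) blast
    obtain e where e: "bij_betw e {..<card N} N" using ex_bij_betw_nat_finite[of N] N by (auto simp: atLeast0LessThan)
    have "is_prime {0 :: complex}" by (auto simp: is_prime_def ideal_in_def)
    then obtain c where c: "\<exists>C\<in>F. c C \<noteq> 0" "\<forall>j<card N. (\<Sum>C\<in>F. c C * u C (e j)) = 0"
      using linear_dependence[of "{0 :: complex}" F "card N" "\<lambda>C j. u C (e j)"] F(1,4) N by auto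
    have c0: "(\<Sum>C\<in>F. c C * u C b) = 0" if "b \<in> N" for b
    proof -
      have "b \<in> e ` {..<card N}" using that bij_betw_imp_surj_on[OF e] by simp
      then obtain j where "j < card N" "b = e j" by blast
      then show ?thesis using c(2) by simp
    qed
    have "(\<Sum>C\<in>F. smul (c C) (r C - (\<Sum>b\<in>N. smul (u C b) b))) \<in> boundaries"
      using u by (intro chain_space.subspace_sum[OF subspace_boundaries] chain_space.subspace_scale[OF subspace_boundaries])
    moreover have "(\<Sum>C\<in>F. smul (c C) (\<Sum>b\<in>N. smul (u C b) b)) = (\<Sum>b\<in>N. smul (\<Sum>C\<in>F. c C * u C b) b)"
    proof -
      have "(\<Sum>C\<in>F. smul (c C) (\<Sum>b\<in>N. smul (u C b) b)) = (\<Sum>C\<in>F. \<Sum>b\<in>N. smul (c C * u C b) b)"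
        by (simp add: chain_space.scale_sum_right)
      also have "\<dots> = (\<Sum>b\<in>N. \<Sum>C\<in>F. smul (c C * u C b) b)" by (rule sum.swap)
      finally show ?thesis by (simp add: chain_space.scale_sum_left)
    qed
    then have "(\<Sum>C\<in>F. smul (c C) (\<Sum>b\<in>N. smul (u C b) b)) = 0" using c0 by simp
    ultimately have "(\<Sum>C\<in>F. smul (c C) (r C)) \<in> boundaries"
      by (simp add: chain_space.scale_right_diff_distrib sum_subtractf)
    then have "(\<Oplus>\<^bsub>group_H1 G\<^esub>C\<in>F. c C \<odot>\<^bsub>group_H1 G\<^esub> C) = \<zero>\<^bsub>group_H1 G\<^esub>"
      using H1_finsum[OF F(1), of r c] r by (simp add: H1_simps(4) hcls_eq)
    then show False using F(3) c(1) unfolding lin_indep_def by blast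
  qed
  obtain M where M: "M \<subseteq> N" "card M = 3"
  proof (cases "finite N")
    case True
    then have "3 \<le> card N" using Nf by simp
    then show ?thesis using obtain_subset_with_card_n that by metis
  next
    case False
    then show ?thesis using infinite_arbitrarily_large[of N 3] that by blast
  qed
  then have "finite M" using card.infinite by force
  then obtain e where "bij_betw e {0..<card M} M" using ex_bij_betw_nat_finite by blast
  then have e: "bij_betw e {..<3} M" using M(2) by (simp add: atLeast0LessThan)
  have eN: "e i \<in> N" if "i < 3" for i using e M(1) that by (auto simp: bij_betw_def)
  have "\<exists>g\<in>carrier G. e i = ?e g" if "i < 3" for i using eN[OF that] B(2) by (auto simp: N_def)
  then obtain g where g: "\<And>i. i < 3 \<Longrightarrow> g i \<in> carrier G \<and> e i = ?e (g i)" by metis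
  have "\<exists>h. Vector_Spaces.linear smul (*) h \<and> (\<forall>x\<in>B. h x = (if x = e i then 1 else 0 :: complex))" for i
    by (rule chain_space_pair.linear_independent_extend[OF B(3)])
  then obtain h where h: "\<And>i. Vector_Spaces.linear smul (*) (h i)"
    "\<And>i x. x \<in> B \<Longrightarrow> h i x = (if x = e i then 1 else 0 :: complex)" by metis
  have hb: "h i b = 0" if i: "i < 3" and b: "b \<in> boundaries" for i b
  proof (rule chain_space_pair.linear_eq_0_on_span[OF h(1)])
    show "b \<in> chain_space.span S" using b S(3) by blast
    fix x assume "x \<in> S"
    then have "x \<in> B" "x \<noteq> e i" using SN eN[OF i] unfolding N_def by blast+
    then show "h i x = 0" using h(2)[of x i] by simp
  qed
  define \<phi> where "\<phi> i y = h i (?e y)" for i y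
  have "additive_on G (\<phi> i)" if i: "i < 3" for i
    unfolding additive_on_def
  proof (intro ballI)
    fix x y assume "x \<in> carrier G" "y \<in> carrier G"
    then have "h i (bar_term (x, y) 1) = 0" by (intro hb[OF i] bar_term_boundary)
    then show "\<phi> i (x \<otimes>\<^bsub>G\<^esub> y) = \<phi> i x + \<phi> i y"
      unfolding bar_term_def prod.case \<phi>_def chain_space_pair.linear_add[OF h(1)] chain_space_pair.linear_diff[OF h(1)]
      by (simp add: algebra_simps)
  qed
  moreover have "\<phi> i (g j) = (if i = j then 1 else 0)" if "i < 3" "j < 3" for i j
  proof -
    have "e j \<in> B" using eN[OF that(2)] SN by blast
    moreover have "e j = e i \<longleftrightarrow> i = j" using e that by (auto simp: bij_betw_def inj_on_def)
    ultimately show ?thesis using h(2)[of "e j" i] g[OF that(2)] by (simp add: \<phi>_def)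
  qed
  ultimately have 1: "\<forall>i<3. g i \<in> carrier G \<and> additive_on G (\<phi> i)" and
      2: "\<forall>i<3. \<forall>j<3. \<phi> i (g j) = (if i = j then 1 else 0)" using g by simp_all
  show ?thesis by (rule exI[of _ g], rule exI[of _ \<phi>], rule conjI[OF 1 2])
qed

end

section \<open>The ring generated by the traces\<close>

text \<open>\<open>rational_point\<close> works in a ring given by a type; with the trace algebra as
  a type, X(\<Gamma>) is presented by the contraction of the relation ideal to it.\<close>

typedef 'i trace_ring = "trace_alg :: 'i mpoly set" morphisms tr_poly Tr
  using trace_alg_0 by blast

instantiation trace_ring :: (type) comm_ring_1
begin

definition zero_trace_ring_def: "0 = Tr 0"
definition one_trace_ring_def: "1 = Tr 1"
definition plus_trace_ring_def: "a + b = Tr (tr_poly a + tr_poly b)"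
definition minus_trace_ring_def: "a - b = Tr (tr_poly a - tr_poly b)"
definition uminus_trace_ring_def: "- a = Tr (- tr_poly a)"
definition times_trace_ring_def: "a * b = Tr (tr_poly a * tr_poly b)"

lemma tr_poly_ops: "tr_poly (0 :: 'a trace_ring) = 0" "tr_poly (1 :: 'a trace_ring) = 1"
  "tr_poly (a + b :: 'a trace_ring) = tr_poly a + tr_poly b" "tr_poly (a - b :: 'a trace_ring) = tr_poly a - tr_poly b"
  "tr_poly (- a :: 'a trace_ring) = - tr_poly a" "tr_poly (a * b :: 'a trace_ring) = tr_poly a * tr_poly b"
  using tr_poly[of a] tr_poly[of b]
  by (simp_all add: zero_trace_ring_def one_trace_ring_def plus_trace_ring_def minus_trace_ring_def
      uminus_trace_ring_def times_trace_ring_def Tr_inverse trace_alg_0 trace_alg_1 trace_alg_add trace_alg_diff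
      trace_alg_uminus trace_alg_mult)

instance
  by standard (simp_all add: tr_poly_inject[symmetric] tr_poly_ops algebra_simps)

end

lemma tr_poly_2: "tr_poly 2 = 2"
  unfolding one_add_one[symmetric] tr_poly_ops ..

definition tr_const :: "complex \<Rightarrow> 'i trace_ring" where "tr_const c = Tr (Const c)"
definition tr_word :: "('i \<times> bool) list \<Rightarrow> 'i trace_ring" where "tr_word w = Tr (trace (word_mat w))"

lemma tr_poly_simps [simp]: "tr_poly (tr_const c) = Const c" "tr_poly (tr_word w) = trace (word_mat w)"
  by (simp_all add: tr_const_def tr_word_def Tr_inverse trace_alg_Const trace_alg_trace)

lemma tr_const_hom: "tr_const (c + d) = tr_const c + tr_const d" "tr_const (c * d) = tr_const c * tr_const d" "tr_const 1 = 1"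
  by (simp_all add: tr_poly_inject[symmetric] tr_poly_ops Const_simps)

lemma tr_const_2: "tr_const 2 = 2"
  unfolding one_add_one[symmetric] tr_const_hom ..

lemma trace_ring_induct [case_names const word add mult]:
  assumes "\<And>c. P (tr_const c)" "\<And>w. P (tr_word w)" "\<And>a b. P a \<Longrightarrow> P b \<Longrightarrow> P (a + b)" "\<And>a b. P a \<Longrightarrow> P b \<Longrightarrow> P (a * b)"
  shows "P a"
proof -
  have "P (Tr p)" if "p \<in> trace_alg" for p
    using that
  proof (induction p rule: trace_alg.induct)
    case (trace_alg_Const c) then show ?case using assms(1)[of c] by (simp add: tr_const_def)
  next
    case (trace_alg_trace w) then show ?case using assms(2)[of w] by (simp add: tr_word_def)
  next
    case (trace_alg_add p q) then show ?case using assms(3)[of "Tr p" "Tr q"] by (simp add: plus_trace_ring_def Tr_inverse)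
  next
    case (trace_alg_mult p q) then show ?case using assms(4)[of "Tr p" "Tr q"] by (simp add: times_trace_ring_def Tr_inverse)
  qed
  from this[OF tr_poly[of a]] show ?thesis by (simp add: tr_poly_inverse)
qed

text \<open>Valid before det = 1 is imposed, because \<open>inv_word\<close> stands for the
  adjugate. This identity is the source of the functional equation for quadratic functions.\<close>

lemma tr_word_product: "tr_word u * tr_word v = tr_word (u @ v) + tr_word (u @ inv_word v)"
  by (simp add: tr_poly_inject[symmetric] tr_poly_ops trace_product word_mat_append adjugate2_word_mat)

text \<open>The factor 2 avoids the determinant: 2 det(x) is tr(x)^2 - tr(x^2), which stays inside
  the trace algebra.\<close>

lemma tr_word_repeated_letter:
  "2 * tr_word (xs @ [a] @ ys @ [a] @ zs) = 2 * tr_word ([a] @ ys) * tr_word ([a] @ zs @ xs)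
     - (tr_word [a] * tr_word [a] - tr_word ([a] @ [a])) * tr_word (ys @ inv_word (zs @ xs))"
proof -
  have "trace (word_mat (xs @ [a] @ ys @ [a] @ zs)) = trace (word_mat ([a] @ ys @ [a] @ zs) ** word_mat xs)"
    unfolding word_mat_append[of xs] by (rule trace2_mult_commute)
  also have "\<dots> = trace (word_mat [a] ** word_mat ys ** word_mat [a] ** word_mat (zs @ xs))"
    by (simp only: word_mat_append matrix_mul_assoc)
  finally have e: "trace (word_mat (xs @ [a] @ ys @ [a] @ zs)) = trace (word_mat [a] ** word_mat ys ** word_mat [a] ** word_mat (zs @ xs))" .
  show ?thesis
    unfolding tr_poly_inject[symmetric] tr_poly_ops tr_poly_simps tr_poly_2 e trace_repeated_letter
    by (simp only: word_mat_append adjugate2_word_mat[symmetric])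
qed

lemma trace_ring_generated: "\<exists>ys. adjoin_list (range tr_const) ys = (UNIV :: 'i::finite trace_ring set)"
proof -
  define N where "N = card (UNIV :: ('i \<times> bool) set)"
  \<comment> \<open>A word longer than \<open>N\<close> repeats a letter. That \<open>N\<close> is
    at least 2 ensures that \<open>[a] @ [a]\<close>, which the reduction produces, is shorter than
    the word being reduced.\<close>
  have "1 \<le> CARD('i)" by (simp add: Suc_leI)
  then have N2: "2 \<le> N" by (simp add: N_def card_prod)
  have "finite {w :: ('i \<times> bool) list. length w \<le> N}"
    using finite_lists_length_le[of "UNIV :: ('i \<times> bool) set" N] by simp
  then obtain L where L: "set L = {w :: ('i \<times> bool) list. length w \<le> N}" using finite_list by blast
  define T where "T = adjoin_list (range tr_const) (map tr_word L)"
  have z: "tr_const 0 = 0" using tr_const_hom(1)[of 0 0] by simp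
  have um: "tr_const (c - d) = tr_const c - tr_const d" for c d using tr_const_hom(1)[of "c - d" d, symmetric] by (simp add: eq_diff_eq)
  have S: "subring_of (range tr_const)"
    unfolding subring_of_def using z[symmetric] tr_const_hom(3)[symmetric]
    by (auto simp: tr_const_hom(1,2)[symmetric] um[symmetric])
  have T: "subring_of T" unfolding T_def by (rule subring_of_adjoin_list[OF S])
  have Tc: "tr_const c \<in> T" for c unfolding T_def using adjoin_list_superset(1)[OF S] by blast
  have T2: "2 \<in> T" using Tc[of 2] by (simp add: tr_const_2)
  have Top: "a + b \<in> T" "a - b \<in> T" "a * b \<in> T" if "a \<in> T" "b \<in> T" for a b using T that by (auto simp: subring_of_def)
  have Tw: "tr_word w \<in> T" for w
  proof (induction w rule: length_induct)
    case (1 w)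
    show ?case
    proof (cases "length w \<le> N")
      case True
      then have "tr_word w \<in> set (map tr_word L)" using L by auto
      then show ?thesis unfolding T_def using adjoin_list_superset(2)[OF S] by blast
    next
      case False
      have "\<not> distinct w"
      proof
        assume "distinct w"
        then have "length w = card (set w)" by (simp add: distinct_card)
        also have "\<dots> \<le> N" unfolding N_def by (rule card_mono) auto
        finally show False using False by simp
      qed
      then obtain xs ys zs a where w: "w = xs @ [a] @ ys @ [a] @ zs" using not_distinct_decomp by blast
      have IH: "tr_word v \<in> T" if "length v < length w" for v using 1 that by blast
      have lw: "2 < length w" using False N2 by simp
      have "tr_word ([a] @ ys) \<in> T" "tr_word ([a] @ zs @ xs) \<in> T" "tr_word [a] \<in> T" "tr_word ([a] @ [a]) \<in> T"
        "tr_word (ys @ inv_word (zs @ xs)) \<in> T"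
        by (rule IH; use lw w in \<open>simp add: inv_word_def\<close>)+
      then have "2 * tr_word w \<in> T" unfolding w tr_word_repeated_letter by (intro Top T2)
      then have "tr_const (1 / 2) * (2 * tr_word w) \<in> T" by (rule Top(3)[OF Tc])
      also have "tr_const (1 / 2) * (2 * tr_word w) = tr_const (1 / 2 * 2) * tr_word w"
        by (simp only: tr_const_hom(2) tr_const_2 mult.assoc)
      also have "\<dots> = tr_word w" by (simp add: tr_const_hom)
      finally show ?thesis .
    qed
  qed
  have "a \<in> T" for a by (induction a rule: trace_ring_induct) (use Tc Tw Top in auto)
  then show ?thesis unfolding T_def by blast
qed

section \<open>The character scheme\<close>

lemma mpoly_alg_simps: "carrier mpoly_alg = UNIV" "p \<oplus>\<^bsub>mpoly_alg\<^esub> q = p + q" "p \<otimes>\<^bsub>mpoly_alg\<^esub> q = p * q"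
  "\<one>\<^bsub>mpoly_alg\<^esub> = 1" "\<zero>\<^bsub>mpoly_alg\<^esub> = 0" "c \<odot>\<^bsub>mpoly_alg\<^esub> p = Const c * p"
  by (simp_all add: mpoly_alg_def ring_of_type_algebra_def ring.defs module.defs)

lemma cring_of_surj:
  fixes \<pi> :: "'a::comm_ring_1 \<Rightarrow> 'b" and R :: "('b, 'c) ring_scheme"
  assumes c: "carrier R = range \<pi>" and p: "\<And>a b. \<pi> (a + b) = \<pi> a \<oplus>\<^bsub>R\<^esub> \<pi> b" "\<And>a b. \<pi> (a * b) = \<pi> a \<otimes>\<^bsub>R\<^esub> \<pi> b"
    "\<pi> 1 = \<one>\<^bsub>R\<^esub>" "\<pi> 0 = \<zero>\<^bsub>R\<^esub>"
  shows "cring R"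
proof (rule cringI)
  show "abelian_group R"
  proof (rule abelian_groupI; unfold c)
    fix x assume "x \<in> range \<pi>"
    then obtain a where "x = \<pi> a" by blast
    then have "\<pi> (- a) \<oplus>\<^bsub>R\<^esub> x = \<zero>\<^bsub>R\<^esub>" by (simp add: p[symmetric])
    then show "\<exists>y\<in>range \<pi>. y \<oplus>\<^bsub>R\<^esub> x = \<zero>\<^bsub>R\<^esub>" by blast
  qed (auto simp: p[symmetric] ac_simps)
  show "comm_monoid R" by (rule comm_monoidI; unfold c) (auto simp: p[symmetric] ac_simps)
qed (unfold c, auto simp: p[symmetric] algebra_simps)

lemma cring_mpoly_alg: "cring mpoly_alg"
  by (rule cring_of_surj[where \<pi> = "\<lambda>x. x"]) (simp_all add: mpoly_alg_simps)

lemma ideal_mpoly_alg: "ideal I mpoly_alg \<longleftrightarrow> is_ideal I"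
proof
  assume "ideal I mpoly_alg"
  then interpret ideal I mpoly_alg .
  show "is_ideal I"
    unfolding ideal_in_def
    using additive_subgroup.a_closed[OF is_additive_subgroup] additive_subgroup.zero_closed[OF is_additive_subgroup] I_l_closed
    by (simp add: mpoly_alg_simps)
next
  assume I: "is_ideal I"
  interpret P: cring mpoly_alg by (rule cring_mpoly_alg)
  have inv: "inv\<^bsub>add_monoid mpoly_alg\<^esub> p = - p" for p
    using P.minus_equality[of "- p" p] by (simp add: mpoly_alg_simps a_inv_def)
  have "subgroup I (add_monoid mpoly_alg)"
  proof (rule subgroup.intro)
    show "x \<otimes>\<^bsub>add_monoid mpoly_alg\<^esub> y \<in> I" if "x \<in> I" "y \<in> I" for x y
      using is_idealD(2)[OF I that] by (simp add: mpoly_alg_simps)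
    show "inv\<^bsub>add_monoid mpoly_alg\<^esub> x \<in> I" if "x \<in> I" for x unfolding inv by (rule is_idealD(5)[OF I that])
  qed (simp_all add: mpoly_alg_simps is_idealD(1)[OF I])
  then show "ideal I mpoly_alg"
    by (rule idealI[OF P.ring_axioms]) (use is_idealD(3,4)[OF I] in \<open>auto simp: mpoly_alg_simps\<close>)
qed

definition rep_gens :: "('g, 'm) monoid_scheme \<Rightarrow> ('i \<Rightarrow> 'g) \<Rightarrow> 'i mpoly set" where
  "rep_gens G \<gamma> = {det (gen_mat l) - 1 | l. True} \<union> {ent (word_mat w - mat 1) i j | w i j. word_val G \<gamma> w = \<one>\<^bsub>G\<^esub>}"

lemma rep_ideal_gens: "rep_ideal G \<gamma> = \<Inter>{I. is_ideal I \<and> rep_gens G \<gamma> \<subseteq> I}"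
  unfolding rep_ideal_def genideal_def ideal_mpoly_alg rep_gens_def ..

lemma is_ideal_rep_ideal: "is_ideal (rep_ideal G \<gamma>)"
  unfolding rep_ideal_gens ideal_in_def by auto

lemma rep_ideal_least: "is_ideal K \<Longrightarrow> rep_gens G \<gamma> \<subseteq> K \<Longrightarrow> rep_ideal G \<gamma> \<subseteq> K"
  unfolding rep_ideal_gens by blast

lemma rep_gens_in: "p \<in> rep_gens G \<gamma> \<Longrightarrow> p \<in> rep_ideal G \<gamma>"
  unfolding rep_ideal_gens by blast

lemma det_gen_in_rep_ideal: "det (gen_mat l) - 1 \<in> rep_ideal G \<gamma>"
  by (rule rep_gens_in) (auto simp: rep_gens_def)

lemma relation_in_rep_ideal: "word_val G \<gamma> w = \<one>\<^bsub>G\<^esub> \<Longrightarrow> ent (word_mat w - mat 1) i j \<in> rep_ideal G \<gamma>"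
  by (rule rep_gens_in) (auto simp: rep_gens_def)

abbreviation cmat :: "complex^2^2 \<Rightarrow> 'i mpoly^2^2" where "cmat \<equiv> mat_map Const"

section \<open>Conjugation, words and the relation ideal\<close>

lemma conj_act_hom: "ring_hom_map (conj_act s)"
  unfolding conj_act_def msubst_evalp by (rule ring_hom_map_evalp[OF ring_hom_map_Const])

lemma conj_act_Const: "conj_act s (Const c) = Const c"
  unfolding conj_act_def msubst_evalp by (rule evalp_Const[OF ring_hom_map_Const])

lemma conj_act_gen_mat: "det s = 1 \<Longrightarrow> mat_map (conj_act s) (gen_mat l) = cmat (adjugate2 s) ** gen_mat l ** cmat s"
  by (subst vec2_eq_iff, unfold mat_map_nth)
    (simp add: gen_mat_def conj_act_def msubst_evalp evalp_Var[OF ring_hom_map_Const] matrix_inv_SL2 mat_map_def)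

lemma cmat_adjugate2:
  assumes "det s = 1"
  shows "cmat s ** cmat (adjugate2 s) = mat 1" "cmat (adjugate2 s) ** cmat s = mat 1"
proof -
  have "s ** adjugate2 s = mat 1" "adjugate2 s ** s = mat 1" unfolding mult_adjugate2 assms by (simp_all add: mat_def)
  then show "cmat s ** cmat (adjugate2 s) = mat 1" "cmat (adjugate2 s) ** cmat s = mat 1"
    by (simp_all add: mat_map_hom[OF ring_hom_map_Const, symmetric])
qed

lemma conj_act_word_mat:
  assumes s: "det s = 1"
  shows "mat_map (conj_act s) (word_mat w) = cmat (adjugate2 s) ** word_mat w ** cmat s"
proof (induction w)
  case Nil
  then show ?case by (simp add: mat_map_hom[OF conj_act_hom] cmat_adjugate2[OF s])
next
  case (Cons x w)
  obtain l e where x: "x = (l, e)" by (cases x)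
  define A where "A = (if e then gen_mat l else adjugate2 (gen_mat l))"
  have A: "mat_map (conj_act s) A = cmat (adjugate2 s) ** A ** cmat s"
    by (simp add: A_def conj_act_gen_mat[OF s] mat_map_hom[OF conj_act_hom] adjugate2_mult
        mat_map_hom[OF ring_hom_map_Const, symmetric] adjugate2_adjugate2 matrix_mul_assoc)
  have "mat_map (conj_act s) (word_mat (x # w)) =
      cmat (adjugate2 s) ** A ** (cmat s ** cmat (adjugate2 s)) ** word_mat w ** cmat s"
    unfolding x word_mat_Cons A_def[symmetric] mat_map_hom(1)[OF conj_act_hom] A Cons by (simp only: matrix_mul_assoc)
  also have "\<dots> = cmat (adjugate2 s) ** word_mat (x # w) ** cmat s"
    unfolding cmat_adjugate2[OF s] x word_mat_Cons A_def[symmetric] by (simp add: matrix_mul_assoc)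
  finally show ?case .
qed

lemma conj_act_trace_alg:
  assumes s: "det s = 1" and p: "p \<in> trace_alg"
  shows "conj_act s p = p"
  using p
proof (induction p rule: trace_alg.induct)
  case (trace_alg_trace w)
  have "conj_act s (trace (word_mat w)) = trace ((cmat (adjugate2 s) ** word_mat w) ** cmat s)"
    unfolding mat_map_hom(4)[OF conj_act_hom] conj_act_word_mat[OF s] ..
  also have "\<dots> = trace (cmat s ** (cmat (adjugate2 s) ** word_mat w))" by (rule trace2_mult_commute)
  also have "\<dots> = trace (word_mat w)" unfolding matrix_mul_assoc cmat_adjugate2[OF s] by simp
  finally show ?case .
qed (simp_all add: conj_act_Const ring_hom_mapD[OF conj_act_hom])

lemma is_ideal_vimage:
  assumes h: "ring_hom_map h" and I: "is_ideal I"
  shows "is_ideal {x. h x \<in> I}"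
  unfolding ideal_in_def[of UNIV "{x. h x \<in> I}"]
  by (simp add: ring_hom_mapD[OF h] is_idealD(1)[OF I] is_idealD(2)[OF I] is_idealD(3)[OF I])

lemma conj_act_rep_ideal:
  assumes s: "det s = 1" and p: "p \<in> rep_ideal G \<gamma>"
  shows "conj_act s p \<in> rep_ideal G \<gamma>"
proof -
  note I = is_ideal_rep_ideal[of G \<gamma>]
  let ?K = "{x. conj_act s x \<in> rep_ideal G \<gamma>}"
  have "rep_ideal G \<gamma> \<subseteq> ?K"
  proof (rule rep_ideal_least[OF is_ideal_vimage[OF conj_act_hom I]], rule subsetI)
    fix x assume "x \<in> rep_gens G \<gamma>"
    then consider l where "x = det (gen_mat l) - 1" | w i j where "x = ent (word_mat w - mat 1) i j" "word_val G \<gamma> w = \<one>\<^bsub>G\<^esub>"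
      unfolding rep_gens_def by blast
    then show "x \<in> ?K"
    proof cases
      case 1
      have "det (cmat (adjugate2 s)) * det (cmat s) = det (cmat (adjugate2 s) ** cmat s)" by (rule det2_mult[symmetric])
      also have "\<dots> = 1" unfolding cmat_adjugate2[OF s] by (simp add: det_2 mat2_one)
      finally have d: "det (cmat (adjugate2 s)) * det (cmat s) = 1" .
      have "conj_act s (det (gen_mat l)) = det (cmat (adjugate2 s)) * det (gen_mat l) * det (cmat s)"
        unfolding mat_map_hom(5)[OF conj_act_hom] conj_act_gen_mat[OF s] det2_mult ..
      also have "\<dots> = det (gen_mat l) * (det (cmat (adjugate2 s)) * det (cmat s))" by (simp only: ac_simps)
      finally have "conj_act s (det (gen_mat l)) = det (gen_mat l)" unfolding d by simp
      then show ?thesis using det_gen_in_rep_ideal[of l G \<gamma>] 1 by (simp add: ring_hom_mapD[OF conj_act_hom])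
    next
      case 2
      define E where "E = word_mat w - mat 1"
      have "mat_map (conj_act s) E = cmat (adjugate2 s) ** word_mat w ** cmat s - mat 1"
      proof -
        have "mat_map (conj_act s) E = mat_map (conj_act s) (word_mat w) - mat_map (conj_act s) (mat 1)"
          by (simp add: vec2_eq_iff E_def ring_hom_mapD[OF conj_act_hom])
        then show ?thesis unfolding conj_act_word_mat[OF s] mat_map_hom(3)[OF conj_act_hom] .
      qed
      also have "\<dots> = cmat (adjugate2 s) ** E ** cmat s"
      proof -
        have "cmat (adjugate2 s) ** E ** cmat s = cmat (adjugate2 s) ** word_mat w ** cmat s - cmat (adjugate2 s) ** cmat s"
          unfolding E_def by (simp add: vec2_eq_iff mat2_mult mat2_one algebra_simps)
        then show ?thesis unfolding cmat_adjugate2[OF s] by simp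
      qed
      finally have "conj_act s (ent E i j) = ent (cmat (adjugate2 s) ** E ** cmat s) i j"
        by (metis mat_map_nth)
      moreover have "ent E a b \<in> rep_ideal G \<gamma>" for a b unfolding E_def using 2(2) by (rule relation_in_rep_ideal)
      then have "ent (cmat (adjugate2 s) ** E ** cmat s) i j \<in> rep_ideal G \<gamma>"
        unfolding mat2_mult by (intro is_idealD(2,3,4)[OF I])
      ultimately show ?thesis using 2(1) by (simp add: E_def)
    qed
  qed
  then show ?thesis using p by blast
qed

text \<open>Invariance of a coset is an equality of sets; the inverse automorphism supplies the
  inclusion of the coset in its image.\<close>

lemma conj_act_inverse:
  assumes s: "det s = 1"
  shows "conj_act s (conj_act (adjugate2 s) p) = p"
proof -
  have s': "det (adjugate2 s) = 1" using s by (simp add: det_2 mult.commute)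
  have g: "mat_map (conj_act s) (mat_map (conj_act (adjugate2 s)) (gen_mat l)) = gen_mat l" for l
  proof -
    have c: "mat_map (conj_act s) (cmat A) = cmat A" for A by (simp add: vec2_eq_iff conj_act_Const)
    have "mat_map (conj_act s) (mat_map (conj_act (adjugate2 s)) (gen_mat l)) =
      (cmat s ** cmat (adjugate2 s)) ** gen_mat l ** (cmat s ** cmat (adjugate2 s))"
      unfolding conj_act_gen_mat[OF s'] mat_map_hom(1)[OF conj_act_hom] c conj_act_gen_mat[OF s] adjugate2_adjugate2
      by (simp only: matrix_mul_assoc)
    then show ?thesis unfolding cmat_adjugate2[OF s] by simp
  qed
  show ?thesis
  proof (induction p rule: mpoly_induct)
    case (Var x)
    obtain l i j where x: "x = (l, i, j)" by (cases x) auto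
    have "ent (mat_map (conj_act s) (mat_map (conj_act (adjugate2 s)) (gen_mat l))) i j = ent (gen_mat l) i j" unfolding g ..
    then show ?case by (simp add: x gen_mat_def mat_map_def)
  qed (simp_all add: conj_act_Const ring_hom_mapD[OF conj_act_hom])
qed

lemma word_val_Nil [simp]: "word_val G \<gamma> [] = \<one>\<^bsub>G\<^esub>"
  by (simp add: word_val_def)

lemma word_val_Cons: "word_val G \<gamma> ((l, e) # w) = (if e then \<gamma> l else inv\<^bsub>G\<^esub> \<gamma> l) \<otimes>\<^bsub>G\<^esub> word_val G \<gamma> w"
  by (simp add: word_val_def)

section \<open>Presentation of the character scheme by the trace ring\<close>

locale character_scheme = group G for G :: "('g, 'm) monoid_scheme" (structure) +
  fixes \<gamma> :: "'i::finite \<Rightarrow> 'g"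
  assumes gamma_closed: "range \<gamma> \<subseteq> carrier G" and gamma_generates: "generate G (range \<gamma>) = carrier G"
begin

abbreviation "I \<equiv> rep_ideal G \<gamma>"
abbreviation "val \<equiv> word_val G \<gamma>"

lemmas I = is_ideal_rep_ideal[of G \<gamma>]

definition rc :: "'i mpoly \<Rightarrow> 'i mpoly set" where "rc p = {q. q - p \<in> I}"

lemma rc_eq: "rc a = rc b \<longleftrightarrow> a - b \<in> I"
proof
  assume "rc a = rc b"
  moreover have "a \<in> rc a" using is_idealD(1)[OF I] by (simp add: rc_def)
  ultimately show "a - b \<in> I" by (simp add: rc_def)
next
  assume ab: "a - b \<in> I"
  have "c - a \<in> I \<longleftrightarrow> c - b \<in> I" for c
    using is_idealD(2)[OF I _ ab, of "c - a"] is_idealD(6)[OF I _ ab, of "c - b"] by auto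
  then show "rc a = rc b" by (simp add: rc_def)
qed

lemma rc_self: "p \<in> rc p"
  using is_idealD(1)[OF I] by (simp add: rc_def)

lemma coset_rc: "I +>\<^bsub>mpoly_alg\<^esub> p = rc p"
proof -
  have "I +>\<^bsub>mpoly_alg\<^esub> p = (\<lambda>w. w + p) ` I"
    by (auto simp: a_r_coset_def r_coset_def mpoly_alg_simps)
  also have "\<dots> = rc p"
  proof
    show "rc p \<subseteq> (\<lambda>w. w + p) ` I"
    proof
      fix b assume "b \<in> rc p"
      then show "b \<in> (\<lambda>w. w + p) ` I" by (intro image_eqI[of _ _ "b - p"]) (auto simp: rc_def)
    qed
  qed (auto simp: rc_def)
  finally show ?thesis .
qed

abbreviation "A \<equiv> rep_alg G \<gamma>"

lemma rep_alg_simps: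
  "carrier A = range rc" "rc p \<oplus>\<^bsub>A\<^esub> rc q = rc (p + q)" "rc p \<otimes>\<^bsub>A\<^esub> rc q = rc (p * q)"
  "\<one>\<^bsub>A\<^esub> = rc 1" "\<zero>\<^bsub>A\<^esub> = rc 0" "c \<odot>\<^bsub>A\<^esub> rc p = rc (Const c * p)"
proof -
  have UNc: "(\<Union>x\<in>rc p. rc q) = rc q" for p q
  proof -
    have "rc p \<noteq> {}" using rc_self[of p] by blast
    then show ?thesis by (simp only: UN_constant if_False)
  qed
  show "carrier A = range rc"
  proof -
    have "carrier A = a_rcosets\<^bsub>mpoly_alg\<^esub> I" by (simp add: rep_alg_def quot_mod_def ring.defs module.defs FactRing_def)
    also have "\<dots> = (\<Union>y\<in>carrier mpoly_alg. {I +>\<^bsub>mpoly_alg\<^esub> y})" by (simp add: A_RCOSETS_def')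
    also have "\<dots> = range rc" by (auto simp: coset_rc mpoly_alg_simps)
    finally show ?thesis .
  qed
  show "rc p \<oplus>\<^bsub>A\<^esub> rc q = rc (p + q)"
  proof -
    have "rc p \<oplus>\<^bsub>A\<^esub> rc q = {x + y | x y. x \<in> rc p \<and> y \<in> rc q}"
      by (auto simp: rep_alg_def quot_mod_def ring.defs module.defs FactRing_def set_add_def set_mult_def mpoly_alg_simps)
    also have "\<dots> = rc (p + q)"
    proof
      show "{x + y | x y. x \<in> rc p \<and> y \<in> rc q} \<subseteq> rc (p + q)"
      proof
        fix z assume "z \<in> {x + y | x y. x \<in> rc p \<and> y \<in> rc q}"
        then obtain u v where "z = u + v" "u - p \<in> I" "v - q \<in> I" by (auto simp: rc_def)
        then show "z \<in> rc (p + q)" using is_idealD(2)[OF I, of "u - p" "v - q"] by (simp add: rc_def algebra_simps)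
      qed
      show "rc (p + q) \<subseteq> {x + y | x y. x \<in> rc p \<and> y \<in> rc q}"
      proof
        fix z assume z: "z \<in> rc (p + q)"
        have "z = (z - q) + q" by simp
        moreover have "z - q \<in> rc p" using z by (simp add: rc_def algebra_simps)
        ultimately show "z \<in> {x + y | x y. x \<in> rc p \<and> y \<in> rc q}" using rc_self[of q] by blast
      qed
    qed
    finally show ?thesis .
  qed
  show "rc p \<otimes>\<^bsub>A\<^esub> rc q = rc (p * q)"
  proof -
    have "rc p \<otimes>\<^bsub>A\<^esub> rc q = (\<Union>a\<in>rc p. \<Union>b\<in>rc q. rc (a * b))"
      by (simp add: rep_alg_def quot_mod_def ring.defs module.defs FactRing_def rcoset_mult_def coset_rc mpoly_alg_simps)
    also have "\<dots> = (\<Union>a\<in>rc p. \<Union>b\<in>rc q. rc (p * q))"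
    proof (intro SUP_cong refl)
      fix a b assume "a \<in> rc p" "b \<in> rc q"
      then have "(a - p) * b + p * (b - q) \<in> I" unfolding rc_def by (intro is_idealD(2,3,4)[OF I]) auto
      then show "rc (a * b) = rc (p * q)" unfolding rc_eq by (simp add: algebra_simps)
    qed
    also have "\<dots> = rc (p * q)" unfolding UNc ..
    finally show ?thesis .
  qed
  show "\<one>\<^bsub>A\<^esub> = rc 1" "\<zero>\<^bsub>A\<^esub> = rc 0"
    by (simp_all add: rep_alg_def quot_mod_def ring.defs module.defs FactRing_def coset_rc mpoly_alg_simps) (simp add: rc_def)
  show "c \<odot>\<^bsub>A\<^esub> rc p = rc (Const c * p)"
  proof -
    have "c \<odot>\<^bsub>A\<^esub> rc p = (\<Union>x\<in>rc p. rc (Const c * x))"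
      by (simp add: rep_alg_def quot_mod_def ring.defs module.defs coset_rc mpoly_alg_simps)
    also have "\<dots> = (\<Union>x\<in>rc p. rc (Const c * p))"
    proof (intro SUP_cong refl)
      fix x assume "x \<in> rc p"
      then have "Const c * (x - p) \<in> I" unfolding rc_def by (intro is_idealD(3)[OF I]) auto
      then show "rc (Const c * x) = rc (Const c * p)" unfolding rc_eq by (simp add: algebra_simps)
    qed
    also have "\<dots> = rc (Const c * p)" unfolding UNc ..
    finally show ?thesis .
  qed
qed

abbreviation "R \<equiv> char_alg G \<gamma>"

definition pr :: "'i trace_ring \<Rightarrow> 'i mpoly set" where "pr a = rc (tr_poly a)"

text \<open>A coset fixed by conjugation has representatives that are invariant only modulo the
  relations, which is the hypothesis of \<open>invariant_lift\<close>. Conversely, trace polynomials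
  are fixed outright and conjugation preserves the relations.\<close>

lemma carrier_char_alg: "carrier R = range pr"
proof
  show "carrier R \<subseteq> range pr"
  proof
    fix a assume "a \<in> carrier R"
    then obtain p where p: "a = rc p" "\<And>s. det s = 1 \<Longrightarrow> conj_act s ` rc p = rc p"
      unfolding char_alg_def by (auto simp: rep_alg_simps)
    have "conj_act s p - p \<in> I" if "det s = 1" for s
    proof -
      have "conj_act s p \<in> rc p" using p(2)[OF that] rc_self[of p] by blast
      then show ?thesis by (simp add: rc_def)
    qed
    from invariant_lift[OF I this] obtain q where q: "q \<in> trace_alg" "p - q \<in> I" by blast
    then have "a = pr (Tr q)" unfolding p pr_def rc_eq by (simp add: Tr_inverse)
    then show "a \<in> range pr" by blast
  qed
  show "range pr \<subseteq> carrier R"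
  proof
    fix a assume "a \<in> range pr"
    then obtain t where a: "a = rc (tr_poly t)" by (auto simp: pr_def)
    let ?q = "tr_poly t"
    have sub: "conj_act s x \<in> rc ?q" if "det s = 1" "x \<in> rc ?q" for s x
    proof -
      have "conj_act s (x - ?q) \<in> I" using that by (intro conj_act_rep_ideal) (auto simp: rc_def)
      then show ?thesis by (simp add: rc_def ring_hom_mapD[OF conj_act_hom] conj_act_trace_alg[OF that(1) tr_poly])
    qed
    have "conj_act s ` rc ?q = rc ?q" if s: "det s = 1" for s
    proof
      show "conj_act s ` rc ?q \<subseteq> rc ?q" using sub[OF s] by blast
      show "rc ?q \<subseteq> conj_act s ` rc ?q"
      proof
        fix x assume x: "x \<in> rc ?q"
        have "det (adjugate2 s) = 1" using s by (simp add: det_2 mult.commute)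
        from sub[OF this x] show "x \<in> conj_act s ` rc ?q" using conj_act_inverse[OF s, of x] by (metis imageI)
      qed
    qed
    then show "a \<in> carrier R" unfolding char_alg_def a by (simp add: rep_alg_simps)
  qed
qed

lemma pr_simps: "pr (a + b) = pr a \<oplus>\<^bsub>R\<^esub> pr b" "pr (a * b) = pr a \<otimes>\<^bsub>R\<^esub> pr b" "pr 1 = \<one>\<^bsub>R\<^esub>"
  "pr 0 = \<zero>\<^bsub>R\<^esub>" "pr (tr_const c * a) = c \<odot>\<^bsub>R\<^esub> pr a"
  by (simp_all add: char_alg_def pr_def rep_alg_simps tr_poly_ops)

lemma cring_char_alg: "cring R"
  by (rule cring_of_surj[OF carrier_char_alg pr_simps(1-4)])

definition ev1 :: "'i mpoly \<Rightarrow> complex" where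
  "ev1 = evalp (\<lambda>c. c) (\<lambda>(l, i, j). if i = j then 1 else 0)"

lemma ev1_hom: "ring_hom_map ev1"
  unfolding ev1_def by (rule ring_hom_map_evalp[OF ring_hom_map_id])

lemma ev1_Const [simp]: "ev1 (Const c) = c"
  unfolding ev1_def by (rule evalp_Const[OF ring_hom_map_id])

lemma ev1_word_mat: "mat_map ev1 (word_mat w) = mat 1"
proof -
  have g: "mat_map ev1 (gen_mat l) = mat 1" for l
    by (simp add: vec2_eq_iff gen_mat_def ev1_def evalp_Var[OF ring_hom_map_id] mat2_one)
  show ?thesis
  proof (induction w)
    case (Cons x w)
    obtain l e where "x = (l, e)" by (cases x)
    then show ?case using Cons by (simp add: word_mat_Cons mat_map_hom[OF ev1_hom] g adjugate2_one)
  qed (simp add: mat_map_hom[OF ev1_hom])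
qed

lemma ev1_trace_word [simp]: "ev1 (trace (word_mat w)) = 2"
  unfolding mat_map_hom(4)[OF ev1_hom] ev1_word_mat by (simp add: trace2 mat2_one)

definition val1 :: "'i trace_ring \<Rightarrow> complex" where "val1 a = ev1 (tr_poly a)"

lemma val1_hom: "ring_hom_map val1"
  unfolding ring_hom_map_def val1_def by (simp add: tr_poly_ops ring_hom_mapD[OF ev1_hom])

text \<open>The kernel of evaluation at the trivial representation.
  \<open>trivial_character_eq\<close> identifies its image with the ideal generated by the functions
  t - 2.\<close>

definition trivial_ideal :: "'i trace_ring set" where "trivial_ideal = {a. val1 a = 0}"
definition relation_ideal :: "'i trace_ring set" where "relation_ideal = {a. tr_poly a \<in> I}"

lemma I_ev1: "p \<in> I \<Longrightarrow> ev1 p = 0"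
proof -
  have "is_ideal {x. ev1 x \<in> {0}}" by (rule is_ideal_vimage[OF ev1_hom]) (auto simp: ideal_in_def)
  then have "I \<subseteq> {x. ev1 x \<in> {0}}"
  proof (rule rep_ideal_least)
    have "ev1 (det (gen_mat l)) = 1" for l
    proof -
      have "mat_map ev1 (gen_mat l) = mat 1" using ev1_word_mat[of "[(l, True)]"] by (simp add: word_mat_Cons)
      then show ?thesis unfolding mat_map_hom(5)[OF ev1_hom] by (simp add: det_2 mat2_one)
    qed
    moreover have "ev1 (ent (word_mat w - mat 1) i j) = 0" for w i j
    proof -
      have "ev1 (ent (word_mat w - mat 1) i j) = ent (mat_map ev1 (word_mat w)) i j - ent (mat_map ev1 (mat 1)) i j"
        by (simp add: ring_hom_mapD[OF ev1_hom])
      then show ?thesis unfolding ev1_word_mat mat_map_hom(3)[OF ev1_hom] by simp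
    qed
    ultimately show "rep_gens G \<gamma> \<subseteq> {x. ev1 x \<in> {0}}"
      unfolding rep_gens_def by (auto simp: ring_hom_mapD[OF ev1_hom])
  qed
  then show "p \<in> I \<Longrightarrow> ev1 p = 0" by blast
qed

definition ys where "ys = (SOME ys. adjoin_list (range tr_const) ys = (UNIV :: 'i trace_ring set))"

lemma spec_point_char_alg: "spec_point tr_const ys trivial_ideal relation_ideal R pr"
proof (intro spec_point.intro rational_point.intro complex_algebra.intro rational_point_axioms.intro spec_point_axioms.intro)
  show "tr_const (c + d) = tr_const c + tr_const d" "tr_const (c * d) = tr_const c * tr_const d"
    "tr_const 1 = (1 :: 'i trace_ring)" for c d by (rule tr_const_hom)+
  show "cring R" "carrier R = range pr" by (rule cring_char_alg carrier_char_alg)+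
  show "pr (a + b) = pr a \<oplus>\<^bsub>R\<^esub> pr b" "pr (a * b) = pr a \<otimes>\<^bsub>R\<^esub> pr b" "pr 1 = \<one>\<^bsub>R\<^esub>"
    "pr (tr_const c * a) = c \<odot>\<^bsub>R\<^esub> pr a" for a b c by (rule pr_simps)+
  show "adjoin_list (range tr_const) ys = UNIV" unfolding ys_def by (rule someI_ex[OF trace_ring_generated])
  show "is_ideal trivial_ideal" using is_ideal_vimage[OF val1_hom, of "{0}"] by (auto simp: trivial_ideal_def ideal_in_def)
  show "1 \<notin> trivial_ideal" by (simp add: trivial_ideal_def ring_hom_mapD[OF val1_hom])
  have "ring_hom_map tr_poly" by (simp add: ring_hom_map_def tr_poly_ops)
  from is_ideal_vimage[OF this I] show "is_ideal relation_ideal" by (simp add: relation_ideal_def)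
  show "relation_ideal \<subseteq> trivial_ideal" using I_ev1 by (auto simp: relation_ideal_def trivial_ideal_def val1_def)
  show "\<exists>c. a - tr_const c \<in> trivial_ideal" for a
    by (intro exI[of _ "val1 a"]) (simp add: trivial_ideal_def ring_hom_mapD[OF val1_hom], simp add: val1_def)
  show "pr a = \<zero>\<^bsub>R\<^esub> \<longleftrightarrow> a \<in> relation_ideal" for a
    unfolding pr_simps(4)[symmetric] pr_def rc_eq relation_ideal_def by (simp add: tr_poly_ops)
qed

end

section \<open>Functionals on the cotangent space\<close>

context rational_point
begin

text \<open>The coordinates in a basis of m / (m^2 + J) are functionals of this kind, and an element
  with all coordinates zero lies in m^2 + J. Congruences modulo m^2 can thus be proved one
  functional at a time.\<close>

lemma functional_separation:
  assumes a: "a \<in> m"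
    and z: "\<And>\<l>. \<forall>a\<in>m. \<forall>b\<in>m. \<l> (a + b) = \<l> a + \<l> b \<Longrightarrow> \<forall>c. \<forall>a\<in>m. \<l> (\<kappa> c * a) = c * \<l> a \<Longrightarrow>
      \<forall>a\<in>filt m J 2. \<l> a = 0 \<Longrightarrow> \<l> a = (0 :: complex)"
  shows "a \<in> filt m J 2"
proof -
  have "indep (\<lambda>_. 0) 0" by (simp add: indep_def)
  from indep_extend_basis[OF this] obtain x and D :: nat where x: "indep x D" "spans x D" by auto
  have ex: "\<exists>c. a - (\<Sum>i<D. \<kappa> (c i) * x i) \<in> filt m J 2" if "a \<in> m" for a using x(2) that by (simp add: spans_def)
  define co where "co a = (SOME c. a - (\<Sum>i<D. \<kappa> (c i) * x i) \<in> filt m J 2)" for a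
  have co: "a - (\<Sum>i<D. \<kappa> (co a i) * x i) \<in> filt m J 2" if "a \<in> m" for a
    unfolding co_def by (rule someI_ex[OF ex[OF that]])
  have uniq: "co a i = c i" if a: "a \<in> m" "a - (\<Sum>i<D. \<kappa> (c i) * x i) \<in> filt m J 2" "i < D" for a c i
  proof -
    from is_idealD(6)[OF filt2(1) a(2) co[OF a(1)]]
    have "(\<Sum>i<D. \<kappa> (co a i - c i) * x i) \<in> filt m J 2"
      by (simp add: \<kappa>_diff left_diff_distrib sum_subtractf)
    then have "\<forall>i<D. co a i - c i = 0" by (rule spec[OF x(1)[unfolded indep_def], of "\<lambda>i. co a i - c i", THEN mp])
    then show ?thesis using a(3) by simp
  qed
  have "co a i = 0" if i: "i < D" for i
  proof (rule z[of "\<lambda>a. co a i"])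
    show "\<forall>a\<in>m. \<forall>b\<in>m. co (a + b) i = co a i + co b i"
    proof (intro ballI)
      fix a b assume a: "a \<in> m" and b: "b \<in> m"
      from is_idealD(2)[OF filt2(1) co[OF a] co[OF b]]
      have "a + b - (\<Sum>i<D. \<kappa> (co a i + co b i) * x i) \<in> filt m J 2"
        by (simp add: \<kappa>_add algebra_simps sum.distrib)
      from uniq[OF is_idealD(2)[OF m(1) a b] this i] show "co (a + b) i = co a i + co b i" .
    qed
    show "\<forall>c. \<forall>a\<in>m. co (\<kappa> c * a) i = c * co a i"
    proof (intro allI ballI)
      fix c a assume a: "a \<in> m"
      from is_idealD(3)[OF filt2(1) co[OF a], of "\<kappa> c"]
      have "\<kappa> c * a - (\<Sum>i<D. \<kappa> (c * co a i) * x i) \<in> filt m J 2"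
        by (simp add: \<kappa>_mult right_diff_distrib sum_distrib_left mult.assoc)
      from uniq[OF is_idealD(3)[OF m(1) a] this i] show "co (\<kappa> c * a) i = c * co a i" .
    qed
    show "\<forall>a\<in>filt m J 2. co a i = 0"
    proof
      fix a assume a: "a \<in> filt m J 2"
      then have "a - (\<Sum>i<D. \<kappa> ((\<lambda>_. 0) i) * x i) \<in> filt m J 2" by (simp add: \<kappa>_0)
      from uniq[OF _ this i] show "co a i = 0" using a filt2(3) by auto
    qed
  qed
  then have "(\<Sum>i<D. \<kappa> (co a i) * x i) = 0" by (intro sum.neutral) (simp add: \<kappa>_0)
  then show ?thesis using co[OF a] by simp
qed

lemma sum_single_coefficient:
  assumes "finite A" "S \<in> A"
  shows "(\<Sum>M\<in>A. \<kappa> (if M = S then c else 0) * y M) = \<kappa> c * y S"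
proof -
  have "(\<Sum>M\<in>A. \<kappa> (if M = S then c else 0) * y M) = (\<Sum>M\<in>A. if M = S then \<kappa> c * y S else 0)"
    by (intro sum.cong) (auto simp: \<kappa>_0)
  then show ?thesis using assms by simp
qed

end

section \<open>A Gram determinant\<close>

text \<open>The square on the left is that of the determinant of the rows (x_i, b_i, c_i). On the
  right stands the determinant of their Gram matrix for the form x x' + 2 (b c' + c b'), whose own
  matrix has determinant -4.\<close>

lemma gram_scalar:
  fixes x1 x2 x3 :: "'a::comm_ring_1"
  shows "4 * (x1 * (b2 * c3 - b3 * c2) + b1 * (c2 * x3 - x2 * c3) + c1 * (x2 * b3 - x3 * b2))\<^sup>2 =
    - ((x1 * x1 + 2 * (b1 * c1 + c1 * b1)) * ((x2 * x2 + 2 * (b2 * c2 + c2 * b2)) * (x3 * x3 + 2 * (b3 * c3 + c3 * b3)) - (x2 * x3 + 2 * (b2 * c3 + c2 * b3))\<^sup>2)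
     - (x1 * x2 + 2 * (b1 * c2 + c1 * b2)) * ((x1 * x2 + 2 * (b1 * c2 + c1 * b2)) * (x3 * x3 + 2 * (b3 * c3 + c3 * b3)) - (x2 * x3 + 2 * (b2 * c3 + c2 * b3)) * (x1 * x3 + 2 * (b1 * c3 + c1 * b3)))
     + (x1 * x3 + 2 * (b1 * c3 + c1 * b3)) * ((x1 * x2 + 2 * (b1 * c2 + c1 * b2)) * (x2 * x3 + 2 * (b2 * c3 + c2 * b3)) - (x2 * x2 + 2 * (b2 * c2 + c2 * b2)) * (x1 * x3 + 2 * (b1 * c3 + c1 * b3))))"
  by (simp add: power2_eq_square algebra_simps)

text \<open>Twice the trace form of the traceless parts of the two matrices.\<close>

definition gram_entry :: "('i \<times> bool) list \<Rightarrow> ('i \<times> bool) list \<Rightarrow> 'i trace_ring" where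
  "gram_entry u v = 2 * tr_word (u @ v) - tr_word u * tr_word v"

text \<open>The difference of traces is the trace of u times the commutator of v and w. It depends
  only on the traceless parts and is the determinant of their coordinates, so
  \<open>gram_scalar\<close> applies.\<close>

lemma gram_words:
  "4 * (tr_word (u @ v @ w) - tr_word (u @ w @ v))\<^sup>2 =
    - (gram_entry u u * (gram_entry v v * gram_entry w w - (gram_entry v w)\<^sup>2) - gram_entry u v * (gram_entry u v * gram_entry w w - gram_entry v w * gram_entry u w)
      + gram_entry u w * (gram_entry u v * gram_entry v w - gram_entry v v * gram_entry u w))"
proof -
  have h: "tr_poly (gram_entry u v) = (ent (word_mat u) 1 1 - ent (word_mat u) 2 2) * (ent (word_mat v) 1 1 - ent (word_mat v) 2 2)
    + 2 * (ent (word_mat u) 1 2 * ent (word_mat v) 2 1 + ent (word_mat u) 2 1 * ent (word_mat v) 1 2)" for u v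
    by (simp add: gram_entry_def tr_poly_ops tr_poly_2 word_mat_append mat2_simps algebra_simps)
  let ?x = "\<lambda>u. ent (word_mat u) 1 1 - ent (word_mat u) 2 2"
  have z: "tr_poly (tr_word (u @ v @ w) - tr_word (u @ w @ v)) =
    ?x u * (ent (word_mat v) 1 2 * ent (word_mat w) 2 1 - ent (word_mat w) 1 2 * ent (word_mat v) 2 1)
    + ent (word_mat u) 1 2 * (ent (word_mat v) 2 1 * ?x w - ?x v * ent (word_mat w) 2 1)
    + ent (word_mat u) 2 1 * (?x v * ent (word_mat w) 1 2 - ?x w * ent (word_mat v) 1 2)"
    by (simp add: tr_poly_ops word_mat_append mat2_simps algebra_simps)
  have p2: "tr_poly (a\<^sup>2) = (tr_poly a)\<^sup>2" for a :: "'a trace_ring" by (simp add: power2_eq_square tr_poly_ops)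
  have "(4 :: 'a trace_ring) = 1 + 1 + 1 + 1" by simp
  then have "tr_poly (4 :: 'a trace_ring) = 1 + 1 + 1 + 1" by (simp only: tr_poly_ops)
  then have p4: "tr_poly (4 :: 'a trace_ring) = 4" by simp
  have opsd: "tr_poly (a + b) = tr_poly a + tr_poly b" "tr_poly (a * b) = tr_poly a * tr_poly b" "tr_poly (- a) = - tr_poly a" 
    for a b :: "'a trace_ring" by (simp_all add: tr_poly_ops)
  have hd: "tr_poly (gram_entry u u * (gram_entry v v * gram_entry w w - (gram_entry v w)\<^sup>2) - gram_entry u v * (gram_entry u v * gram_entry w w - gram_entry v w * gram_entry u w)
      + gram_entry u w * (gram_entry u v * gram_entry v w - gram_entry v v * gram_entry u w)) =
     tr_poly (gram_entry u u) * (tr_poly (gram_entry v v) * tr_poly (gram_entry w w) - (tr_poly (gram_entry v w))\<^sup>2)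
      - tr_poly (gram_entry u v) * (tr_poly (gram_entry u v) * tr_poly (gram_entry w w) - tr_poly (gram_entry v w) * tr_poly (gram_entry u w))
      + tr_poly (gram_entry u w) * (tr_poly (gram_entry u v) * tr_poly (gram_entry v w) - tr_poly (gram_entry v v) * tr_poly (gram_entry u w))"
    by (simp only: tr_poly_ops p2)
  show ?thesis unfolding tr_poly_inject[symmetric] opsd(2,3) p2 p4 z hd h by (rule gram_scalar)
qed

lemma multiset_neqI: "count M i \<noteq> count N i \<Longrightarrow> M \<noteq> N"
  by auto

section \<open>The trivial character as a point of the spectrum\<close>

context character_scheme
begin

interpretation S: spec_point tr_const ys trivial_ideal relation_ideal R pr
  by (rule spec_point_char_alg)

lemma val1_simps [simp]: "val1 (tr_word w) = 2" "val1 (tr_const c) = c" "val1 2 = 2"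
proof -
  show "val1 (tr_word w) = 2" "val1 (tr_const c) = c" for c by (simp_all add: val1_def)
  then show "val1 2 = 2" by (simp flip: tr_const_2)
qed

lemma trace_minus_2_in_trivial_ideal: "tr_word w - 2 \<in> trivial_ideal"
  by (simp add: trivial_ideal_def ring_hom_mapD[OF val1_hom])

text \<open>The list \<open>ys\<close> is only known through a choice, so all traces take the place
  of generators and the induction runs over the trace ring.\<close>

lemma spans_of_traces:
  assumes t: "\<And>w. tr_word w - 2 \<in> S.lspan x D" and x: "\<And>i. i < D \<Longrightarrow> x i \<in> trivial_ideal"
  shows "S.spans x D"
proof -
  have m: "a - tr_const (val1 a) \<in> trivial_ideal" for a by (simp add: trivial_ideal_def ring_hom_mapD[OF val1_hom])
  have "a - tr_const (val1 a) \<in> S.lspan x D" for a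
  proof (induction a rule: trace_ring_induct)
    case (const c)
    show ?case using S.lspan_filt2[OF is_idealD(1)[OF S.filt2(1)], of x D] by simp
  next
    case (word w) then show ?case using t[of w] by (simp add: tr_const_2)
  next
    case (add a b)
    from S.lspan_add[OF this] show ?case by (simp add: ring_hom_mapD[OF val1_hom] tr_const_hom algebra_simps)
  next
    case (mult a b)
    have "(a - tr_const (val1 a)) * (b - tr_const (val1 b)) \<in> S.lspan x D" by (intro S.lspan_filt2 S.filt2_mult m)
    from S.lspan_add[OF S.lspan_add[OF S.lspan_scale[OF mult(1), of "val1 b"] S.lspan_scale[OF mult(2), of "val1 a"]] this]
    show ?case by (simp add: ring_hom_mapD[OF val1_hom] tr_const_hom algebra_simps)
  qed
  note all = this
  have "a \<in> S.lspan x D" if "a \<in> trivial_ideal" for a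
    using all[of a] that by (simp add: trivial_ideal_def S.\<kappa>_0)
  then show ?thesis using x by (auto simp: S.spans_def S.lspan_def)
qed

lemma trivial_character_eq: "trivial_character G \<gamma> = pr ` trivial_ideal"
proof -
  interpret R: cring R by (rule cring_char_alg)
  have prc: "pr a \<in> carrier R" for a using carrier_char_alg by auto
  have diff: "pr (a - b) = pr a \<ominus>\<^bsub>R\<^esub> pr b" for a b
  proof -
    have "pr (a - b) \<oplus>\<^bsub>R\<^esub> pr b = pr a" by (simp flip: pr_simps)
    then show ?thesis using prc[of "a - b"] prc[of a] prc[of b]
      by (metis R.add.inv_solve_right a_minus_def)
  qed
  have gen: "trace_fun G \<gamma> w \<ominus>\<^bsub>R\<^esub> (2 \<odot>\<^bsub>R\<^esub> \<one>\<^bsub>R\<^esub>) = pr (tr_word w - 2)" for w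
  proof -
    have "trace_fun G \<gamma> w = pr (tr_word w)" unfolding trace_fun_def coset_rc pr_def by simp
    moreover have "2 \<odot>\<^bsub>R\<^esub> \<one>\<^bsub>R\<^esub> = pr 2"
      unfolding pr_simps(3)[symmetric] pr_simps(5)[symmetric] by (simp add: tr_const_2)
    ultimately show ?thesis by (simp add: diff)
  qed
  have g: "{trace_fun G \<gamma> w \<ominus>\<^bsub>R\<^esub> (2 \<odot>\<^bsub>R\<^esub> \<one>\<^bsub>R\<^esub>) | w. True} = range (\<lambda>w. pr (tr_word w - 2))"
    unfolding gen by auto
  have idm: "ideal (pr ` trivial_ideal) R" using S.prime_image[OF S.is_prime_m S.J(2)] by (rule primeideal.axioms(1))
  show ?thesis unfolding trivial_character_def g genideal_def
  proof
    show "\<Inter>{I. ideal I R \<and> range (\<lambda>w. pr (tr_word w - 2)) \<subseteq> I} \<subseteq> pr ` trivial_ideal"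
      using idm trace_minus_2_in_trivial_ideal by blast
    show "pr ` trivial_ideal \<subseteq> \<Inter>{I. ideal I R \<and> range (\<lambda>w. pr (tr_word w - 2)) \<subseteq> I}"
    proof (rule Inter_greatest)
      fix H assume "H \<in> {I. ideal I R \<and> range (\<lambda>w. pr (tr_word w - 2)) \<subseteq> I}"
      then have H: "ideal H R" "\<And>w. pr (tr_word w - 2) \<in> H" by auto
      interpret H: ideal H R by (rule H(1))
      have Hadd: "pr (a + b) \<in> H" if "pr a \<in> H" "pr b \<in> H" for a b
        unfolding pr_simps using that by (rule additive_subgroup.a_closed[OF H.is_additive_subgroup])
      have Hmul: "pr (a * b) \<in> H" if "pr b \<in> H" for a b
        unfolding pr_simps using that prc by (rule H.I_l_closed)
      have "pr (a - tr_const (val1 a)) \<in> H" for a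
      proof (induction a rule: trace_ring_induct)
        case (const c)
        then show ?case using additive_subgroup.zero_closed[OF H.is_additive_subgroup] by (simp add: pr_simps)
      next
        case (word w) then show ?case using H(2)[of w] by (simp add: tr_const_2)
      next
        case (add a b)
        from Hadd[OF this] show ?case by (simp add: ring_hom_mapD[OF val1_hom] tr_const_hom algebra_simps)
      next
        case (mult a b)
        have "a * b - tr_const (val1 (a * b)) = b * (a - tr_const (val1 a)) + tr_const (val1 a) * (b - tr_const (val1 b))"
          by (simp add: ring_hom_mapD[OF val1_hom] tr_const_hom algebra_simps)
        then show ?case using Hadd[OF Hmul[OF mult(1)] Hmul[OF mult(2)]] by simp
      qed
      note all = this
      show "pr ` trivial_ideal \<subseteq> H"
      proof
        fix y assume "y \<in> pr ` trivial_ideal"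
        then obtain a where "a \<in> trivial_ideal" "y = pr a" by blast
        then show "y \<in> H" using all[of a] by (simp add: trivial_ideal_def S.\<kappa>_0)
      qed
    qed
  qed
qed

lemma smooth_iff: "S.spans x D \<Longrightarrow> S.indep x D \<Longrightarrow>
    smooth_at R (trivial_character G \<gamma>) \<longleftrightarrow> local_dim (spec_topology R) (pr ` trivial_ideal) = enat D"
  by (simp add: smooth_at_def trivial_character_eq S.vdim_tan)

section \<open>Traces of group elements\<close>

lemma gamma_closed' [simp]: "\<gamma> l \<in> carrier G"
  using gamma_closed by auto

lemma val_closed [simp]: "val w \<in> carrier G"
  by (induction w) (auto simp: word_val_Cons)

lemma val_append: "val (u @ v) = val u \<otimes> val v"
  by (induction u) (auto simp: word_val_Cons m_assoc)

lemma val_inv_word: "val (inv_word w) = inv (val w)"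
proof (induction w)
  case (Cons x w)
  obtain l e where x: "x = (l, e)" by (cases x)
  have "inv_word (x # w) = inv_word w @ [(l, \<not> e)]" by (simp add: inv_word_def x)
  then show ?case using Cons by (simp add: val_append word_val_Cons x inv_mult_group)
qed (simp add: inv_word_def)

lemma ex_word:
  assumes "g \<in> carrier G"
  shows "\<exists>w. val w = g"
proof -
  have "g \<in> generate G (range \<gamma>)" using assms gamma_generates by simp
  then show ?thesis
  proof (induction g rule: generate.induct)
    case one then show ?case by (intro exI[of _ "[]"]) simp
  next
    case (incl h)
    then obtain l where "h = \<gamma> l" by blast
    then show ?case by (intro exI[of _ "[(l, True)]"]) (simp add: word_val_Cons)
  next
    case (inv h)
    then obtain l where "h = \<gamma> l" by blast
    then show ?case by (intro exI[of _ "[(l, False)]"]) (simp add: word_val_Cons)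
  next
    case (eng h1 h2)
    then obtain u v where "val u = h1" "val v = h2" by blast
    then show ?case by (intro exI[of _ "u @ v"]) (simp add: val_append)
  qed
qed

lemma det_word_mat: "det (word_mat w) - 1 \<in> I"
proof (induction w)
  case Nil
  then show ?case using is_idealD(1)[OF I] by (simp add: det_2 mat2_one)
next
  case (Cons x w)
  obtain l e where x: "x = (l, e)" by (cases x)
  have "det (adjugate2 (gen_mat l)) = det (gen_mat l)" by (simp add: det_2 mult.commute)
  then have e: "det (word_mat (x # w)) - 1 = det (gen_mat l) * (det (word_mat w) - 1) + (det (gen_mat l) - 1)"
    by (simp add: x word_mat_Cons det2_mult algebra_simps)
  show ?case unfolding e by (rule is_idealD(2)[OF I is_idealD(3)[OF I Cons] det_gen_in_rep_ideal])
qed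

text \<open>With E = U adj(V) - 1, whose entries are relations, one has E V = det(V) U - V; as
  det(V) is 1 modulo the relations, so is tr U - tr V zero.\<close>

lemma tr_word_cong:
  assumes "val u = val v"
  shows "tr_word u - tr_word v \<in> relation_ideal"
proof -
  let ?U = "word_mat u" and ?V = "word_mat v"
  define E where "E = word_mat (u @ inv_word v) - mat 1"
  have "val (u @ inv_word v) = \<one>" using assms by (simp add: val_append val_inv_word)
  then have E: "ent E i j \<in> I" for i j unfolding E_def by (rule relation_in_rep_ideal)
  have "trace (E ** ?V) = trace (?U ** (adjugate2 ?V ** ?V)) - trace ?V"
    unfolding E_def word_mat_append adjugate2_word_mat[symmetric] by (simp add: mat2_simps algebra_simps)
  also have "trace (?U ** (adjugate2 ?V ** ?V)) = det ?V * trace ?U"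
    unfolding mult_adjugate2 by (simp add: mat2_simps algebra_simps)
  finally have e: "trace ?U - trace ?V = trace (E ** ?V) - (det ?V - 1) * trace ?U" by (simp add: algebra_simps)
  have "trace (E ** ?V) \<in> I" unfolding trace2 mat2_mult by (intro is_idealD(2,4)[OF I] E)
  from is_idealD(6)[OF I this is_idealD(4)[OF I det_word_mat[of v]], of "trace ?U"]
  show ?thesis by (simp add: relation_ideal_def tr_poly_ops e)
qed

section \<open>Diagonal representations\<close>

text \<open>The one-parameter subgroup diag(exp(c u), exp(-c u)) over formal power series in u. The
  coefficient ring is a domain, and orders in u can be read off.\<close>

definition dg :: "complex \<Rightarrow> complex fps^2^2" where
  "dg c = (\<chi> i j. if i = j then (if i = 1 then fps_exp c else fps_exp (- c)) else 0)"

lemma dg_nth [simp]: "ent (dg c) 1 1 = fps_exp c" "ent (dg c) 1 2 = 0" "ent (dg c) 2 1 = 0" "ent (dg c) 2 2 = fps_exp (- c)"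
  by (simp_all add: dg_def)

lemma fps_exp_minus_mult: "fps_exp c * fps_exp (- c) = (1 :: complex fps)"
  by (simp flip: fps_exp_add_mult)

lemma fps_exp_minus_add: "fps_exp (- a) * fps_exp (- b) = fps_exp (- a - b :: complex)"
  using fps_exp_add_mult[of "- a" "- b"] by simp

lemma dg_simps: "dg a ** dg b = dg (a + b)" "adjugate2 (dg a) = dg (- a)" "mat 1 = dg 0" "det (dg a) = 1"
  "trace (dg a) = fps_exp a + fps_exp (- a)"
  by (simp_all add: vec2_eq_iff mat2_mult mat2_one det_2 trace2 fps_exp_add_mult fps_exp_minus_mult fps_exp_minus_add)

definition evf :: "('g \<Rightarrow> complex) \<Rightarrow> 'i mpoly \<Rightarrow> complex fps" where
  "evf \<phi> = evalp fps_const (\<lambda>(l, i, j). ent (dg (\<phi> (\<gamma> l))) i j)"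

lemma fps_const_hom: "ring_hom_map (fps_const :: complex \<Rightarrow> _)"
  by (simp add: ring_hom_map_def)

lemma evf_hom: "ring_hom_map (evf \<phi>)"
  unfolding evf_def by (rule ring_hom_map_evalp[OF fps_const_hom])

lemma evf_nth_0: "fps_nth (evf \<phi> p) 0 = ev1 p"
proof -
  have "fps_nth (evf \<phi> p) 0 = evalp (\<lambda>c. c) (\<lambda>x. fps_nth ((\<lambda>(l, i, j). ent (dg (\<phi> (\<gamma> l))) i j) x) 0) p"
    unfolding evf_def
    by (rule evalp_comp[OF fps_const_hom _ ring_hom_map_id]) (simp_all add: ring_hom_map_def)
  also have "(\<lambda>x. fps_nth ((\<lambda>(l :: 'i, i :: 2, j :: 2). ent (dg (\<phi> (\<gamma> l))) i j) x) 0) = (\<lambda>(l, i, j). if i = j then 1 else 0)"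
    by (auto simp: fun_eq_iff dg_def)
  finally show ?thesis by (simp add: ev1_def)
qed

context
  fixes \<phi> :: "'g \<Rightarrow> complex"
  assumes \<phi>: "additive_on G \<phi>"
begin

lemma additive_simps: "x \<in> carrier G \<Longrightarrow> y \<in> carrier G \<Longrightarrow> \<phi> (x \<otimes> y) = \<phi> x + \<phi> y" "\<phi> \<one> = 0"
  "x \<in> carrier G \<Longrightarrow> \<phi> (inv x) = - \<phi> x"
proof -
  show add: "\<phi> (x \<otimes> y) = \<phi> x + \<phi> y" if "x \<in> carrier G" "y \<in> carrier G" for x y
    using \<phi> that by (simp add: additive_on_def)
  show one: "\<phi> \<one> = 0" using add[of \<one> \<one>] by simp
  show "\<phi> (inv x) = - \<phi> x" if "x \<in> carrier G"
    using add[of x "inv x"] one that by (simp add: eq_neg_iff_add_eq_0 add.commute)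
qed

lemma evf_word_mat: "mat_map (evf \<phi>) (word_mat w) = dg (\<phi> (val w))"
proof -
  have g: "mat_map (evf \<phi>) (gen_mat l) = dg (\<phi> (\<gamma> l))" for l
    by (simp add: vec2_eq_iff gen_mat_def evf_def evalp_Var[OF fps_const_hom])
  show ?thesis
  proof (induction w)
    case Nil
    then show ?case by (simp add: mat_map_hom[OF evf_hom] dg_simps(3) additive_simps)
  next
    case (Cons x w)
    obtain l e where "x = (l, e)" by (cases x)
    then show ?case using Cons
      by (simp add: word_mat_Cons word_val_Cons mat_map_hom[OF evf_hom] g dg_simps additive_simps)
  qed
qed

lemma evf_trace: "evf \<phi> (trace (word_mat w)) = fps_exp (\<phi> (val w)) + fps_exp (- \<phi> (val w))"
  unfolding mat_map_hom(4)[OF evf_hom] evf_word_mat dg_simps ..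

lemma evf_I: "p \<in> I \<Longrightarrow> evf \<phi> p = 0"
proof -
  have "is_ideal {x. evf \<phi> x \<in> {0}}" by (rule is_ideal_vimage[OF evf_hom]) (auto simp: ideal_in_def)
  then have "I \<subseteq> {x. evf \<phi> x \<in> {0}}"
  proof (rule rep_ideal_least)
    have 1: "evf \<phi> (det (gen_mat l)) = 1" for l
    proof -
      have "word_mat [(l, True)] = gen_mat l" by (simp add: word_mat_Cons)
      then have "mat_map (evf \<phi>) (gen_mat l) = dg (\<phi> (val [(l, True)]))" using evf_word_mat[of "[(l, True)]"] by simp
      then show ?thesis unfolding mat_map_hom(5)[OF evf_hom] by (simp only: dg_simps)
    qed
    have 2: "evf \<phi> (ent (word_mat w - mat 1) i j) = 0" if "val w = \<one>" for w i j
    proof -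
      have "evf \<phi> (ent (word_mat w - mat 1) i j) = ent (mat_map (evf \<phi>) (word_mat w)) i j - ent (mat_map (evf \<phi>) (mat 1)) i j"
        by (simp add: ring_hom_mapD[OF evf_hom])
      also have "\<dots> = ent (dg 0) i j - ent (dg 0) i j"
        unfolding evf_word_mat that mat_map_hom(3)[OF evf_hom] additive_simps(2) dg_simps(3) ..
      finally show ?thesis by simp
    qed
    show "rep_gens G \<gamma> \<subseteq> {x. evf \<phi> x \<in> {0}}"
    proof
      fix x assume "x \<in> rep_gens G \<gamma>"
      then consider l where "x = det (gen_mat l) - 1" | w i j where "x = ent (word_mat w - mat 1) i j" "val w = \<one>"
        unfolding rep_gens_def by blast
      then show "x \<in> {x. evf \<phi> x \<in> {0}}"
        by cases (use 1 2 in \<open>simp_all only: ring_hom_mapD[OF evf_hom] mem_Collect_eq singleton_iff diff_self\<close>)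
    qed
  qed
  then show "p \<in> I \<Longrightarrow> evf \<phi> p = 0" by blast
qed

text \<open>Traces are even in u, so along the diagonal curve the first-order coefficient vanishes.
  The second-order coefficient is therefore a derivation at the trivial character, that is, a
  tangent vector.\<close>

definition fval :: "'i trace_ring \<Rightarrow> complex" where "fval a = fps_nth (evf \<phi> (tr_poly a)) 2"

lemma evf_nth_1: "fps_nth (evf \<phi> (tr_poly a)) 1 = 0"
proof (induction a rule: trace_ring_induct)
  case (const c)
  then show ?case by (simp add: evf_def evalp_Const[OF fps_const_hom])
next
  case (word w)
  then show ?case by (simp add: evf_trace)
next
  case (add a b)
  then show ?case by (simp add: tr_poly_ops ring_hom_mapD[OF evf_hom])
next
  case (mult a b)
  then show ?case by (simp add: tr_poly_ops ring_hom_mapD[OF evf_hom] fps_mult_nth)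
qed

lemma fval_add: "fval (a + b) = fval a + fval b" and fval_diff: "fval (a - b) = fval a - fval b"
  by (simp_all add: fval_def tr_poly_ops ring_hom_mapD[OF evf_hom])

lemma fval_mult: "fval (a * b) = val1 a * fval b + fval a * val1 b"
proof -
  have n2: "fps_nth (p * q) 2 = fps_nth p 0 * fps_nth q 2 + fps_nth p 1 * fps_nth q 1 + fps_nth p 2 * fps_nth q 0" for p q :: "complex fps"
    by (simp add: fps_mult_nth numeral_2_eq_2)
  show ?thesis
    unfolding fval_def tr_poly_ops ring_hom_mapD(3)[OF evf_hom] n2 evf_nth_1 evf_nth_0 val1_def by simp
qed

lemma fval_const: "fval (tr_const c) = 0"
  by (simp add: fval_def evf_def evalp_Const[OF fps_const_hom])

lemma fval_2: "fval 2 = 0"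
  using fval_const[of 2] by (simp add: tr_const_2)

lemma fval_scale: "fval (tr_const c * a) = c * fval a"
  by (simp add: fval_mult fval_const)

lemma fval_tr_word: "fval (tr_word w) = (\<phi> (val w))\<^sup>2"
  by (simp add: fval_def evf_trace numeral_2_eq_2)

lemma fval_filt2: "a \<in> filt trivial_ideal relation_ideal 2 \<Longrightarrow> fval a = 0"
proof -
  have "filt trivial_ideal relation_ideal 2 \<subseteq> {a \<in> trivial_ideal. fval a = 0}"
  proof (rule filt_2_least[OF _ _ _ S.m(1) S.J(2)])
    have "fval 0 = 0" using fval_add[of 0 0] by simp
    then show "is_ideal {a \<in> trivial_ideal. fval a = 0}"
      unfolding ideal_in_def using is_idealD(1)[OF S.m(1)] is_idealD(2)[OF S.m(1)] is_idealD(3)[OF S.m(1)]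
      by (auto simp: fval_add fval_mult trivial_ideal_def)
    show "relation_ideal \<subseteq> {a \<in> trivial_ideal. fval a = 0}" using S.J(2) evf_I by (auto simp: relation_ideal_def fval_def)
    show "a * b \<in> {a \<in> trivial_ideal. fval a = 0}" if "a \<in> trivial_ideal" "b \<in> trivial_ideal" for a b
      using that is_idealD(3)[OF S.m(1), of b a] by (simp add: fval_mult trivial_ideal_def)
  qed
  then show "a \<in> filt trivial_ideal relation_ideal 2 \<Longrightarrow> fval a = 0" by blast
qed

lemma fval_gram_entry: "fval (gram_entry u v) = 4 * \<phi> (val u) * \<phi> (val v)"
  by (simp add: gram_entry_def fval_diff fval_mult fval_2 fval_tr_word val_append additive_simps power2_eq_square algebra_simps)

text \<open>On the diagonal curve the relations vanish, whereas a has a nonzero coefficient at u^2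
  and b a nonzero constant term; power series form a domain.\<close>

lemma power_notin_relation_ideal:
  assumes "fval a \<noteq> 0" "b \<notin> trivial_ideal"
  shows "a ^ k * b \<notin> relation_ideal"
proof
  assume "a ^ k * b \<in> relation_ideal"
  then have "evf \<phi> (tr_poly (a ^ k * b)) = 0" using evf_I by (simp add: relation_ideal_def)
  moreover have "tr_poly (a ^ k) = tr_poly a ^ k" by (induction k) (simp_all add: tr_poly_ops)
  ultimately have "evf \<phi> (tr_poly a) ^ k * evf \<phi> (tr_poly b) = 0"
    by (simp add: tr_poly_ops ring_hom_mapD[OF evf_hom])
  moreover have "evf \<phi> (tr_poly a) \<noteq> 0" using assms(1) by (auto simp: fval_def)
  moreover have "evf \<phi> (tr_poly b) \<noteq> 0" using assms(2) evf_nth_0[of \<phi> "tr_poly b"] by (auto simp: trivial_ideal_def val1_def)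
  ultimately show False by simp
qed

end

section \<open>Smoothness at the trivial character\<close>

text \<open>Written in terms of t - 2, \<open>tr_word_product\<close> becomes the functional
  equation up to the product of (t_x - 2) and (t_y - 2), which lies in m^2. Since the functional
  kills the relations, it sees a word only through its group value.\<close>

lemma functional_quadratic:
  assumes l: "\<forall>a\<in>trivial_ideal. \<forall>b\<in>trivial_ideal. \<l> (a + b) = \<l> a + \<l> b" "\<forall>c. \<forall>a\<in>trivial_ideal. \<l> (tr_const c * a) = c * \<l> a"
    "\<forall>a\<in>filt trivial_ideal relation_ideal 2. \<l> a = (0 :: complex)"
  shows "\<exists>f. (\<forall>w. \<l> (tr_word w - 2) = f (val w)) \<and>
    (\<forall>x\<in>carrier G. \<forall>y\<in>carrier G. f (x \<otimes> y) + f (x \<otimes> inv y) = 2 * f x + 2 * f y)"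
proof -
  define wd where "wd g = (SOME w. val w = g)" for g
  have wd: "val (wd g) = g" if "g \<in> carrier G" for g
    unfolding wd_def by (rule someI_ex[OF ex_word[OF that]])
  define f where "f g = \<l> (tr_word (wd g) - 2)" for g
  note tm = trace_minus_2_in_trivial_ideal
  have fw: "\<l> (tr_word w - 2) = f (val w)" for w
  proof -
    have d: "tr_word w - tr_word (wd (val w)) \<in> filt trivial_ideal relation_ideal 2"
      using tr_word_cong[of w "wd (val w)"] wd[of "val w"] S.filt2(2) by auto
    have "\<l> ((tr_word w - tr_word (wd (val w))) + (tr_word (wd (val w)) - 2)) =
        \<l> (tr_word w - tr_word (wd (val w))) + \<l> (tr_word (wd (val w)) - 2)"
      using l(1) d S.filt2(3) tm by blast
    then show ?thesis using l(3) d by (simp add: f_def)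
  qed
  have "f (x \<otimes> y) + f (x \<otimes> inv y) = 2 * f x + 2 * f y" if x: "x \<in> carrier G" and y: "y \<in> carrier G" for x y
  proof -
    obtain u v where u: "val u = x" and v: "val v = y" using ex_word x y by blast
    let ?u = "tr_word u - 2" and ?v = "tr_word v - 2"
    have "(tr_word (u @ v) - 2) + (tr_word (u @ inv_word v) - 2) = tr_word u * tr_word v - 4"
      unfolding tr_word_product by simp
    also have "\<dots> = ?u * ?v + (tr_const 2 * ?u + tr_const 2 * ?v)"
      by (simp add: tr_const_2 algebra_simps)
    finally have "\<l> ((tr_word (u @ v) - 2) + (tr_word (u @ inv_word v) - 2)) = \<l> (?u * ?v + (tr_const 2 * ?u + tr_const 2 * ?v))"
      by (rule arg_cong)
    also have "\<dots> = \<l> (?u * ?v) + (\<l> (tr_const 2 * ?u) + \<l> (tr_const 2 * ?v))"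
    proof -
      have "?u * ?v \<in> trivial_ideal" "tr_const 2 * ?u \<in> trivial_ideal" "tr_const 2 * ?v \<in> trivial_ideal" by (intro is_idealD(3)[OF S.m(1)] tm)+
      then show ?thesis using l(1) is_idealD(2)[OF S.m(1)] by simp
    qed
    also have "\<dots> = 2 * f x + 2 * f y" using l(2,3) tm S.filt2_mult[OF tm tm, of u v] fw u v by simp
    also have "\<l> ((tr_word (u @ v) - 2) + (tr_word (u @ inv_word v) - 2)) = f (x \<otimes> y) + f (x \<otimes> inv y)"
    proof -
      have "\<l> ((tr_word (u @ v) - 2) + (tr_word (u @ inv_word v) - 2)) = \<l> (tr_word (u @ v) - 2) + \<l> (tr_word (u @ inv_word v) - 2)"
        using l(1) tm by blast
      then show ?thesis by (simp only: fw val_append val_inv_word u v)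
    qed
    finally show ?thesis .
  qed
  then show ?thesis using fw by blast
qed

text \<open>Modulo m^2 and the relations every t_g - 2 is a multiple of \<open>x0\<close>, by the
  square of the ratio \<open>k\<close>. The tangent space thus has dimension 1 or 0, according to
  whether a nonzero additive function exists.\<close>

lemma smooth_if_H1_small:
  assumes n: "vdim (group_H1 G) < 2"
  shows "smooth_at R (trivial_character G \<gamma>)"
proof -
  obtain g0 where g0: "g0 \<in> carrier G" and "\<forall>x\<in>carrier G. \<exists>c. \<forall>\<phi>. additive_on G \<phi> \<longrightarrow> \<phi> x = c * \<phi> g0"
    using additive_on_proportional[OF is_group n] by blast
  then obtain k where k: "\<And>\<phi> x. additive_on G \<phi> \<Longrightarrow> x \<in> carrier G \<Longrightarrow> \<phi> x = k x * \<phi> g0" by metis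
  obtain w0 where w0: "val w0 = g0" using ex_word[OF g0] by blast
  note tm = trace_minus_2_in_trivial_ideal
  define x0 where "x0 = tr_word w0 - 2"
  have x0: "x0 \<in> trivial_ideal" unfolding x0_def by (rule tm)
  have sp: "tr_word w - 2 - tr_const ((k (val w))\<^sup>2) * x0 \<in> filt trivial_ideal relation_ideal 2" for w
  proof (rule S.functional_separation)
    have cx: "tr_const c * x0 \<in> trivial_ideal" for c by (rule is_idealD(3)[OF S.m(1) x0])
    show d: "tr_word w - 2 - tr_const ((k (val w))\<^sup>2) * x0 \<in> trivial_ideal" by (rule is_idealD(6)[OF S.m(1) tm cx])
    fix \<l> :: "'i trace_ring \<Rightarrow> complex"
    assume l: "\<forall>a\<in>trivial_ideal. \<forall>b\<in>trivial_ideal. \<l> (a + b) = \<l> a + \<l> b" "\<forall>c. \<forall>a\<in>trivial_ideal. \<l> (tr_const c * a) = c * \<l> a" "\<forall>a\<in>filt trivial_ideal relation_ideal 2. \<l> a = 0"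
    from functional_quadratic[OF this] obtain f where f: "\<And>w. \<l> (tr_word w - 2) = f (val w)"
      "\<And>x y. x \<in> carrier G \<Longrightarrow> y \<in> carrier G \<Longrightarrow> f (x \<otimes> y) + f (x \<otimes> inv y) = 2 * f x + 2 * f y" by blast
    have "f (val w) = (k (val w))\<^sup>2 * f g0" by (rule quadratic_function(1)[OF f(2) g0 k val_closed])
    moreover have "\<l> ((tr_word w - 2 - tr_const ((k (val w))\<^sup>2) * x0) + tr_const ((k (val w))\<^sup>2) * x0) =
        \<l> (tr_word w - 2 - tr_const ((k (val w))\<^sup>2) * x0) + \<l> (tr_const ((k (val w))\<^sup>2) * x0)"
      using l(1) d cx by blast
    moreover have "\<l> (tr_const ((k (val w))\<^sup>2) * x0) = (k (val w))\<^sup>2 * f g0" using l(2) x0 f(1)[of w0] w0 by (simp add: x0_def)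
    ultimately show "\<l> (tr_word w - 2 - tr_const ((k (val w))\<^sup>2) * x0) = 0" using f(1)[of w] by simp
  qed
  show ?thesis
  proof (cases "\<forall>\<phi>. additive_on G \<phi> \<longrightarrow> \<phi> g0 = 0")
    case True
    have xF: "x0 \<in> filt trivial_ideal relation_ideal 2"
    proof (rule S.functional_separation[OF x0])
      fix \<l> :: "'i trace_ring \<Rightarrow> complex"
      assume l: "\<forall>a\<in>trivial_ideal. \<forall>b\<in>trivial_ideal. \<l> (a + b) = \<l> a + \<l> b" "\<forall>c. \<forall>a\<in>trivial_ideal. \<l> (tr_const c * a) = c * \<l> a" "\<forall>a\<in>filt trivial_ideal relation_ideal 2. \<l> a = 0"
      from functional_quadratic[OF this] obtain f where f: "\<And>w. \<l> (tr_word w - 2) = f (val w)"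
        "\<And>x y. x \<in> carrier G \<Longrightarrow> y \<in> carrier G \<Longrightarrow> f (x \<otimes> y) + f (x \<otimes> inv y) = 2 * f x + 2 * f y" by blast
      have "f g0 = 0" by (rule quadratic_function(2)[OF f(2) g0 k]) (use True in auto)
      then show "\<l> x0 = 0" using f(1)[of w0] w0 by (simp add: x0_def)
    qed
    have "tr_word w - 2 \<in> S.lspan (\<lambda>_. x0) 0" for w
    proof -
      have "tr_word w - 2 - tr_const ((k (val w))\<^sup>2) * x0 + tr_const ((k (val w))\<^sup>2) * x0 \<in> filt trivial_ideal relation_ideal 2"
        by (rule is_idealD(2)[OF S.filt2(1) sp is_idealD(3)[OF S.filt2(1) xF]])
      then show ?thesis by (intro S.lspan_filt2) simp
    qed
    then have sp0: "S.spans (\<lambda>_. x0) 0" by (rule spans_of_traces) simp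
    have "S.indep (\<lambda>_. x0) 0" by (simp add: S.indep_def)
    moreover have "local_dim (spec_topology R) (pr ` trivial_ideal) = enat 0"
      using S.local_dim_le[OF sp0] by (simp add: zero_enat_def[symmetric])
    ultimately show ?thesis using smooth_iff[OF sp0] by simp
  next
    case False
    then obtain \<phi> where \<phi>: "additive_on G \<phi>" "\<phi> g0 \<noteq> 0" by blast
    have fx: "fval \<phi> x0 \<noteq> 0" using \<phi>(2) by (simp add: x0_def fval_diff fval_2 fval_tr_word \<phi>(1) w0)
    have "tr_word w - 2 \<in> S.lspan (\<lambda>_. x0) 1" for w
      unfolding S.lspan_def by (intro CollectI exI[of _ "\<lambda>_. (k (val w))\<^sup>2"]) (use sp[of w] in simp)
    then have sp1: "S.spans (\<lambda>_. x0) 1" by (rule spans_of_traces) (rule x0)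
    have ind: "S.indep (\<lambda>_. x0) 1"
      unfolding S.indep_def
    proof (intro allI impI)
      fix c :: "nat \<Rightarrow> complex" and i :: nat
      assume c: "(\<Sum>i<1. tr_const (c i) * x0) \<in> filt trivial_ideal relation_ideal 2" and i: "i < 1"
      then have "fval \<phi> (tr_const (c 0) * x0) = 0" using fval_filt2[OF \<phi>(1)] by simp
      then show "c i = 0" using fx i by (simp add: fval_scale[OF \<phi>(1)])
    qed
    \<comment> \<open>The diagonal curve shows that no power of \<open>x0\<close> times an element
      outside the maximal ideal is a relation, so some prime through the point avoids
      \<open>x0\<close> and is strictly smaller than the maximal ideal.\<close>
    have "\<exists>P. is_prime P \<and> relation_ideal \<subseteq> P \<and> P \<subseteq> trivial_ideal \<and> x0 \<notin> P"
      using exists_prime_avoiding[OF S.noetherian_UNIV S.J(1) S.is_prime_m, of x0] power_notin_relation_ideal[OF \<phi>(1) fx] S.J(2) by blast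
    then obtain P where P: "is_prime P" "relation_ideal \<subseteq> P" "P \<subset> trivial_ideal" using x0 by blast
    have "enat 1 \<le> local_dim (spec_topology R) (pr ` trivial_ideal)"
      using S.local_dim_ge_1[OF P] by (simp only: one_enat_def)
    then have "local_dim (spec_topology R) (pr ` trivial_ideal) = enat 1" by (rule antisym[OF S.local_dim_le[OF sp1]])
    then show ?thesis using smooth_iff[OF sp1 ind] by simp
  qed
qed

lemma chain_if_smooth:
  assumes "smooth_at R (trivial_character G \<gamma>)" "S.spans x D" "S.indep x D" "0 < D"
  shows "\<exists>p. S.chain_at p D"
proof -
  obtain k where "D = Suc k" using assms(4) by (cases D) auto
  moreover have "local_dim (spec_topology R) (pr ` trivial_ideal) = enat D" using smooth_iff[OF assms(2,3)] assms(1) by simp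
  ultimately show ?thesis using S.local_dim_chain[of k] by simp
qed

lemma not_smooth_if_H1_large:
  assumes n: "2 < vdim (group_H1 G)"
  shows "\<not> smooth_at R (trivial_character G \<gamma>)"
proof
  assume smooth: "smooth_at R (trivial_character G \<gamma>)"
  obtain g :: "nat \<Rightarrow> 'g" and \<phi> where g: "\<forall>i<3. g i \<in> carrier G \<and> additive_on G (\<phi> i)"
    and dual: "\<forall>i<3. \<forall>j<3. \<phi> i (g j) = (if i = j then 1 else (0 :: complex))"
    using additive_on_dual_triple[OF is_group n] by blast
  have "\<forall>i. \<exists>w. i < 3 \<longrightarrow> val w = g i" using ex_word g by blast
  then obtain w where w: "\<And>i. i < 3 \<Longrightarrow> val (w i) = g i" by metis
  define h where "h i j = gram_entry (w i) (w j)" for i j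
  define z where "z = tr_word (w 0 @ w 1 @ w 2) - tr_word (w 0 @ w 2 @ w 1)"
  define d where "d = h 0 0 * (h 1 1 * h 2 2 - (h 1 2)\<^sup>2) - h 0 1 * (h 0 1 * h 2 2 - h 1 2 * h 0 2)
      + h 0 2 * (h 0 1 * h 1 2 - h 1 1 * h 0 2)"
  have gram: "4 * z\<^sup>2 = - d" unfolding z_def d_def h_def by (rule gram_words)
  have hm: "h i j \<in> trivial_ideal" for i j by (simp add: h_def gram_entry_def trivial_ideal_def ring_hom_mapD[OF val1_hom])
  have zm: "z \<in> trivial_ideal" by (simp add: z_def trivial_ideal_def ring_hom_mapD[OF val1_hom])
  show False
  proof (cases "z \<in> filt trivial_ideal relation_ideal 2")
    case False
    have i1: "S.indep (\<lambda>_. z) 1"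
      unfolding S.indep_def
    proof (intro allI impI, rule ccontr)
      fix c :: "nat \<Rightarrow> complex" and i :: nat
      assume c: "(\<Sum>i<1. tr_const (c i) * z) \<in> filt trivial_ideal relation_ideal 2" and i: "i < 1" "c i \<noteq> 0"
      then have "tr_const (c 0) * z \<in> filt trivial_ideal relation_ideal 2" by simp
      then have "tr_const (1 / c 0) * (tr_const (c 0) * z) \<in> filt trivial_ideal relation_ideal 2" by (rule is_idealD(3)[OF S.filt2(1)])
      moreover have "tr_const (1 / c 0) * (tr_const (c 0) * z) = z"
        using i by (simp add: mult.assoc[symmetric] tr_const_hom(2)[symmetric] tr_const_hom(3))
      ultimately show False using False by simp
    qed
    obtain x D where x: "1 \<le> D" "\<forall>i<1. x i = z" "S.indep x D" "S.spans x D"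
      using S.indep_extend_basis[OF i1] zm by auto
    obtain p where p: "S.chain_at p D" using chain_if_smooth[OF smooth x(4,3)] x(1) by auto
    have Jp: "relation_ideal \<subseteq> p 0" using p by (simp add: S.chain_at_def)
    \<comment> \<open>In a basis that begins with \<open>z\<close>, the form z^2 is this single
      monomial.\<close>
    let ?M = "{#0, 0#} :: nat multiset"
    have M: "?M \<in> S.msets D 2" using x(1) by (simp add: S.msets_def)
    have sum: "(\<Sum>M\<in>S.msets D 2. tr_const (if M = ?M then 1 else 0) * S.monm x M) = z\<^sup>2"
      unfolding S.sum_single_coefficient[OF S.finite_msets M] using x(2) by (simp add: tr_const_hom power2_eq_square)
    have f3: "a * b * c \<in> filt trivial_ideal relation_ideal 3" if "a \<in> trivial_ideal" "b \<in> trivial_ideal" "c \<in> trivial_ideal" for a b c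
    proof -
      have "a * (b * c) \<in> filt trivial_ideal relation_ideal (Suc 2)" by (rule filt_mult1[OF that(1) S.filt2_mult[OF that(2,3)]])
      then show ?thesis by (simp add: numeral_3_eq_3 numeral_2_eq_2 mult.assoc del: filt.simps)
    qed
    have "h i j * (h k l * h r s) \<in> filt trivial_ideal relation_ideal 3" for i j k l r s
      using f3[OF hm hm hm] by (simp add: mult.assoc)
    note h3 = this
    have "d \<in> filt trivial_ideal relation_ideal 3"
      unfolding d_def power2_eq_square right_diff_distrib by (intro is_idealD(2,6)[OF is_ideal_filt] h3)
    then have "tr_const (1 / 4) * (- d) \<in> filt trivial_ideal relation_ideal 3" by (intro is_idealD(3,5)[OF is_ideal_filt])
    moreover have "tr_const (1 / 4) * (4 * z\<^sup>2) = z\<^sup>2"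
    proof -
      have four: "(4 :: 'i trace_ring) = tr_const 4"
        using tr_const_hom(1)[of 2 2] by (simp add: tr_const_2)
      have "tr_const (1 / 4) * (tr_const 4 * z\<^sup>2) = tr_const (1 / 4 * 4) * z\<^sup>2"
        by (simp only: tr_const_hom(2) mult.assoc)
      then show ?thesis unfolding four by (simp add: tr_const_hom(3))
    qed
    ultimately have "z\<^sup>2 \<in> filt trivial_ideal relation_ideal 3" using gram by simp
    then have "z\<^sup>2 \<in> filt trivial_ideal (p 0) (Suc 2)" using filt_mono[OF Jp, of trivial_ideal 3] by (auto simp: numeral_3_eq_3 numeral_2_eq_2 simp del: filt.simps)
    from S.form_eq_0[OF p x(4), where f = "\<lambda>M. if M = ?M then 1 else 0" and k = 2 and M = ?M] this M
    show False unfolding sum by simp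
  next
    case True
    \<comment> \<open>Diagonal entries first, then the entries 01, 02, 12; the multisets in
      \<open>f\<close> below use this numbering.\<close>
    define x where "x i = [h 0 0, h 1 1, h 2 2, h 0 1, h 0 2, h 1 2] ! i" for i
    have xs: "x 0 = h 0 0" "x 1 = h 1 1" "x 2 = h 2 2" "x 3 = h 0 1" "x 4 = h 0 2" "x 5 = h 1 2"
      by (simp_all add: x_def)
    have i6: "i = 0 \<or> i = 1 \<or> i = 2 \<or> i = 3 \<or> i = 4 \<or> i = 5" if "i < 6" for i :: nat using that by linarith
    have xm: "x i \<in> trivial_ideal" if "i < 6" for i using i6[OF that] xs hm by metis
    have s6: "(\<Sum>i<6. F i) = F 0 + F 1 + F 2 + F 3 + F 4 + F 5" for F :: "nat \<Rightarrow> 'i trace_ring"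
      by (simp add: eval_nat_numeral)
    have ind: "S.indep x 6"
      unfolding S.indep_def
    proof (intro allI impI)
      fix c :: "nat \<Rightarrow> complex" and i :: nat
      assume c: "(\<Sum>i<6. tr_const (c i) * x i) \<in> filt trivial_ideal relation_ideal 2" and i: "i < 6"
      \<comment> \<open>The additive function with coordinates \<open>s\<close> gives a tangent
        vector taking \<open>h i j\<close> to 4 s_i s_j, so a linear relation between the
        \<open>h i j\<close> becomes a quadratic form that vanishes at every
        \<open>s\<close>.\<close>
      have Q: "c 0 * (s 0 * s 0) + c 1 * (s 1 * s 1) + c 2 * (s 2 * s 2) + c 3 * (s 0 * s 1) + c 4 * (s 0 * s 2) + c 5 * (s 1 * s 2) = 0"
        for s :: "nat \<Rightarrow> complex"
      proof -
        define \<psi> where "\<psi> y = s 0 * \<phi> 0 y + s 1 * \<phi> 1 y + s 2 * \<phi> 2 y" for y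
        have \<psi>: "additive_on G \<psi>" using g by (simp add: additive_on_def \<psi>_def algebra_simps)
        have "\<psi> (g 0) = s 0" "\<psi> (g 1) = s 1" "\<psi> (g 2) = s 2" using dual by (simp_all add: \<psi>_def)
        then have fh: "fval \<psi> (h i j) = 4 * (s i * s j)" if "i \<in> {0, 1, 2}" "j \<in> {0, 1, 2}" for i j
          using that w by (auto simp: h_def fval_gram_entry[OF \<psi>])
        have "fval \<psi> (\<Sum>i<6. tr_const (c i) * x i) = 0" using fval_filt2[OF \<psi> c] .
        then have "4 * (c 0 * (s 0 * s 0) + c 1 * (s 1 * s 1) + c 2 * (s 2 * s 2) + c 3 * (s 0 * s 1) + c 4 * (s 0 * s 2) + c 5 * (s 1 * s 2)) = 0"
          unfolding s6 xs fval_add[OF \<psi>] fval_scale[OF \<psi>] by (simp add: fh algebra_simps)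
        then show ?thesis by (metis mult_eq_0_iff zero_neq_numeral)
      qed
      \<comment> \<open>Unit vectors give the coefficients of the squares, then vectors with a
        single zero entry those of the mixed terms.\<close>
      have "c 0 = 0" using Q[of "\<lambda>i. if i = 0 then 1 else 0"] by simp
      moreover have "c 1 = 0" using Q[of "\<lambda>i. if i = 1 then 1 else 0"] by simp
      moreover have "c 2 = 0" using Q[of "\<lambda>i. if i = 2 then 1 else 0"] by simp
      ultimately have c012: "c 0 = 0" "c 1 = 0" "c 2 = 0" by simp_all
      have "c 3 = 0" using Q[of "\<lambda>i. if i = 2 then 0 else 1"] c012 by simp
      moreover have "c 4 = 0" using Q[of "\<lambda>i. if i = 1 then 0 else 1"] c012 by simp
      moreover have "c 5 = 0" using Q[of "\<lambda>i. if i = 0 then 0 else 1"] c012 by simp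
      ultimately show "c i = 0" using c012 i6[OF i] by metis
    qed
    obtain x' D where x': "6 \<le> D" "\<forall>i<6. x' i = x i" "S.indep x' D" "S.spans x' D"
      using S.indep_extend_basis[OF ind xm] by blast
    obtain p where p: "S.chain_at p D" using chain_if_smooth[OF smooth x'(4,3)] x'(1) by auto
    have Jp: "relation_ideal \<subseteq> p 0" using p by (simp add: S.chain_at_def)
    \<comment> \<open>Coefficients of the determinant of a symmetric 3-by-3 matrix, written as a sum
      of five indicators so that \<open>sum_single_coefficient\<close> evaluates each term.\<close>
    define f :: "nat multiset \<Rightarrow> complex" where
      "f M = (if M = {#0, 1, 2#} then 1 else 0) + (if M = {#3, 4, 5#} then 2 else 0) + (if M = {#0, 5, 5#} then -1 else 0)
         + (if M = {#1, 4, 4#} then -1 else 0) + (if M = {#2, 3, 3#} then -1 else 0)" for M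
    have ms: "{#0, 1, 2#} \<in> S.msets D 3" "{#3, 4, 5#} \<in> S.msets D 3" "{#0, 5, 5#} \<in> S.msets D 3"
      "{#1, 4, 4#} \<in> S.msets D 3" "{#2, 3, 3#} \<in> S.msets D 3" using x'(1) by (simp_all add: S.msets_def)
    have x'x: "x' 0 = h 0 0" "x' 1 = h 1 1" "x' 2 = h 2 2" "x' 3 = h 0 1" "x' 4 = h 0 2" "x' 5 = h 1 2"
      using x'(2) xs by simp_all
    have m1: "tr_const (- 1) = (- 1 :: 'i trace_ring)" using S.\<kappa>_uminus[of 1] by (simp add: tr_const_hom)
    have "(\<Sum>M\<in>S.msets D 3. tr_const (f M) * S.monm x' M) = d"
      unfolding f_def tr_const_hom(1) distrib_right sum.distrib S.sum_single_coefficient[OF S.finite_msets ms(1)]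
        S.sum_single_coefficient[OF S.finite_msets ms(2)] S.sum_single_coefficient[OF S.finite_msets ms(3)]
        S.sum_single_coefficient[OF S.finite_msets ms(4)] S.sum_single_coefficient[OF S.finite_msets ms(5)]
        S.monm_simps x'x m1 tr_const_hom(3) tr_const_2 d_def
      by (simp add: algebra_simps power2_eq_square)
    note sum = this
    have "z * z \<in> filt trivial_ideal relation_ideal (2 + 2)" by (rule filt_mult[OF S.J(1) True True])
    then have "- (4 * (z * z)) \<in> filt trivial_ideal relation_ideal (2 + 2)"
      by (rule is_idealD(5)[OF is_ideal_filt is_idealD(3)[OF is_ideal_filt]])
    then have "d \<in> filt trivial_ideal relation_ideal (Suc 3)" using gram by (simp add: power2_eq_square numeral_3_eq_3 numeral_2_eq_2 del: filt.simps)
    then have "d \<in> filt trivial_ideal (p 0) (Suc 3)" using filt_mono[OF Jp, of trivial_ideal "Suc 3"] by (auto simp del: filt.simps)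
    \<comment> \<open>The product of the diagonal entries has coefficient 1: the inequalities of
      multisets that follow exclude any contribution of the other indicators.\<close>
    then have "f {#0, 1, 2#} = 0" using S.form_eq_0[OF p x'(4) _ ms(1), of f] unfolding sum by simp
    moreover have "({#0, 1, 2#} :: nat multiset) \<noteq> {#3, 4, 5#}" by (rule multiset_neqI[of _ 0]) simp
    moreover have "({#0, 1, 2#} :: nat multiset) \<noteq> {#0, 5, 5#}" by (rule multiset_neqI[of _ 5]) simp
    moreover have "({#0, 1, 2#} :: nat multiset) \<noteq> {#1, 4, 4#}" by (rule multiset_neqI[of _ 4]) simp
    moreover have "({#0, 1, 2#} :: nat multiset) \<noteq> {#2, 3, 3#}" by (rule multiset_neqI[of _ 3]) simp
    ultimately show False unfolding f_def by simp
  qed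
qed

end

theorem proposition3p7:
  fixes G :: "('g, 'm) monoid_scheme" and \<gamma> :: "'i::finite \<Rightarrow> 'g" and n :: enat
  assumes "group G"
    and "range \<gamma> \<subseteq> carrier G"
    and "generate G (range \<gamma>) = carrier G"
    and "n = vdim (group_H1 G)"
  shows "(n < 2 \<longrightarrow> smooth_at (char_alg G \<gamma>) (trivial_character G \<gamma>)) \<and>
    (n > 2 \<longrightarrow> \<not> smooth_at (char_alg G \<gamma>) (trivial_character G \<gamma>))"
proof -
  have "character_scheme G \<gamma>"
    using assms(1-3) by (intro character_scheme.intro character_scheme_axioms.intro)
  then show ?thesis
    using character_scheme.smooth_if_H1_small character_scheme.not_smooth_if_H1_large assms(4) by blast
qed

end
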